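(* Let $E$ be a finite directed graph with no sources, and let $(G,E)$ be a self-similar groupoid action. There is an isomorphism $\pi:\mathcal{O}(G,E)\to C^*(\mathcal{G}_{G,E})$ such that $\pi(u_g)=1_{Z(c(g),g,d(g))}$ and $\pi(s_e)=1_{Z(e,s(e),s(e))}$ for all $g\in G$ and $e\in E^1$.
   Context: **Graphs.** A directed graph is $E=(E^0,E^1,r,s)$ with $r,s:E^1\to E^0$. Paths are $\mu=e_1\cdots e_n$ with $s(e_i)=r(e_{i+1})$; $r(\mu)=r(e_1)$, $s(\mu)=s(e_n)$ (for a vertex $v$, $r(v)=s(v)=v$); $E^*$ is the set of all finite paths including vertices, $vE^*$ those with range $v$, $vE^1$ the edges with range $v$. No sources: $vE^1\ne\emptyset$ for all $v$. $E^\infty$ is the set of right-infinite paths $x=x_1x_2\cdots$ with $s(x_i)=r(x_{i+1})$, $r(x)=r(x_1)$, with the cylinder-set topology. For $n\le l$, $y(n,l)=y_{n+1}\cdots y_l$ (the vertex $r(y_{n+1})$ if $n=l$). $\varsigma(x_1x_2\cdots)=x_2x_3\cdots$. **Self-similar groupoid actions.** A partial isomorphism of $E^*$ is a length-preserving bijection $g:vE^*\to wE^*$ with $g(\mu e)\in g(\mu)E^1$; $d(g)=v$, $c(g)=w$. These form a groupoid $\mathrm{PIso}(E^* )$ with unit space $E^0$. A self-similar groupoid action $(G,E)$ is a groupoid $G$ with unit space $E^0$ and an injective homomorphism $G\to\mathrm{PIso}(E^* )$, identity on $E^0$ (written $g\cdot\mu$), such that for all $g\in G$, $e\in d(g)E^1$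 there is a (necessarily unique) $g|_e\in G$ with $d(g|_e)=s(e)$, $c(g|_e)=s(g\cdot e)$, $g\cdot(e\mu)=(g\cdot e)(g|_e\cdot\mu)$ for all $\mu\in s(e)E^*$. Put $g|_{d(g)}=g$, $g|_{e\mu}=(g|_e)|_\mu$. $G$ acts on $E^\infty$ via initial segments. **The algebra $\mathcal{O}(G,E)$.** The universal $C^*$-algebra generated by $u_g$ ($g\in G$), $p_v$ ($v\in E^0$), $s_e$ ($e\in E^1$) such that: $u_gu_h=u_{gh}$ if $d(g)=c(h)$ and $0$ otherwise, $u_{g^{-1}}=u_g^*$; the $p_v$ are mutually orthogonal projections, $s_e^*s_e=p_{s(e)}$, $p_v=\sum_{e\in vE^1}s_es_e^*$; $p_v=u_v$; and $u_gs_e=s_{g\cdot e}u_{g|_e}$ for $e\in d(g)E^1$. **The groupoid $\mathcal{G}_{G,E}$.** On tuples $(x,m,g,n,y)\in E^\infty\times\mathbb{N}\times G\times\mathbb{N}\times E^\infty$ ($0\in\mathbb{N}$) with $d(g)=r(\varsigma^n(y))$ and $\varsigma^m(x)=g\cdot\varsigma^n(y)$, put $(x,m,g,n,y)\sim(w,p,h,q,z)$ iff $x=w$, $y=z$, $m-n=p-q$ and $g|_{y(n,l)}=h|_{y(q,l)}$ for some $l\ge\max\{n,q\}$. $\mathcal{G}_{G,E}$ is the set of classes $[x,m,g,n,y]$, with range $x$, source $y$, product $[x,m,g,n,y][y,p,h,q,z]=[x,m+p,g|_{y(n,n+p)}h|_{z(q,q+n)},n+q,z]$, inverse $[y,n,g^{-1},m,x]$,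 and units $[x,0,r(x),0,x]$ identified with $x\in E^\infty$. Its topology has as basis the sets $Z(\mu,g,\nu)=\{[\mu(g\cdot y),|\mu|,g,|\nu|,\nu y]: y\in E^\infty,\ r(y)=s(\nu)\}$ for $\mu,\nu\in E^*$, $g\in G$ with $s(\mu)=c(g)$, $s(\nu)=d(g)$; these are compact open Hausdorff bisections, and $\mathcal{G}_{G,E}$ is a locally Hausdorff (not necessarily Hausdorff) étale groupoid. $C^*(\mathcal{G}_{G,E})$ is the full groupoid $C^*$-algebra: the completion in the universal norm of the convolution $*$-algebra spanned by the spaces $C_c(U)$, $U$ an open bisection. $1_Z$ denotes an indicator function. *)

theory Defs
  imports
    "HOL-Analysis.Analysis"
    "HOL-Algebra.FiniteProduct"
    "HOL-Library.Omega_Words_Fun"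
    "Graph_Theory.Digraph"
begin

section \<open>\<open>C\<^sup>*\<close>-algebras\<close>

text \<open>Algebras are complex, associative and not assumed unital.\<close>

record 'a star_algebra = "'a partial_object" +
  azero :: 'a
  aadd :: "'a \<Rightarrow> 'a \<Rightarrow> 'a"
  ascale :: "complex \<Rightarrow> 'a \<Rightarrow> 'a"
  amult :: "'a \<Rightarrow> 'a \<Rightarrow> 'a"
  astar :: "'a \<Rightarrow> 'a"

record 'a normed_star_algebra = "'a star_algebra" +
  anorm :: "'a \<Rightarrow> real"

definition additive_part :: "('a, 'm) star_algebra_scheme \<Rightarrow> 'a monoid" where
  "additive_part A = \<lparr>carrier = carrier A, monoid.mult = aadd A, one = azero A\<rparr>"

definition asub :: "('a, 'm) star_algebra_scheme \<Rightarrow> 'a \<Rightarrow> 'a \<Rightarrow> 'a" where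
  "asub A x y = aadd A x (ascale A (-1) y)"

definition asum :: "('a, 'm) star_algebra_scheme \<Rightarrow> ('i \<Rightarrow> 'a) \<Rightarrow> 'i set \<Rightarrow> 'a" where
  "asum A f I = finprod (additive_part A) f I"

locale star_algebra =
  fixes A :: "('a, 'm) star_algebra_scheme"
  assumes additive_group: "comm_group (additive_part A)"
    and scale_closed: "x \<in> carrier A \<Longrightarrow> ascale A c x \<in> carrier A"
    and scale_add_right: "x \<in> carrier A \<Longrightarrow> y \<in> carrier A \<Longrightarrow>
          ascale A c (aadd A x y) = aadd A (ascale A c x) (ascale A c y)"
    and scale_add_left: "x \<in> carrier A \<Longrightarrow>
          ascale A (c + d) x = aadd A (ascale A c x) (ascale A d x)"
    and scale_scale: "x \<in> carrier A \<Longrightarrow> ascale A c (ascale A d x) = ascale A (c * d) x"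
    and scale_one: "x \<in> carrier A \<Longrightarrow> ascale A 1 x = x"
    and mult_closed: "x \<in> carrier A \<Longrightarrow> y \<in> carrier A \<Longrightarrow> amult A x y \<in> carrier A"
    and mult_assoc: "x \<in> carrier A \<Longrightarrow> y \<in> carrier A \<Longrightarrow> z \<in> carrier A \<Longrightarrow>
          amult A (amult A x y) z = amult A x (amult A y z)"
    and mult_add_left: "x \<in> carrier A \<Longrightarrow> y \<in> carrier A \<Longrightarrow> z \<in> carrier A \<Longrightarrow>
          amult A (aadd A x y) z = aadd A (amult A x z) (amult A y z)"
    and mult_add_right: "x \<in> carrier A \<Longrightarrow> y \<in> carrier A \<Longrightarrow> z \<in> carrier A \<Longrightarrow>
          amult A x (aadd A y z) = aadd A (amult A x y) (amult A x z)"
    and mult_scale_left: "x \<in> carrier A \<Longrightarrow> y \<in> carrier A \<Longrightarrow>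
          amult A (ascale A c x) y = ascale A c (amult A x y)"
    and mult_scale_right: "x \<in> carrier A \<Longrightarrow> y \<in> carrier A \<Longrightarrow>
          amult A x (ascale A c y) = ascale A c (amult A x y)"
    and star_closed: "x \<in> carrier A \<Longrightarrow> astar A x \<in> carrier A"
    and star_star: "x \<in> carrier A \<Longrightarrow> astar A (astar A x) = x"
    and star_add: "x \<in> carrier A \<Longrightarrow> y \<in> carrier A \<Longrightarrow>
          astar A (aadd A x y) = aadd A (astar A x) (astar A y)"
    and star_scale: "x \<in> carrier A \<Longrightarrow> astar A (ascale A c x) = ascale A (cnj c) (astar A x)"
    and star_mult: "x \<in> carrier A \<Longrightarrow> y \<in> carrier A \<Longrightarrow>
          astar A (amult A x y) = amult A (astar A y) (astar A x)"

definition cstar_seminorm :: "('a, 'm) star_algebra_scheme \<Rightarrow> ('a \<Rightarrow> real) \<Rightarrow> bool" where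
  "cstar_seminorm A N \<longleftrightarrow>
     (\<forall>x\<in>carrier A. 0 \<le> N x) \<and>
     (\<forall>x\<in>carrier A. \<forall>y\<in>carrier A. N (aadd A x y) \<le> N x + N y) \<and>
     (\<forall>c. \<forall>x\<in>carrier A. N (ascale A c x) = norm c * N x) \<and>
     (\<forall>x\<in>carrier A. \<forall>y\<in>carrier A. N (amult A x y) \<le> N x * N y) \<and>
     (\<forall>x\<in>carrier A. N (amult A (astar A x) x) = (N x)\<^sup>2)"

definition Cauchy_seqs :: "('a, 'm) star_algebra_scheme \<Rightarrow> ('a \<Rightarrow> real) \<Rightarrow> (nat \<Rightarrow> 'a) set" where
  "Cauchy_seqs A N = {X. range X \<subseteq> carrier A \<and>
     (\<forall>\<epsilon>>0. \<exists>M. \<forall>m\<ge>M. \<forall>n\<ge>M. N (asub A (X m) (X n)) < \<epsilon>)}"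

locale cstar_algebra = star_algebra A
  for A :: "('a, 'm) normed_star_algebra_scheme" +
  assumes cstar_norm: "cstar_seminorm A (anorm A)"
    and norm_eq_zero: "x \<in> carrier A \<Longrightarrow> anorm A x = 0 \<Longrightarrow> x = azero A"
    and complete: "X \<in> Cauchy_seqs A (anorm A) \<Longrightarrow>
          \<exists>x\<in>carrier A. (\<lambda>n. anorm A (asub A (X n) x)) \<longlonglongrightarrow> 0"

definition star_hom ::
  "('a, 'm) star_algebra_scheme \<Rightarrow> ('b, 'n) star_algebra_scheme \<Rightarrow> ('a \<Rightarrow> 'b) \<Rightarrow> bool" where
  "star_hom A B \<phi> \<longleftrightarrow>
     (\<forall>x\<in>carrier A. \<phi> x \<in> carrier B) \<and>
     (\<forall>x\<in>carrier A. \<forall>y\<in>carrier A. \<phi> (aadd A x y) = aadd B (\<phi> x) (\<phi> y)) \<and>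
     (\<forall>c. \<forall>x\<in>carrier A. \<phi> (ascale A c x) = ascale B c (\<phi> x)) \<and>
     (\<forall>x\<in>carrier A. \<forall>y\<in>carrier A. \<phi> (amult A x y) = amult B (\<phi> x) (\<phi> y)) \<and>
     (\<forall>x\<in>carrier A. \<phi> (astar A x) = astar B (\<phi> x))"

definition cstar_isomorphism ::
  "('a, 'm) normed_star_algebra_scheme \<Rightarrow> ('b, 'n) normed_star_algebra_scheme \<Rightarrow>
     ('a \<Rightarrow> 'b) \<Rightarrow> bool" where
  "cstar_isomorphism A B \<phi> \<longleftrightarrow>
     cstar_algebra A \<and> cstar_algebra B \<and> star_hom A B \<phi> \<and>
     bij_betw \<phi> (carrier A) (carrier B)"


subsection \<open>Completion in a \<open>C\<^sup>*\<close>-seminorm\<close>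

text \<open>The Hausdorff completion: Cauchy sequences modulo null sequences. Elements of seminorm zero
  are thereby identified with zero.\<close>

definition null_rel :: "('a, 'm) star_algebra_scheme \<Rightarrow> ('a \<Rightarrow> real) \<Rightarrow>
    ((nat \<Rightarrow> 'a) \<times> (nat \<Rightarrow> 'a)) set" where
  "null_rel A N = {(X, Y). X \<in> Cauchy_seqs A N \<and> Y \<in> Cauchy_seqs A N \<and>
     (\<lambda>n. N (asub A (X n) (Y n))) \<longlonglongrightarrow> 0}"

definition cstar_completion :: "('a, 'm) star_algebra_scheme \<Rightarrow> ('a \<Rightarrow> real) \<Rightarrow>
    (nat \<Rightarrow> 'a) set normed_star_algebra" where
  "cstar_completion A N =
     \<lparr>carrier = Cauchy_seqs A N // null_rel A N,
      azero = null_rel A N `` {\<lambda>_. azero A},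
      aadd = (\<lambda>S T. \<Union>X\<in>S. \<Union>Y\<in>T. null_rel A N `` {\<lambda>n. aadd A (X n) (Y n)}),
      ascale = (\<lambda>c S. \<Union>X\<in>S. null_rel A N `` {\<lambda>n. ascale A c (X n)}),
      amult = (\<lambda>S T. \<Union>X\<in>S. \<Union>Y\<in>T. null_rel A N `` {\<lambda>n. amult A (X n) (Y n)}),
      astar = (\<lambda>S. \<Union>X\<in>S. null_rel A N `` {\<lambda>n. astar A (X n)}),
      anorm = (\<lambda>S. the_elem ((\<lambda>X. lim (\<lambda>n. N (X n))) ` S))\<rparr>"

definition completion_embed :: "('a, 'm) star_algebra_scheme \<Rightarrow> ('a \<Rightarrow> real) \<Rightarrow>
    'a \<Rightarrow> (nat \<Rightarrow> 'a) set" where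
  "completion_embed A N a = null_rel A N `` {\<lambda>_. a}"

text \<open>The universal norm of a \<open>*\<close>-algebra, possibly subject to a condition \<open>P\<close>. The
  \<open>C\<^sup>*\<close>-seminorms on a \<open>*\<close>-algebra are exactly the functions \<open>a \<mapsto> \<parallel>\<phi> a\<parallel>\<close> for a
  \<open>*\<close>-homomorphism \<open>\<phi>\<close> into a \<open>C\<^sup>*\<close>-algebra, so this is the supremum over all such
  representations; ranging over seminorms avoids a quantification over types. The supremum is
  meaningful only where these seminorms are pointwise bounded.\<close>

definition universal_seminorm :: "('a, 'm) star_algebra_scheme \<Rightarrow> (('a \<Rightarrow> real) \<Rightarrow> bool) \<Rightarrow>
    'a \<Rightarrow> real" where
  "universal_seminorm A P a = (SUP N \<in> {N. cstar_seminorm A N \<and> P N}. N a)"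


subsection \<open>The free \<open>*\<close>-algebra on a set\<close>

text \<open>Non-commutative polynomials without constant term: finitely supported functions on non-empty
  words, where the letter \<open>(x, False)\<close> stands for the generator \<open>x\<close> and \<open>(x, True)\<close> for its
  adjoint.\<close>

definition free_star_algebra :: "'x set \<Rightarrow> (('x \<times> bool) list \<Rightarrow> complex) star_algebra" where
  "free_star_algebra X =
     \<lparr>carrier = {f. finite {w. f w \<noteq> 0} \<and> (\<forall>w. f w \<noteq> 0 \<longrightarrow> w \<noteq> [] \<and> fst ` set w \<subseteq> X)},
      azero = (\<lambda>w. 0),
      aadd = (\<lambda>f g w. f w + g w),
      ascale = (\<lambda>c f w. c * f w),
      amult = (\<lambda>f g w. \<Sum>k\<le>length w. f (take k w) * g (drop k w)),
      astar = (\<lambda>f w. cnj (f (rev (map (apsnd Not) w))))\<rparr>"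

definition free_gen :: "'x \<Rightarrow> ('x \<times> bool) list \<Rightarrow> complex" where
  "free_gen x = (\<lambda>w. if w = [(x, False)] then 1 else 0)"


section \<open>Groupoids and their full \<open>C\<^sup>*\<close>-algebras\<close>

record ('o, 'a) groupoid =
  obj :: "'o set"
  arr :: "'a set"
  gdom :: "'a \<Rightarrow> 'o"
  gcod :: "'a \<Rightarrow> 'o"
  gmult :: "'a \<Rightarrow> 'a \<Rightarrow> 'a"
  ginv :: "'a \<Rightarrow> 'a"
  gunit :: "'o \<Rightarrow> 'a"

text \<open>The product \<open>gmult G g h\<close> is meaningful when \<open>gdom G g = gcod G h\<close>; the unit space is
  \<open>obj G\<close>, embedded into the arrows by \<open>gunit G\<close>.\<close>

locale groupoid =
  fixes G :: "('o, 'a, 'm) groupoid_scheme"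
  assumes dom_closed: "g \<in> arr G \<Longrightarrow> gdom G g \<in> obj G"
    and cod_closed: "g \<in> arr G \<Longrightarrow> gcod G g \<in> obj G"
    and mult_arr: "g \<in> arr G \<Longrightarrow> h \<in> arr G \<Longrightarrow> gdom G g = gcod G h \<Longrightarrow> gmult G g h \<in> arr G"
    and dom_mult: "g \<in> arr G \<Longrightarrow> h \<in> arr G \<Longrightarrow> gdom G g = gcod G h \<Longrightarrow>
          gdom G (gmult G g h) = gdom G h"
    and cod_mult: "g \<in> arr G \<Longrightarrow> h \<in> arr G \<Longrightarrow> gdom G g = gcod G h \<Longrightarrow>
          gcod G (gmult G g h) = gcod G g"
    and mult_assoc: "g \<in> arr G \<Longrightarrow> h \<in> arr G \<Longrightarrow> k \<in> arr G \<Longrightarrow>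
          gdom G g = gcod G h \<Longrightarrow> gdom G h = gcod G k \<Longrightarrow>
          gmult G (gmult G g h) k = gmult G g (gmult G h k)"
    and unit_arr: "v \<in> obj G \<Longrightarrow> gunit G v \<in> arr G"
    and dom_unit: "v \<in> obj G \<Longrightarrow> gdom G (gunit G v) = v"
    and cod_unit: "v \<in> obj G \<Longrightarrow> gcod G (gunit G v) = v"
    and mult_unit_right: "g \<in> arr G \<Longrightarrow> gmult G g (gunit G (gdom G g)) = g"
    and mult_unit_left: "g \<in> arr G \<Longrightarrow> gmult G (gunit G (gcod G g)) g = g"
    and inv_arr: "g \<in> arr G \<Longrightarrow> ginv G g \<in> arr G"
    and dom_inv: "g \<in> arr G \<Longrightarrow> gdom G (ginv G g) = gcod G g"
    and cod_inv: "g \<in> arr G \<Longrightarrow> gcod G (ginv G g) = gdom G g"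
    and mult_inv_right: "g \<in> arr G \<Longrightarrow> gmult G g (ginv G g) = gunit G (gcod G g)"
    and mult_inv_left: "g \<in> arr G \<Longrightarrow> gmult G (ginv G g) g = gunit G (gdom G g)"

record ('o, 'a) top_groupoid = "('o, 'a) groupoid" +
  otop :: "'o topology"
  atop :: "'a topology"

definition open_bisection :: "('o, 'a, 'm) top_groupoid_scheme \<Rightarrow> 'a set \<Rightarrow> bool" where
  "open_bisection \<Gamma> U \<longleftrightarrow> openin (atop \<Gamma>) U \<and>
     (\<forall>\<rho>\<in>{gdom \<Gamma>, gcod \<Gamma>}. openin (otop \<Gamma>) (\<rho> ` U) \<and>
        homeomorphic_map (subtopology (atop \<Gamma>) U) (subtopology (otop \<Gamma>) (\<rho> ` U)) \<rho>)"

text \<open>Continuous compactly supported functions on the subspace \<open>U\<close>, extended by zero. When the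
  groupoid is not Hausdorff they need not be continuous on all of it.\<close>

definition Cc_on :: "('o, 'a, 'm) top_groupoid_scheme \<Rightarrow> 'a set \<Rightarrow> ('a \<Rightarrow> complex) set" where
  "Cc_on \<Gamma> U = {f. continuous_map (subtopology (atop \<Gamma>) U) euclidean f \<and>
     (\<exists>K\<subseteq>U. compactin (atop \<Gamma>) K \<and> (\<forall>\<gamma>. \<gamma> \<notin> K \<longrightarrow> f \<gamma> = 0))}"

text \<open>The carrier is the linear span of the spaces \<open>C\<^sub>c(U)\<close>, \<open>U\<close> an open bisection. Each of its
  elements is non-zero at only finitely many arrows with a given range or source, so the
  convolution sum is finite.\<close>

definition convolution_algebra ::
  "('o, 'a, 'm) top_groupoid_scheme \<Rightarrow> ('a \<Rightarrow> complex) star_algebra" where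
  "convolution_algebra \<Gamma> =
     \<lparr>carrier = {f. \<exists>F c. finite F \<and> F \<subseteq> (\<Union>U\<in>Collect (open_bisection \<Gamma>). Cc_on \<Gamma> U) \<and>
                     f = (\<lambda>\<gamma>. \<Sum>h\<in>F. c h * h \<gamma>)},
      azero = (\<lambda>\<gamma>. 0),
      aadd = (\<lambda>f h \<gamma>. f \<gamma> + h \<gamma>),
      ascale = (\<lambda>c f \<gamma>. c * f \<gamma>),
      amult = (\<lambda>f h \<gamma>. \<Sum>(\<alpha>, \<beta>) | \<alpha> \<in> arr \<Gamma> \<and> \<beta> \<in> arr \<Gamma> \<and> gdom \<Gamma> \<alpha> = gcod \<Gamma> \<beta> \<and>
                   gmult \<Gamma> \<alpha> \<beta> = \<gamma> \<and> f \<alpha> \<noteq> 0 \<and> h \<beta> \<noteq> 0. f \<alpha> * h \<beta>),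
      astar = (\<lambda>f \<gamma>. if \<gamma> \<in> arr \<Gamma> then cnj (f (ginv \<Gamma> \<gamma>)) else 0)\<rparr>"

definition groupoid_norm :: "('o, 'a, 'm) top_groupoid_scheme \<Rightarrow> ('a \<Rightarrow> complex) \<Rightarrow> real" where
  "groupoid_norm \<Gamma> = universal_seminorm (convolution_algebra \<Gamma>) (\<lambda>_. True)"

definition groupoid_cstar :: "('o, 'a, 'm) top_groupoid_scheme \<Rightarrow>
    (nat \<Rightarrow> 'a \<Rightarrow> complex) set normed_star_algebra" where
  "groupoid_cstar \<Gamma> = cstar_completion (convolution_algebra \<Gamma>) (groupoid_norm \<Gamma>)"

definition groupoid_cstar_embed :: "('o, 'a, 'm) top_groupoid_scheme \<Rightarrow> ('a \<Rightarrow> complex) \<Rightarrow>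
    (nat \<Rightarrow> 'a \<Rightarrow> complex) set" where
  "groupoid_cstar_embed \<Gamma> = completion_embed (convolution_algebra \<Gamma>) (groupoid_norm \<Gamma>)"


section \<open>Paths\<close>

text \<open>For a directed graph \<open>E\<close> the source and range maps are \<open>s = tail E\<close> and \<open>r = head E\<close>, so
  \<open>in_arcs E v\<close> is the set \<open>vE\<^sup>1\<close>. A finite path is the pair of its range and its list of edges,
  listed from the range end; \<open>(v, [])\<close> is the vertex \<open>v\<close>.\<close>

type_synonym ('v, 'e) fpath = "'v \<times> 'e list"

definition no_sources :: "('v, 'e) pre_digraph \<Rightarrow> bool" where
  "no_sources E \<longleftrightarrow> (\<forall>v\<in>verts E. in_arcs E v \<noteq> {})"

definition fpaths :: "('v, 'e) pre_digraph \<Rightarrow> ('v, 'e) fpath set" where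
  "fpaths E = {(v, es). v \<in> verts E \<and> set es \<subseteq> arcs E \<and> (es \<noteq> [] \<longrightarrow> head E (hd es) = v) \<and>
     successively (\<lambda>e f. tail E e = head E f) es}"

definition psource :: "('v, 'e) pre_digraph \<Rightarrow> ('v, 'e) fpath \<Rightarrow> 'v" where
  "psource E \<mu> = (if snd \<mu> = [] then fst \<mu> else tail E (last (snd \<mu>)))"

definition paths_to :: "('v, 'e) pre_digraph \<Rightarrow> 'v \<Rightarrow> ('v, 'e) fpath set" where
  "paths_to E v = {\<mu> \<in> fpaths E. fst \<mu> = v}"

definition plength :: "('v, 'e) fpath \<Rightarrow> nat" where
  "plength \<mu> = length (snd \<mu>)"

definition pcat :: "('v, 'e) fpath \<Rightarrow> ('v, 'e) fpath \<Rightarrow> ('v, 'e) fpath" where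
  "pcat \<mu> \<nu> = (fst \<mu>, snd \<mu> @ snd \<nu>)"

definition edge_path :: "('v, 'e) pre_digraph \<Rightarrow> 'e \<Rightarrow> ('v, 'e) fpath" where
  "edge_path E e = (head E e, [e])"

definition inf_paths :: "('v, 'e) pre_digraph \<Rightarrow> 'e word set" where
  "inf_paths E = {x. \<forall>i. x i \<in> arcs E \<and> tail E (x i) = head E (x (Suc i))}"

definition irange :: "('v, 'e) pre_digraph \<Rightarrow> 'e word \<Rightarrow> 'v" where
  "irange E x = head E (x 0)"

text \<open>Infinite paths are indexed from \<open>0\<close>, so that \<open>y(n, l)\<close> consists of the edges
  \<open>y n, \<dots>, y (l - 1)\<close>; the shift \<open>\<sigma>\<^sup>n(y)\<close> is \<open>suffix n y\<close>.\<close>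

definition segment :: "('v, 'e) pre_digraph \<Rightarrow> 'e word \<Rightarrow> nat \<Rightarrow> nat \<Rightarrow> ('v, 'e) fpath" where
  "segment E y n l = (head E (y n), subsequence y n l)"

definition cylinder :: "('v, 'e) pre_digraph \<Rightarrow> ('v, 'e) fpath \<Rightarrow> 'e word set" where
  "cylinder E \<mu> = {x \<in> inf_paths E. segment E x 0 (plength \<mu>) = \<mu>}"

definition inf_path_topology :: "('v, 'e) pre_digraph \<Rightarrow> 'e word topology" where
  "inf_path_topology E = topology_generated_by (cylinder E ` fpaths E)"


section \<open>Self-similar groupoid actions\<close>

definition partial_isomorphism :: "('v, 'e) pre_digraph \<Rightarrow> 'v \<Rightarrow> 'v \<Rightarrow>
    (('v, 'e) fpath \<Rightarrow> ('v, 'e) fpath) \<Rightarrow> bool" where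
  "partial_isomorphism E v w \<phi> \<longleftrightarrow>
     bij_betw \<phi> (paths_to E v) (paths_to E w) \<and>
     (\<forall>\<mu>\<in>paths_to E v. plength (\<phi> \<mu>) = plength \<mu>) \<and>
     (\<forall>\<mu>\<in>paths_to E v. \<forall>e\<in>in_arcs E (psource E \<mu>).
        \<exists>f\<in>in_arcs E (psource E (\<phi> \<mu>)). \<phi> (pcat \<mu> (edge_path E e)) = pcat (\<phi> \<mu>) (edge_path E f))"

text \<open>\<open>is_restriction E G act g e h\<close> says that \<open>h\<close> is the restriction \<open>g|\<^sub>e\<close>.\<close>

definition is_restriction :: "('v, 'e) pre_digraph \<Rightarrow> ('v, 'g, 'm) groupoid_scheme \<Rightarrow>
    ('g \<Rightarrow> ('v, 'e) fpath \<Rightarrow> ('v, 'e) fpath) \<Rightarrow> 'g \<Rightarrow> 'e \<Rightarrow> 'g \<Rightarrow> bool" where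
  "is_restriction E G act g e h \<longleftrightarrow>
     h \<in> arr G \<and> gdom G h = tail E e \<and> gcod G h = psource E (act g (edge_path E e)) \<and>
     (\<forall>\<mu>\<in>paths_to E (tail E e).
        act g (pcat (edge_path E e) \<mu>) = pcat (act g (edge_path E e)) (act h \<mu>))"

text \<open>The value \<open>act g \<mu>\<close> matters only for \<open>\<mu> \<in> paths_to E (gdom G g)\<close>. Thus \<open>act_hom\<close> and
  \<open>act_unit\<close> say that \<open>act\<close> is a homomorphism into the groupoid of partial isomorphisms that is the
  identity on \<open>E\<^sup>0\<close>, and \<open>act_faithful\<close> that it is injective.\<close>

locale self_similar_action = graph: wf_digraph E + groupoid G
  for E :: "('v, 'e) pre_digraph" and G :: "('v, 'g, 'm) groupoid_scheme" +
  fixes act :: "'g \<Rightarrow> ('v, 'e) fpath \<Rightarrow> ('v, 'e) fpath"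
  assumes obj_eq: "obj G = verts E"
    and act_partial_isomorphism:
      "g \<in> arr G \<Longrightarrow> partial_isomorphism E (gdom G g) (gcod G g) (act g)"
    and act_hom: "g \<in> arr G \<Longrightarrow> h \<in> arr G \<Longrightarrow> gdom G g = gcod G h \<Longrightarrow>
          \<mu> \<in> paths_to E (gdom G h) \<Longrightarrow> act (gmult G g h) \<mu> = act g (act h \<mu>)"
    and act_unit: "v \<in> verts E \<Longrightarrow> \<mu> \<in> paths_to E v \<Longrightarrow> act (gunit G v) \<mu> = \<mu>"
    and act_faithful: "g \<in> arr G \<Longrightarrow> h \<in> arr G \<Longrightarrow>
          gdom G g = gdom G h \<Longrightarrow> gcod G g = gcod G h \<Longrightarrow>
          (\<And>\<mu>. \<mu> \<in> paths_to E (gdom G g) \<Longrightarrow> act g \<mu> = act h \<mu>) \<Longrightarrow> g = h"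
    and restriction_exists: "g \<in> arr G \<Longrightarrow> e \<in> in_arcs E (gdom G g) \<Longrightarrow>
          \<exists>h. is_restriction E G act g e h"

definition edge_restrict :: "('v, 'e) pre_digraph \<Rightarrow> ('v, 'g, 'm) groupoid_scheme \<Rightarrow>
    ('g \<Rightarrow> ('v, 'e) fpath \<Rightarrow> ('v, 'e) fpath) \<Rightarrow> 'g \<Rightarrow> 'e \<Rightarrow> 'g" where
  "edge_restrict E G act g e = (THE h. is_restriction E G act g e h)"

definition path_restrict :: "('v, 'e) pre_digraph \<Rightarrow> ('v, 'g, 'm) groupoid_scheme \<Rightarrow>
    ('g \<Rightarrow> ('v, 'e) fpath \<Rightarrow> ('v, 'e) fpath) \<Rightarrow> 'g \<Rightarrow> ('v, 'e) fpath \<Rightarrow> 'g" where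
  "path_restrict E G act g \<mu> = foldl (edge_restrict E G act) g (snd \<mu>)"

definition act_edge :: "('v, 'e) pre_digraph \<Rightarrow> ('g \<Rightarrow> ('v, 'e) fpath \<Rightarrow> ('v, 'e) fpath) \<Rightarrow>
    'g \<Rightarrow> 'e \<Rightarrow> 'e" where
  "act_edge E act g e = hd (snd (act g (edge_path E e)))"

text \<open>The \<open>n\<close>-th edge of \<open>g \<cdot> x\<close> is the last edge of the image of the initial segment of length
  \<open>n + 1\<close>.\<close>

definition act_inf :: "('v, 'e) pre_digraph \<Rightarrow> ('g \<Rightarrow> ('v, 'e) fpath \<Rightarrow> ('v, 'e) fpath) \<Rightarrow>
    'g \<Rightarrow> 'e word \<Rightarrow> 'e word" where
  "act_inf E act g x = (\<lambda>n. snd (act g (segment E x 0 (Suc n))) ! n)"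


section \<open>The algebra \<open>O(G, E)\<close>\<close>

text \<open>The defining relations for elements \<open>u g\<close>, \<open>p v\<close>, \<open>s e\<close> of \<open>A\<close>, relative to a notion of
  equality: the latter is \<open>(=)\<close> in a \<open>C\<^sup>*\<close>-algebra, and being at distance zero for a seminorm on
  the free \<open>*\<close>-algebra.\<close>

definition ssa_relations :: "('a, 'n) star_algebra_scheme \<Rightarrow> ('a \<Rightarrow> 'a \<Rightarrow> bool) \<Rightarrow>
    ('v, 'e) pre_digraph \<Rightarrow> ('v, 'g, 'm) groupoid_scheme \<Rightarrow>
    ('g \<Rightarrow> ('v, 'e) fpath \<Rightarrow> ('v, 'e) fpath) \<Rightarrow>
    ('g \<Rightarrow> 'a) \<Rightarrow> ('v \<Rightarrow> 'a) \<Rightarrow> ('e \<Rightarrow> 'a) \<Rightarrow> bool" where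
  "ssa_relations A eqv E G act u p s \<longleftrightarrow>
     (\<forall>g\<in>arr G. \<forall>h\<in>arr G. eqv (amult A (u g) (u h))
        (if gdom G g = gcod G h then u (gmult G g h) else azero A)) \<and>
     (\<forall>g\<in>arr G. eqv (u (ginv G g)) (astar A (u g))) \<and>
     (\<forall>v\<in>verts E. eqv (astar A (p v)) (p v) \<and> eqv (amult A (p v) (p v)) (p v)) \<and>
     (\<forall>v\<in>verts E. \<forall>w\<in>verts E. v \<noteq> w \<longrightarrow> eqv (amult A (p v) (p w)) (azero A)) \<and>
     (\<forall>e\<in>arcs E. eqv (amult A (astar A (s e)) (s e)) (p (tail E e))) \<and>
     (\<forall>v\<in>verts E. eqv (p v) (asum A (\<lambda>e. amult A (s e) (astar A (s e))) (in_arcs E v))) \<and>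
     (\<forall>v\<in>verts E. eqv (p v) (u (gunit G v))) \<and>
     (\<forall>g\<in>arr G. \<forall>e\<in>in_arcs E (gdom G g).
        eqv (amult A (u g) (s e)) (amult A (s (act_edge E act g e)) (u (edge_restrict E G act g e))))"

datatype ('v, 'e, 'g) generator = U_gen 'g | P_gen 'v | S_gen 'e

definition ssa_free :: "('v, 'e) pre_digraph \<Rightarrow> ('v, 'g, 'm) groupoid_scheme \<Rightarrow>
    ((('v, 'e, 'g) generator \<times> bool) list \<Rightarrow> complex) star_algebra" where
  "ssa_free E G = free_star_algebra (U_gen ` arr G \<union> P_gen ` verts E \<union> S_gen ` arcs E)"

definition ssa_norm :: "('v, 'e) pre_digraph \<Rightarrow> ('v, 'g, 'm) groupoid_scheme \<Rightarrow>
    ('g \<Rightarrow> ('v, 'e) fpath \<Rightarrow> ('v, 'e) fpath) \<Rightarrow>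
    ((('v, 'e, 'g) generator \<times> bool) list \<Rightarrow> complex) \<Rightarrow> real" where
  "ssa_norm E G act = universal_seminorm (ssa_free E G)
     (\<lambda>N. ssa_relations (ssa_free E G) (\<lambda>a b. N (asub (ssa_free E G) a b) = 0) E G act
        (\<lambda>g. free_gen (U_gen g)) (\<lambda>v. free_gen (P_gen v)) (\<lambda>e. free_gen (S_gen e)))"

definition ssa_cstar :: "('v, 'e) pre_digraph \<Rightarrow> ('v, 'g, 'm) groupoid_scheme \<Rightarrow>
    ('g \<Rightarrow> ('v, 'e) fpath \<Rightarrow> ('v, 'e) fpath) \<Rightarrow>
    (nat \<Rightarrow> (('v, 'e, 'g) generator \<times> bool) list \<Rightarrow> complex) set normed_star_algebra" where
  "ssa_cstar E G act = cstar_completion (ssa_free E G) (ssa_norm E G act)"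

definition ssa_gen :: "('v, 'e) pre_digraph \<Rightarrow> ('v, 'g, 'm) groupoid_scheme \<Rightarrow>
    ('g \<Rightarrow> ('v, 'e) fpath \<Rightarrow> ('v, 'e) fpath) \<Rightarrow> ('v, 'e, 'g) generator \<Rightarrow>
    (nat \<Rightarrow> (('v, 'e, 'g) generator \<times> bool) list \<Rightarrow> complex) set" where
  "ssa_gen E G act x = completion_embed (ssa_free E G) (ssa_norm E G act) (free_gen x)"


section \<open>The groupoid of germs\<close>

type_synonym ('e, 'g) germ_tuple = "'e word \<times> nat \<times> 'g \<times> nat \<times> 'e word"

definition germ_tuples :: "('v, 'e) pre_digraph \<Rightarrow> ('v, 'g, 'm) groupoid_scheme \<Rightarrow>
    ('g \<Rightarrow> ('v, 'e) fpath \<Rightarrow> ('v, 'e) fpath) \<Rightarrow> ('e, 'g) germ_tuple set" where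
  "germ_tuples E G act = {(x, m, g, n, y). x \<in> inf_paths E \<and> y \<in> inf_paths E \<and> g \<in> arr G \<and>
     gdom G g = irange E (suffix n y) \<and> suffix m x = act_inf E act g (suffix n y)}"

definition germ_rel :: "('v, 'e) pre_digraph \<Rightarrow> ('v, 'g, 'm) groupoid_scheme \<Rightarrow>
    ('g \<Rightarrow> ('v, 'e) fpath \<Rightarrow> ('v, 'e) fpath) \<Rightarrow>
    (('e, 'g) germ_tuple \<times> ('e, 'g) germ_tuple) set" where
  "germ_rel E G act = {((x, m, g, n, y), (w, p, h, q, z)).
     (x, m, g, n, y) \<in> germ_tuples E G act \<and> (w, p, h, q, z) \<in> germ_tuples E G act \<and>
     x = w \<and> y = z \<and> int m - int n = int p - int q \<and>
     (\<exists>l\<ge>max n q. path_restrict E G act g (segment E y n l) =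
                    path_restrict E G act h (segment E y q l))}"

definition germ :: "('v, 'e) pre_digraph \<Rightarrow> ('v, 'g, 'm) groupoid_scheme \<Rightarrow>
    ('g \<Rightarrow> ('v, 'e) fpath \<Rightarrow> ('v, 'e) fpath) \<Rightarrow>
    ('e, 'g) germ_tuple \<Rightarrow> ('e, 'g) germ_tuple set" where
  "germ E G act t = germ_rel E G act `` {t}"

text \<open>The set \<open>Z(\<mu>, g, \<nu>)\<close>.\<close>

definition germ_cylinder :: "('v, 'e) pre_digraph \<Rightarrow> ('v, 'g, 'm) groupoid_scheme \<Rightarrow>
    ('g \<Rightarrow> ('v, 'e) fpath \<Rightarrow> ('v, 'e) fpath) \<Rightarrow>
    ('v, 'e) fpath \<Rightarrow> 'g \<Rightarrow> ('v, 'e) fpath \<Rightarrow> ('e, 'g) germ_tuple set set" where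
  "germ_cylinder E G act \<mu> g \<nu> =
     {germ E G act (snd \<mu> \<frown> act_inf E act g y, plength \<mu>, g, plength \<nu>, snd \<nu> \<frown> y) | y.
        y \<in> inf_paths E \<and> irange E y = psource E \<nu>}"

definition germ_groupoid :: "('v, 'e) pre_digraph \<Rightarrow> ('v, 'g, 'm) groupoid_scheme \<Rightarrow>
    ('g \<Rightarrow> ('v, 'e) fpath \<Rightarrow> ('v, 'e) fpath) \<Rightarrow>
    ('e word, ('e, 'g) germ_tuple set) top_groupoid" where
  "germ_groupoid E G act =
     \<lparr>obj = inf_paths E,
      arr = germ_tuples E G act // germ_rel E G act,
      gdom = (\<lambda>S. the_elem ((\<lambda>(x, m, g, n, y). y) ` S)),
      gcod = (\<lambda>S. the_elem ((\<lambda>(x, m, g, n, y). x) ` S)),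
      gmult = (\<lambda>S T. \<Union>(x, m, g, n, y)\<in>S. \<Union>(y', p, h, q, z)\<in>T.
         germ E G act (x, m + p,
           gmult G (path_restrict E G act g (segment E y n (n + p)))
                   (path_restrict E G act h (segment E z q (q + n))),
           n + q, z)),
      ginv = (\<lambda>S. \<Union>(x, m, g, n, y)\<in>S. germ E G act (y, n, ginv G g, m, x)),
      gunit = (\<lambda>x. germ E G act (x, 0, gunit G (irange E x), 0, x)),
      otop = inf_path_topology E,
      atop = topology_generated_by
        {germ_cylinder E G act \<mu> g \<nu> | \<mu> g \<nu>. \<mu> \<in> fpaths E \<and> \<nu> \<in> fpaths E \<and> g \<in> arr G \<and>
           psource E \<mu> = gcod G g \<and> psource E \<nu> = gdom G g}\<rparr>"

end

theory Submission
  imports Defs "HOL-Computational_Algebra.Polynomial"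
begin

text \<open>Mapping the generators to indicator functions of basic bisections defines a
  \<open>*\<close>-homomorphism \<open>\<Phi>\<close> from the free \<open>*\<close>-algebra to the convolution algebra, and both algebras in the
  theorem are completions. So it suffices that \<open>\<Phi>\<close> preserves the universal norms and has dense image.

  A function \<open>f\<close> that is a finite sum of functions \<open>f\<^sub>i\<close> on basic bisections satisfies
  \<open>N f \<le> \<Sum>\<^sub>i \<parallel>f\<^sub>i\<parallel>\<^sub>\<infinity>\<close> for every \<open>C\<^sup>*\<close>-seminorm \<open>N\<close>, since a continuous function on the unit space with
  values in \<open>[-1, 1]\<close> is the real part of a unitary. The same bound for \<open>f = \<Phi> a\<close> holds for \<open>N a\<close>, for
  every \<open>C\<^sup>*\<close>-seminorm \<open>N\<close> on the free algebra that respects the relations: by compactness of the path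
  space, \<open>a\<close> can be cut into finitely many pieces by the mutually orthogonal projections \<open>s\<^sub>\<lambda> s\<^sub>\<lambda>\<^sup>*\<close> of long
  paths, on which the words \<open>s\<^sub>\<mu> u\<^sub>g s\<^sub>\<nu>\<^sup>*\<close> depend only on the germ. Hence \<open>N\<close> factors through \<open>\<Phi>\<close> and extends
  by continuity to the convolution algebra. The orthogonality of the projections \<open>s\<^sub>e s\<^sub>e\<^sup>*\<close> with the same
  range is not a relation; it follows because their sum is a projection.\<close>

section \<open>Sums and seminorms in *-algebras\<close>

text \<open>The groupoid need not be Hausdorff, so intersections of basic bisections need not be
  compact and a sum of functions on them cannot in general be rewritten with disjoint supports. Two
  decompositions of one function are therefore compared over each source separately, where only
  finitely many germs are involved. The pieces must then be recombined without a loss per piece: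
  each is kept in the corner cut out by its projection, and a sum over orthogonal corners is no
  larger than its largest term. \<open>bd f M\<close> says that \<open>f\<close> has some
  decomposition of total cost at most \<open>M\<close>. It does not mention how \<open>f\<close>
  arose, so the bound for \<open>N a\<close> holds for every decomposition of the image of
  \<open>a\<close>, in particular at cost \<open>0\<close> when the image is zero; this is why
  \<open>N\<close> factors. The seminorms are abstract, with neither an order nor spectral theory at
  hand, so positivity arguments are replaced by repeated use of the C*-identity and by polynomial
  identities in one self-adjoint element.\<close>

context star_algebra
begin

lemma additive_monoid: "comm_monoid (additive_part A)"
  using additive_group by (rule comm_group.axioms)

lemma additive_grp: "group (additive_part A)"
  using additive_group by (rule comm_group.axioms)

lemma add_closed [simp, intro]:
  "x \<in> carrier A \<Longrightarrow> y \<in> carrier A \<Longrightarrow> aadd A x y \<in> carrier A"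
  using monoid.m_closed[OF comm_monoid.axioms(1)[OF additive_monoid], of x y]
  by (simp add: additive_part_def)

lemma zero_closed [simp, intro]: "azero A \<in> carrier A"
  using monoid.one_closed[OF comm_monoid.axioms(1)[OF additive_monoid]]
  by (simp add: additive_part_def)

lemma add_assoc:
  "x \<in> carrier A \<Longrightarrow> y \<in> carrier A \<Longrightarrow> z \<in> carrier A \<Longrightarrow>
     aadd A (aadd A x y) z = aadd A x (aadd A y z)"
  using monoid.m_assoc[OF comm_monoid.axioms(1)[OF additive_monoid], of x y z]
  by (simp add: additive_part_def)

lemma add_commute:
  "x \<in> carrier A \<Longrightarrow> y \<in> carrier A \<Longrightarrow> aadd A x y = aadd A y x"
  using comm_monoid.m_comm[OF additive_monoid, of x y]
  by (simp add: additive_part_def)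

lemma add_left_commute:
  "x \<in> carrier A \<Longrightarrow> y \<in> carrier A \<Longrightarrow> z \<in> carrier A \<Longrightarrow>
     aadd A x (aadd A y z) = aadd A y (aadd A x z)"
  using comm_monoid.m_lcomm[OF additive_monoid, of x y z]
  by (simp add: additive_part_def)

lemma add_zero_left [simp]: "x \<in> carrier A \<Longrightarrow> aadd A (azero A) x = x"
  using monoid.l_one[OF comm_monoid.axioms(1)[OF additive_monoid], of x]
  by (simp add: additive_part_def)

lemma add_zero_right [simp]: "x \<in> carrier A \<Longrightarrow> aadd A x (azero A) = x"
  using monoid.r_one[OF comm_monoid.axioms(1)[OF additive_monoid], of x]
  by (simp add: additive_part_def)

lemma add_left_cancel:
  assumes "x \<in> carrier A" "y \<in> carrier A" "z \<in> carrier A"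
  shows "aadd A x y = aadd A x z \<longleftrightarrow> y = z"
proof
  assume eq: "aadd A x y = aadd A x z"
  interpret add: Group.group "additive_part A" by (rule additive_grp)
  show "y = z"
    using add.inv_closed[of x] add.l_inv[of x] add.m_assoc[of "inv\<^bsub>additive_part A\<^esub> x" x] assms eq
      add.l_one[of y] add.l_one[of z]
    unfolding additive_part_def by (simp, metis)
qed simp

declare scale_closed [simp, intro] mult_closed [simp, intro] star_closed [simp, intro]
  star_star [simp] scale_one [simp]

lemma scale_zero_left [simp]:
  assumes x: "x \<in> carrier A"
  shows "ascale A 0 x = azero A"
proof -
  have "aadd A (ascale A 0 x) (ascale A 0 x) = aadd A (ascale A 0 x) (azero A)"
    using scale_add_left[OF x, of 0 0] x by simp
  then show ?thesis using x by (subst (asm) add_left_cancel) auto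
qed

lemma scale_zero_right [simp]: "ascale A c (azero A) = azero A"
  using scale_scale[of "azero A" c 0] by simp

lemma add_neg [simp]: "x \<in> carrier A \<Longrightarrow> aadd A x (ascale A (-1) x) = azero A"
  using scale_add_left[of x 1 "-1"] by simp

lemma mult_zero_left [simp]: "x \<in> carrier A \<Longrightarrow> amult A (azero A) x = azero A"
  using mult_scale_left[of "azero A" x 0] by simp

lemma mult_zero_right [simp]: "x \<in> carrier A \<Longrightarrow> amult A x (azero A) = azero A"
  using mult_scale_right[of x "azero A" 0] by simp

lemma star_zero [simp]: "astar A (azero A) = azero A"
  using star_scale[of "azero A" 0] by simp

lemma asub_closed [simp, intro]:
  "x \<in> carrier A \<Longrightarrow> y \<in> carrier A \<Longrightarrow> asub A x y \<in> carrier A"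
  by (simp add: asub_def)

lemma asub_self [simp]: "x \<in> carrier A \<Longrightarrow> asub A x x = azero A"
  by (simp add: asub_def)

lemma asub_zero [simp]: "x \<in> carrier A \<Longrightarrow> asub A x (azero A) = x"
  by (simp add: asub_def)

lemma add_asub_cancel:
  "x \<in> carrier A \<Longrightarrow> y \<in> carrier A \<Longrightarrow> aadd A (asub A x y) y = x"
  unfolding asub_def
  by (subst add_assoc) (auto simp: add_commute[of "ascale A (-1) y" y])

lemma asub_eq_zero:
  "x \<in> carrier A \<Longrightarrow> y \<in> carrier A \<Longrightarrow> asub A x y = azero A \<longleftrightarrow> x = y"
  using add_asub_cancel[of x y] by auto

lemma asub_trans:
  "x \<in> carrier A \<Longrightarrow> y \<in> carrier A \<Longrightarrow> z \<in> carrier A \<Longrightarrow>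
     aadd A (asub A x y) (asub A y z) = asub A x z"
  using add_asub_cancel[of x y] unfolding asub_def
  by (simp add: add_assoc[symmetric])

lemma asub_swap:
  "x \<in> carrier A \<Longrightarrow> y \<in> carrier A \<Longrightarrow> ascale A (-1) (asub A x y) = asub A y x"
  unfolding asub_def by (simp add: scale_add_right scale_scale add_commute)

lemma asub_asub_swap:
  assumes "x \<in> carrier A" "y \<in> carrier A" "z \<in> carrier A" "w \<in> carrier A"
  shows "asub A (aadd A x y) (aadd A z w) = aadd A (asub A x z) (asub A y w)"
  using assms unfolding asub_def
  by (simp add: scale_add_right add_assoc add_left_commute)

lemma asub_scale:
  "x \<in> carrier A \<Longrightarrow> y \<in> carrier A \<Longrightarrow>
     asub A (ascale A c x) (ascale A c y) = ascale A c (asub A x y)"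
  unfolding asub_def by (simp add: scale_add_right scale_scale mult.commute)

lemma asub_mult_left:
  "x \<in> carrier A \<Longrightarrow> y \<in> carrier A \<Longrightarrow> z \<in> carrier A \<Longrightarrow>
     amult A (asub A x y) z = asub A (amult A x z) (amult A y z)"
  unfolding asub_def by (simp add: mult_add_left mult_scale_left)

lemma asub_mult_right:
  "x \<in> carrier A \<Longrightarrow> y \<in> carrier A \<Longrightarrow> z \<in> carrier A \<Longrightarrow>
     amult A z (asub A x y) = asub A (amult A z x) (amult A z y)"
  unfolding asub_def by (simp add: mult_add_right mult_scale_right)

lemma asub_mult:
  assumes "x \<in> carrier A" "y \<in> carrier A" "z \<in> carrier A" "w \<in> carrier A"
  shows "asub A (amult A x y) (amult A z w) =
    aadd A (amult A (asub A x z) y) (amult A z (asub A y w))"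
  using assms by (simp add: asub_mult_left asub_mult_right asub_trans)

lemma asub_star:
  "x \<in> carrier A \<Longrightarrow> y \<in> carrier A \<Longrightarrow>
     asub A (astar A x) (astar A y) = astar A (asub A x y)"
  unfolding asub_def by (simp add: star_add star_scale)

lemma asum_empty [simp]: "asum A f {} = azero A"
  unfolding asum_def using comm_monoid.finprod_empty[OF additive_monoid]
  by (simp add: additive_part_def)

lemma asum_insert [simp]:
  assumes "finite I" "i \<notin> I" "\<And>j. j \<in> I \<Longrightarrow> f j \<in> carrier A" "f i \<in> carrier A"
  shows "asum A f (insert i I) = aadd A (f i) (asum A f I)"
  unfolding asum_def using comm_monoid.finprod_insert[OF additive_monoid, of I i f] assms
  by (auto simp: additive_part_def)

lemma asum_closed [simp, intro]:
  assumes "\<And>j. j \<in> I \<Longrightarrow> f j \<in> carrier A"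
  shows "asum A f I \<in> carrier A"
  unfolding asum_def using comm_monoid.finprod_closed[OF additive_monoid, of f I] assms
  by (auto simp: additive_part_def)

lemma asum_cong:
  assumes "I = J" "\<And>j. j \<in> J \<Longrightarrow> f j = g j" "\<And>j. j \<in> J \<Longrightarrow> g j \<in> carrier A"
  shows "asum A f I = asum A g J"
  unfolding asum_def using comm_monoid.finprod_cong'[OF additive_monoid, of I J g f] assms
  by (auto simp: additive_part_def)

lemma asum_zero [simp]: "asum A (\<lambda>_. azero A) I = azero A"
  unfolding asum_def using comm_monoid.finprod_one[OF additive_monoid, of I]
  by (simp add: additive_part_def)

lemma asum_zeroI: "(\<And>i. i \<in> I \<Longrightarrow> f i = azero A) \<Longrightarrow> asum A f I = azero A"
  using asum_cong[of I I f "\<lambda>_. azero A"] by simp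

lemma asum_infinite: "infinite I \<Longrightarrow> asum A f I = azero A"
  unfolding asum_def using comm_monoid.finprod_infinite[OF additive_monoid, of I f]
  by (simp add: additive_part_def)

lemma asum_mono_neutral:
  assumes "finite J" "I \<subseteq> J" "\<And>i. i \<in> J - I \<Longrightarrow> f i = azero A" "\<And>i. i \<in> J \<Longrightarrow> f i \<in> carrier A"
  shows "asum A f I = asum A f J"
  unfolding asum_def
  using comm_monoid.finprod_mono_neutral_cong_left[OF additive_monoid, of J I f f] assms
  by (auto simp: additive_part_def)

lemma asum_add:
  assumes "\<And>i. i \<in> I \<Longrightarrow> f i \<in> carrier A" "\<And>i. i \<in> I \<Longrightarrow> g i \<in> carrier A"
  shows "asum A (\<lambda>i. aadd A (f i) (g i)) I = aadd A (asum A f I) (asum A g I)"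
  unfolding asum_def using comm_monoid.finprod_multf[OF additive_monoid, of f I g] assms
  by (auto simp: additive_part_def)

lemma asum_scale:
  assumes "\<And>i. i \<in> I \<Longrightarrow> f i \<in> carrier A"
  shows "asum A (\<lambda>i. ascale A c (f i)) I = ascale A c (asum A f I)"
proof (cases "finite I")
  case True
  then show ?thesis using assms
    by (induction I) (auto simp: scale_add_right)
qed (simp add: asum_infinite)

lemma asum_mult_left:
  assumes "x \<in> carrier A" "\<And>i. i \<in> I \<Longrightarrow> f i \<in> carrier A"
  shows "asum A (\<lambda>i. amult A x (f i)) I = amult A x (asum A f I)"
proof (cases "finite I")
  case True
  then show ?thesis using assms
    by (induction I) (auto simp: mult_add_right)
qed (use assms in \<open>simp add: asum_infinite\<close>)

lemma asum_mult_right: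
  assumes "x \<in> carrier A" "\<And>i. i \<in> I \<Longrightarrow> f i \<in> carrier A"
  shows "asum A (\<lambda>i. amult A (f i) x) I = amult A (asum A f I) x"
proof (cases "finite I")
  case True
  then show ?thesis using assms
    by (induction I) (auto simp: mult_add_left)
qed (use assms in \<open>simp add: asum_infinite\<close>)

lemma asum_star:
  assumes "\<And>i. i \<in> I \<Longrightarrow> f i \<in> carrier A"
  shows "asum A (\<lambda>i. astar A (f i)) I = astar A (asum A f I)"
proof (cases "finite I")
  case True
  then show ?thesis using assms
    by (induction I) (auto simp: star_add)
qed (simp add: asum_infinite)

lemma asum_swap:
  assumes "finite I" "finite J" "\<And>i j. i \<in> I \<Longrightarrow> j \<in> J \<Longrightarrow> f i j \<in> carrier A"
  shows "asum A (\<lambda>i. asum A (\<lambda>j. f i j) J) I = asum A (\<lambda>j. asum A (\<lambda>i. f i j) I) J"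
  using assms(1,3)
proof (induction I)
  case (insert i I)
  have "asum A (\<lambda>j. asum A (\<lambda>i. f i j) (insert i I)) J =
      asum A (\<lambda>j. aadd A (f i j) (asum A (\<lambda>i. f i j) I)) J"
    using insert by (intro asum_cong) auto
  also have "\<dots> = aadd A (asum A (f i) J) (asum A (\<lambda>j. asum A (\<lambda>i. f i j) I) J)"
    using insert by (subst asum_add) auto
  finally show ?case using insert by simp
qed simp

lemma asum_single:
  assumes "i \<in> I" "finite I" "\<And>j. j \<in> I \<Longrightarrow> j \<noteq> i \<Longrightarrow> f j = azero A" "f i \<in> carrier A"
  shows "asum A f I = f i"
proof -
  have "asum A f I = asum A f {i}"
    using assms by (intro asum_mono_neutral[symmetric]) (auto, metis zero_closed)
  then show ?thesis using assms asum_insert[of "{}" i f] by (simp del: asum_insert)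
qed

lemma asum_scale_sum:
  assumes "x \<in> carrier A" "finite I"
  shows "asum A (\<lambda>i. ascale A (c i) x) I = ascale A (\<Sum>i\<in>I. c i) x"
  using assms(2) by (induction I) (auto simp: assms scale_add_left)

end

text \<open>\<open>star_hom\<close> does not ask for zero to be preserved; it follows because zero
  is \<open>0\<close> times itself and \<open>\<phi>\<close> respects scalars.\<close>

lemma star_hom_zero:
  assumes "star_algebra A" "star_algebra A'" "star_hom A A' \<phi>"
  shows "\<phi> (azero A) = azero A'"
proof -
  interpret A: star_algebra A by fact
  interpret B: star_algebra A' by fact
  have "\<phi> (ascale A 0 (azero A)) = ascale A' 0 (\<phi> (azero A))" "\<phi> (azero A) \<in> carrier A'"
    using assms(3) A.zero_closed unfolding star_hom_def by blast+
  then show ?thesis by (simp only: A.scale_zero_right B.scale_zero_left)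
qed

lemma star_hom_asum:
  assumes "star_algebra A" "star_algebra A'" "star_hom A A' \<phi>" "\<And>i. i \<in> I \<Longrightarrow> f i \<in> carrier A"
  shows "\<phi> (asum A f I) = asum A' (\<lambda>i. \<phi> (f i)) I"
proof -
  interpret A: star_algebra A by fact
  interpret B: star_algebra A' by fact
  note zero = star_hom_zero[OF assms(1-3)]
  show ?thesis
  proof (cases "finite I")
    case True
    then show ?thesis using assms(4)
    proof (induction I)
      case (insert i I)
      have "\<phi> (f j) \<in> carrier A'" if "j \<in> insert i I" for j
        using insert.prems that assms(3) unfolding star_hom_def by auto
      moreover have "\<phi> (asum A f (insert i I)) = aadd A' (\<phi> (f i)) (\<phi> (asum A f I))"
        using insert assms(3) by (simp add: star_hom_def)
      ultimately show ?case using insert by simp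
    qed (simp add: zero)
  qed (simp add: A.asum_infinite B.asum_infinite zero)
qed

lemma star_hom_asub:
  assumes "star_algebra A" "star_hom A A' \<phi>" "x \<in> carrier A" "y \<in> carrier A"
  shows "\<phi> (asub A x y) = asub A' (\<phi> x) (\<phi> y)"
  using assms star_algebra.scale_closed[OF assms(1)] unfolding asub_def star_hom_def by simp

section \<open>Consequences of the C*-identity for a seminorm\<close>

locale cstar_seminormed = star_algebra A
  for A :: "('a, 'm) star_algebra_scheme" +
  fixes N :: "'a \<Rightarrow> real"
  assumes cstar_seminorm: "cstar_seminorm A N"
begin

lemma norm_nonneg [simp]: "x \<in> carrier A \<Longrightarrow> 0 \<le> N x"
  and norm_add: "x \<in> carrier A \<Longrightarrow> y \<in> carrier A \<Longrightarrow> N (aadd A x y) \<le> N x + N y"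
  and norm_scale: "x \<in> carrier A \<Longrightarrow> N (ascale A c x) = norm c * N x"
  and norm_mult: "x \<in> carrier A \<Longrightarrow> y \<in> carrier A \<Longrightarrow> N (amult A x y) \<le> N x * N y"
  and norm_star_mult: "x \<in> carrier A \<Longrightarrow> N (amult A (astar A x) x) = (N x)\<^sup>2"
  using cstar_seminorm unfolding cstar_seminorm_def by blast+

lemma norm_zero [simp]: "N (azero A) = 0"
  using norm_scale[of "azero A" 0] by simp

text \<open>That the involution is isometric is not part of \<open>cstar_seminorm\<close>. The
  square of \<open>N y\<close> is the value at \<open>y^* y\<close>, hence at most \<open>N\<close>
  of the adjoint times \<open>N y\<close>, and \<open>N y\<close> cancels.\<close>

lemma norm_star [simp]:
  assumes x: "x \<in> carrier A"
  shows "N (astar A x) = N x"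
proof -
  have le: "N y \<le> N (astar A y)" if y: "y \<in> carrier A" for y
  proof (cases "N y = 0")
    case False
    then have "N y > 0" using norm_nonneg[OF y] by linarith
    moreover have "N y * N y \<le> N (astar A y) * N y"
      using norm_mult[of "astar A y" y] norm_star_mult[OF y] y by (simp add: power2_eq_square)
    ultimately show ?thesis by simp
  qed (use y in simp)
  show ?thesis using le[OF x] le[of "astar A x"] x by simp
qed

lemma norm_asub_swap: "x \<in> carrier A \<Longrightarrow> y \<in> carrier A \<Longrightarrow> N (asub A x y) = N (asub A y x)"
  using norm_scale[of "asub A x y" "-1"] by (simp add: asub_swap)

lemma norm_asub_trans:
  "x \<in> carrier A \<Longrightarrow> y \<in> carrier A \<Longrightarrow> z \<in> carrier A \<Longrightarrow>
    N (asub A x z) \<le> N (asub A x y) + N (asub A y z)"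
  using norm_add[of "asub A x y" "asub A y z"] by (simp add: asub_trans)

lemma norm_le_asub: "x \<in> carrier A \<Longrightarrow> y \<in> carrier A \<Longrightarrow> N x \<le> N y + N (asub A x y)"
  using norm_add[of "asub A x y" y] by (simp add: add_asub_cancel)

lemma norm_diff_le: "x \<in> carrier A \<Longrightarrow> y \<in> carrier A \<Longrightarrow> \<bar>N x - N y\<bar> \<le> N (asub A x y)"
  using norm_le_asub[of x y] norm_le_asub[of y x] norm_asub_swap[of x y] by auto

lemma norm_asum:
  assumes "\<And>i. i \<in> I \<Longrightarrow> f i \<in> carrier A"
  shows "N (asum A f I) \<le> (\<Sum>i\<in>I. N (f i))"
proof (cases "finite I")
  case True
  then show ?thesis using assms
  proof (induction I)
    case (insert i I)
    then show ?case using norm_add[of "f i" "asum A f I"] by force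
  qed simp
qed (simp add: asum_infinite)

lemma norm_projection_le_1:
  assumes "p \<in> carrier A" "astar A p = p" "amult A p p = p"
  shows "N p \<le> 1"
proof -
  have "(N p)\<^sup>2 = N p" using norm_star_mult[OF assms(1)] assms by simp
  then have "N p * (N p - 1) = 0" by (simp add: algebra_simps power2_eq_square)
  then show ?thesis by auto
qed

text \<open>The \<open>C\<^sup>*\<close>-identity lets one replace a family by \<open>x\<^sub>i\<^sup>*x\<^sub>i\<close> and the bound by its square; after
  \<open>n\<close> such steps the crude bound \<open>card I * M ^ 2 ^ n\<close> loses only a factor whose \<open>2 ^ n\<close>-th root
  tends to \<open>1\<close>.\<close>

lemma norm_orthogonal_sum_power:
  fixes M :: real
  assumes "finite I" "\<And>i. i \<in> I \<Longrightarrow> f i \<in> carrier A"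
    "\<And>i j. i \<in> I \<Longrightarrow> j \<in> I \<Longrightarrow> i \<noteq> j \<Longrightarrow> amult A (astar A (f i)) (f j) = azero A"
    "\<And>i j. i \<in> I \<Longrightarrow> j \<in> I \<Longrightarrow> i \<noteq> j \<Longrightarrow> amult A (f i) (astar A (f j)) = azero A"
    "\<And>i. i \<in> I \<Longrightarrow> N (f i) \<le> M"
  shows "N (asum A f I) ^ 2 ^ n \<le> card I * M ^ 2 ^ n"
  using assms(2-5)
proof (induction n arbitrary: f M)
  case 0
  have "N (asum A f I) \<le> (\<Sum>i\<in>I. N (f i))" using 0 by (intro norm_asum) auto
  also have "\<dots> \<le> card I * M" using 0 sum_bounded_above[of I "\<lambda>i. N (f i)" M] by auto
  finally show ?case by simp
next
  case (Suc n)
  \<comment> \<open>These are self-adjoint, so for them the two orthogonality hypotheses of the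
    induction coincide.\<close>
  let ?g = "\<lambda>i. amult A (astar A (f i)) (f i)"
  have gc: "?g i \<in> carrier A" if "i \<in> I" for i using Suc.prems that by auto
  have gs: "astar A (?g i) = ?g i" if "i \<in> I" for i
    using Suc.prems that by (simp add: star_mult)
  have g0: "amult A (?g i) (?g j) = azero A" if "i \<in> I" "j \<in> I" "i \<noteq> j" for i j
  proof -
    have "amult A (?g i) (?g j) = amult A (astar A (f i)) (amult A (amult A (f i) (astar A (f j))) (f j))"
      using Suc.prems(1) that by (simp add: mult_assoc)
    then show ?thesis using Suc.prems that by simp
  qed
  have gN: "N (?g i) \<le> M\<^sup>2" if "i \<in> I" for i
    using Suc.prems that by (simp add: norm_star_mult power_mono)
  have "N (asum A f I) ^ 2 ^ Suc n = (N (asum A f I) ^ 2) ^ 2 ^ n"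
    by (simp add: power_mult)
  also have "(N (asum A f I))\<^sup>2 = N (amult A (astar A (asum A f I)) (asum A f I))"
    using Suc.prems(1) by (intro norm_star_mult[symmetric] asum_closed)
  also have "amult A (astar A (asum A f I)) (asum A f I) =
     asum A (\<lambda>i. asum A (\<lambda>j. amult A (astar A (f i)) (f j)) I) I"
  proof -
    have "amult A (astar A (asum A f I)) (asum A f I) =
       asum A (\<lambda>i. amult A (astar A (f i)) (asum A f I)) I"
      using Suc.prems(1) by (simp add: asum_star[symmetric] asum_mult_right[symmetric])
    also have "\<dots> = asum A (\<lambda>i. asum A (\<lambda>j. amult A (astar A (f i)) (f j)) I) I"
      using Suc.prems(1) by (intro asum_cong) (auto simp: asum_mult_left)
    finally show ?thesis .
  qed
  also have "\<dots> = asum A ?g I"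
    using Suc.prems \<open>finite I\<close> by (intro asum_cong asum_single) auto
  also have "N (asum A ?g I) ^ 2 ^ n \<le> card I * (M\<^sup>2) ^ 2 ^ n"
    using gs g0 by (intro Suc.IH gc gN) (simp_all add: gs g0)
  finally show ?case by (simp add: power_mult)
qed

lemma norm_orthogonal_sum:
  fixes M :: real
  assumes "finite I" "\<And>i. i \<in> I \<Longrightarrow> f i \<in> carrier A"
    "\<And>i j. i \<in> I \<Longrightarrow> j \<in> I \<Longrightarrow> i \<noteq> j \<Longrightarrow> amult A (astar A (f i)) (f j) = azero A"
    "\<And>i j. i \<in> I \<Longrightarrow> j \<in> I \<Longrightarrow> i \<noteq> j \<Longrightarrow> amult A (f i) (astar A (f j)) = azero A"
    "\<And>i. i \<in> I \<Longrightarrow> N (f i) \<le> M" "0 \<le> M"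
  shows "N (asum A f I) \<le> M"
proof (rule ccontr)
  let ?x = "N (asum A f I)"
  have pow: "?x ^ 2 ^ n \<le> card I * M ^ 2 ^ n" for n
    by (rule norm_orthogonal_sum_power) (use assms in auto)
  assume "\<not> ?x \<le> M"
  then have gt: "M < ?x" by simp
  show False
  proof (cases "M = 0")
    case True
    then have "?x \<le> 0"
      using pow[of 0] by simp
    then show False using gt True by simp
  next
    case False
    then have M: "M > 0" using assms(6) by simp
    \<comment> \<open>The power bound keeps \<open>(1 + c) ^ 2 ^ n\<close> below
      \<open>card I\<close>, while Bernoulli's inequality pushes it above \<open>1 + n * c\<close>;
      \<open>n\<close> is chosen so that the two collide.\<close>
    define c where "c = ?x / M - 1"
    have c: "c > 0" using gt M by (simp add: c_def)
    obtain n :: nat where n: "card I / c < n" using reals_Archimedean2 by blast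
    have "1 + n * c \<le> 1 + real (2 ^ n) * c"
      using c less_exp[of n] by (simp add: less_imp_le mult_right_mono)
    also have "\<dots> \<le> (1 + c) ^ 2 ^ n"
      using Bernoulli_inequality[of c "2 ^ n"] c by simp
    also have "\<dots> = (?x / M) ^ 2 ^ n" by (simp add: c_def)
    also have "\<dots> \<le> card I"
      using pow[of n] M by (simp add: power_divide divide_le_eq)
    finally have "1 + n * c \<le> card I" .
    moreover have "card I < n * c" using n c by (simp add: field_simps)
    ultimately show False by simp
  qed
qed

end

section \<open>Completions\<close>

context cstar_seminormed
begin

abbreviation Cs :: "(nat \<Rightarrow> 'a) set" where "Cs \<equiv> Cauchy_seqs A N"
abbreviation Cmp :: "(nat \<Rightarrow> 'a) set normed_star_algebra" where "Cmp \<equiv> cstar_completion A N"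

definition cls :: "(nat \<Rightarrow> 'a) \<Rightarrow> (nat \<Rightarrow> 'a) set" where
  "cls X = null_rel A N `` {X}"

lemma Cs_closed [simp]: "X \<in> Cs \<Longrightarrow> X n \<in> carrier A"
  unfolding Cauchy_seqs_def by auto

lemma CsI:
  assumes "\<And>n. X n \<in> carrier A"
    and "\<And>\<epsilon>. \<epsilon> > 0 \<Longrightarrow> \<exists>M. \<forall>m\<ge>M. \<forall>n\<ge>M. N (asub A (X m) (X n)) < \<epsilon>"
  shows "X \<in> Cs"
  using assms unfolding Cauchy_seqs_def by auto

lemma CsD:
  assumes "X \<in> Cs" "\<epsilon> > 0"
  obtains M where "\<And>m n. m \<ge> M \<Longrightarrow> n \<ge> M \<Longrightarrow> N (asub A (X m) (X n)) < \<epsilon>"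
proof -
  have "\<exists>M. \<forall>m\<ge>M. \<forall>n\<ge>M. N (asub A (X m) (X n)) < \<epsilon>"
    using assms by (simp add: Cauchy_seqs_def)
  then show ?thesis using that by meson
qed

lemma Cs_const [simp]: "a \<in> carrier A \<Longrightarrow> (\<lambda>_. a) \<in> Cs"
  by (rule CsI) auto

lemma Cs_convergent:
  assumes X: "X \<in> Cs"
  shows "convergent (\<lambda>n. N (X n))"
proof -
  have "Cauchy (\<lambda>n. N (X n))"
  proof (rule metric_CauchyI)
    fix \<epsilon> :: real assume e: "\<epsilon> > 0"
    obtain M where M: "\<And>m n. m \<ge> M \<Longrightarrow> n \<ge> M \<Longrightarrow> N (asub A (X m) (X n)) < \<epsilon>"
      using CsD[OF X e] by blast
    have "dist (N (X m)) (N (X n)) < \<epsilon>" if "m \<ge> M" "n \<ge> M" for m n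
      using M[OF that] norm_diff_le[of "X m" "X n"] X by (simp add: dist_real_def)
    then show "\<exists>M. \<forall>m\<ge>M. \<forall>n\<ge>M. dist (N (X m)) (N (X n)) < \<epsilon>" by blast
  qed
  then show ?thesis by (simp add: Cauchy_convergent_iff)
qed

lemma Cs_bounded:
  assumes X: "X \<in> Cs"
  obtains K where "K > 0" "\<And>n. N (X n) \<le> K"
proof -
  have "Bseq (\<lambda>n. N (X n))" using Cs_convergent[OF X] by (rule convergent_imp_Bseq)
  then obtain K where "K > 0" "\<And>n. norm (N (X n)) \<le> K" unfolding Bseq_def by auto
  then show ?thesis using that by (metis abs_le_D1 real_norm_def)
qed

text \<open>One notion for all four operations; a unary one ignores its second argument. Only
  \<open>x'\<close> and \<open>y\<close> are bounded: they are the factors that remain in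
  \<open>x y - x' y' = (x - x') y + x' (y - y')\<close>, and both can be taken from fixed Cauchy
  sequences.\<close>

definition lipschitz :: "('a \<Rightarrow> 'a \<Rightarrow> 'a) \<Rightarrow> bool" where
  "lipschitz F \<longleftrightarrow> (\<forall>x\<in>carrier A. \<forall>y\<in>carrier A. F x y \<in> carrier A) \<and>
     (\<forall>R>0. \<exists>C>0. \<forall>x\<in>carrier A. \<forall>y\<in>carrier A. \<forall>x'\<in>carrier A. \<forall>y'\<in>carrier A.
        N x' \<le> R \<longrightarrow> N y \<le> R \<longrightarrow> N (asub A (F x y) (F x' y')) \<le> C * (N (asub A x x') + N (asub A y y')))"

lemma lipschitz_on:
  assumes "lipschitz F" "X \<in> Cs" "Y \<in> Cs"
  obtains C where "C > 0" "\<And>x y' n k. x \<in> carrier A \<Longrightarrow> y' \<in> carrier A \<Longrightarrow>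
    N (asub A (F x (Y k)) (F (X n) y')) \<le> C * (N (asub A x (X n)) + N (asub A (Y k) y'))"
proof -
  obtain K where K: "K > 0" "\<And>n. N (X n) \<le> K" using Cs_bounded[OF assms(2)] by blast
  obtain L where L: "L > 0" "\<And>n. N (Y n) \<le> L" using Cs_bounded[OF assms(3)] by blast
  have R: "max K L > 0" "\<And>n. N (X n) \<le> max K L" "\<And>n. N (Y n) \<le> max K L"
    using K L by (auto simp: le_max_iff_disj)
  obtain C where "C > 0" "\<forall>x\<in>carrier A. \<forall>y\<in>carrier A. \<forall>x'\<in>carrier A. \<forall>y'\<in>carrier A.
        N x' \<le> max K L \<longrightarrow> N y \<le> max K L \<longrightarrow> N (asub A (F x y) (F x' y')) \<le> C * (N (asub A x x') + N (asub A y y'))"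
    using assms(1) R(1) unfolding lipschitz_def by blast
  then show ?thesis using R(2,3) assms(2,3) by (intro that[of C]) auto
qed

lemma lipschitz_Cs:
  assumes F: "lipschitz F" and X: "X \<in> Cs" and Y: "Y \<in> Cs"
  shows "(\<lambda>n. F (X n) (Y n)) \<in> Cs"
proof (rule CsI)
  obtain C where C: "C > 0" "\<And>x y' n k. x \<in> carrier A \<Longrightarrow> y' \<in> carrier A \<Longrightarrow>
    N (asub A (F x (Y k)) (F (X n) y')) \<le> C * (N (asub A x (X n)) + N (asub A (Y k) y'))"
    using lipschitz_on[OF assms] by blast
  fix \<epsilon> :: real assume "\<epsilon> > 0"
  then have e: "\<epsilon> / (2 * C) > 0" using C by simp
  obtain M where M: "\<And>m n. m \<ge> M \<Longrightarrow> n \<ge> M \<Longrightarrow> N (asub A (X m) (X n)) < \<epsilon> / (2 * C)"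
    using CsD[OF X e] by blast
  obtain M' where M': "\<And>m n. m \<ge> M' \<Longrightarrow> n \<ge> M' \<Longrightarrow> N (asub A (Y m) (Y n)) < \<epsilon> / (2 * C)"
    using CsD[OF Y e] by blast
  have "N (asub A (F (X m) (Y m)) (F (X n) (Y n))) < \<epsilon>" if "m \<ge> max M M'" "n \<ge> max M M'" for m n
  proof -
    have "C * (N (asub A (X m) (X n)) + N (asub A (Y m) (Y n))) < C * (\<epsilon> / (2 * C) + \<epsilon> / (2 * C))"
      using M[of m n] M'[of m n] that C(1) by (intro mult_strict_left_mono add_strict_mono) auto
    also have "\<dots> = \<epsilon>" using C(1) by simp
    finally show ?thesis using C(2)[of "X m" "Y n" m n] X Y by simp
  qed
  then show "\<exists>M. \<forall>m\<ge>M. \<forall>n\<ge>M. N (asub A (F (X m) (Y m)) (F (X n) (Y n))) < \<epsilon>" by blast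
qed (use assms in \<open>simp add: lipschitz_def\<close>)

lemma lipschitz_add: "lipschitz (aadd A)"
  unfolding lipschitz_def
  by (intro conjI allI impI exI[of _ 1]) (auto simp: asub_asub_swap norm_add)

lemma lipschitz_scale: "lipschitz (\<lambda>x y. ascale A c x)"
  unfolding lipschitz_def
proof (intro conjI allI impI exI[of _ "norm c + 1"] ballI)
  fix x y x' y' assume c: "x \<in> carrier A" "x' \<in> carrier A" "y \<in> carrier A" "y' \<in> carrier A"
  have "norm c * N (asub A x x') \<le> (norm c + 1) * (N (asub A x x') + N (asub A y y'))"
    using c by (intro mult_mono) auto
  then show "N (asub A (ascale A c x) (ascale A c x')) \<le> (norm c + 1) * (N (asub A x x') + N (asub A y y'))"
    using c by (simp add: asub_scale norm_scale)
qed (auto simp: add_nonneg_pos)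

lemma lipschitz_star: "lipschitz (\<lambda>x y. astar A x)"
  unfolding lipschitz_def
  by (intro conjI allI impI exI[of _ 1]) (auto simp: asub_star)

lemma lipschitz_mult: "lipschitz (amult A)"
  unfolding lipschitz_def
proof (intro conjI allI impI)
  fix R :: real assume R: "R > 0"
  have "N (asub A (amult A x y) (amult A x' y')) \<le> R * (N (asub A x x') + N (asub A y y'))"
    if c: "x \<in> carrier A" "y \<in> carrier A" "x' \<in> carrier A" "y' \<in> carrier A" "N x' \<le> R" "N y \<le> R" for x y x' y'
  proof -
    have "N (asub A (amult A x y) (amult A x' y')) \<le> N (amult A (asub A x x') y) + N (amult A x' (asub A y y'))"
      using c by (subst asub_mult) (auto intro!: norm_add)
    also have "\<dots> \<le> N (asub A x x') * N y + N x' * N (asub A y y')"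
      using c by (intro add_mono norm_mult) auto
    also have "\<dots> \<le> N (asub A x x') * R + R * N (asub A y y')"
      using c by (intro add_mono mult_left_mono mult_right_mono) auto
    finally show ?thesis by (simp add: algebra_simps)
  qed
  then show "\<exists>C>0. \<forall>x\<in>carrier A. \<forall>y\<in>carrier A. \<forall>x'\<in>carrier A. \<forall>y'\<in>carrier A.
      N x' \<le> R \<longrightarrow> N y \<le> R \<longrightarrow>
      N (asub A (amult A x y) (amult A x' y')) \<le> C * (N (asub A x x') + N (asub A y y'))"
    using R by blast
qed auto

lemmas Cs_add [simp] = lipschitz_Cs[OF lipschitz_add]
  and Cs_mult [simp] = lipschitz_Cs[OF lipschitz_mult]

lemma Cs_scale [simp]: "X \<in> Cs \<Longrightarrow> (\<lambda>n. ascale A c (X n)) \<in> Cs"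
  and Cs_star [simp]: "X \<in> Cs \<Longrightarrow> (\<lambda>n. astar A (X n)) \<in> Cs"
  using lipschitz_Cs[OF lipschitz_scale] lipschitz_Cs[OF lipschitz_star] by blast+

lemma null_rel_iff:
  "(X, Y) \<in> null_rel A N \<longleftrightarrow> X \<in> Cs \<and> Y \<in> Cs \<and> (\<lambda>n. N (asub A (X n) (Y n))) \<longlonglongrightarrow> 0"
  unfolding null_rel_def by simp

lemma null_rel_trans:
  assumes "(X, Y) \<in> null_rel A N" "(Y, Z) \<in> null_rel A N"
  shows "(X, Z) \<in> null_rel A N"
proof -
  have "(\<lambda>n. N (asub A (X n) (Z n))) \<longlonglongrightarrow> 0"
  proof (rule tendsto_sandwich)
    show "\<forall>\<^sub>F n in sequentially. 0 \<le> N (asub A (X n) (Z n))"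
      using assms by (simp add: null_rel_iff)
    show "\<forall>\<^sub>F n in sequentially. N (asub A (X n) (Z n)) \<le>
        N (asub A (X n) (Y n)) + N (asub A (Y n) (Z n))"
      using assms by (simp add: null_rel_iff norm_asub_trans)
    show "(\<lambda>n. N (asub A (X n) (Y n)) + N (asub A (Y n) (Z n))) \<longlonglongrightarrow> 0"
      using assms tendsto_add[of "\<lambda>n. N (asub A (X n) (Y n))" 0 sequentially
          "\<lambda>n. N (asub A (Y n) (Z n))" 0] by (simp add: null_rel_iff)
  qed simp
  then show ?thesis using assms by (simp add: null_rel_iff)
qed

lemma null_swap:
  assumes "X \<in> Cs" "Y \<in> Cs" "(\<lambda>n. N (asub A (X n) (Y n))) \<longlonglongrightarrow> 0"
  shows "(\<lambda>n. N (asub A (Y n) (X n))) \<longlonglongrightarrow> 0"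
proof -
  have "N (asub A (Y n) (X n)) = N (asub A (X n) (Y n))" for n
    using assms(1,2) by (intro norm_asub_swap) auto
  then show ?thesis using assms(3) by simp
qed

lemma null_rel_equiv: "equiv Cs (null_rel A N)"
proof (rule equivI)
  show "null_rel A N \<subseteq> Cs \<times> Cs" by (auto simp: null_rel_iff)
  show "refl_on Cs (null_rel A N)" by (auto simp: refl_on_def null_rel_iff)
  show "sym (null_rel A N)"
    by (auto simp: sym_def null_rel_iff intro: null_swap)
  show "trans (null_rel A N)" using null_rel_trans by (blast intro: transI)
qed

lemma cls_eq_iff:
  "X \<in> Cs \<Longrightarrow> Y \<in> Cs \<Longrightarrow> cls X = cls Y \<longleftrightarrow> (\<lambda>n. N (asub A (X n) (Y n))) \<longlonglongrightarrow> 0"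
  using eq_equiv_class_iff[OF null_rel_equiv, of X Y] by (simp add: cls_def null_rel_iff)

lemma mem_cls: "Y \<in> cls X \<longleftrightarrow> X \<in> Cs \<and> Y \<in> Cs \<and> (\<lambda>n. N (asub A (X n) (Y n))) \<longlonglongrightarrow> 0"
  by (simp add: cls_def null_rel_iff)

lemma self_mem_cls [simp]: "X \<in> Cs \<Longrightarrow> X \<in> cls X"
  by (simp add: mem_cls)

lemma carrier_Cmp: "carrier Cmp = cls ` Cs"
  unfolding cstar_completion_def quotient_def cls_def by auto

lemma cls_in_carrier [simp]: "X \<in> Cs \<Longrightarrow> cls X \<in> carrier Cmp"
  by (simp add: carrier_Cmp)

lemma cls_eqI:
  assumes "X \<in> Cs" "Y \<in> Cs" "f \<longlonglongrightarrow> (0::real)" "\<And>n. N (asub A (X n) (Y n)) \<le> f n"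
  shows "cls X = cls Y"
proof -
  have "(\<lambda>n. N (asub A (X n) (Y n))) \<longlonglongrightarrow> 0"
    by (rule tendsto_sandwich[OF _ _ tendsto_const assms(3)]) (use assms in auto)
  then show ?thesis using assms by (simp add: cls_eq_iff)
qed

lemma Cmp_zero: "azero Cmp = cls (\<lambda>_. azero A)"
  by (simp add: cstar_completion_def cls_def)

lemma lipschitz_cls:
  assumes F: "lipschitz F" and X: "X \<in> Cs" and Y: "Y \<in> Cs" and X': "X' \<in> cls X" and Y': "Y' \<in> cls Y"
  shows "cls (\<lambda>n. F (X' n) (Y' n)) = cls (\<lambda>n. F (X n) (Y n))"
proof -
  have C: "X' \<in> Cs" "Y' \<in> Cs" using X' Y' by (auto simp: mem_cls)
  obtain K where "K > 0" and K: "\<And>x y' n k. x \<in> carrier A \<Longrightarrow> y' \<in> carrier A \<Longrightarrow>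
    N (asub A (F x (Y k)) (F (X' n) y')) \<le> K * (N (asub A x (X' n)) + N (asub A (Y k) y'))"
    using lipschitz_on[OF F C(1) Y] by blast
  have "(\<lambda>n. K * (N (asub A (X n) (X' n)) + N (asub A (Y n) (Y' n)))) \<longlonglongrightarrow> K * (0 + 0)"
    using X' Y' unfolding mem_cls by (intro tendsto_add tendsto_mult tendsto_const) blast+
  then have lim: "(\<lambda>n. K * (N (asub A (X n) (X' n)) + N (asub A (Y n) (Y' n)))) \<longlonglongrightarrow> 0" by simp
  show ?thesis
    by (rule sym, rule cls_eqI[OF lipschitz_Cs[OF F X Y] lipschitz_Cs[OF F C] lim])
      (use K C X Y in simp)
qed

text \<open>The completion defines its operations as unions over all representatives. By
  \<open>lipschitz_cls\<close> all classes in such a union coincide, so the union is that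
  class.\<close>

lemma Cmp_binary:
  assumes X: "X \<in> Cs" and Y: "Y \<in> Cs"
  shows "aadd Cmp (cls X) (cls Y) = cls (\<lambda>n. aadd A (X n) (Y n))"
    and "amult Cmp (cls X) (cls Y) = cls (\<lambda>n. amult A (X n) (Y n))"
proof -
  have "(\<Union>X'\<in>cls X. \<Union>Y'\<in>cls Y. cls (\<lambda>n. F (X' n) (Y' n))) = cls (\<lambda>n. F (X n) (Y n))"
    if F: "lipschitz F" for F
  proof -
    have "(\<Union>X'\<in>cls X. \<Union>Y'\<in>cls Y. cls (\<lambda>n. F (X' n) (Y' n))) =
        (\<Union>X'\<in>cls X. \<Union>Y'\<in>cls Y. cls (\<lambda>n. F (X n) (Y n)))"
      by (intro SUP_cong refl lipschitz_cls[OF F X Y])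
    then show ?thesis using self_mem_cls[OF X] self_mem_cls[OF Y] by auto
  qed
  note this[OF lipschitz_add, symmetric] this[OF lipschitz_mult, symmetric]
  then show "aadd Cmp (cls X) (cls Y) = cls (\<lambda>n. aadd A (X n) (Y n))"
    "amult Cmp (cls X) (cls Y) = cls (\<lambda>n. amult A (X n) (Y n))"
    by (simp_all only: cstar_completion_def cls_def star_algebra.simps)
qed

lemma Cmp_unary:
  assumes X: "X \<in> Cs"
  shows "ascale Cmp c (cls X) = cls (\<lambda>n. ascale A c (X n))"
    and "astar Cmp (cls X) = cls (\<lambda>n. astar A (X n))"
proof -
  have "(\<Union>X'\<in>cls X. cls (\<lambda>n. F (X' n))) = cls (\<lambda>n. F (X n))"
    if F: "lipschitz (\<lambda>x y. F x)" for F
  proof -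
    have "(\<Union>X'\<in>cls X. cls (\<lambda>n. F (X' n))) = (\<Union>X'\<in>cls X. cls (\<lambda>n. F (X n)))"
      by (intro SUP_cong refl lipschitz_cls[OF F X X _ self_mem_cls[OF X]])
    then show ?thesis using self_mem_cls[OF X] by auto
  qed
  note this[OF lipschitz_scale, symmetric] this[OF lipschitz_star, symmetric]
  then show "ascale Cmp c (cls X) = cls (\<lambda>n. ascale A c (X n))" "astar Cmp (cls X) = cls (\<lambda>n. astar A (X n))"
    by (simp_all only: cstar_completion_def cls_def star_algebra.simps)
qed

text \<open>The norm of a class is \<open>the_elem\<close> of a set of limits, so all
  representatives must first be shown to have the same limit.\<close>

lemma Cmp_norm:
  assumes X: "X \<in> Cs"
  shows "anorm Cmp (cls X) = lim (\<lambda>n. N (X n))" "(\<lambda>n. N (X n)) \<longlonglongrightarrow> anorm Cmp (cls X)"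
proof -
  have "lim (\<lambda>n. N (X' n)) = lim (\<lambda>n. N (X n))" if "X' \<in> cls X" for X'
  proof -
    have C: "X' \<in> Cs" using that by (auto simp: mem_cls)
    have "(\<lambda>n. N (X n) - N (X' n)) \<longlonglongrightarrow> 0"
    proof (rule tendsto_rabs_zero_cancel, rule tendsto_sandwich[OF _ _ tendsto_const])
      show "(\<lambda>n. N (asub A (X n) (X' n))) \<longlonglongrightarrow> 0" using that by (auto simp: mem_cls)
    qed (use X C norm_diff_le in auto)
    moreover have "(\<lambda>n. N (X n)) \<longlonglongrightarrow> lim (\<lambda>n. N (X n))" using Cs_convergent[OF X] convergent_LIMSEQ_iff by blast
    ultimately have "(\<lambda>n. N (X n) - (N (X n) - N (X' n))) \<longlonglongrightarrow> lim (\<lambda>n. N (X n)) - 0"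
      by (intro tendsto_diff)
    then show ?thesis by (simp add: limI)
  qed
  then have "(\<lambda>X. lim (\<lambda>n. N (X n))) ` cls X \<subseteq> {lim (\<lambda>n. N (X n))}"
    by blast
  then have "(\<lambda>X. lim (\<lambda>n. N (X n))) ` cls X = {lim (\<lambda>n. N (X n))}"
    using imageI[OF self_mem_cls[OF X], of "\<lambda>X. lim (\<lambda>n. N (X n))"] by blast
  then show eq: "anorm Cmp (cls X) = lim (\<lambda>n. N (X n))"
    by (simp add: cstar_completion_def)
  show "(\<lambda>n. N (X n)) \<longlonglongrightarrow> anorm Cmp (cls X)"
    unfolding eq using Cs_convergent[OF X] convergent_LIMSEQ_iff by blast
qed

lemmas Cmp_ops = Cmp_binary Cmp_unary Cmp_zero

lemma Cmp_cases:
  assumes "x \<in> carrier Cmp"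
  obtains X where "X \<in> Cs" "x = cls X"
  using assms by (auto simp: carrier_Cmp)

lemma Cmp_additive_group: "comm_group (additive_part Cmp)"
proof (rule comm_groupI)
  fix x y z assume "x \<in> carrier (additive_part Cmp)" "y \<in> carrier (additive_part Cmp)"
    "z \<in> carrier (additive_part Cmp)"
  then obtain X Y Z where "X \<in> Cs" "Y \<in> Cs" "Z \<in> Cs" "x = cls X" "y = cls Y" "z = cls Z"
    by (auto simp: additive_part_def carrier_Cmp)
  then show "x \<otimes>\<^bsub>additive_part Cmp\<^esub> y \<otimes>\<^bsub>additive_part Cmp\<^esub> z =
     x \<otimes>\<^bsub>additive_part Cmp\<^esub> (y \<otimes>\<^bsub>additive_part Cmp\<^esub> z)"
    by (simp add: additive_part_def Cmp_ops add_assoc)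
next
  fix x y assume "x \<in> carrier (additive_part Cmp)" "y \<in> carrier (additive_part Cmp)"
  then obtain X Y where X: "X \<in> Cs" "Y \<in> Cs" "x = cls X" "y = cls Y"
    by (auto simp: additive_part_def carrier_Cmp)
  then show "x \<otimes>\<^bsub>additive_part Cmp\<^esub> y \<in> carrier (additive_part Cmp)"
    by (simp add: additive_part_def Cmp_ops)
  have "(\<lambda>n. aadd A (X n) (Y n)) = (\<lambda>n. aadd A (Y n) (X n))"
    using X by (simp add: add_commute)
  then show "x \<otimes>\<^bsub>additive_part Cmp\<^esub> y = y \<otimes>\<^bsub>additive_part Cmp\<^esub> x"
    using X by (simp add: additive_part_def Cmp_ops)
next
  show "\<one>\<^bsub>additive_part Cmp\<^esub> \<in> carrier (additive_part Cmp)"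
    by (simp add: additive_part_def Cmp_ops)
next
  fix x assume "x \<in> carrier (additive_part Cmp)"
  then obtain X where X: "X \<in> Cs" "x = cls X"
    by (auto simp: additive_part_def carrier_Cmp)
  then show "\<one>\<^bsub>additive_part Cmp\<^esub> \<otimes>\<^bsub>additive_part Cmp\<^esub> x = x"
    by (simp add: additive_part_def Cmp_ops)
  have "aadd Cmp (cls (\<lambda>n. ascale A (-1) (X n))) (cls X) = azero Cmp"
    using X by (simp add: Cmp_ops add_commute[of "ascale A (- 1) (X _)" "X _"])
  then show "\<exists>y\<in>carrier (additive_part Cmp). y \<otimes>\<^bsub>additive_part Cmp\<^esub> x = \<one>\<^bsub>additive_part Cmp\<^esub>"
    using X by (auto simp: additive_part_def intro!: bexI[of _ "cls (\<lambda>n. ascale A (-1) (X n))"])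
qed

lemma Cmp_star_algebra: "star_algebra Cmp"
proof (intro star_algebra.intro)
  show "comm_group (additive_part Cmp)" by (rule Cmp_additive_group)
  fix x y z c d assume "x \<in> carrier Cmp"
  then obtain X where X: "X \<in> Cs" "x = cls X" by (rule Cmp_cases)
  show "ascale Cmp c x \<in> carrier Cmp" "astar Cmp x \<in> carrier Cmp"
    using X(1) by (simp_all add: X(2) Cmp_ops)
  show "ascale Cmp (c + d) x = aadd Cmp (ascale Cmp c x) (ascale Cmp d x)"
    using X(1) by (simp add: X(2) Cmp_ops scale_add_left)
  show "ascale Cmp c (ascale Cmp d x) = ascale Cmp (c * d) x"
    using X(1) by (simp add: X(2) Cmp_ops scale_scale)
  show "ascale Cmp 1 x = x" "astar Cmp (astar Cmp x) = x"
    using X(1) by (simp_all add: X(2) Cmp_ops)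
  show "astar Cmp (ascale Cmp c x) = ascale Cmp (cnj c) (astar Cmp x)"
    using X(1) by (simp add: X(2) Cmp_ops star_scale)
  assume "y \<in> carrier Cmp"
  then obtain Y where Y: "Y \<in> Cs" "y = cls Y" by (rule Cmp_cases)
  show "amult Cmp x y \<in> carrier Cmp"
    using X(1) Y(1) by (simp add: X(2) Y(2) Cmp_ops)
  show "ascale Cmp c (aadd Cmp x y) = aadd Cmp (ascale Cmp c x) (ascale Cmp c y)"
    using X(1) Y(1) by (simp add: X(2) Y(2) Cmp_ops scale_add_right)
  show "amult Cmp (ascale Cmp c x) y = ascale Cmp c (amult Cmp x y)"
    using X(1) Y(1) by (simp add: X(2) Y(2) Cmp_ops mult_scale_left)
  show "amult Cmp x (ascale Cmp c y) = ascale Cmp c (amult Cmp x y)"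
    using X(1) Y(1) by (simp add: X(2) Y(2) Cmp_ops mult_scale_right)
  show "astar Cmp (aadd Cmp x y) = aadd Cmp (astar Cmp x) (astar Cmp y)"
    using X(1) Y(1) by (simp add: X(2) Y(2) Cmp_ops star_add)
  show "astar Cmp (amult Cmp x y) = amult Cmp (astar Cmp y) (astar Cmp x)"
    using X(1) Y(1) by (simp add: X(2) Y(2) Cmp_ops star_mult)
  assume "z \<in> carrier Cmp"
  then obtain Z where Z: "Z \<in> Cs" "z = cls Z" by (rule Cmp_cases)
  show "amult Cmp (amult Cmp x y) z = amult Cmp x (amult Cmp y z)"
    using X(1) Y(1) Z(1) by (simp add: X(2) Y(2) Z(2) Cmp_ops mult_assoc)
  show "amult Cmp (aadd Cmp x y) z = aadd Cmp (amult Cmp x z) (amult Cmp y z)"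
    using X(1) Y(1) Z(1) by (simp add: X(2) Y(2) Z(2) Cmp_ops mult_add_left)
  show "amult Cmp x (aadd Cmp y z) = aadd Cmp (amult Cmp x y) (amult Cmp x z)"
    using X(1) Y(1) Z(1) by (simp add: X(2) Y(2) Z(2) Cmp_ops mult_add_right)
qed

lemma Cmp_cstar_seminorm: "cstar_seminorm Cmp (anorm Cmp)"
  unfolding cstar_seminorm_def
proof (intro conjI ballI allI)
  fix x y c assume "x \<in> carrier Cmp" "y \<in> carrier Cmp"
  then obtain X Y where X: "X \<in> Cs" "x = cls X" and Y: "Y \<in> Cs" "y = cls Y"
    by (auto simp: carrier_Cmp)
  show "anorm Cmp (aadd Cmp x y) \<le> anorm Cmp x + anorm Cmp y"
    unfolding X Y Cmp_binary(1)[OF X(1) Y(1)]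
    by (rule LIMSEQ_le[OF Cmp_norm(2) tendsto_add[OF Cmp_norm(2) Cmp_norm(2)]])
      (use X Y norm_add in auto)
  show "anorm Cmp (amult Cmp x y) \<le> anorm Cmp x * anorm Cmp y"
    unfolding X Y Cmp_binary(2)[OF X(1) Y(1)]
    by (rule LIMSEQ_le[OF Cmp_norm(2) tendsto_mult[OF Cmp_norm(2) Cmp_norm(2)]])
      (use X Y norm_mult in auto)
next
  fix x c assume "x \<in> carrier Cmp"
  then obtain X where X: "X \<in> Cs" "x = cls X" by (auto simp: carrier_Cmp)
  show "0 \<le> anorm Cmp x"
    unfolding X by (rule LIMSEQ_le_const[OF Cmp_norm(2)]) (use X in auto)
  show "anorm Cmp (ascale Cmp c x) = norm c * anorm Cmp x"
    unfolding X Cmp_unary(1)[OF X(1)]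
    by (rule LIMSEQ_unique[OF Cmp_norm(2)])
      (use X tendsto_mult_left[OF Cmp_norm(2)[OF X(1)], of "norm c"] in \<open>simp_all add: norm_scale\<close>)
  show "anorm Cmp (amult Cmp (astar Cmp x) x) = (anorm Cmp x)\<^sup>2"
    using LIMSEQ_unique[OF Cmp_norm(2), of "\<lambda>n. amult A (astar A (X n)) (X n)" "(anorm Cmp x)\<^sup>2"]
      tendsto_power[OF Cmp_norm(2)[OF X(1)], of 2] X
    by (simp add: Cmp_ops norm_star_mult)
qed

lemma embed_eq: "completion_embed A N a = cls (\<lambda>_. a)"
  by (simp add: completion_embed_def cls_def)

lemma embed_star_hom: "star_hom A Cmp (completion_embed A N)"
  unfolding star_hom_def embed_eq by (simp add: Cmp_ops)

lemma norm_embed [simp]: "a \<in> carrier A \<Longrightarrow> anorm Cmp (completion_embed A N a) = N a"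
  using LIMSEQ_unique[OF Cmp_norm(2)[of "\<lambda>_. a"] tendsto_const] by (simp add: embed_eq)

lemma Cmp_asub: "X \<in> Cs \<Longrightarrow> Y \<in> Cs \<Longrightarrow> asub Cmp (cls X) (cls Y) = cls (\<lambda>n. asub A (X n) (Y n))"
  by (simp add: asub_def Cmp_ops)

lemma Cs_asub [simp]: "X \<in> Cs \<Longrightarrow> Y \<in> Cs \<Longrightarrow> (\<lambda>n. asub A (X n) (Y n)) \<in> Cs"
  by (simp add: asub_def)

lemma embed_near_cls:
  assumes X: "X \<in> Cs" and "a \<in> carrier A" "\<And>n. n \<ge> M \<Longrightarrow> N (asub A a (X n)) \<le> \<epsilon>"
  shows "anorm Cmp (asub Cmp (completion_embed A N a) (cls X)) \<le> \<epsilon>"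
  unfolding embed_eq
  by (subst Cmp_asub) (use assms in \<open>auto intro!: LIMSEQ_le_const2[OF Cmp_norm(2)]\<close>)

lemma embed_dense:
  assumes "x \<in> carrier Cmp" "\<epsilon> > 0"
  shows "\<exists>a\<in>carrier A. anorm Cmp (asub Cmp (completion_embed A N a) x) \<le> \<epsilon>"
proof -
  obtain X where X: "X \<in> Cs" "x = cls X" using assms by (auto simp: carrier_Cmp)
  obtain M where M: "\<And>m n. m \<ge> M \<Longrightarrow> n \<ge> M \<Longrightarrow> N (asub A (X m) (X n)) < \<epsilon>"
    using CsD[OF X(1) assms(2)] by blast
  have "anorm Cmp (asub Cmp (completion_embed A N (X M)) x) \<le> \<epsilon>"
    unfolding X(2) using M[of M] X by (intro embed_near_cls[of X _ M]) (auto intro: less_imp_le)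
  then show ?thesis using X by (intro bexI[of _ "X M"]) auto
qed

text \<open>Diagonal argument: by density \<open>S n\<close> is within \<open>1 / Suc n\<close> of
  the embedding of some \<open>Y n\<close>. Then \<open>Y\<close> is itself a Cauchy sequence of
  \<open>A\<close>, and its class is the limit.\<close>

lemma Cmp_complete:
  assumes S: "S \<in> Cauchy_seqs Cmp (anorm Cmp)"
  shows "\<exists>x\<in>carrier Cmp. (\<lambda>n. anorm Cmp (asub Cmp (S n) x)) \<longlonglongrightarrow> 0"
proof -
  interpret C: cstar_seminormed Cmp "anorm Cmp"
    by (intro cstar_seminormed.intro cstar_seminormed_axioms.intro Cmp_star_algebra Cmp_cstar_seminorm)
  let ?i = "completion_embed A N"
  have ic [simp]: "?i a \<in> carrier Cmp" if "a \<in> carrier A" for a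
    using that by (simp add: embed_eq)
  have Sc [simp]: "S n \<in> carrier Cmp" for n using S by simp
  have "\<exists>a\<in>carrier A. anorm Cmp (asub Cmp (?i a) (S n)) \<le> 1 / Suc n" for n
    by (rule embed_dense) auto
  then obtain Y where Y [simp]: "\<And>n. Y n \<in> carrier A"
    and YS: "\<And>n. anorm Cmp (asub Cmp (?i (Y n)) (S n)) \<le> 1 / Suc n" by metis
  have dist: "N (asub A (Y m) (Y n)) \<le> 1 / Suc m + anorm Cmp (asub Cmp (S m) (S n)) + 1 / Suc n" for m n
  proof -
    have "N (asub A (Y m) (Y n)) = anorm Cmp (asub Cmp (?i (Y m)) (?i (Y n)))"
      by (simp add: star_hom_asub[OF star_algebra_axioms embed_star_hom, symmetric])
    also have "\<dots> \<le> anorm Cmp (asub Cmp (?i (Y m)) (S m)) + anorm Cmp (asub Cmp (S m) (?i (Y n)))"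
      by (rule C.norm_asub_trans) auto
    also have "anorm Cmp (asub Cmp (S m) (?i (Y n))) \<le>
        anorm Cmp (asub Cmp (S m) (S n)) + anorm Cmp (asub Cmp (S n) (?i (Y n)))"
      by (rule C.norm_asub_trans) auto
    finally show ?thesis
      using YS[of m] YS[of n] C.norm_asub_swap[of "S n" "?i (Y n)"] by simp
  qed
  have inv: "\<exists>M. \<forall>n\<ge>M. 1 / Suc n < \<epsilon>" if "\<epsilon> > 0" for \<epsilon> :: real
    using LIMSEQ_inverse_real_of_nat that unfolding LIMSEQ_iff by (simp add: inverse_eq_divide)
  have YC: "Y \<in> Cs"
  proof (rule CsI)
    fix \<epsilon> :: real assume "\<epsilon> > 0"
    then have e: "\<epsilon> / 3 > 0" by simp
    obtain M where M: "\<And>m n. m \<ge> M \<Longrightarrow> n \<ge> M \<Longrightarrow> anorm Cmp (asub Cmp (S m) (S n)) < \<epsilon> / 3"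
      using C.CsD[OF S e] by blast
    obtain K where K: "\<And>n. n \<ge> K \<Longrightarrow> 1 / Suc n < \<epsilon> / 3" using inv[OF e] by blast
    have "N (asub A (Y m) (Y n)) < \<epsilon>" if "m \<ge> max M K" "n \<ge> max M K" for m n
      using dist[of m n] M[of m n] K[of m] K[of n] that by simp
    then show "\<exists>M. \<forall>m\<ge>M. \<forall>n\<ge>M. N (asub A (Y m) (Y n)) < \<epsilon>" by blast
  qed simp
  have "(\<lambda>n. anorm Cmp (asub Cmp (S n) (cls Y))) \<longlonglongrightarrow> 0"
  proof (rule LIMSEQ_I)
    fix \<epsilon> :: real assume "\<epsilon> > 0"
    then have e: "\<epsilon> / 3 > 0" by simp
    obtain M where M: "\<And>m n. m \<ge> M \<Longrightarrow> n \<ge> M \<Longrightarrow> N (asub A (Y m) (Y n)) < \<epsilon> / 3"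
      using CsD[OF YC e] by blast
    obtain K where K: "\<And>n. n \<ge> K \<Longrightarrow> 1 / Suc n < \<epsilon> / 3" using inv[OF e] by blast
    have "anorm Cmp (asub Cmp (S n) (cls Y)) < \<epsilon>" if n: "n \<ge> max M K" for n
    proof -
      have "anorm Cmp (asub Cmp (S n) (cls Y)) \<le>
          anorm Cmp (asub Cmp (S n) (?i (Y n))) + anorm Cmp (asub Cmp (?i (Y n)) (cls Y))"
        using YC by (intro C.norm_asub_trans) auto
      moreover have "anorm Cmp (asub Cmp (?i (Y n)) (cls Y)) \<le> \<epsilon> / 3"
        using M[of n] n YC by (intro embed_near_cls[of Y _ M]) (auto intro: less_imp_le)
      moreover have "anorm Cmp (asub Cmp (S n) (?i (Y n))) \<le> 1 / Suc n"
        using YS[of n] C.norm_asub_swap[of "S n" "?i (Y n)"] by simp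
      ultimately show ?thesis using K[of n] n \<open>\<epsilon> > 0\<close> by simp
    qed
    then show "\<exists>no. \<forall>n\<ge>no. norm (anorm Cmp (asub Cmp (S n) (cls Y)) - 0) < \<epsilon>"
      using YC by (intro exI[of _ "max M K"]) simp
  qed
  then show ?thesis using YC by (intro bexI[of _ "cls Y"]) auto
qed

theorem completion_cstar_algebra: "cstar_algebra Cmp"
proof (intro cstar_algebra.intro cstar_algebra_axioms.intro)
  fix x assume "x \<in> carrier Cmp" "anorm Cmp x = 0"
  then obtain X where X: "X \<in> Cs" "x = cls X" by (auto simp: carrier_Cmp)
  have "(\<lambda>n. N (X n)) \<longlonglongrightarrow> 0" using Cmp_norm(2)[OF X(1)] X(2) \<open>anorm Cmp x = 0\<close> by simp
  then show "x = azero Cmp" using X by (simp add: Cmp_zero cls_eq_iff)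
qed (use Cmp_star_algebra Cmp_cstar_seminorm Cmp_complete in auto)

end

section \<open>Isomorphisms of completions and universal seminorms\<close>

lemma cstar_algebra_seminormed:
  "cstar_algebra A \<Longrightarrow> cstar_seminormed A (anorm A)"
  by (simp add: cstar_algebra_def cstar_algebra_axioms_def cstar_seminormed_def
      cstar_seminormed_axioms_def)

text \<open>\<open>\<phi>\<close> may have a kernel and need not be onto: the kernel has seminorm
  zero, so the completion identifies it with zero, and density supplies the missing limits.\<close>

theorem completion_isomorphism:
  assumes A: "cstar_seminormed A N" and B: "cstar_seminormed B K"
    and hom: "star_hom A B \<phi>"
    and iso: "\<And>a. a \<in> carrier A \<Longrightarrow> K (\<phi> a) = N a"
    and dense: "\<And>b \<epsilon>. b \<in> carrier B \<Longrightarrow> \<epsilon> > 0 \<Longrightarrow> \<exists>a\<in>carrier A. K (asub B (\<phi> a) b) < \<epsilon>"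
  shows "\<exists>\<pi>. cstar_isomorphism (cstar_completion A N) (cstar_completion B K) \<pi> \<and>
    (\<forall>a\<in>carrier A. \<pi> (completion_embed A N a) = completion_embed B K (\<phi> a))"
proof -
  interpret A: cstar_seminormed A N by fact
  interpret B: cstar_seminormed B K by fact
  have \<phi> [simp]: "\<phi> a \<in> carrier B" if "a \<in> carrier A" for a
    using hom that by (simp add: star_hom_def)
  have sub: "K (asub B (\<phi> x) (\<phi> y)) = N (asub A x y)" if "x \<in> carrier A" "y \<in> carrier A" for x y
    using that by (simp add: star_hom_asub[OF A.star_algebra_axioms hom, symmetric] iso)
  have C [simp]: "(\<lambda>n. \<phi> (X n)) \<in> B.Cs" if "X \<in> A.Cs" for X
    using that unfolding Cauchy_seqs_def by (auto simp: sub image_subset_iff)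
  define \<pi> where "\<pi> S = (\<Union>X\<in>S. B.cls (\<lambda>n. \<phi> (X n)))" for S
  have \<pi>: "\<pi> (A.cls X) = B.cls (\<lambda>n. \<phi> (X n))" if X: "X \<in> A.Cs" for X
  proof -
    have "B.cls (\<lambda>n. \<phi> (X' n)) = B.cls (\<lambda>n. \<phi> (X n))" if "X' \<in> A.cls X" for X'
    proof -
      have X': "X' \<in> A.Cs" using that by (simp add: A.mem_cls)
      have "(\<lambda>n. N (asub A (X' n) (X n))) \<longlonglongrightarrow> 0"
        using A.null_swap[OF X X'] that by (simp add: A.mem_cls)
      then show ?thesis using X X' by (simp add: B.cls_eq_iff sub)
    qed
    then show ?thesis unfolding \<pi>_def using A.self_mem_cls[OF X] by (intro UN_constant_eq) blast+
  qed
  have "star_hom A.Cmp B.Cmp \<pi>"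
    using hom unfolding star_hom_def
    by (auto elim!: A.Cmp_cases simp: \<pi> A.Cmp_ops B.Cmp_ops)
  moreover have "inj_on \<pi> (carrier A.Cmp)"
  proof (rule inj_onI)
    fix x y assume "x \<in> carrier A.Cmp" "y \<in> carrier A.Cmp" and eq: "\<pi> x = \<pi> y"
    then obtain X Y where XY: "X \<in> A.Cs" "Y \<in> A.Cs" "x = A.cls X" "y = A.cls Y"
      by (meson A.Cmp_cases)
    then have "(\<lambda>n. N (asub A (X n) (Y n))) \<longlonglongrightarrow> 0"
      using eq by (simp add: \<pi> B.cls_eq_iff sub)
    then show "x = y" using XY by (simp add: A.cls_eq_iff)
  qed
  moreover have "\<pi> ` carrier A.Cmp = carrier B.Cmp"
  proof
    show "\<pi> ` carrier A.Cmp \<subseteq> carrier B.Cmp"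
      by (auto elim!: A.Cmp_cases simp: \<pi>)
    show "carrier B.Cmp \<subseteq> \<pi> ` carrier A.Cmp"
    proof
      fix y assume "y \<in> carrier B.Cmp"
      then obtain Y where Y: "Y \<in> B.Cs" "y = B.cls Y" by (auto simp: B.carrier_Cmp)
      \<comment> \<open>A preimage of the class of \<open>Y\<close> is assembled from approximate
        preimages of its terms with errors tending to zero. It is Cauchy because
        \<open>\<phi>\<close> preserves distances.\<close>
      have "\<exists>a\<in>carrier A. K (asub B (\<phi> a) (Y n)) < 1 / Suc n" for n
        using dense[of "Y n" "1 / Suc n"] Y by simp
      then obtain X where X [simp]: "\<And>n. X n \<in> carrier A"
        and XY: "\<And>n. K (asub B (\<phi> (X n)) (Y n)) < 1 / Suc n" by metis
      have lim: "(\<lambda>n. K (asub B (\<phi> (X n)) (Y n))) \<longlonglongrightarrow> 0"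
        by (rule tendsto_sandwich[OF _ _ tendsto_const LIMSEQ_inverse_real_of_nat])
          (use XY Y in \<open>auto simp: inverse_eq_divide intro!: less_imp_le always_eventually\<close>)
      have "X \<in> A.Cs"
      proof (rule A.CsI)
        fix \<epsilon> :: real assume "\<epsilon> > 0"
        then have e: "\<epsilon> / 3 > 0" by simp
        obtain M where M: "\<And>m n. m \<ge> M \<Longrightarrow> n \<ge> M \<Longrightarrow> K (asub B (Y m) (Y n)) < \<epsilon> / 3"
          using B.CsD[OF Y(1) e] by blast
        obtain L where L: "\<And>n. n \<ge> L \<Longrightarrow> K (asub B (\<phi> (X n)) (Y n)) < \<epsilon> / 3"
          using order_tendstoD(2)[OF lim e] unfolding eventually_sequentially by blast
        have "N (asub A (X m) (X n)) < \<epsilon>" if "m \<ge> max M L" "n \<ge> max M L" for m n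
        proof -
          have "K (asub B (\<phi> (X m)) (\<phi> (X n))) \<le>
              K (asub B (\<phi> (X m)) (Y m)) + K (asub B (Y m) (\<phi> (X n)))"
            using Y by (intro B.norm_asub_trans) auto
          moreover have "K (asub B (Y m) (\<phi> (X n))) \<le>
              K (asub B (Y m) (Y n)) + K (asub B (Y n) (\<phi> (X n)))"
            using Y by (intro B.norm_asub_trans) auto
          ultimately show ?thesis
            using M[of m n] L[of m] L[of n] that Y B.norm_asub_swap[of "Y n" "\<phi> (X n)"]
            by (simp add: sub)
        qed
        then show "\<exists>M. \<forall>m\<ge>M. \<forall>n\<ge>M. N (asub A (X m) (X n)) < \<epsilon>" by blast
      qed simp
      moreover from this have "B.cls (\<lambda>n. \<phi> (X n)) = y"
        using Y lim by (simp add: B.cls_eq_iff)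
      ultimately show "y \<in> \<pi> ` carrier A.Cmp"
        by (intro image_eqI[of _ _ "A.cls X"]) (simp_all add: \<pi>)
    qed
  qed
  moreover have "\<pi> (completion_embed A N a) = completion_embed B K (\<phi> a)" if "a \<in> carrier A" for a
    using that by (simp add: A.embed_eq B.embed_eq \<pi>)
  ultimately show ?thesis
    unfolding cstar_isomorphism_def bij_betw_def
    using A.completion_cstar_algebra B.completion_cstar_algebra by blast
qed

text \<open>The supremum is meaningful for a nonempty, pointwise bounded family, hence
  \<open>N0\<close> and the bound. The C*-identity survives because the supremum of the squares of
  nonnegative numbers is the square of their supremum.\<close>

theorem universal_seminorm_cstar_seminorm:
  assumes "star_algebra A" and ex: "cstar_seminorm A N0" "P N0"
    and bdd: "\<And>x. x \<in> carrier A \<Longrightarrow> \<exists>M. \<forall>N. cstar_seminorm A N \<and> P N \<longrightarrow> N x \<le> M"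
  shows "cstar_seminorm A (universal_seminorm A P)"
proof -
  interpret star_algebra A by fact
  let ?S = "{N. cstar_seminorm A N \<and> P N}"
  let ?U = "universal_seminorm A P"
  have ne: "?S \<noteq> {}" using ex by auto
  have upper: "N x \<le> ?U x" if N: "N \<in> ?S" and x: "x \<in> carrier A" for N x
  proof -
    obtain M where "\<And>N. N \<in> ?S \<Longrightarrow> N x \<le> M" using bdd[OF x] by auto
    then have "bdd_above ((\<lambda>N. N x) ` ?S)" by (rule bdd_aboveI2)
    then show ?thesis
      unfolding universal_seminorm_def using N by (intro cSUP_upper) auto
  qed
  have least: "?U x \<le> M" if "\<And>N. N \<in> ?S \<Longrightarrow> N x \<le> M" for x M
    unfolding universal_seminorm_def using ne that by (rule cSUP_least)
  have sn: "cstar_seminormed A N" if "N \<in> ?S" for N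
    using that star_algebra_axioms
    by (simp add: cstar_seminormed_def cstar_seminormed_axioms_def)
  have nonneg: "0 \<le> ?U x" if "x \<in> carrier A" for x
    using upper[of N0 x] ex that cstar_seminormed.norm_nonneg[OF sn, of N0 x] by auto
  have scale_le: "?U (ascale A c x) \<le> norm c * ?U x" if "x \<in> carrier A" for c x
    using that upper
    by (intro least) (auto simp: cstar_seminormed.norm_scale[OF sn] intro!: mult_left_mono)
  show ?thesis
    unfolding cstar_seminorm_def
  proof (intro conjI ballI allI)
    fix x y assume xy: "x \<in> carrier A" "y \<in> carrier A"
    show "?U (aadd A x y) \<le> ?U x + ?U y"
    proof (rule least)
      fix N assume N: "N \<in> ?S"
      then show "N (aadd A x y) \<le> ?U x + ?U y"
        using cstar_seminormed.norm_add[OF sn[OF N] xy] upper[OF N xy(1)] upper[OF N xy(2)] by simp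
    qed
    show "?U (amult A x y) \<le> ?U x * ?U y"
    proof (rule least)
      fix N assume N: "N \<in> ?S"
      have "N x * N y \<le> ?U x * ?U y"
        using upper[OF N xy(1)] upper[OF N xy(2)] nonneg xy
          cstar_seminormed.norm_nonneg[OF sn[OF N]] by (intro mult_mono) auto
      then show "N (amult A x y) \<le> ?U x * ?U y"
        using cstar_seminormed.norm_mult[OF sn[OF N] xy] by simp
    qed
  next
    fix x c assume x: "x \<in> carrier A"
    show "0 \<le> ?U x" using nonneg x .
    show "?U (ascale A c x) = norm c * ?U x"
    proof (cases "c = 0")
      case True
      have "?U (azero A) \<le> 0"
        by (rule least) (simp add: cstar_seminormed.norm_zero[OF sn])
      then show ?thesis using True x nonneg[of "azero A"] by simp
    next
      case False
      \<comment> \<open>The supremum gives one inequality for scaling directly; the other is the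
        same inequality for \<open>1 / c\<close>.\<close>
      have "?U x \<le> norm (1 / c) * ?U (ascale A c x)"
        using scale_le[of "ascale A c x" "1 / c"] x False by (simp add: scale_scale)
      then have "norm c * ?U x \<le> ?U (ascale A c x)"
        using False by (simp add: norm_divide field_simps)
      then show ?thesis using scale_le[OF x, of c] by simp
    qed
    show "?U (amult A (astar A x) x) = (?U x)\<^sup>2"
    proof (rule antisym)
      show "?U (amult A (astar A x) x) \<le> (?U x)\<^sup>2"
      proof (rule least)
        fix N assume N: "N \<in> ?S"
        then show "N (amult A (astar A x) x) \<le> (?U x)\<^sup>2"
          using cstar_seminormed.norm_star_mult[OF sn[OF N] x] upper[OF N x]
            cstar_seminormed.norm_nonneg[OF sn[OF N] x] by (simp add: power_mono)
      qed
      have "?U x \<le> sqrt (?U (amult A (astar A x) x))"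
      proof (rule least)
        fix N assume N: "N \<in> ?S"
        then show "N x \<le> sqrt (?U (amult A (astar A x) x))"
          using cstar_seminormed.norm_star_mult[OF sn[OF N] x] x
            upper[OF N, of "amult A (astar A x) x"] by (intro real_le_rsqrt) auto
      qed
      then show "(?U x)\<^sup>2 \<le> ?U (amult A (astar A x) x)"
        using nonneg[of x] nonneg[of "amult A (astar A x) x"] x
        by (metis mult_closed star_closed power_mono real_sqrt_pow2)
    qed
  qed
qed

lemma universal_seminorm_upper:
  assumes "cstar_seminorm A N" "P N" "\<And>K. cstar_seminorm A K \<Longrightarrow> P K \<Longrightarrow> K x \<le> M"
  shows "N x \<le> universal_seminorm A P x"
  unfolding universal_seminorm_def
  using assms by (intro cSUP_upper) (auto intro!: bdd_aboveI2)

text \<open>The seminorm that keeps the family in \<open>universal_seminorm\<close> from being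
  empty.\<close>

lemma cstar_seminorm_zero: "cstar_seminorm A (\<lambda>_. 0)"
  by (simp add: cstar_seminorm_def)

section \<open>Free *-algebras\<close>

definition word_star :: "('x \<times> bool) list \<Rightarrow> ('x \<times> bool) list" where
  "word_star w = rev (map (apsnd Not) w)"

lemma word_star_simps [simp]:
  "word_star [] = []" "word_star (l # w) = word_star w @ [apsnd Not l]"
  "word_star (u @ v) = word_star v @ word_star u" "word_star (word_star w) = w"
  "word_star w = [] \<longleftrightarrow> w = []" "fst ` set (word_star w) = fst ` set w"
proof -
  have [simp]: "apsnd Not \<circ> apsnd Not = id" by (auto simp: fun_eq_iff)
  show "word_star (word_star w) = w" by (simp add: word_star_def rev_map)
  show "fst ` set (word_star w) = fst ` set w" by (force simp: word_star_def image_iff)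
qed (simp_all add: word_star_def)

text \<open>Pairs of factors in place of the cut positions of \<open>free_star_algebra\<close>:
  associativity becomes a bijection between triples of factors, and the adjoint exchanges the two
  factors.\<close>

definition splits :: "'b list \<Rightarrow> ('b list \<times> 'b list) set" where
  "splits w = {(u, v). u @ v = w}"

lemma splits_image: "splits w = (\<lambda>k. (take k w, drop k w)) ` {..length w}"
proof (rule Set.set_eqI)
  fix p show "p \<in> splits w \<longleftrightarrow> p \<in> (\<lambda>k. (take k w, drop k w)) ` {..length w}"
    by (cases p) (auto simp: splits_def intro!: image_eqI[of _ _ "length (fst p)"])
qed

lemma finite_splits [simp]: "finite (splits w)"
  by (simp add: splits_image)

lemma sum_splits:
  fixes f g :: "'b list \<Rightarrow> complex"
  shows "(\<Sum>k\<le>length w. f (take k w) * g (drop k w)) = (\<Sum>(u, v)\<in>splits w. f u * g v)"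
  by (rule sum.reindex_bij_witness[where i = "\<lambda>(u, v). length u" and j = "\<lambda>k. (take k w, drop k w)"])
    (auto simp: splits_def)

definition free_word :: "('x \<times> bool) list \<Rightarrow> ('x \<times> bool) list \<Rightarrow> complex" where
  "free_word w = (\<lambda>u. if u = w then 1 else 0)"

definition words_on :: "'x set \<Rightarrow> ('x \<times> bool) list set" where
  "words_on X = {w. w \<noteq> [] \<and> fst ` set w \<subseteq> X}"

lemma words_on_append: "u \<in> words_on X \<Longrightarrow> v \<in> words_on X \<Longrightarrow> u @ v \<in> words_on X"
  and words_on_star: "u \<in> words_on X \<Longrightarrow> word_star u \<in> words_on X"
  unfolding words_on_def by (simp_all add: image_Un)

lemma free_carrier:
  "f \<in> carrier (free_star_algebra X) \<longleftrightarrow> finite {w. f w \<noteq> 0} \<and> {w. f w \<noteq> 0} \<subseteq> words_on X"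
  by (auto simp: free_star_algebra_def words_on_def)

lemma free_ops:
  "azero (free_star_algebra X) = (\<lambda>w. 0)"
  "aadd (free_star_algebra X) f g = (\<lambda>w. f w + g w)"
  "ascale (free_star_algebra X) c f = (\<lambda>w. c * f w)"
  "amult (free_star_algebra X) f g = (\<lambda>w. \<Sum>(u, v)\<in>splits w. f u * g v)"
  "astar (free_star_algebra X) f = (\<lambda>w. cnj (f (word_star w)))"
  by (simp_all add: free_star_algebra_def sum_splits word_star_def)

lemma free_mult_assoc:
  fixes f g h :: "'b list \<Rightarrow> complex"
  shows "(\<Sum>(p, x)\<in>splits w. (\<Sum>(u, v)\<in>splits p. f u * g v) * h x) =
    (\<Sum>(u, p)\<in>splits w. f u * (\<Sum>(v, x)\<in>splits p. g v * h x))"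
proof -
  have "(\<Sum>(p, x)\<in>splits w. (\<Sum>(u, v)\<in>splits p. f u * g v) * h x) =
     (\<Sum>((p, x), (u, v))\<in>Sigma (splits w) (\<lambda>(p, x). splits p). f u * g v * h x)"
    by (subst sum.Sigma[symmetric]) (auto simp: sum_distrib_right case_prod_beta intro!: sum.cong)
  also have "\<dots> = (\<Sum>((u, p), (v, x))\<in>Sigma (splits w) (\<lambda>(u, p). splits p). f u * g v * h x)"
    by (rule sum.reindex_bij_witness[where i = "\<lambda>((u, p), (v, x)). ((u @ v, x), (u, v))"
          and j = "\<lambda>((p, x), (u, v)). ((u, v @ x), (v, x))"]) (auto simp: splits_def)
  also have "\<dots> = (\<Sum>(u, p)\<in>splits w. f u * (\<Sum>(v, x)\<in>splits p. g v * h x))"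
    by (subst sum.Sigma[symmetric])
      (auto simp: sum_distrib_left case_prod_beta mult.assoc intro!: sum.cong)
  finally show ?thesis .
qed

lemma free_mult_closed:
  assumes "f \<in> carrier (free_star_algebra X)" "g \<in> carrier (free_star_algebra X)"
  shows "(\<lambda>w. \<Sum>(u, v)\<in>splits w. f u * g v) \<in> carrier (free_star_algebra X)"
proof -
  let ?S = "(\<lambda>(u, v). u @ v) ` ({w. f w \<noteq> 0} \<times> {w. g w \<noteq> 0})"
  have sub: "{w. (\<Sum>(u, v)\<in>splits w. f u * g v) \<noteq> 0} \<subseteq> ?S"
  proof
    fix w assume "w \<in> {w. (\<Sum>(u, v)\<in>splits w. f u * g v) \<noteq> 0}"
    then obtain p where "p \<in> splits w" "(case p of (u, v) \<Rightarrow> f u * g v) \<noteq> 0"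
      using sum.not_neutral_contains_not_neutral by blast
    then show "w \<in> ?S" by (cases p) (force simp: splits_def image_iff)
  qed
  moreover have "finite ?S" using assms by (auto simp: free_carrier)
  moreover have "?S \<subseteq> words_on X"
  proof
    fix w assume "w \<in> ?S"
    then obtain u v where w: "w = u @ v" "f u \<noteq> 0" "g v \<noteq> 0" by auto
    then have "u \<in> words_on X" "v \<in> words_on X" using assms unfolding free_carrier by blast+
    then show "w \<in> words_on X" by (simp add: w(1) words_on_append)
  qed
  ultimately show ?thesis unfolding free_carrier using finite_subset by blast
qed

lemma free_star_closed:
  assumes "f \<in> carrier (free_star_algebra X)"
  shows "(\<lambda>w. cnj (f (word_star w))) \<in> carrier (free_star_algebra X)"
proof -
  have "{w. cnj (f (word_star w)) \<noteq> 0} = word_star ` {w. f w \<noteq> 0}"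
    by (auto simp: image_iff intro!: exI[of _ "word_star _"])
  then show ?thesis using assms words_on_star unfolding free_carrier by auto
qed

lemma free_add_closed:
  assumes "f \<in> carrier (free_star_algebra X)" "g \<in> carrier (free_star_algebra X)"
  shows "(\<lambda>w. f w + g w) \<in> carrier (free_star_algebra X)"
proof -
  have "{w. f w + g w \<noteq> 0} \<subseteq> {w. f w \<noteq> 0} \<union> {w. g w \<noteq> 0}" by auto
  then show ?thesis using assms unfolding free_carrier
    by (meson finite_Un finite_subset le_sup_iff order_trans)
qed

lemma free_scale_closed:
  assumes "f \<in> carrier (free_star_algebra X)"
  shows "(\<lambda>w. c * f w) \<in> carrier (free_star_algebra X)"
proof -
  have "{w. c * f w \<noteq> 0} \<subseteq> {w. f w \<noteq> 0}" by auto
  then show ?thesis using assms unfolding free_carrier by (meson finite_subset order_trans)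
qed

lemma free_star_algebra: "star_algebra (free_star_algebra X)"
proof (intro star_algebra.intro)
  let ?F = "free_star_algebra X"
  show "comm_group (additive_part ?F)"
  proof (rule comm_groupI)
    fix f assume f: "f \<in> carrier (additive_part ?F)"
    show "\<exists>g\<in>carrier (additive_part ?F). g \<otimes>\<^bsub>additive_part ?F\<^esub> f = \<one>\<^bsub>additive_part ?F\<^esub>"
      using f free_scale_closed[of f X "-1"]
      by (intro bexI[of _ "\<lambda>w. - f w"]) (auto simp: additive_part_def free_ops)
  next
    show "\<one>\<^bsub>additive_part ?F\<^esub> \<in> carrier (additive_part ?F)"
      by (simp add: additive_part_def free_carrier free_ops)
  qed (simp_all add: additive_part_def free_ops free_add_closed add_ac)
  fix f g assume "f \<in> carrier ?F" "g \<in> carrier ?F"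
  have "cnj (\<Sum>(u, v)\<in>splits (word_star w). f u * g v) =
      (\<Sum>(u, v)\<in>splits w. cnj (g (word_star u)) * cnj (f (word_star v)))" for w
  proof -
    have "(\<Sum>(u, v)\<in>splits (word_star w). cnj (f u * g v)) =
        (\<Sum>(u, v)\<in>splits w. cnj (g (word_star u)) * cnj (f (word_star v)))"
      by (rule sum.reindex_bij_witness[where i = "\<lambda>(u, v). (word_star v, word_star u)"
            and j = "\<lambda>(u, v). (word_star v, word_star u)"])
        (auto simp: splits_def simp flip: word_star_simps(3))
    then show ?thesis by (simp add: case_prod_beta)
  qed
  then show "astar ?F (amult ?F f g) = amult ?F (astar ?F g) (astar ?F f)"
    by (simp add: free_ops fun_eq_iff)
next
  let ?F = "free_star_algebra X"
  fix f g h assume "f \<in> carrier ?F" "g \<in> carrier ?F"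
  then show "amult ?F f g \<in> carrier ?F" by (simp add: free_ops(4) free_mult_closed)
  show "amult ?F (amult ?F f g) h = amult ?F f (amult ?F g h)"
    by (simp add: free_ops(4) free_mult_assoc)
qed (auto simp: free_ops free_scale_closed free_mult_closed free_star_closed free_mult_assoc
    algebra_simps sum.distrib sum_distrib_left case_prod_beta)

lemma free_word_carrier [simp]: "w \<in> words_on X \<Longrightarrow> free_word w \<in> carrier (free_star_algebra X)"
  by (auto simp: free_carrier free_word_def)

lemma free_word_mult:
  "amult (free_star_algebra X) (free_word u) (free_word v) = free_word (u @ v)"
proof
  fix w
  have "(\<Sum>(p, q)\<in>splits w. free_word u p * free_word v q) =
      (\<Sum>x\<in>splits w. if x = (u, v) then 1 else 0)"
    by (intro sum.cong) (auto simp: free_word_def split: if_splits)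
  also have "\<dots> = (if (u, v) \<in> splits w then 1 else 0)" by simp
  finally have "(\<Sum>(p, q)\<in>splits w. free_word u p * free_word v q) =
      (if (u, v) \<in> splits w then 1 else 0)" .
  then show "amult (free_star_algebra X) (free_word u) (free_word v) w = free_word (u @ v) w"
    by (auto simp: free_ops free_word_def splits_def split: if_splits)
qed

lemma free_word_star: "astar (free_star_algebra X) (free_word w) = free_word (word_star w)"
  by (auto simp: free_ops free_word_def fun_eq_iff)

lemma free_gen_word: "free_gen x = free_word [(x, False)]"
  by (simp add: free_gen_def free_word_def)

lemma free_gen_carrier [simp]: "x \<in> X \<Longrightarrow> free_gen x \<in> carrier (free_star_algebra X)"
  by (simp add: free_gen_word words_on_def)

lemma free_induct [consumes 1, case_names zero add]:
  assumes "f \<in> carrier (free_star_algebra X)" and zero: "P (azero (free_star_algebra X))"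
    and add: "\<And>f w c. f \<in> carrier (free_star_algebra X) \<Longrightarrow> w \<in> words_on X \<Longrightarrow> P f \<Longrightarrow>
      P (aadd (free_star_algebra X) f (ascale (free_star_algebra X) c (free_word w)))"
  shows "P f"
proof -
  have "P f" if "finite W" "W \<subseteq> words_on X" "{w. f w \<noteq> 0} \<subseteq> W" for W f
    using that
  proof (induction W arbitrary: f)
    case empty
    then have "f = azero (free_star_algebra X)" by (auto simp: free_ops)
    then show ?case using zero by simp
  next
    case (insert w W)
    let ?g = "f(w := 0)"
    have g: "{w. ?g w \<noteq> 0} \<subseteq> W" using insert.prems by auto
    then have "?g \<in> carrier (free_star_algebra X)"
      unfolding free_carrier using insert.prems insert.hyps by (meson finite_subset insert_subset order_trans)
    moreover have "P ?g" using insert g by (intro insert.IH) auto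
    ultimately have "P (aadd (free_star_algebra X) ?g (ascale (free_star_algebra X) (f w) (free_word w)))"
      using insert.prems by (intro add) auto
    moreover have "aadd (free_star_algebra X) ?g (ascale (free_star_algebra X) (f w) (free_word w)) = f"
      by (auto simp: free_ops free_word_def fun_eq_iff)
    ultimately show ?case by simp
  qed
  then show ?thesis using assms(1) by (auto simp: free_carrier)
qed

section \<open>The homomorphism induced by images of the generators\<close>

definition letter_eval :: "('a, 'm) star_algebra_scheme \<Rightarrow> ('x \<Rightarrow> 'a) \<Rightarrow> 'x \<times> bool \<Rightarrow> 'a" where
  "letter_eval A \<eta> l = (if snd l then astar A (\<eta> (fst l)) else \<eta> (fst l))"

text \<open>The target may have no unit, so the recursion stops at one letter. The value at the
  empty word is a default; no element of the free algebra contains that word.\<close>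

fun word_eval :: "('a, 'm) star_algebra_scheme \<Rightarrow> ('x \<Rightarrow> 'a) \<Rightarrow> ('x \<times> bool) list \<Rightarrow> 'a" where
  "word_eval A \<eta> [] = azero A"
| "word_eval A \<eta> [l] = letter_eval A \<eta> l"
| "word_eval A \<eta> (l # w) = amult A (letter_eval A \<eta> l) (word_eval A \<eta> w)"

definition free_hom :: "('a, 'm) star_algebra_scheme \<Rightarrow> ('x \<Rightarrow> 'a) \<Rightarrow>
    (('x \<times> bool) list \<Rightarrow> complex) \<Rightarrow> 'a" where
  "free_hom A \<eta> f = asum A (\<lambda>w. ascale A (f w) (word_eval A \<eta> w)) {w. f w \<noteq> 0}"

locale generators = star_algebra A
  for A :: "('a, 'm) star_algebra_scheme" +
  fixes \<eta> :: "'x \<Rightarrow> 'a" and X :: "'x set"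
  assumes gen_closed: "x \<in> X \<Longrightarrow> \<eta> x \<in> carrier A"
begin

abbreviation "ev \<equiv> word_eval A \<eta>"
abbreviation "\<Phi> \<equiv> free_hom A \<eta>"
abbreviation "FX \<equiv> free_star_algebra X"

sublocale free: star_algebra FX by (rule free_star_algebra)

lemma letter_closed: "fst l \<in> X \<Longrightarrow> letter_eval A \<eta> l \<in> carrier A"
  using gen_closed by (auto simp: letter_eval_def)

lemma ev_closed_set: "fst ` set w \<subseteq> X \<Longrightarrow> ev w \<in> carrier A"
proof (induction w rule: induct_list012)
  case (3 l k w)
  then show ?case using letter_closed[of l] by auto
qed (auto simp: letter_closed)

lemma ev_closed [simp]: "w \<in> words_on X \<Longrightarrow> ev w \<in> carrier A"
  using ev_closed_set by (simp add: words_on_def)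

lemma ev_Cons: "w \<noteq> [] \<Longrightarrow> ev (l # w) = amult A (letter_eval A \<eta> l) (ev w)"
  by (cases w) auto

lemma ev_append:
  assumes "u \<in> words_on X" "v \<in> words_on X"
  shows "ev (u @ v) = amult A (ev u) (ev v)"
  using assms
proof (induction u)
  case (Cons l u)
  show ?case
  proof (cases "u = []")
    case True
    then show ?thesis using Cons.prems by (simp add: ev_Cons words_on_def)
  next
    case False
    then have u: "u \<in> words_on X" "fst l \<in> X" using Cons.prems by (auto simp: words_on_def)
    then show ?thesis using Cons.IH Cons.prems False letter_closed[of l]
      by (simp add: ev_Cons mult_assoc)
  qed
qed (simp add: words_on_def)

lemma ev_star: "w \<in> words_on X \<Longrightarrow> ev (word_star w) = astar A (ev w)"
proof (induction w)
  case (Cons l w)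
  then have l: "fst l \<in> X" by (auto simp: words_on_def)
  have st: "letter_eval A \<eta> (apsnd Not l) = astar A (letter_eval A \<eta> l)"
    using gen_closed[OF l] by (simp add: letter_eval_def)
  show ?case
  proof (cases "w = []")
    case True
    then show ?thesis using st by simp
  next
    case False
    then have w: "w \<in> words_on X" using Cons.prems by (auto simp: words_on_def)
    then have "word_star w \<in> words_on X" "[apsnd Not l] \<in> words_on X"
      using l by (simp_all add: words_on_def)
    then show ?thesis
      using Cons.IH[OF w] False w letter_closed[OF l] st
      by (simp add: ev_append ev_Cons star_mult)
  qed
qed (simp add: words_on_def)

text \<open>Lets elements with different supports be expanded over a common finite set of
  words.\<close>

lemma \<Phi>_on:
  assumes "finite W" "W \<subseteq> words_on X" "{w. f w \<noteq> 0} \<subseteq> W"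
  shows "\<Phi> f = asum A (\<lambda>w. ascale A (f w) (ev w)) W"
  unfolding free_hom_def using assms by (intro asum_mono_neutral) auto

lemma \<Phi>_closed [simp]: "f \<in> carrier FX \<Longrightarrow> \<Phi> f \<in> carrier A"
  unfolding free_hom_def free_carrier by (intro asum_closed scale_closed ev_closed) blast

lemma \<Phi>_add:
  assumes "f \<in> carrier FX" "g \<in> carrier FX"
  shows "\<Phi> (aadd FX f g) = aadd A (\<Phi> f) (\<Phi> g)"
proof -
  let ?W = "{w. f w \<noteq> 0} \<union> {w. g w \<noteq> 0}"
  have W: "finite ?W" "?W \<subseteq> words_on X" using assms by (auto simp: free_carrier)
  have "\<Phi> (aadd FX f g) =
      asum A (\<lambda>w. ascale A (aadd FX f g w) (ev w)) ?W"
    by (rule \<Phi>_on[OF W]) (auto simp: free_ops)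
  also have "\<dots> = asum A (\<lambda>w. aadd A (ascale A (f w) (ev w)) (ascale A (g w) (ev w))) ?W"
    using W by (intro asum_cong) (auto simp: free_ops scale_add_left)
  also have "\<dots> = aadd A (asum A (\<lambda>w. ascale A (f w) (ev w)) ?W) (asum A (\<lambda>w. ascale A (g w) (ev w)) ?W)"
    using W by (intro asum_add) auto
  also have "\<dots> = aadd A (\<Phi> f) (\<Phi> g)"
    using \<Phi>_on[OF W, of f] \<Phi>_on[OF W, of g] by auto
  finally show ?thesis .
qed

lemma \<Phi>_scale:
  assumes f: "f \<in> carrier FX"
  shows "\<Phi> (ascale FX c f) = ascale A c (\<Phi> f)"
proof -
  let ?W = "{w. f w \<noteq> 0}"
  have W: "finite ?W" "?W \<subseteq> words_on X" using assms by (auto simp: free_carrier)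
  have "\<Phi> (ascale FX c f) = asum A (\<lambda>w. ascale A (c * f w) (ev w)) ?W"
    using \<Phi>_on[OF W, of "ascale FX c f"] by (auto simp: free_ops)
  also have "\<dots> = asum A (\<lambda>w. ascale A c (ascale A (f w) (ev w))) ?W"
    using W by (intro asum_cong) (auto simp: scale_scale)
  also have "\<dots> = ascale A c (\<Phi> f)"
    using W by (subst asum_scale) (auto simp: free_hom_def)
  finally show ?thesis .
qed

lemma \<Phi>_zero: "\<Phi> (azero FX) = azero A"
  by (simp add: free_hom_def free_ops)

lemma \<Phi>_word [simp]: "w \<in> words_on X \<Longrightarrow> \<Phi> (free_word w) = ev w"
  using \<Phi>_on[of "{w}" "free_word w"] asum_insert[of "{}" w "\<lambda>u. ascale A (free_word w u) (ev u)"]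
  by (auto simp: free_word_def)

declare words_on_append [simp] words_on_star [simp]

lemma \<Phi>_mult_word:
  assumes "u \<in> words_on X" "g \<in> carrier FX"
  shows "\<Phi> (amult FX (free_word u) g) = amult A (ev u) (\<Phi> g)"
  using assms(2)
proof (induction g rule: free_induct)
  case zero
  then show ?case using assms by (simp add: \<Phi>_zero)
next
  case (add g w c)
  then show ?case using assms
    by (simp add: free.mult_add_right free.mult_scale_right \<Phi>_add \<Phi>_scale free_word_mult ev_append
        mult_add_right mult_scale_right)
qed

lemma \<Phi>_mult:
  assumes "f \<in> carrier FX" "g \<in> carrier FX"
  shows "\<Phi> (amult FX f g) = amult A (\<Phi> f) (\<Phi> g)"
  using assms(1)
proof (induction f rule: free_induct)
  case zero
  then show ?case using assms by (simp add: \<Phi>_zero)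
next
  case (add f w c)
  then show ?case using assms
    by (simp add: free.mult_add_left free.mult_scale_left \<Phi>_add \<Phi>_scale \<Phi>_mult_word
        mult_add_left mult_scale_left)
qed

lemma \<Phi>_star:
  assumes "f \<in> carrier FX"
  shows "\<Phi> (astar FX f) = astar A (\<Phi> f)"
  using assms
proof (induction f rule: free_induct)
  case zero
  then show ?case using assms by (simp add: \<Phi>_zero)
next
  case (add f w c)
  then show ?case
    by (simp add: free.star_add free.star_scale \<Phi>_add \<Phi>_scale free_word_star ev_star
        star_add star_scale)
qed

lemma free_hom_star_hom: "star_hom FX A \<Phi>"
  unfolding star_hom_def by (simp add: \<Phi>_add \<Phi>_scale \<Phi>_mult \<Phi>_star)

lemma \<Phi>_gen: "x \<in> X \<Longrightarrow> \<Phi> (free_gen x) = \<eta> x"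
  by (simp add: free_gen_word words_on_def letter_eval_def)

text \<open>Later identifies the embedding of the free algebra into a completion with the
  homomorphism induced by the embedded generators.\<close>

lemma free_hom_unique:
  assumes \<psi>: "star_hom FX A \<psi>" and gen: "\<And>x. x \<in> X \<Longrightarrow> \<psi> (free_gen x) = \<eta> x"
    and f: "f \<in> carrier FX"
  shows "\<psi> f = \<Phi> f"
proof -
  have letter: "\<psi> (free_word [l]) = letter_eval A \<eta> l" if "fst l \<in> X" for l
  proof -
    have "free_word [(fst l, True)] = astar FX (free_gen (fst l))"
      by (simp add: free_gen_word free_word_star)
    then have "\<psi> (free_word [(fst l, True)]) = astar A (\<eta> (fst l))"
      using \<psi> gen[OF that] that unfolding star_hom_def by simp
    then show ?thesis
      using gen[OF that] by (cases l; cases "snd l") (auto simp: letter_eval_def free_gen_word)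
  qed
  have word: "\<psi> (free_word w) = ev w" if "w \<in> words_on X" for w
    using that
  proof (induction w)
    case (Cons l w)
    show ?case
    proof (cases "w = []")
      case True
      then show ?thesis using letter Cons.prems by (simp add: words_on_def)
    next
      case False
      then have w: "w \<in> words_on X" "[l] \<in> words_on X" using Cons.prems by (auto simp: words_on_def)
      have "free_word (l # w) = amult FX (free_word [l]) (free_word w)"
        by (simp add: free_word_mult)
      then show ?thesis using \<psi> Cons.IH w False letter[of l] unfolding star_hom_def
        by (simp add: ev_Cons words_on_def)
    qed
  qed (simp add: words_on_def)
  show ?thesis using f
  proof (induction f rule: free_induct)
    case zero
    then show ?case
      using star_hom_zero[OF free.star_algebra_axioms star_algebra_axioms \<psi>] by (simp add: \<Phi>_zero)
  next
    case (add f w c)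
    then show ?case using \<psi> word unfolding star_hom_def by (simp add: \<Phi>_add \<Phi>_scale)
  qed
qed

end

section \<open>Self-similar actions in terms of edges and edge lists\<close>

text \<open>\<open>fpaths\<close> in recursive form with both end points, for induction along the
  edges. The empty list joins any \<open>v\<close> to itself, whether or not \<open>v\<close> is a
  vertex, which is why later statements add \<open>w \<in> verts E\<close>.\<close>

fun walk :: "('v, 'e) pre_digraph \<Rightarrow> 'v \<Rightarrow> 'e list \<Rightarrow> 'v \<Rightarrow> bool" where
  "walk E v [] w \<longleftrightarrow> v = w"
| "walk E v (e # es) w \<longleftrightarrow> e \<in> arcs E \<and> head E e = v \<and> walk E (tail E e) es w"

lemma walk_append: "walk E v (es @ fs) w \<longleftrightarrow> (\<exists>u. walk E v es u \<and> walk E u fs w)"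
  by (induction es arbitrary: v) auto

lemma walk_end_unique: "walk E v es w \<Longrightarrow> walk E v es w' \<Longrightarrow> w = w'"
  by (induction es arbitrary: v) auto

lemma walk_iff:
  "(\<exists>w. walk E v es w) \<longleftrightarrow> set es \<subseteq> arcs E \<and> (es \<noteq> [] \<longrightarrow> head E (hd es) = v) \<and>
     successively (\<lambda>e f. tail E e = head E f) es"
proof (induction es arbitrary: v)
  case (Cons e es)
  have "(\<exists>w. walk E v (e # es) w) \<longleftrightarrow> e \<in> arcs E \<and> head E e = v \<and> (\<exists>w. walk E (tail E e) es w)"
    by auto
  then show ?case by (auto simp: Cons.IH successively_Cons)
qed auto

lemma fpaths_iff: "(v, es) \<in> fpaths E \<longleftrightarrow> v \<in> verts E \<and> (\<exists>w. walk E v es w)"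
  unfolding walk_iff by (auto simp: fpaths_def)

lemma psource_walk: "walk E v es w \<Longrightarrow> psource E (v, es) = w"
  by (induction es arbitrary: v) (auto simp: psource_def)

lemma fpaths_psource: "(v, es) \<in> fpaths E \<Longrightarrow> walk E v es (psource E (v, es))"
  using psource_walk by (fastforce simp: fpaths_iff)

lemma prefix_Suc: "prefix (Suc n) x = prefix n x @ [x n]"
  by (simp add: subsequence_def)

lemma prefix_length [simp]: "length (prefix n x) = n"
  by (simp add: subsequence_def)

lemma prefix_suffix: "prefix n x \<frown> suffix n x = x"
  by (auto simp: conc_def subsequence_def fun_eq_iff)

lemma suffix_conc [simp]: "suffix (length es) (es \<frown> x) = x"
  by (simp add: fun_eq_iff)

lemma prefix_conc_length [simp]: "prefix (length es) (es \<frown> x) = es"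
  by (rule nth_equalityI) (simp_all add: subsequence_def)

lemma prefix_conc_add: "prefix (length es + k) (es \<frown> x) = es @ prefix k x"
  by (rule nth_equalityI) (auto simp: subsequence_def nth_append)

lemma conc_eq_iff [simp]: "es \<frown> x = es \<frown> y \<longleftrightarrow> x = y"
  by (metis suffix_conc)

lemma conc_eq_length:
  assumes "es \<frown> x = fs \<frown> y" "length es = length fs"
  shows "es = fs" "x = y"
  using assms prefix_conc_length suffix_conc by metis+

lemma conc_eq_le:
  assumes eq: "es \<frown> x = fs \<frown> y" and le: "length es \<le> length fs"
  shows "\<exists>k. fs = es @ k \<and> x = k \<frown> y"
proof -
  let ?k = "drop (length es) fs"
  have "es \<frown> x = take (length es) fs \<frown> (?k \<frown> y)" using eq by simp
  then have "es = take (length es) fs" "x = ?k \<frown> y"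
    by (rule conc_eq_length; use le in simp)+
  then show ?thesis by (metis append_take_drop_id)
qed

lemma prefix_add: "prefix (n + k) x = prefix n x @ prefix k (suffix n x)"
  by (rule nth_equalityI) (auto simp: subsequence_def nth_append)

lemma subsequence_suffix: "n \<le> l \<Longrightarrow> subsequence x n l = prefix (l - n) (suffix n x)"
  by (rule nth_equalityI) (auto simp: subsequence_def)

section \<open>Inverses in a groupoid\<close>

lemma (in groupoid) mult_inv_cancel:
  assumes "x \<in> arr G" "y \<in> arr G" "gdom G x = gcod G y" "gmult G x y = gunit G (gdom G y)"
  shows "x = ginv G y"
proof -
  have "x = gmult G x (gmult G y (ginv G y))"
    using assms mult_unit_right[of x] by (simp add: mult_inv_right)
  also have "\<dots> = gmult G (gmult G x y) (ginv G y)"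
    using assms(1-3) by (simp add: mult_assoc inv_arr cod_inv)
  also have "\<dots> = ginv G y"
    unfolding assms(4) using assms mult_unit_left[of "ginv G y"] by (simp add: inv_arr cod_inv)
  finally show ?thesis .
qed

lemma (in groupoid) inv_inv: "x \<in> arr G \<Longrightarrow> ginv G (ginv G x) = x"
  using mult_inv_cancel[of x "ginv G x"] by (simp add: inv_arr cod_inv dom_inv mult_inv_right)

lemma (in groupoid) inv_mult:
  assumes "x \<in> arr G" "y \<in> arr G" "gdom G x = gcod G y"
  shows "ginv G (gmult G x y) = gmult G (ginv G y) (ginv G x)"
proof (rule mult_inv_cancel[symmetric])
  have "gmult G (gmult G (ginv G y) (ginv G x)) (gmult G x y) =
      gmult G (ginv G y) (gmult G (gmult G (ginv G x) x) y)"
    using assms by (simp add: mult_assoc inv_arr dom_inv cod_inv mult_arr cod_mult dom_mult)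
  then show "gmult G (gmult G (ginv G y) (ginv G x)) (gmult G x y) = gunit G (gdom G (gmult G x y))"
    using assms mult_unit_left[of y] by (simp add: mult_inv_left dom_mult)
qed (use assms in \<open>simp_all add: mult_arr dom_mult cod_mult inv_arr dom_inv cod_inv\<close>)

lemma (in groupoid) inv_unit: "v \<in> obj G \<Longrightarrow> ginv G (gunit G v) = gunit G v"
  using mult_inv_cancel[of "gunit G v" "gunit G v"] mult_unit_right[of "gunit G v"]
  by (simp add: unit_arr dom_unit cod_unit)

section \<open>The action and its restrictions on edges and edge lists\<close>

locale finite_self_similar_action = self_similar_action E G act
  for E :: "('v, 'e) pre_digraph" and G :: "('v, 'g, 'm) groupoid_scheme"
    and act :: "'g \<Rightarrow> ('v, 'e) fpath \<Rightarrow> ('v, 'e) fpath" +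
  assumes fin_digraph: "fin_digraph E"
begin

abbreviation "dm \<equiv> gdom G"
abbreviation "cm \<equiv> gcod G"
abbreviation "ae \<equiv> act_edge E act"
abbreviation "er \<equiv> edge_restrict E G act"

lemma finite_arcs [simp]: "finite (arcs E)" and finite_verts [simp]: "finite (verts E)"
  using fin_digraph by (auto simp: fin_digraph_def fin_digraph_axioms_def)

lemma finite_in_arcs [simp]: "finite (in_arcs E v)"
  unfolding in_arcs_def by simp

lemma dm_verts [simp]: "g \<in> arr G \<Longrightarrow> dm g \<in> verts E"
  and cm_verts [simp]: "g \<in> arr G \<Longrightarrow> cm g \<in> verts E"
  using dom_closed cod_closed by (simp_all add: obj_eq)

lemma unit_arr' [simp]: "v \<in> verts E \<Longrightarrow> gunit G v \<in> arr G"
  and dm_unit [simp]: "v \<in> verts E \<Longrightarrow> dm (gunit G v) = v"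
  and cm_unit [simp]: "v \<in> verts E \<Longrightarrow> cm (gunit G v) = v"
  using unit_arr dom_unit cod_unit by (simp_all add: obj_eq)

declare mult_arr [simp] dom_mult [simp] cod_mult [simp] inv_arr [simp] dom_inv [simp] cod_inv [simp]
  mult_unit_left [simp] mult_unit_right [simp] mult_inv_left [simp] mult_inv_right [simp]
  inv_inv [simp]

lemma inv_unit' [simp]: "v \<in> verts E \<Longrightarrow> ginv G (gunit G v) = gunit G v"
  using inv_unit by (simp add: obj_eq)

lemma walk_start_verts: "walk E v es w \<Longrightarrow> w \<in> verts E \<Longrightarrow> v \<in> verts E"
  by (cases es) auto

lemma act_paths:
  assumes "g \<in> arr G" "\<mu> \<in> paths_to E (dm g)"
  shows "act g \<mu> \<in> paths_to E (cm g)" "length (snd (act g \<mu>)) = length (snd \<mu>)"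
  using act_partial_isomorphism[OF assms(1)] assms(2)
  unfolding partial_isomorphism_def bij_betw_def plength_def by auto

lemma act_edge_path:
  assumes g: "g \<in> arr G" and e: "e \<in> arcs E" "head E e = dm g"
  shows "act g (edge_path E e) = edge_path E (ae g e)" "ae g e \<in> arcs E" "head E (ae g e) = cm g"
proof -
  let ?v = "(dm g, []) :: ('v, 'e) fpath"
  have v: "?v \<in> paths_to E (dm g)" using g by (simp add: paths_to_def fpaths_iff)
  have "fst (act g ?v) = cm g" "snd (act g ?v) = []"
    using act_paths[OF g v] by (auto simp: paths_to_def)
  then have av: "act g ?v = (cm g, [])" by (simp add: prod_eq_iff)
  have "\<exists>f\<in>in_arcs E (psource E (act g ?v)).
      act g (pcat ?v (edge_path E e)) = pcat (act g ?v) (edge_path E f)"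
    using act_partial_isomorphism[OF g] v e
    unfolding partial_isomorphism_def by (auto simp: psource_def)
  then obtain f where f: "f \<in> arcs E" "head E f = cm g"
      "act g (edge_path E e) = edge_path E f"
    using e by (auto simp: av psource_def pcat_def edge_path_def)
  then have "ae g e = f" by (simp add: act_edge_def edge_path_def)
  then show "act g (edge_path E e) = edge_path E (ae g e)" "ae g e \<in> arcs E" "head E (ae g e) = cm g"
    using f by auto
qed

text \<open>Two candidates act alike on all paths, because the common first edge can be cancelled;
  faithfulness of the action does the rest.\<close>

lemma restriction_unique:
  assumes g: "g \<in> arr G" and h: "is_restriction E G act g e h" and h': "is_restriction E G act g e h'"
  shows "h = h'"
proof (rule act_faithful)
  show "h \<in> arr G" "h' \<in> arr G" "dm h = dm h'" "cm h = cm h'"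
    using h h' by (auto simp: is_restriction_def)
  fix \<mu> assume \<mu>: "\<mu> \<in> paths_to E (dm h)"
  then have "pcat (act g (edge_path E e)) (act h \<mu>) = pcat (act g (edge_path E e)) (act h' \<mu>)"
    using h h' unfolding is_restriction_def by metis
  then have "snd (act h \<mu>) = snd (act h' \<mu>)" by (simp add: pcat_def)
  moreover have "fst (act h \<mu>) = cm h" "fst (act h' \<mu>) = cm h'"
    using act_paths(1)[of h \<mu>] act_paths(1)[of h' \<mu>] \<mu> \<open>h \<in> arr G\<close> \<open>h' \<in> arr G\<close> \<open>dm h = dm h'\<close>
    by (auto simp: paths_to_def)
  ultimately show "act h \<mu> = act h' \<mu>" using \<open>cm h = cm h'\<close> by (simp add: prod_eq_iff)
qed

lemma edge_restrict_is_restriction: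
  assumes "g \<in> arr G" "e \<in> arcs E" "head E e = dm g"
  shows "is_restriction E G act g e (er g e)"
  unfolding edge_restrict_def
  by (rule theI') (use restriction_exists[of g e] restriction_unique assms in auto)

lemma edge_restrict_eqI:
  assumes "g \<in> arr G" "e \<in> arcs E" "head E e = dm g" "is_restriction E G act g e h"
  shows "er g e = h"
  using restriction_unique[OF assms(1) edge_restrict_is_restriction assms(4)] assms by blast

lemma edge_restrict [simp]:
  assumes "g \<in> arr G" "e \<in> arcs E" "head E e = dm g"
  shows "er g e \<in> arr G" "dm (er g e) = tail E e" "cm (er g e) = tail E (ae g e)"
  using edge_restrict_is_restriction[OF assms] act_edge_path(1)[OF assms]
  unfolding is_restriction_def by (auto simp: psource_def edge_path_def)

declare act_edge_path(2,3) [simp]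

lemma act_edge_path_cat:
  assumes "g \<in> arr G" "e \<in> arcs E" "head E e = dm g" "\<mu> \<in> paths_to E (tail E e)"
  shows "act g (pcat (edge_path E e) \<mu>) = pcat (edge_path E (ae g e)) (act (er g e) \<mu>)"
  using edge_restrict_is_restriction[OF assms(1-3)] act_edge_path(1)[OF assms(1-3)] assms(4)
  unfolding is_restriction_def by auto

lemma edge_path_in_paths: "e \<in> arcs E \<Longrightarrow> edge_path E e \<in> paths_to E (head E e)"
  using graph.head_in_verts by (auto simp: paths_to_def edge_path_def fpaths_iff)

lemma pcat_in_paths:
  assumes "e \<in> arcs E" "\<mu> \<in> paths_to E (tail E e)"
  shows "pcat (edge_path E e) \<mu> \<in> paths_to E (head E e)"
  using assms graph.head_in_verts by (cases \<mu>) (auto simp: paths_to_def edge_path_def fpaths_iff pcat_def)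

lemma act_edge_mult:
  assumes "g \<in> arr G" "h \<in> arr G" "dm g = cm h" "e \<in> arcs E" "head E e = dm h"
  shows "ae (gmult G g h) e = ae g (ae h e)"
proof -
  have "act (gmult G g h) (edge_path E e) = act g (act h (edge_path E e))"
    using assms edge_path_in_paths[of e] by (intro act_hom) auto
  then have "edge_path E (ae (gmult G g h) e) = edge_path E (ae g (ae h e))"
    using assms by (simp add: act_edge_path(1))
  then show ?thesis by (simp add: edge_path_def)
qed

text \<open>By uniqueness of restrictions it suffices that the product on the right has the defining
  property of the restriction of \<open>gmult G g h\<close>.\<close>

lemma edge_restrict_mult:
  assumes "g \<in> arr G" "h \<in> arr G" "dm g = cm h" "e \<in> arcs E" "head E e = dm h"
  shows "er (gmult G g h) e = gmult G (er g (ae h e)) (er h e)"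
proof (rule edge_restrict_eqI)
  show "is_restriction E G act (gmult G g h) e (gmult G (er g (ae h e)) (er h e))"
    unfolding is_restriction_def
  proof (intro conjI ballI)
    show "cm (gmult G (er g (ae h e)) (er h e)) = psource E (act (gmult G g h) (edge_path E e))"
      using assms by (simp add: act_edge_path(1) act_edge_mult psource_def) (simp add: edge_path_def)
    fix \<mu> assume \<mu>: "\<mu> \<in> paths_to E (tail E e)"
    have h\<mu>: "act (er h e) \<mu> \<in> paths_to E (tail E (ae h e))"
      using act_paths(1)[of "er h e" \<mu>] assms \<mu> by simp
    have "act (gmult G g h) (pcat (edge_path E e) \<mu>) = act g (act h (pcat (edge_path E e) \<mu>))"
      using assms pcat_in_paths[OF assms(4) \<mu>] by (intro act_hom) auto
    also have "\<dots> = pcat (edge_path E (ae g (ae h e))) (act (er g (ae h e)) (act (er h e) \<mu>))"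
      using assms \<mu> h\<mu> by (simp add: act_edge_path_cat)
    also have "act (er g (ae h e)) (act (er h e) \<mu>) = act (gmult G (er g (ae h e)) (er h e)) \<mu>"
      using assms \<mu> by (intro act_hom[symmetric]) auto
    finally show "act (gmult G g h) (pcat (edge_path E e) \<mu>) =
       pcat (act (gmult G g h) (edge_path E e)) (act (gmult G (er g (ae h e)) (er h e)) \<mu>)"
      using assms by (simp add: act_edge_path(1) act_edge_mult)
  qed (use assms in simp_all)
qed (use assms in simp_all)

lemma act_edge_unit:
  assumes "v \<in> verts E" "e \<in> arcs E" "head E e = v"
  shows "ae (gunit G v) e = e"
proof -
  have "edge_path E (ae (gunit G v) e) = edge_path E e"
    using act_unit[OF assms(1), of "edge_path E e"] assms edge_path_in_paths[of e]
      act_edge_path(1)[of "gunit G v" e] by simp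
  then show ?thesis by (simp add: edge_path_def)
qed

lemma edge_restrict_unit:
  assumes "v \<in> verts E" "e \<in> arcs E" "head E e = v"
  shows "er (gunit G v) e = gunit G (tail E e)"
proof (rule edge_restrict_eqI)
  have t: "tail E e \<in> verts E" using assms by simp
  have "act (gunit G v) (edge_path E e) = edge_path E e"
    using act_unit[OF assms(1)] edge_path_in_paths[of e] assms by simp
  moreover have "act (gunit G v) (pcat (edge_path E e) \<mu>) = pcat (edge_path E e) \<mu>"
    if "\<mu> \<in> paths_to E (tail E e)" for \<mu>
    using act_unit[OF assms(1)] pcat_in_paths[OF assms(2) that] assms by simp
  ultimately show "is_restriction E G act (gunit G v) e (gunit G (tail E e))"
    using assms act_unit[OF t] t unfolding is_restriction_def
    by (simp add: psource_def) (simp add: edge_path_def)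
qed (use assms in simp_all)

lemma act_edge_inv:
  assumes "g \<in> arr G" "e \<in> arcs E" "head E e = dm g"
  shows "ae (ginv G g) (ae g e) = e" "er (ginv G g) (ae g e) = ginv G (er g e)"
proof -
  show ae: "ae (ginv G g) (ae g e) = e"
    using act_edge_mult[of "ginv G g" g e] assms act_edge_unit[of "dm g" e] by simp
  show "er (ginv G g) (ae g e) = ginv G (er g e)"
  proof (rule mult_inv_cancel)
    show "gmult G (er (ginv G g) (ae g e)) (er g e) = gunit G (dm (er g e))"
      using edge_restrict_mult[of "ginv G g" g e] assms edge_restrict_unit[of "dm g" e] by simp
  qed (use assms ae in simp_all)
qed

definition res :: "'g \<Rightarrow> 'e list \<Rightarrow> 'g" where
  "res g es = foldl er g es"

text \<open>The image of an edge list under \<open>g\<close>, computed edge by edge through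
  restrictions; \<open>act_eq_la\<close> ties it to \<open>act\<close>. The range vertex is left
  out, being determined by \<open>g\<close>.\<close>

fun la :: "'g \<Rightarrow> 'e list \<Rightarrow> 'e list" where
  "la g [] = []"
| "la g (e # es) = ae g e # la (er g e) es"

lemma res_simps [simp]: "res g [] = g" "res g (e # es) = res (er g e) es"
  by (simp_all add: res_def)

lemma res_append: "res g (es @ fs) = res (res g es) fs"
  by (simp add: res_def)

lemma la_append: "la g (es @ fs) = la g es @ la (res g es) fs"
  by (induction es arbitrary: g) auto

lemma la_length [simp]: "length (la g es) = length es"
  by (induction es arbitrary: g) auto

lemma la_eq_Nil [simp]: "la g es = [] \<longleftrightarrow> es = []"
  using la_length[of g es] by (metis length_0_conv)

lemma res_walk:
  assumes "g \<in> arr G" "walk E (dm g) es w"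
  shows "res g es \<in> arr G" "dm (res g es) = w" "walk E (cm g) (la g es) (cm (res g es))"
  using assms
proof (induction es arbitrary: g)
  case (Cons e es)
  {
    case 1 then show ?case using Cons.IH(1)[of "er g e"] by simp
  next
    case 2 then show ?case using Cons.IH(2)[of "er g e"] by simp
  next
    case 3 then show ?case using Cons.IH(3)[of "er g e"] by simp
  }
qed simp_all

lemma la_mult:
  assumes "g \<in> arr G" "h \<in> arr G" "dm g = cm h" "walk E (dm h) es w"
  shows "la (gmult G g h) es = la g (la h es)"
    "res (gmult G g h) es = gmult G (res g (la h es)) (res h es)"
  using assms by (induction es arbitrary: g h) (auto simp: act_edge_mult edge_restrict_mult)

lemma la_unit:
  assumes "v \<in> verts E" "walk E v es w"
  shows "la (gunit G v) es = es" "res (gunit G v) es = gunit G w"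
  using assms by (induction es arbitrary: v) (auto simp: act_edge_unit edge_restrict_unit)

lemma la_inv:
  assumes "g \<in> arr G" "walk E (dm g) es w"
  shows "la (ginv G g) (la g es) = es" "res (ginv G g) (la g es) = ginv G (res g es)"
  using assms by (induction es arbitrary: g) (auto simp: act_edge_inv)

lemma act_eq_la:
  assumes "g \<in> arr G" "walk E (dm g) es w"
  shows "act g (dm g, es) = (cm g, la g es)"
  using assms
proof (induction es arbitrary: g)
  case Nil
  have "(dm g, []) \<in> paths_to E (dm g)" using dm_verts[OF Nil(1)] by (simp add: paths_to_def fpaths_iff)
  from act_paths[OF Nil(1) this] show ?case by (auto simp: paths_to_def prod_eq_iff)
next
  case (Cons e es)
  have "(tail E e, es) \<in> paths_to E (tail E e)"
    using Cons.prems by (auto simp: paths_to_def fpaths_iff)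
  then have "act g (pcat (edge_path E e) (tail E e, es)) =
      pcat (edge_path E (ae g e)) (act (er g e) (tail E e, es))"
    using Cons.prems by (intro act_edge_path_cat) auto
  moreover have "act (er g e) (tail E e, es) = (cm (er g e), la (er g e) es)"
    using Cons.IH[of "er g e"] Cons.prems by simp
  ultimately show ?case using Cons.prems by (simp add: pcat_def edge_path_def)
qed

subsection \<open>Infinite paths\<close>

abbreviation "IP \<equiv> inf_paths E"
abbreviation "ir \<equiv> irange E"

text \<open>Agrees with \<open>act_inf\<close> on its domain by \<open>act_inf_eq\<close>. In terms
  of restrictions the formulas for prefixes, suffixes and concatenations hold without a domain
  condition.\<close>

definition ia :: "'g \<Rightarrow> 'e word \<Rightarrow> 'e word" where
  "ia g x = (\<lambda>n. ae (res g (prefix n x)) (x n))"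

lemma IP_arc: "x \<in> IP \<Longrightarrow> x n \<in> arcs E"
  by (simp add: inf_paths_def)

lemma ir_verts [simp]: "x \<in> IP \<Longrightarrow> ir x \<in> verts E"
  by (simp add: irange_def IP_arc)

lemma suffix_IP [simp]: "x \<in> IP \<Longrightarrow> suffix n x \<in> IP"
  by (simp add: inf_paths_def)

lemma walk_prefix: "x \<in> IP \<Longrightarrow> walk E (ir x) (prefix n x) (ir (suffix n x))"
  by (induction n) (auto simp: prefix_Suc walk_append irange_def inf_paths_def subsequence_def)

lemma conc_IP_iff:
  "(\<exists>v. walk E v es (ir x)) \<and> x \<in> IP \<longleftrightarrow> es \<frown> x \<in> IP"
proof (induction es)
  case (Cons e es)
  have cons: "((e # es) \<frown> x) 0 = e" "((e # es) \<frown> x) (Suc n) = (es \<frown> x) n" for n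
    by (simp_all add: conc_def)
  have "(e # es) \<frown> x \<in> IP \<longleftrightarrow> e \<in> arcs E \<and> tail E e = ir (es \<frown> x) \<and> es \<frown> x \<in> IP" (is "?L = ?R")
  proof
    assume L: ?L
    have "suffix 1 ((e # es) \<frown> x) = es \<frown> x" by (auto simp: fun_eq_iff conc_def)
    then have "es \<frown> x \<in> IP" using suffix_IP[OF L, of 1] by simp
    moreover have "e \<in> arcs E" using IP_arc[OF L, of 0] by simp
    moreover have "tail E e = ir (es \<frown> x)"
      using L unfolding inf_paths_def irange_def by (auto dest!: spec[of _ 0] simp: conc_def)
    ultimately show ?R by simp
  next
    assume R: ?R
    show ?L unfolding inf_paths_def
    proof (intro CollectI allI)
      fix i show "((e # es) \<frown> x) i \<in> arcs E \<and>
          tail E (((e # es) \<frown> x) i) = head E (((e # es) \<frown> x) (Suc i))"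
        using R cons by (cases i) (simp_all add: inf_paths_def irange_def)
    qed
  qed
  moreover have "ir (es \<frown> x) = v" if "walk E v es (ir x)" for v
    using that by (cases es) (auto simp: irange_def)
  ultimately have "(e # es) \<frown> x \<in> IP \<longleftrightarrow> e \<in> arcs E \<and> x \<in> IP \<and> walk E (tail E e) es (ir x)"
    using Cons.IH by metis
  then show ?case by (simp del: build_cons) blast
qed simp

lemma conc_IP [simp]: "walk E v es (ir x) \<Longrightarrow> x \<in> IP \<Longrightarrow> es \<frown> x \<in> IP"
  using conc_IP_iff by blast

lemma ir_conc: "walk E v es (ir x) \<Longrightarrow> ir (es \<frown> x) = v"
  by (cases es) (auto simp: irange_def)

lemma conc_IP_walk: "es \<frown> x \<in> IP \<Longrightarrow> walk E (ir (es \<frown> x)) es (ir x)"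
  using conc_IP_iff ir_conc by metis

lemma conc_IP_suffix: "es \<frown> x \<in> IP \<Longrightarrow> x \<in> IP"
  using conc_IP_iff by blast

lemma ia_conc: "ia g (es \<frown> x) = la g es \<frown> ia (res g es) x"
proof
  fix n
  show "ia g (es \<frown> x) n = (la g es \<frown> ia (res g es) x) n"
  proof (cases "n < length es")
    case True
    have la: "la g es ! n = ae (res g (take n es)) (es ! n)"
      using True
    proof (induction es arbitrary: g n)
      case (Cons e es)
      then show ?case by (cases n) auto
    qed simp
    have "prefix n (es \<frown> x) = take n es"
      using True by (intro nth_equalityI) (auto simp: subsequence_def)
    then show ?thesis using True la by (simp add: ia_def)
  next
    case False
    then obtain k where k: "n = length es + k" by (metis le_Suc_ex not_less)
    show ?thesis by (simp add: ia_def k prefix_conc_add res_append)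
  qed
qed

lemma ia_prefix: "prefix n (ia g x) = la g (prefix n x)"
  and ia_suffix: "suffix n (ia g x) = ia (res g (prefix n x)) (suffix n x)"
proof -
  have eq: "ia g x = la g (prefix n x) \<frown> ia (res g (prefix n x)) (suffix n x)"
    using ia_conc[of g "prefix n x" "suffix n x"] by (simp add: prefix_suffix)
  show "prefix n (ia g x) = la g (prefix n x)"
    using prefix_conc_length[of "la g (prefix n x)" "ia (res g (prefix n x)) (suffix n x)"]
    by (simp only: la_length prefix_length eq[symmetric])
  show "suffix n (ia g x) = ia (res g (prefix n x)) (suffix n x)"
    using suffix_conc[of "la g (prefix n x)" "ia (res g (prefix n x)) (suffix n x)"]
    by (simp only: la_length prefix_length eq[symmetric])
qed

lemma ia_IP [simp]:
  assumes "g \<in> arr G" "x \<in> IP" "dm g = ir x"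
  shows "ia g x \<in> IP" "ir (ia g x) = cm g"
proof -
  have w: "walk E (dm g) (prefix n x) (ir (suffix n x))" for n
    using walk_prefix assms by simp
  note r = res_walk[OF assms(1) w]
  have h: "head E (x n) = ir (suffix n x)" for n by (simp add: irange_def)
  have "ia g x n \<in> arcs E \<and> tail E (ia g x n) = head E (ia g x (Suc n))" for n
    using r[of n] r[of "Suc n"] h assms(2) unfolding ia_def
    by (simp add: IP_arc prefix_Suc res_append)
  then show "ia g x \<in> IP" by (simp add: inf_paths_def)
  show "ir (ia g x) = cm g"
    using assms by (simp add: irange_def ia_def IP_arc subsequence_def)
qed

lemma ia_mult:
  assumes "g \<in> arr G" "h \<in> arr G" "dm g = cm h" "x \<in> IP" "dm h = ir x"
  shows "ia (gmult G g h) x = ia g (ia h x)"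
proof
  fix n
  have w: "walk E (dm h) (prefix n x) (ir (suffix n x))" using walk_prefix assms by simp
  have h: "head E (x n) = ir (suffix n x)" by (simp add: irange_def)
  have p: "prefix n (ia h x) = la h (prefix n x)" by (rule ia_prefix)
  note r = res_walk[OF assms(2) w]
  have w': "walk E (dm g) (la h (prefix n x)) (cm (res h (prefix n x)))" using r assms by simp
  note r' = res_walk[OF assms(1) w']
  show "ia (gmult G g h) x n = ia g (ia h x) n"
    unfolding ia_def p[unfolded ia_def]
    using r r' h assms by (simp add: la_mult[OF assms(1-3) w] act_edge_mult IP_arc)
qed

lemma ia_unit:
  assumes "x \<in> IP"
  shows "ia (gunit G (ir x)) x = x"
proof
  fix n
  have w: "walk E (ir x) (prefix n x) (ir (suffix n x))" using walk_prefix assms by simp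
  show "ia (gunit G (ir x)) x n = x n"
    unfolding ia_def using la_unit(2)[OF _ w] assms by (simp add: irange_def act_edge_unit IP_arc)
qed

lemma ia_unit': "x \<in> IP \<Longrightarrow> v = ir x \<Longrightarrow> ia (gunit G v) x = x"
  using ia_unit by simp

lemma ia_inv:
  assumes "g \<in> arr G" "x \<in> IP" "dm g = ir x"
  shows "ia (ginv G g) (ia g x) = x"
  using ia_mult[of "ginv G g" g x] ia_unit assms by simp

lemma act_inf_eq:
  assumes "g \<in> arr G" "x \<in> IP" "dm g = ir x"
  shows "act_inf E act g x = ia g x"
proof
  fix n
  have w: "walk E (dm g) (prefix (Suc n) x) (ir (suffix (Suc n) x))"
    using walk_prefix[OF assms(2), of "Suc n"] assms(3) by simp
  have "act_inf E act g x n = la g (prefix (Suc n) x) ! n"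
    using act_eq_la[OF assms(1) w] assms by (simp add: act_inf_def segment_def irange_def)
  also have "\<dots> = prefix (Suc n) (ia g x) ! n" by (simp add: ia_prefix)
  also have "\<dots> = ia g x n" by (simp add: subsequence_def del: upt_Suc)
  finally show "act_inf E act g x n = ia g x n" .
qed

text \<open>The form in which compactness of the path space enters. If \<open>Q []\<close> failed,
  \<open>step\<close> and dependent choice would give one failing extension after another, and the
  resulting infinite path would contradict \<open>leaf\<close>.\<close>

lemma path_bar_induct:
  assumes step: "\<And>es w. walk E v es w \<Longrightarrow>
      (\<And>e. e \<in> in_arcs E w \<Longrightarrow> Q (es @ [e])) \<Longrightarrow> Q es"
    and leaf: "\<And>x. x \<in> IP \<Longrightarrow> ir x = v \<Longrightarrow> \<exists>n. Q (prefix n x)"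
  shows "Q []"
proof (rule ccontr)
  assume nQ: "\<not> Q []"
  have "\<exists>f. \<forall>n. (\<not> Q (f n) \<and> length (f n) = n \<and> (\<exists>w. walk E v (f n) w)) \<and> (\<exists>e. f (Suc n) = f n @ [e])"
  proof (rule dependent_nat_choice)
    show "\<exists>es. \<not> Q es \<and> length es = 0 \<and> (\<exists>w. walk E v es w)" using nQ by auto
    fix es n assume es: "\<not> Q es \<and> length es = n \<and> (\<exists>w. walk E v es w)"
    then obtain w where w: "walk E v es w" by blast
    then obtain e where e: "e \<in> in_arcs E w" "\<not> Q (es @ [e])" using step es by blast
    then have "walk E v (es @ [e]) (tail E e)" using w by (auto simp: walk_append)
    then show "\<exists>fs. (\<not> Q fs \<and> length fs = Suc n \<and> (\<exists>w. walk E v fs w)) \<and> (\<exists>e. fs = es @ [e])"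
      using es e by auto
  qed
  then obtain f where f: "\<And>n. \<not> Q (f n)" "\<And>n. length (f n) = n" "\<And>n. \<exists>w. walk E v (f n) w"
    "\<And>n. \<exists>e. f (Suc n) = f n @ [e]" by blast
  define x where "x n = last (f (Suc n))" for n
  have fS: "f (Suc n) = f n @ [x n]" for n using f(4)[of n] by (auto simp: x_def)
  have px: "prefix n x = f n" for n
  proof (induction n)
    case 0 then show ?case using f(2)[of 0] by simp
  next
    case (Suc n) then show ?case by (simp add: prefix_Suc fS)
  qed
  have "x n \<in> arcs E \<and> tail E (x n) = head E (x (Suc n))" for n
  proof -
    obtain w where "walk E v (f (Suc (Suc n))) w" using f(3) by blast
    then show ?thesis by (auto simp: fS walk_append)
  qed
  then have x: "x \<in> IP" by (simp add: inf_paths_def)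
  obtain w where "walk E v (f 1) w" using f(3) by blast
  then have "ir x = v" using fS[of 0] f(2)[of 0] by (auto simp: irange_def)
  then show False using leaf[OF x] f(1) by (simp add: px)
qed

text \<open>A triple \<open>(m, g, n)\<close> of edge lists \<open>m\<close>, \<open>n\<close> and a groupoid element \<open>g\<close> stands for
  \<open>s\<^sub>m u\<^sub>g s\<^sub>n\<^sup>*\<close> and for the set \<open>Z(m, g, n)\<close>.\<close>

definition valid :: "'e list \<times> 'g \<times> 'e list \<Rightarrow> bool" where
  "valid = (\<lambda>(m, g, n). g \<in> arr G \<and> (\<exists>v. walk E v m (cm g)) \<and> (\<exists>v. walk E v n (dm g)))"

text \<open>The range of the element that the triple stands for. A triple stores edges and no
  vertices, so for empty \<open>m\<close> the range is read off \<open>g\<close>.\<close>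

definition top_vertex :: "'e list \<times> 'g \<times> 'e list \<Rightarrow> 'v" where
  "top_vertex = (\<lambda>(m, g, n). if m = [] then cm g else head E (hd m))"

lemma valid_top_vertex:
  assumes "valid (m, g, n)"
  shows "walk E (top_vertex (m, g, n)) m (cm g)" "top_vertex (m, g, n) \<in> verts E"
proof -
  have "g \<in> arr G" using assms by (simp add: valid_def)
  then show "walk E (top_vertex (m, g, n)) m (cm g)" "top_vertex (m, g, n) \<in> verts E"
    using assms by (cases m; auto simp: valid_def top_vertex_def)+
qed

end

section \<open>Projections that sum to a projection\<close>

text \<open>The involution on polynomials in one self-adjoint variable.\<close>

definition poly_cnj :: "complex poly \<Rightarrow> complex poly" where
  "poly_cnj = map_poly cnj"

lemma poly_cnj_simps [simp]:
  "poly_cnj 0 = 0" "poly_cnj 1 = 1" "poly_cnj (pCons a p) = pCons (cnj a) (poly_cnj p)"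
  "poly_cnj (p + q) = poly_cnj p + poly_cnj q" "poly_cnj (p - q) = poly_cnj p - poly_cnj q"
  "poly_cnj (smult c p) = smult (cnj c) (poly_cnj p)" "poly_cnj (p * q) = poly_cnj p * poly_cnj q"
  "poly_cnj (p ^ n) = poly_cnj p ^ n" "poly_cnj (numeral k) = numeral k"
proof -
  show mult: "poly_cnj (p * q) = poly_cnj p * poly_cnj q" for p q
    unfolding poly_cnj_def by (rule poly_eqI) (simp add: coeff_map_poly coeff_mult)
  show one: "poly_cnj 1 = 1" by (simp add: poly_cnj_def)
  show "poly_cnj (p ^ n) = poly_cnj p ^ n" by (induction n) (simp_all add: one mult)
  show "poly_cnj (numeral k) = numeral k" by (simp add: poly_cnj_def numeral_poly map_poly_pCons)
qed (simp_all add: poly_cnj_def map_poly_pCons poly_eq_iff coeff_map_poly)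

text \<open>The seminorm \<open>p \<mapsto> \<parallel>p(z)\<parallel>\<close> for a self-adjoint element \<open>z\<close> of a corner \<open>qAq\<close>, \<open>q\<close> a
  projection.\<close>

locale poly_cstar_seminorm =
  fixes M :: "complex poly \<Rightarrow> real"
  assumes M_add: "M (p + q) \<le> M p + M q"
    and M_smult: "M (smult c p) = norm c * M p"
    and M_mult: "M (p * q) \<le> M p * M q"
    and M_cnj_mult: "M (poly_cnj p * p) = (M p)\<^sup>2"
    and M_nonneg: "0 \<le> M p"
begin

lemma M_le_power: "M p \<le> 1 \<Longrightarrow> M (p ^ Suc n) \<le> 1"
proof (induction n)
  case (Suc n)
  have "M (p ^ Suc (Suc n)) \<le> M p * M (p ^ Suc n)" using M_mult[of p "p ^ Suc n"] by simp
  also have "\<dots> \<le> 1" using Suc M_nonneg mult_mono[of "M p" 1 "M (p ^ Suc n)" 1] by simp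
  finally show ?case .
qed simp

lemma M_le_2: "M p \<le> 1 \<Longrightarrow> M (p\<^sup>2) \<le> 1" and M_le_3: "M p \<le> 1 \<Longrightarrow> M (p ^ 3) \<le> 1"
  using M_le_power[of p 1] M_le_power[of p 2] by (simp_all add: numeral_eq_Suc)

lemma M_minus: "M (- p) = M p"
  using M_smult[of "-1" p] by simp

lemma M_of_smult: "M (numeral k * p) = numeral k * M p"
  using M_smult[of "numeral k" p] by (simp add: numeral_poly)

abbreviation "I \<equiv> [:\<i>:]"

lemma I_sq: "I * I = -1" by (simp add: one_pCons)

lemma M_I: "M (I * p) = M p"
  using M_smult[of \<i> p] by simp

text \<open>Such an \<open>h\<close> has seminorm zero: it is at most \<open>1/2\<close>, while \<open>(3h + h\<^sup>3)/2\<close> has the same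
  properties and a seminorm larger by the factor \<open>11/8\<close>.\<close>

definition unit_square :: "complex poly \<Rightarrow> bool" where
  "unit_square h \<longleftrightarrow> poly_cnj h = h \<and> M (1 + h) \<le> 1 \<and> M (1 - h) \<le> 1"

text \<open>For self-adjoint \<open>a\<close> the elements \<open>1 + I * a\<close> and
  \<open>1 - I * a\<close> are adjoint to each other and their product is \<open>1 + a^2\<close>, so
  the C*-identity turns the hypothesis into a bound for both.\<close>

lemma imaginary_bound:
  assumes a: "poly_cnj a = a" and sq: "M (1 + a\<^sup>2) \<le> 1"
  shows "M (1 + I * a) \<le> 1" "M (1 - I * a) \<le> 1"
proof -
  have c: "poly_cnj (1 + I * a) = 1 - I * a" "poly_cnj (1 - I * a) = 1 + I * a"
    by (simp_all add: a)
  have e: "(1 - I * a) * (1 + I * a) = 1 + a\<^sup>2" "(1 + I * a) * (1 - I * a) = 1 + a\<^sup>2"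
    using I_sq by algebra+
  have "(M (1 + I * a))\<^sup>2 \<le> 1" "(M (1 - I * a))\<^sup>2 \<le> 1"
    unfolding M_cnj_mult[symmetric] c e by (rule sq)+
  then show "M (1 + I * a) \<le> 1" "M (1 - I * a) \<le> 1"
    by (simp_all only: abs_square_le_1 abs_le_iff)
qed

text \<open>\<open>1 + h^2\<close> is the mean of the squares of the contractions
  \<open>1 + h\<close> and \<open>1 - h\<close>.\<close>

lemma unit_square_imaginary:
  assumes h: "unit_square h"
  shows "M (1 + I * h) \<le> 1" "M (1 - I * h) \<le> 1"
proof -
  have "2 * M (1 + h\<^sup>2) = M (2 * (1 + h\<^sup>2))" by (rule M_of_smult[symmetric])
  also have "2 * (1 + h\<^sup>2) = (1 + h)\<^sup>2 + (1 - h)\<^sup>2" by algebra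
  also have "M \<dots> \<le> 1 + 1"
    using h M_le_2[of "1 + h"] M_le_2[of "1 - h"] M_add[of "(1 + h)\<^sup>2" "(1 - h)\<^sup>2"]
    unfolding unit_square_def by linarith
  finally have sq: "M (1 + h\<^sup>2) \<le> 1" by simp
  have "poly_cnj h = h" using h by (simp add: unit_square_def)
  then show "M (1 + I * h) \<le> 1" "M (1 - I * h) \<le> 1"
    using sq by (rule imaginary_bound)+
qed

text \<open>Polarisation: the squares of \<open>1 + h\<close> and \<open>1 - h\<close> differ by
  \<open>4 * h\<close>, those of \<open>1 + I * h\<close> and \<open>1 - I * h\<close> by
  \<open>4 * I * h\<close>. So \<open>8 * h\<close> is a combination of four contractions with
  coefficients of modulus one.\<close>

lemma unit_square_le_half:
  assumes h: "unit_square h"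
  shows "M h \<le> 1 / 2"
proof -
  have "8 * h = (1 + h)\<^sup>2 - (1 - h)\<^sup>2 + (- (I * (1 + I * h)\<^sup>2) + I * (1 - I * h)\<^sup>2)"
    using I_sq by algebra
  then have "8 * M h = M ((1 + h)\<^sup>2 + - ((1 - h)\<^sup>2) + (- (I * (1 + I * h)\<^sup>2) + I * (1 - I * h)\<^sup>2))"
    using M_of_smult[of "num.Bit0 (num.Bit0 (num.Bit0 num.One))" h] by simp
  also have "\<dots> \<le> (M ((1 + h)\<^sup>2) + M ((1 - h)\<^sup>2)) + (M ((1 + I * h)\<^sup>2) + M ((1 - I * h)\<^sup>2))"
    using M_add[of "(1 + h)\<^sup>2" "- ((1 - h)\<^sup>2)"]
      M_add[of "- (I * (1 + I * h)\<^sup>2)" "I * (1 - I * h)\<^sup>2"]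
      M_add[of "(1 + h)\<^sup>2 + - ((1 - h)\<^sup>2)" "- (I * (1 + I * h)\<^sup>2) + I * (1 - I * h)\<^sup>2"]
    unfolding M_minus M_I by linarith
  also have "\<dots> \<le> (1 + 1) + (1 + 1)"
    using h unit_square_imaginary[OF h] unfolding unit_square_def
    by (intro add_mono M_le_2) auto
  finally show ?thesis by simp
qed

lemma unit_square_grow:
  assumes h: "unit_square h"
  shows "\<exists>h'. unit_square h' \<and> 11 / 8 * M h \<le> M h'"
proof -
  let ?h = "smult (1 / 4) (6 * h + 2 * h ^ 3)"
  have sm: "smult (1 / 4) 4 = (1 :: complex poly)" by (simp add: numeral_poly one_pCons)
  have bound: "M (2 * p ^ 3 + (q ^ 3 + r ^ 3)) \<le> 4" if "M p \<le> 1" "M q \<le> 1" "M r \<le> 1" for p q r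
  proof -
    have "M (2 * p ^ 3 + (q ^ 3 + r ^ 3)) \<le> 2 * M (p ^ 3) + (M (q ^ 3) + M (r ^ 3))"
      using M_add[of "2 * p ^ 3" "q ^ 3 + r ^ 3"] M_add[of "q ^ 3" "r ^ 3"]
      unfolding M_of_smult by linarith
    then show ?thesis using M_le_3 that by (smt (verit))
  qed
  have "1 + ?h = smult (1 / 4) (4 + (6 * h + 2 * h ^ 3))" by (simp add: smult_add_right sm)
  \<comment> \<open>The squares of \<open>h\<close> cancel between the two kinds of cubes. After
    division by 4 this is a mean of cubes of contractions with weights 1/2, 1/4 and 1/4.\<close>
  also have "4 + (6 * h + 2 * h ^ 3) = 2 * (1 + h) ^ 3 + ((1 + I * h) ^ 3 + (1 - I * h) ^ 3)"
    using I_sq by algebra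
  finally have p: "M (1 + ?h) \<le> 1"
    using bound[of "1 + h" "1 + I * h" "1 - I * h"] unit_square_imaginary[OF h] h
    unfolding unit_square_def by (simp add: M_smult)
  have "1 - ?h = smult (1 / 4) (4 - (6 * h + 2 * h ^ 3))" by (simp add: smult_diff_right sm)
  also have "4 - (6 * h + 2 * h ^ 3) = 2 * (1 - h) ^ 3 + ((1 + I * h) ^ 3 + (1 - I * h) ^ 3)"
    using I_sq by algebra
  finally have m: "M (1 - ?h) \<le> 1"
    using bound[of "1 - h" "1 + I * h" "1 - I * h"] unit_square_imaginary[OF h] h
    unfolding unit_square_def by (simp add: M_smult)
  have "unit_square ?h" using p m h unfolding unit_square_def by simp
  moreover have "11 / 8 * M h \<le> M ?h"
  proof -
    \<comment> \<open>By \<open>unit_square_le_half\<close> the term \<open>2 * h ^ 3\<close> costs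
      at most half of \<open>M h\<close>, so \<open>6\<close> drops to \<open>11 / 2\<close>, and
      the factor \<open>1 / 4\<close> gives \<open>11 / 8\<close>.\<close>
    have "6 * M h = M (6 * h)" using M_of_smult[of _ h] by simp
    also have "\<dots> = M ((6 * h + 2 * h ^ 3) + - (2 * h ^ 3))" by simp
    also have "\<dots> \<le> M (6 * h + 2 * h ^ 3) + M (2 * h ^ 3)"
      using M_add[of "6 * h + 2 * h ^ 3" "- (2 * h ^ 3)"] unfolding M_minus .
    also have "M (2 * h ^ 3) = 2 * M (h ^ 3)" using M_of_smult[of _ "h ^ 3"] by simp
    also have "M (h ^ 3) \<le> M h / 4"
    proof -
      have "M (h ^ 3) \<le> M h * M (h * h)"
        using M_mult[of h "h * h"] by (simp add: power3_eq_cube mult.assoc)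
      also have "M (h * h) \<le> M h * M h" by (rule M_mult)
      also have "M h * M h \<le> 1 / 2 * (1 / 2)"
        using unit_square_le_half[OF h] M_nonneg[of h] by (intro mult_mono) auto
      finally show ?thesis using M_nonneg[of h] by (simp add: mult_left_mono)
    qed
    finally show ?thesis using M_smult[of "1 / 4" "6 * h + 2 * h ^ 3"] by simp
  qed
  ultimately show ?thesis by blast
qed

lemma unit_square_zero:
  assumes h: "unit_square h"
  shows "M h = 0"
proof (rule ccontr)
  assume "M h \<noteq> 0"
  then have pos: "M h > 0" using M_nonneg[of h] by simp
  have grow: "\<exists>k. unit_square k \<and> (11 / 8) ^ n * M h \<le> M k" for n
  proof (induction n)
    case (Suc n)
    then obtain k where k: "unit_square k" "(11 / 8) ^ n * M h \<le> M k" by blast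
    obtain l where "unit_square l" "11 / 8 * M k \<le> M l" using unit_square_grow[OF k(1)] by blast
    then show ?case using k(2) by (intro exI[of _ l]) (simp add: mult.assoc)
  qed (use h in auto)
  obtain n where n: "1 / M h < (11 / 8 :: real) ^ n" using real_arch_pow[of "11 / 8"] by auto
  obtain k where "unit_square k" "(11 / 8) ^ n * M h \<le> M k" using grow by blast
  then have "(11 / 8) ^ n * M h \<le> 1 / 2" using unit_square_le_half by fastforce
  moreover have "1 < (11 / 8) ^ n * M h" using n pos by (simp add: field_simps)
  ultimately show False by simp
qed

text \<open>For a real number, \<open>\<bar>1 - z\<bar> \<le> 1\<close> gives \<open>z \<ge> 0\<close> and \<open>\<bar>T + z\<bar> \<le> T\<close> gives \<open>z \<le> 0\<close>.\<close>

lemma M_zero_of_bounds: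
  fixes T :: real
  assumes z: "poly_cnj z = z" and T: "T > 0"
    and 1: "M (1 - z) \<le> 1" and 2: "M ([:complex_of_real T:] + z) \<le> T"
  shows "M z = 0"
proof -
  let ?T = "[:complex_of_real T:]"
  let ?c = "complex_of_real (1 / sqrt T)"
  let ?a = "smult ?c z"
  have cc: "?c * ?c = complex_of_real (1 / T)"
    using T by (simp flip: of_real_mult real_sqrt_mult add: real_sqrt_mult_self)
  have "?a\<^sup>2 = smult (?c * ?c) (z\<^sup>2)" by (simp add: power2_eq_square)
  then have aa: "?a\<^sup>2 = smult (complex_of_real (1 / T)) (z\<^sup>2)" by (simp only: cc)
  have TT: "smult (complex_of_real (1 / T)) ?T = 1" using T by (simp add: one_pCons)
  have T2: "[:complex_of_real (1 / T):] * ?T = 1" using T by (simp add: one_pCons)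
  \<comment> \<open>The weights \<open>1\<close> and \<open>1 / T\<close> are those for which the
    linear terms of \<open>(1 - z)^2\<close> and \<open>(T + z)^2\<close> cancel. Dividing
    \<open>z\<close> by the square root of \<open>T\<close> makes the rest a multiple of
    \<open>1 + ?a^2\<close>.\<close>
  have "smult (complex_of_real (1 + T)) (1 + ?a\<^sup>2) =
      (1 - z)\<^sup>2 + smult (complex_of_real (1 / T)) ((?T + z)\<^sup>2)"
  proof -
    have "smult (complex_of_real (1 + T)) (1 + ?a\<^sup>2) =
      (1 + ?T) * (1 + [:complex_of_real (1 / T):] * z\<^sup>2)"
      unfolding aa by (simp add: one_pCons)
    also have "\<dots> = (1 - z)\<^sup>2 + [:complex_of_real (1 / T):] * (?T + z)\<^sup>2"
      using T2 by algebra
    finally show ?thesis by simp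
  qed
  then have "(1 + T) * M (1 + ?a\<^sup>2) = M ((1 - z)\<^sup>2 + smult (complex_of_real (1 / T)) ((?T + z)\<^sup>2))"
    using M_smult[of "complex_of_real (1 + T)" "1 + ?a\<^sup>2"] T by (simp flip: of_real_add)
  also have "\<dots> \<le> M ((1 - z)\<^sup>2) + 1 / T * M ((?T + z)\<^sup>2)"
    using M_add[of "(1 - z)\<^sup>2" "smult (complex_of_real (1 / T)) ((?T + z)\<^sup>2)"] T
    by (simp add: M_smult norm_divide)
  also have "\<dots> \<le> 1 + 1 / T * (T * T)"
  proof -
    have "M ((?T + z)\<^sup>2) \<le> M (?T + z) * M (?T + z)" unfolding power2_eq_square by (rule M_mult)
    also have "\<dots> \<le> T * T" using 2 M_nonneg T by (intro mult_mono) auto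
    finally show ?thesis using M_le_2[OF 1] T by (intro add_mono mult_left_mono) auto
  qed
  also have "\<dots> = 1 + T" using T by simp
  finally have s: "M (1 + ?a\<^sup>2) \<le> 1" using T by simp
  have ca: "poly_cnj ?a = ?a" using z by simp
  note i = imaginary_bound[OF ca s]
  \<comment> \<open>The squares of the contractions \<open>1 + I * ?a\<close> and
    \<open>1 - I * ?a\<close> have mean \<open>1 - ?a^2\<close>. Both bounds together make
    \<open>?a^2\<close> a \<open>unit_square\<close>, so its seminorm is zero.\<close>
  have "2 * M (1 - ?a\<^sup>2) = M (2 * (1 - ?a\<^sup>2))" using M_of_smult[of _ "1 - ?a\<^sup>2"] by simp
  also have "2 * (1 - ?a\<^sup>2) = (1 + I * ?a)\<^sup>2 + (1 - I * ?a)\<^sup>2" using I_sq by algebra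
  also have "M \<dots> \<le> 1 + 1"
    using M_le_2[OF i(1)] M_le_2[OF i(2)] M_add[of "(1 + I * ?a)\<^sup>2" "(1 - I * ?a)\<^sup>2"]
    by linarith
  finally have "M (1 - ?a\<^sup>2) \<le> 1" by simp
  then have "unit_square (?a\<^sup>2)" using s ca unfolding unit_square_def by (simp only: poly_cnj_simps)
  then have "M (?a\<^sup>2) = 0" by (rule unit_square_zero)
  then have "(M ?a)\<^sup>2 = 0" using M_cnj_mult[of ?a] ca by (simp only: power2_eq_square)
  then show "M z = 0" using T M_smult[of ?c z] by (simp add: norm_divide)
qed

end

section \<open>Polynomials in a self-adjoint element of a corner\<close>

locale corner_element = star_algebra A
  for A :: "('a, 'm) star_algebra_scheme" +
  fixes q h :: 'a
  assumes q: "q \<in> carrier A" "amult A q q = q" "astar A q = q"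
    and h: "h \<in> carrier A" "amult A q h = h" "amult A h q = h" "astar A h = h"
begin

text \<open>Horner evaluation at \<open>h\<close> with the projection \<open>q\<close> as the unit,
  so that constants make sense in an algebra without unit.\<close>

definition poly_at :: "complex poly \<Rightarrow> 'a" where
  "poly_at p = fold_coeffs (\<lambda>a x. aadd A (ascale A a q) (amult A h x)) p (azero A)"

lemma poly_at_0 [simp]: "poly_at 0 = azero A"
  by (simp add: poly_at_def)

lemma poly_at_pCons [simp]: "poly_at (pCons a p) = aadd A (ascale A a q) (amult A h (poly_at p))"
  by (cases "p = 0"; cases "a = 0") (simp_all add: poly_at_def q h)

lemma poly_at_closed [simp]: "poly_at p \<in> carrier A"
  by (induction p) (simp_all add: q h)

lemma poly_at_add: "poly_at (p + r) = aadd A (poly_at p) (poly_at r)"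
  by (induction p r rule: poly_induct2)
    (simp_all add: q h scale_add_left mult_add_right add_assoc add_left_commute)

lemma poly_at_smult: "poly_at (smult c p) = ascale A c (poly_at p)"
  by (induction p) (simp_all add: q h scale_add_right scale_scale mult_scale_right)

lemma q_poly_at: "amult A q (poly_at p) = poly_at p"
  by (induction p) (simp_all add: q h mult_add_right mult_scale_right mult_assoc[symmetric])

lemma h_poly_at: "amult A (poly_at p) h = amult A h (poly_at p)"
  by (induction p) (simp_all add: q h mult_add_right mult_add_left mult_scale_right
      mult_scale_left mult_assoc)

lemma poly_at_mult: "poly_at (p * r) = amult A (poly_at p) (poly_at r)"
  by (induction p) (simp_all add: q h poly_at_add poly_at_smult mult_add_left mult_scale_left
      q_poly_at mult_assoc)

lemma poly_at_cnj: "poly_at (poly_cnj p) = astar A (poly_at p)"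
  by (induction p) (simp_all add: q h star_add star_scale star_mult h_poly_at[symmetric])

lemma poly_at_1: "poly_at 1 = q" and poly_at_X: "poly_at [:0, 1:] = h"
  by (simp_all add: one_pCons q h)

end

text \<open>Multiplication by \<open>1 - p\<close>, written without a unit, is a contraction: the
  result \<open>y\<close> satisfies \<open>p y = 0\<close>, so \<open>y^* y = x^* y\<close>, and the
  C*-identity gives \<open>N y * N y \<le> N x * N y\<close>.\<close>

lemma (in cstar_seminormed) norm_complement_le:
  assumes p: "p \<in> carrier A" "amult A p p = p" "astar A p = p" and x: "x \<in> carrier A"
  shows "N (asub A x (amult A p x)) \<le> N x"
proof -
  let ?y = "asub A x (amult A p x)"
  have y: "?y \<in> carrier A" using p x by simp
  have "amult A p ?y = azero A"
    using p x by (simp add: asub_mult_right mult_assoc[symmetric])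
  then have "amult A (astar A ?y) ?y = amult A (astar A x) ?y"
    using p x by (simp add: asub_star[symmetric] star_mult asub_mult_left mult_assoc)
  then have "N ?y * N ?y \<le> N x * N ?y"
    using norm_star_mult[OF y] norm_mult[of "astar A x" ?y] x y by (simp add: power2_eq_square)
  then show ?thesis using norm_nonneg[OF y] norm_nonneg[OF x]
    by (cases "N ?y = 0") auto
qed

lemma (in cstar_algebra) norm_definite:
  "x \<in> carrier A \<Longrightarrow> amult A (astar A x) x = azero A \<Longrightarrow> x = azero A"
proof -
  assume x: "x \<in> carrier A" and z: "amult A (astar A x) x = azero A"
  interpret cstar_seminormed A "anorm A"
    by (rule cstar_algebra_seminormed) (rule cstar_algebra_axioms)
  have "(anorm A x)\<^sup>2 = 0" using norm_star_mult[OF x] z by simp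
  then show "x = azero A" using norm_eq_zero x by simp
qed

text \<open>Compress everything to the corner of \<open>q = p j\<close>. There the sum becomes
  \<open>q\<close> plus the compressions \<open>x k\<close> of the other projections and is still a
  contraction, so positivity would force the \<open>x k\<close> to vanish. Without an order,
  \<open>N (q - x i) \<le> 1\<close> plays the role of \<open>x i\<close> being nonnegative and
  \<open>N (T q + x i) \<le> T\<close> that of its being nonpositive;
  \<open>M_zero_of_bounds\<close> combines them.\<close>

theorem (in cstar_algebra) orthogonal_projections:
  assumes fin: "finite J" and proj: "\<And>j. j \<in> J \<Longrightarrow> p j \<in> carrier A \<and> amult A (p j) (p j) = p j \<and> astar A (p j) = p j"
    and sum: "amult A (asum A p J) (asum A p J) = asum A p J"
    and ij: "i \<in> J" "j \<in> J" "i \<noteq> j"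
  shows "amult A (p i) (p j) = azero A"
proof -
  interpret cstar_seminormed A "anorm A"
    by (rule cstar_algebra_seminormed) (rule cstar_algebra_axioms)
  let ?q = "p j" and ?N = "anorm A" and ?s = "asum A p J"
  have pc [simp]: "p k \<in> carrier A" "amult A (p k) (p k) = p k" "astar A (p k) = p k" if "k \<in> J" for k
    using proj that by auto
  define x where "x k = amult A ?q (amult A (p k) ?q)" for k
  have xc [simp]: "x k \<in> carrier A" if "k \<in> J" for k using that ij by (simp add: x_def)
  have xstar: "astar A (x k) = x k" if "k \<in> J" for k
    using that ij by (simp add: x_def star_mult mult_assoc)
  have x_eq: "x k = amult A (astar A (amult A (p k) ?q)) (amult A (p k) ?q)" if "k \<in> J" for k
  proof -
    have "amult A (astar A (amult A (p k) ?q)) (amult A (p k) ?q) =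
        amult A ?q (amult A (amult A (p k) (p k)) ?q)"
      using that ij(2) by (simp add: star_mult mult_assoc del: pc(2))
    then show ?thesis using that ij by (simp add: x_def)
  qed
  \<comment> \<open>This is the C*-identity for \<open>y = q - p k q\<close>, since
    \<open>y^* y = q - x k\<close>.\<close>
  have near: "?N (asub A ?q (x k)) \<le> 1" if k: "k \<in> J" for k
  proof -
    let ?y = "asub A ?q (amult A (p k) ?q)"
    have "amult A (p k) ?y = azero A"
      using k ij by (simp add: asub_mult_right mult_assoc[symmetric])
    then have "amult A (astar A ?y) ?y = amult A ?q ?y"
      using k ij by (simp add: asub_star[symmetric] star_mult asub_mult_left mult_assoc)
    also have "\<dots> = asub A ?q (x k)"
      using k ij by (simp add: asub_mult_right x_def)
    finally have "?N (asub A ?q (x k)) = (?N ?y)\<^sup>2"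
      using norm_star_mult[of ?y] k ij by simp
    moreover have "?N ?y \<le> ?N ?q" using k ij by (intro norm_complement_le) auto
    moreover have "?N ?q \<le> 1" using ij by (intro norm_projection_le_1) auto
    moreover have "0 \<le> ?N ?y" using k ij by simp
    ultimately show ?thesis using power_mono[of "?N ?y" 1 2] by simp
  qed
  define K where "K = J - {i, j}"
  have K: "finite K" "J = insert i (insert j K)" "i \<notin> K" "j \<notin> K" using fin ij by (auto simp: K_def)
  have KJ: "k \<in> J" if "k \<in> K" for k using that by (simp add: K_def)
  have xj: "x j = ?q" using ij by (simp add: x_def)
  have xK: "x k \<in> carrier A" if "k \<in> insert i (insert j K)" for k
    using that K(2) xc by simp
  have "amult A ?q (amult A ?s ?q) = asum A x J"
    using ij by (simp add: asum_mult_left[symmetric] asum_mult_right[symmetric] x_def[abs_def])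
  also have "\<dots> = aadd A (x i) (aadd A ?q (asum A x K))"
  proof -
    have "asum A x (insert i (insert j K)) = aadd A (x i) (asum A x (insert j K))"
      by (rule asum_insert) (use K ij(3) xK in auto)
    moreover have "asum A x (insert j K) = aadd A (x j) (asum A x K)"
      by (rule asum_insert) (use K xK in auto)
    ultimately show ?thesis by (simp only: K(2)[symmetric] xj)
  qed
  finally have qsq: "amult A ?q (amult A ?s ?q) = aadd A (x i) (aadd A ?q (asum A x K))" .
  \<comment> \<open>\<open>T q + x i\<close> is the compressed sum plus the \<open>card K\<close>
    elements \<open>q - x k\<close>; each of these \<open>1 + card K\<close> terms has norm at most
    one.\<close>
  define T :: real where "T = 1 + card K"
  have T: "T > 0" by (simp add: T_def)
  have Kc: "asum A x K \<in> carrier A" "asum A (\<lambda>k. asub A ?q (x k)) K \<in> carrier A"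
    using ij KJ by auto
  have "aadd A (asum A x K) (asum A (\<lambda>k. asub A ?q (x k)) K) =
      asum A (\<lambda>k. aadd A (x k) (asub A ?q (x k))) K"
    using ij KJ by (subst asum_add) auto
  also have "\<dots> = asum A (\<lambda>k. ascale A 1 ?q) K"
    using ij KJ by (intro asum_cong) (auto simp: add_commute[of "x _"] add_asub_cancel)
  also have "\<dots> = ascale A (of_nat (card K)) ?q"
    using asum_scale_sum[OF _ K(1), of ?q "\<lambda>_. 1"] ij by simp
  finally have Ksum: "aadd A (asum A x K) (asum A (\<lambda>k. asub A ?q (x k)) K) =
      ascale A (of_nat (card K)) ?q" .
  have "aadd A (ascale A (complex_of_real T) ?q) (x i) =
      aadd A (amult A ?q (amult A ?s ?q)) (asum A (\<lambda>k. asub A ?q (x k)) K)"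
  proof -
    have "aadd A (amult A ?q (amult A ?s ?q)) (asum A (\<lambda>k. asub A ?q (x k)) K) =
      aadd A (x i) (aadd A ?q (aadd A (asum A x K) (asum A (\<lambda>k. asub A ?q (x k)) K)))"
      unfolding qsq using ij Kc by (simp add: add_assoc)
    also have "\<dots> = aadd A (x i) (ascale A (complex_of_real T) ?q)"
      unfolding Ksum using ij scale_add_left[of ?q 1 "of_nat (card K)"] by (simp add: T_def)
    finally show ?thesis using ij by (simp add: add_commute)
  qed
  moreover have "?N (aadd A (amult A ?q (amult A ?s ?q)) (asum A (\<lambda>k. asub A ?q (x k)) K)) \<le> T"
  proof -
    have sc: "?s \<in> carrier A" by auto
    have "astar A ?s = asum A (\<lambda>k. astar A (p k)) J" by (rule asum_star[symmetric]) simp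
    also have "\<dots> = ?s" by (rule asum_cong) auto
    finally have "?N ?s \<le> 1" using sum sc by (intro norm_projection_le_1) auto
    moreover have "?N ?q \<le> 1" using ij by (intro norm_projection_le_1) auto
    ultimately have "?N ?q * (?N ?s * ?N ?q) \<le> 1"
      using ij sc by (metis mult_le_one norm_nonneg mult_nonneg_nonneg pc(1))
    moreover have "?N (amult A ?q (amult A ?s ?q)) \<le> ?N ?q * (?N ?s * ?N ?q)"
      using ij sc norm_mult[of ?q "amult A ?s ?q"] norm_mult[of ?s ?q]
      by (smt (verit) mult_left_mono norm_nonneg mult_closed pc(1))
    moreover have "?N (asum A (\<lambda>k. asub A ?q (x k)) K) \<le> (\<Sum>k\<in>K. ?N (asub A ?q (x k)))"
      using ij KJ by (intro norm_asum) auto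
    moreover have "(\<Sum>k\<in>K. ?N (asub A ?q (x k))) \<le> card K"
      using near KJ sum_bounded_above[of K "\<lambda>k. ?N (asub A ?q (x k))" 1] by simp
    moreover have "?N (aadd A (amult A ?q (amult A ?s ?q)) (asum A (\<lambda>k. asub A ?q (x k)) K)) \<le>
        ?N (amult A ?q (amult A ?s ?q)) + ?N (asum A (\<lambda>k. asub A ?q (x k)) K)"
      using ij sc Kc by (intro norm_add) auto
    ultimately show ?thesis unfolding T_def by linarith
  qed
  ultimately have far: "?N (aadd A (ascale A (complex_of_real T) ?q) (x i)) \<le> T" by simp
  interpret corner_element A ?q "x i"
    using ij xstar by unfold_locales (simp_all add: x_def mult_assoc, simp add: mult_assoc[symmetric])
  interpret poly_cstar_seminorm "\<lambda>p. ?N (poly_at p)"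
    by unfold_locales (simp_all add: poly_at_add poly_at_smult poly_at_mult poly_at_cnj
        norm_add norm_scale norm_mult norm_star_mult)
  have "?N (poly_at [:0, 1:]) = 0"
  proof (rule M_zero_of_bounds[OF _ T])
    have "poly_at (1 - [:0, 1:]) = asub A ?q (x i)"
    proof -
      have "1 - [:0, 1:] = 1 + smult (-1) [:0, 1 :: complex:]" by simp
      then show ?thesis by (simp only: poly_at_add poly_at_smult poly_at_1 poly_at_X asub_def)
    qed
    then show "?N (poly_at (1 - [:0, 1:])) \<le> 1" using near ij by simp
    have "poly_at ([:complex_of_real T:] + [:0, 1:]) = aadd A (ascale A (complex_of_real T) ?q) (x i)"
    proof -
      have "[:complex_of_real T:] = smult (complex_of_real T) 1" by (simp add: one_pCons)
      then show ?thesis by (simp only: poly_at_add poly_at_smult poly_at_1 poly_at_X)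
    qed
    then show "?N (poly_at ([:complex_of_real T:] + [:0, 1:])) \<le> T" using far by simp
  qed simp
  then have "x i = azero A" using norm_eq_zero ij by (simp only: poly_at_X) simp
  then have "amult A (astar A (amult A (p i) (p j))) (amult A (p i) (p j)) = azero A"
    by (simp only: x_eq[OF ij(1), symmetric])
  then show ?thesis by (rule norm_definite[rotated]) (use ij in simp)
qed

section \<open>Families satisfying the relations\<close>

text \<open>No norm is involved, so that the convolution algebra itself is an instance. The
  orthogonality in \<open>S_S\<close> and the rules \<open>S_P\<close> and \<open>P_S\<close> are
  not among the defining relations; in a C*-algebra \<open>cstar_ssa_family\<close> derives
  them.\<close>

locale ssa_family = finite_self_similar_action E G act + star_algebra A
  for E :: "('v, 'e) pre_digraph" and G :: "('v, 'g, 'm) groupoid_scheme"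
    and act :: "'g \<Rightarrow> ('v, 'e) fpath \<Rightarrow> ('v, 'e) fpath"
    and A :: "('a, 'n) star_algebra_scheme" +
  fixes U :: "'g \<Rightarrow> 'a" and P :: "'v \<Rightarrow> 'a" and S :: "'e \<Rightarrow> 'a"
  assumes U_closed [simp]: "g \<in> arr G \<Longrightarrow> U g \<in> carrier A"
    and S_closed [simp]: "e \<in> arcs E \<Longrightarrow> S e \<in> carrier A"
    and U_mult: "g \<in> arr G \<Longrightarrow> h \<in> arr G \<Longrightarrow>
      amult A (U g) (U h) = (if dm g = cm h then U (gmult G g h) else azero A)"
    and U_inv: "g \<in> arr G \<Longrightarrow> astar A (U g) = U (ginv G g)"
    and P_unit: "v \<in> verts E \<Longrightarrow> P v = U (gunit G v)"
    and S_P: "e \<in> arcs E \<Longrightarrow> amult A (S e) (P (tail E e)) = S e"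
    and P_S: "e \<in> arcs E \<Longrightarrow> amult A (P (head E e)) (S e) = S e"
    and S_S: "e \<in> arcs E \<Longrightarrow> f \<in> arcs E \<Longrightarrow>
      amult A (astar A (S e)) (S f) = (if e = f then P (tail E e) else azero A)"
    and P_sum: "v \<in> verts E \<Longrightarrow> P v = asum A (\<lambda>e. amult A (S e) (astar A (S e))) (in_arcs E v)"
    and U_S: "g \<in> arr G \<Longrightarrow> e \<in> arcs E \<Longrightarrow> head E e = dm g \<Longrightarrow>
      amult A (U g) (S e) = amult A (S (ae g e)) (U (er g e))"
begin

lemma P_closed [simp]: "v \<in> verts E \<Longrightarrow> P v \<in> carrier A"
  by (simp add: P_unit)

lemma P_star [simp]: "v \<in> verts E \<Longrightarrow> astar A (P v) = P v"
  by (simp add: P_unit U_inv)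

lemma unit_mult_unit [simp]: "v \<in> verts E \<Longrightarrow> gmult G (gunit G v) (gunit G v) = gunit G v"
  using mult_unit_left[of "gunit G v"] by simp

lemma P_mult: "v \<in> verts E \<Longrightarrow> w \<in> verts E \<Longrightarrow>
    amult A (P v) (P w) = (if v = w then P v else azero A)"
  by (simp add: P_unit U_mult)

lemma P_U: "v \<in> verts E \<Longrightarrow> g \<in> arr G \<Longrightarrow>
    amult A (P v) (U g) = (if v = cm g then U g else azero A)"
  by (simp add: P_unit U_mult)

lemma U_P: "v \<in> verts E \<Longrightarrow> g \<in> arr G \<Longrightarrow>
    amult A (U g) (P v) = (if v = dm g then U g else azero A)"
  by (auto simp: P_unit U_mult)

lemma P_S_if:
  assumes "v \<in> verts E" "e \<in> arcs E"
  shows "amult A (P v) (S e) = (if v = head E e then S e else azero A)"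
proof -
  have "amult A (P v) (S e) = amult A (amult A (P v) (P (head E e))) (S e)"
    using assms by (simp add: mult_assoc P_S)
  then show ?thesis using assms by (simp add: P_mult P_S)
qed

text \<open>The vertex \<open>w\<close> is passed along because it cannot be read off the empty
  list, whose value, in the absence of a unit, is a vertex projection.\<close>

fun SL :: "'e list \<Rightarrow> 'v \<Rightarrow> 'a" where
  "SL [] w = P w"
| "SL (e # es) w = amult A (S e) (SL es w)"

lemma SL_closed [simp]: "walk E v es w \<Longrightarrow> w \<in> verts E \<Longrightarrow> SL es w \<in> carrier A"
  by (induction es arbitrary: v) auto

lemma SL_P: "walk E v es w \<Longrightarrow> w \<in> verts E \<Longrightarrow> amult A (SL es w) (P w) = SL es w"
  by (induction es arbitrary: v) (auto simp: P_mult mult_assoc)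

lemma P_SL:
  "walk E v es w \<Longrightarrow> w \<in> verts E \<Longrightarrow> u \<in> verts E \<Longrightarrow>
    amult A (P u) (SL es w) = (if u = v then SL es w else azero A)"
  by (cases es) (auto simp: P_mult P_S_if mult_assoc[symmetric])

lemma SL_append:
  "walk E v es u \<Longrightarrow> walk E u fs w \<Longrightarrow> w \<in> verts E \<Longrightarrow>
    SL (es @ fs) w = amult A (SL es u) (SL fs w)"
proof (induction es arbitrary: v)
  case Nil
  then show ?case using walk_start_verts[of u fs w] by (simp add: P_SL)
next
  case (Cons e es)
  then show ?case using walk_start_verts[of u fs w] by (auto simp: mult_assoc)
qed

lemma U_SL:
  "g \<in> arr G \<Longrightarrow> walk E (dm g) es w \<Longrightarrow>
    amult A (U g) (SL es w) = amult A (SL (la g es) (cm (res g es))) (U (res g es))"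
proof (induction es arbitrary: g)
  case Nil
  then have "w \<in> verts E" by auto
  then show ?case using Nil by (simp add: U_P P_U)
next
  case (Cons e es)
  then have e: "e \<in> arcs E" "head E e = dm g" "walk E (tail E e) es w" by auto
  have w: "w \<in> verts E" using res_walk[OF Cons.prems] dm_verts by metis
  note r = res_walk[of "er g e" es w]
  have "amult A (U g) (SL (e # es) w) = amult A (amult A (U g) (S e)) (SL es w)"
    using Cons.prems e w by (simp add: mult_assoc)
  also have "\<dots> = amult A (S (ae g e)) (amult A (U (er g e)) (SL es w))"
    using Cons.prems e w by (simp add: U_S mult_assoc)
  also have "amult A (U (er g e)) (SL es w) =
      amult A (SL (la (er g e) es) (cm (res (er g e) es))) (U (res (er g e) es))"
    using Cons.IH[of "er g e"] Cons.prems e by simp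
  finally show ?case using Cons.prems e r by (simp add: mult_assoc)
qed

definition tt :: "'e list \<times> 'g \<times> 'e list \<Rightarrow> 'a" where
  "tt = (\<lambda>(m, g, n). amult A (SL m (cm g)) (amult A (U g) (astar A (SL n (dm g)))))"

definition opt_eval :: "('e list \<times> 'g \<times> 'e list) option \<Rightarrow> 'a" where
  "opt_eval t = (case t of None \<Rightarrow> azero A | Some \<tau> \<Rightarrow> tt \<tau>)"

lemma valid_closed:
  assumes "valid (m, g, n)"
  shows "g \<in> arr G" "SL m (cm g) \<in> carrier A" "SL n (dm g) \<in> carrier A" "tt (m, g, n) \<in> carrier A"
proof -
  have g: "g \<in> arr G" using assms by (simp add: valid_def)
  then have v: "cm g \<in> verts E" "dm g \<in> verts E" by simp_all
  show "g \<in> arr G" by fact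
  show "SL m (cm g) \<in> carrier A" "SL n (dm g) \<in> carrier A"
    using assms SL_closed[OF _ v(1)] SL_closed[OF _ v(2)] by (auto simp: valid_def)
  then show "tt (m, g, n) \<in> carrier A" using g by (simp add: tt_def)
qed

lemma tt_closed [simp]: "valid \<tau> \<Longrightarrow> tt \<tau> \<in> carrier A"
  using valid_closed(4) by (cases \<tau>) blast

end

section \<open>Reduction of words to triples\<close>

text \<open>Left multiplication of \<open>s\<^sub>m u\<^sub>g s\<^sub>n\<^sup>*\<close> by a generator or the adjoint of one, computed on triples;
  \<open>None\<close> stands for \<open>0\<close>.\<close>

context finite_self_similar_action
begin

fun lstep :: "('v, 'e, 'g) generator \<times> bool \<Rightarrow> 'e list \<times> 'g \<times> 'e list \<Rightarrow>
    ('e list \<times> 'g \<times> 'e list) option" where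
  "lstep (U_gen h, b) (m, g, n) = (let k = (if b then ginv G h else h) in
     if dm k = top_vertex (m, g, n) then Some (la k m, gmult G (res k m) g, n) else None)"
| "lstep (P_gen v, b) (m, g, n) = (if v = top_vertex (m, g, n) then Some (m, g, n) else None)"
| "lstep (S_gen e, False) (m, g, n) =
     (if tail E e = top_vertex (m, g, n) then Some (e # m, g, n) else None)"
| "lstep (S_gen e, True) ([], g, n) =
     (if head E e = cm g then Some ([], ginv G (er (ginv G g) e), n @ [ae (ginv G g) e]) else None)"
| "lstep (S_gen e, True) (f # m, g, n) = (if e = f then Some (m, g, n) else None)"

fun letter_triple :: "('v, 'e, 'g) generator \<times> bool \<Rightarrow> 'e list \<times> 'g \<times> 'e list" where
  "letter_triple (U_gen h, b) = ([], if b then ginv G h else h, [])"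
| "letter_triple (P_gen v, b) = ([], gunit G v, [])"
| "letter_triple (S_gen e, False) = ([e], gunit G (tail E e), [])"
| "letter_triple (S_gen e, True) = ([], gunit G (tail E e), [e])"

text \<open>The reduction never looks at the algebra: a word yields the same triple for every
  family. This links the image of an element in the convolution algebra to its image under any other
  family. The empty word goes to \<open>None\<close> to match \<open>word_eval\<close>.\<close>

fun red :: "(('v, 'e, 'g) generator \<times> bool) list \<Rightarrow> ('e list \<times> 'g \<times> 'e list) option" where
  "red [] = None"
| "red [l] = Some (letter_triple l)"
| "red (l # w) = Option.bind (red w) (lstep l)"

definition gens :: "('v, 'e, 'g) generator set" where
  "gens = U_gen ` arr G \<union> P_gen ` verts E \<union> S_gen ` arcs E"

end

context ssa_family
begin

definition \<eta> :: "('v, 'e, 'g) generator \<Rightarrow> 'a" where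
  "\<eta> x = (case x of U_gen g \<Rightarrow> U g | P_gen v \<Rightarrow> P v | S_gen e \<Rightarrow> S e)"

lemma \<eta>_simps [simp]: "\<eta> (U_gen g) = U g" "\<eta> (P_gen v) = P v" "\<eta> (S_gen e) = S e"
  by (simp_all add: \<eta>_def)

sublocale generators A \<eta> gens
  by unfold_locales (auto simp: gens_def)

lemma letter_triple_valid: "fst l \<in> gens \<Longrightarrow> valid (letter_triple l)"
  by (cases l rule: letter_triple.cases) (auto simp: gens_def valid_def)

lemma letter_triple_eval: "fst l \<in> gens \<Longrightarrow> tt (letter_triple l) = letter_eval A \<eta> l"
proof (cases l rule: letter_triple.cases)
  case (4 e)
  assume "fst l \<in> gens"
  with 4 have e: "e \<in> arcs E" by (auto simp: gens_def)
  have "amult A (P (tail E e)) (astar A (S e)) = astar A (S e)"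
    using e S_P[OF e] star_mult[of "S e" "P (tail E e)"] by simp
  then show ?thesis using 4 e
    by (simp add: tt_def letter_eval_def P_unit[symmetric] S_P mult_assoc[symmetric] P_mult)
qed (auto simp: gens_def tt_def letter_eval_def P_U U_P U_inv P_unit[symmetric] P_mult S_P mult_assoc)

lemma lstep_valid:
  assumes "fst l \<in> gens" "valid \<tau>" "lstep l \<tau> = Some \<tau>'"
  shows "valid \<tau>'"
  using assms(3)
proof (cases "(l, \<tau>)" rule: lstep.cases)
  case (1 h b m g n)
  let ?k = "if b then ginv G h else h"
  have k: "?k \<in> arr G" using 1 assms(1) by (auto simp: gens_def)
  from 1 assms(3) have d: "dm ?k = top_vertex (m, g, n)" and t: "\<tau>' = (la ?k m, gmult G (res ?k m) g, n)"
    by (auto simp: Let_def split: if_splits)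
  have w: "walk E (dm ?k) m (cm g)" using valid_top_vertex[of m g n] assms(2) 1 d by simp
  show ?thesis using res_walk[OF k w] assms(2) 1 unfolding t valid_def by auto
next
  case (2 v b m g n)
  then show ?thesis using assms by (auto split: if_splits)
next
  case (3 e m g n)
  have "e \<in> arcs E" using 3 assms(1) by (auto simp: gens_def)
  then show ?thesis using assms 3 valid_top_vertex[of m g n]
    by (auto simp: valid_def split: if_splits)
next
  case (4 e g n)
  have e: "e \<in> arcs E" using 4 assms(1) by (auto simp: gens_def)
  have g: "g \<in> arr G" "\<exists>v. walk E v n (dm g)" using 4 assms(2) by (auto simp: valid_def)
  show ?thesis using assms(3) 4 e g by (auto simp: valid_def walk_append split: if_splits)
next
  case (5 e f m g n)
  then show ?thesis using assms by (auto simp: valid_def split: if_splits)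
qed

lemma lstep_U:
  assumes k: "k \<in> arr G" and val: "valid (m, g, n)"
  shows "amult A (U k) (tt (m, g, n)) =
    (if dm k = top_vertex (m, g, n) then tt (la k m, gmult G (res k m) g, n) else azero A)"
proof -
  note v = valid_closed[OF val] valid_top_vertex[OF val]
  let ?R = "amult A (U g) (astar A (SL n (dm g)))"
  have R: "?R \<in> carrier A" using v by simp
  have eq: "amult A (U k) (tt (m, g, n)) = amult A (amult A (U k) (SL m (cm g))) ?R"
    using k v by (simp add: tt_def mult_assoc)
  show ?thesis
  proof (cases "dm k = top_vertex (m, g, n)")
    case True
    then have w: "walk E (dm k) m (cm g)" using v by simp
    note r = res_walk[OF k w]
    have "amult A (amult A (SL (la k m) (cm (res k m))) (U (res k m))) ?R =
        amult A (SL (la k m) (cm (res k m))) (amult A (amult A (U (res k m)) (U g)) (astar A (SL n (dm g))))"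
      using r v SL_closed[OF r(3)] by (simp add: mult_assoc)
    then show ?thesis using True r v unfolding eq U_SL[OF k w] by (simp add: U_mult tt_def)
  next
    case False
    \<comment> \<open>Inserting the source projection of \<open>U k\<close> makes the mismatch of
      vertices visible.\<close>
    have "amult A (U k) (SL m (cm g)) = amult A (amult A (U k) (P (dm k))) (SL m (cm g))"
      using k by (simp add: U_P)
    also have "\<dots> = azero A"
      using P_SL[OF v(5), of "dm k"] False k v by (simp add: mult_assoc)
    finally show ?thesis using False R unfolding eq by simp
  qed
qed

lemma lstep_eval:
  assumes "fst l \<in> gens" "valid \<tau>"
  shows "amult A (letter_eval A \<eta> l) (tt \<tau>) = opt_eval (lstep l \<tau>)"
proof (cases "(l, \<tau>)" rule: lstep.cases)
  case (1 h b m g n)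
  have k: "(if b then ginv G h else h) \<in> arr G" using 1 assms(1) by (auto simp: gens_def)
  have "letter_eval A \<eta> l = U (if b then ginv G h else h)"
    using 1 assms(1) by (auto simp: letter_eval_def gens_def U_inv)
  then show ?thesis using lstep_U[OF k] assms(2) 1 by (simp add: opt_eval_def Let_def)
next
  case (2 v b m g n)
  have v: "v \<in> verts E" using 2 assms(1) by (auto simp: gens_def)
  have "letter_eval A \<eta> l = U (gunit G v)"
    using 2 v by (auto simp: letter_eval_def P_unit U_inv)
  moreover have "la (gunit G v) m = m" "gmult G (res (gunit G v) m) g = g" if "v = top_vertex (m, g, n)"
    using la_unit[OF v, of m "cm g"] valid_top_vertex[of m g n] assms(2) 2 that valid_closed(1)
    by auto
  ultimately show ?thesis using lstep_U[of "gunit G v" m g n] v assms(2) 2 by (auto simp: opt_eval_def)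
next
  case (3 e m g n)
  have e: "e \<in> arcs E" using 3 assms(1) by (auto simp: gens_def)
  have val: "valid (m, g, n)" using assms(2) 3 by simp
  note v = valid_closed[OF val] valid_top_vertex[OF val]
  have "amult A (S e) (tt (m, g, n)) = amult A (S e) (amult A (P (tail E e)) (tt (m, g, n)))"
    using e v by (simp add: mult_assoc[symmetric] S_P)
  also have "amult A (P (tail E e)) (tt (m, g, n)) =
      (if tail E e = top_vertex (m, g, n) then tt (m, g, n) else azero A)"
    using e v P_SL[OF v(5), of "tail E e"] by (simp add: tt_def mult_assoc[symmetric])
  finally have eq: "amult A (S e) (tt (m, g, n)) =
      amult A (S e) (if tail E e = top_vertex (m, g, n) then tt (m, g, n) else azero A)" .
  show ?thesis
  proof (cases "tail E e = top_vertex (m, g, n)")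
    case True
    then show ?thesis using 3 e v by (simp add: letter_eval_def opt_eval_def tt_def mult_assoc)
  next
    case False
    then have "amult A (S e) (tt (m, g, n)) = azero A" using eq e by simp
    then show ?thesis using 3 False by (simp add: letter_eval_def opt_eval_def)
  qed
next
  case (4 e g n)
  have e: "e \<in> arcs E" using 4 assms(1) by (auto simp: gens_def)
  have val: "valid ([], g, n)" using assms(2) 4 by simp
  note v = valid_closed[OF val]
  have t: "tt ([], g, n) = amult A (U g) (astar A (SL n (dm g)))"
    using v by (simp add: tt_def mult_assoc[symmetric] P_U)
  \<comment> \<open>Written as the adjoint of \<open>U (ginv G g)\<close> times \<open>S e\<close>,
    the product can be treated by \<open>U_S\<close>: the edge moves through the inverse of
    \<open>g\<close>, and its image ends up at the end of \<open>n\<close>.\<close>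
  have SU: "amult A (astar A (S e)) (U g) = astar A (amult A (U (ginv G g)) (S e))"
    using e v U_inv[of "ginv G g"] by (simp add: star_mult)
  show ?thesis
  proof (cases "head E e = cm g")
    case True
    let ?k = "er (ginv G g) e" and ?f = "ae (ginv G g) e"
    have f: "?k \<in> arr G" "?f \<in> arcs E" "head E ?f = dm g" "cm ?k = tail E ?f" "dm ?k = tail E e"
      using v e True by simp_all
    obtain u where n: "walk E u n (dm g)" using val by (auto simp: valid_def)
    have "astar A (amult A (U (ginv G g)) (S e)) = amult A (U (ginv G ?k)) (astar A (S ?f))"
      using U_S[of "ginv G g" e] v e True f by (simp add: star_mult U_inv)
    then have "amult A (astar A (S e)) (tt ([], g, n)) =
        amult A (U (ginv G ?k)) (amult A (astar A (S ?f)) (astar A (SL n (dm g))))"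
      using e v f unfolding t by (simp add: mult_assoc[symmetric] SU)
    also have "amult A (astar A (S ?f)) (astar A (SL n (dm g))) = astar A (SL (n @ [?f]) (tail E ?f))"
      using SL_append[OF n, of "[?f]" "tail E ?f"] f v by (simp add: star_mult S_P)
    finally have "amult A (astar A (S e)) (tt ([], g, n)) =
       amult A (U (ginv G ?k)) (astar A (SL (n @ [?f]) (tail E ?f)))" .
    moreover have "SL (n @ [?f]) (tail E ?f) \<in> carrier A"
      using n f by (intro SL_closed[of u]) (auto simp: walk_append)
    ultimately show ?thesis using 4 True f v e
      by (simp add: letter_eval_def opt_eval_def tt_def mult_assoc[symmetric] P_U)
  next
    case False
    have "amult A (U (ginv G g)) (S e) = amult A (amult A (U (ginv G g)) (P (cm g))) (S e)"
      using v by (simp add: U_P)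
    also have "\<dots> = azero A" using False v e by (simp add: mult_assoc P_S_if)
    finally have "amult A (astar A (S e)) (tt ([], g, n)) = azero A"
      using e v unfolding t by (simp add: mult_assoc[symmetric] SU)
    then show ?thesis using 4 False by (simp add: letter_eval_def opt_eval_def)
  qed
next
  case (5 e f m g n)
  have e: "e \<in> arcs E" using 5 assms(1) by (auto simp: gens_def)
  have val: "valid (f # m, g, n)" using assms(2) 5 by simp
  then have f: "f \<in> arcs E" and val': "valid (m, g, n)" by (auto simp: valid_def)
  note v = valid_closed[OF val'] valid_top_vertex[OF val']
  have "top_vertex (m, g, n) = tail E f"
    using val by (cases m) (auto simp: valid_def top_vertex_def)
  then have tf: "amult A (P (tail E f)) (SL m (cm g)) = SL m (cm g)"
    using P_SL[OF v(5)] v f by simp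
  have "amult A (astar A (S e)) (tt (f # m, g, n)) = amult A (amult A (astar A (S e)) (S f)) (tt (m, g, n))"
    using e f v by (simp add: tt_def mult_assoc)
  then show ?thesis using 5 e f v tf
    by (simp add: letter_eval_def opt_eval_def S_S) (simp add: tt_def mult_assoc[symmetric])
qed

lemma red_eval:
  assumes "w \<in> words_on gens"
  shows "ev w = opt_eval (red w)" "\<And>\<tau>. red w = Some \<tau> \<Longrightarrow> valid \<tau>"
proof -
  have "ev w = opt_eval (red w) \<and> (\<forall>\<tau>. red w = Some \<tau> \<longrightarrow> valid \<tau>)"
    using assms
  proof (induction w rule: red.induct)
    case (2 l)
    then show ?case using letter_triple_valid letter_triple_eval
      by (auto simp: words_on_def opt_eval_def)
  next
    case (3 l k w)
    then have w: "k # w \<in> words_on gens" and l: "fst l \<in> gens" by (auto simp: words_on_def)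
    note IH = 3(1)[OF w]
    show ?case
    proof (cases "red (k # w)")
      case None
      then show ?thesis using IH letter_closed[OF l] by (simp add: opt_eval_def)
    next
      case (Some \<tau>)
      then have "valid \<tau>" using IH by blast
      then have "ev (l # k # w) = opt_eval (lstep l \<tau>)"
        using IH Some lstep_eval[OF l] by (simp add: opt_eval_def)
      moreover have "\<forall>\<tau>'. lstep l \<tau> = Some \<tau>' \<longrightarrow> valid \<tau>'"
        using lstep_valid[OF l \<open>valid \<tau>\<close>] by blast
      ultimately show ?thesis using Some by simp
    qed
  qed (simp add: words_on_def)
  then show "ev w = opt_eval (red w)" "\<And>\<tau>. red w = Some \<tau> \<Longrightarrow> valid \<tau>" by auto
qed

end

section \<open>The groupoid of germs\<close>

lemma subsequence_split: "n \<le> l \<Longrightarrow> l \<le> l' \<Longrightarrow> subsequence y n l' = subsequence y n l @ subsequence y l l'"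
  by (rule nth_equalityI) (auto simp: subsequence_def nth_append add.commute)

lemma prefix_0 [simp]: "prefix 0 x = []"
  by (simp add: subsequence_def)

context finite_self_similar_action
begin

abbreviation "gt \<equiv> germ_tuples E G act"
abbreviation "gr \<equiv> germ_rel E G act"
abbreviation "gm \<equiv> germ E G act"
abbreviation "\<Gamma> \<equiv> germ_groupoid E G act"

lemma gt_iff:
  "(x, m, g, n, y) \<in> gt \<longleftrightarrow> x \<in> IP \<and> y \<in> IP \<and> g \<in> arr G \<and> dm g = ir (suffix n y) \<and>
     suffix m x = ia g (suffix n y)"
  unfolding germ_tuples_def using act_inf_eq by auto

lemma gr_iff:
  "((x, m, g, n, y), (w, p, h, q, z)) \<in> gr \<longleftrightarrow>
     (x, m, g, n, y) \<in> gt \<and> (w, p, h, q, z) \<in> gt \<and> x = w \<and> y = z \<and>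
     int m - int n = int p - int q \<and>
     (\<exists>l\<ge>max n q. res g (subsequence y n l) = res h (subsequence y q l))"
  unfolding germ_rel_def by (auto simp: path_restrict_def segment_def res_def)

lemma res_subsequence_later:
  assumes "res g (subsequence y n l) = res h (subsequence y q l)" "max n q \<le> l" "l \<le> l'"
  shows "res g (subsequence y n l') = res h (subsequence y q l')"
  using assms subsequence_split[of n l l' y] subsequence_split[of q l l' y]
  by (simp add: res_append)

lemma gr_equiv: "equiv gt gr"
proof (rule equivI)
  show "gr \<subseteq> gt \<times> gt" unfolding germ_rel_def by auto
  show "refl_on gt gr" by (auto simp: refl_on_def gr_iff split_paired_all)
  show "sym gr"
  proof (rule symI)
    fix s t :: "('e, 'g) germ_tuple" assume "(s, t) \<in> gr"
    moreover obtain x m g n y where s: "s = (x, m, g, n, y)" by (cases s)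
    ultimately obtain p h q where t: "t = (x, p, h, q, y)" by (cases t) (auto simp: gr_iff)
    obtain l where "l \<ge> max n q" "res g (subsequence y n l) = res h (subsequence y q l)"
      using \<open>(s, t) \<in> gr\<close> unfolding s t gr_iff by blast
    then show "(t, s) \<in> gr"
      using \<open>(s, t) \<in> gr\<close> unfolding s t gr_iff by (auto intro!: exI[of _ l])
  qed
  show "trans gr"
  proof (rule transI)
    fix s t u :: "('e, 'g) germ_tuple" assume st: "(s, t) \<in> gr" and tu: "(t, u) \<in> gr"
    obtain x m g n y where s: "s = (x, m, g, n, y)" by (cases s)
    obtain p h q where t: "t = (x, p, h, q, y)" using st s by (cases t) (auto simp: gr_iff)
    obtain a k b where u: "u = (x, a, k, b, y)" using tu t by (cases u) (auto simp: gr_iff)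
    obtain l where l: "l \<ge> max n q" "res g (subsequence y n l) = res h (subsequence y q l)"
      using st s t by (auto simp: gr_iff)
    obtain l' where l': "l' \<ge> max q b" "res h (subsequence y q l') = res k (subsequence y b l')"
      using tu t u by (auto simp: gr_iff)
    have "res g (subsequence y n (max l l')) = res k (subsequence y b (max l l'))"
      using res_subsequence_later[OF l(2), of "max l l'"] res_subsequence_later[OF l'(2), of "max l l'"] l l'
      by simp
    then show "(s, u) \<in> gr"
      using st tu l l' unfolding s t u gr_iff by (auto intro!: exI[of _ "max l l'"])
  qed
qed

lemma gm_eq_iff: "s \<in> gt \<Longrightarrow> t \<in> gt \<Longrightarrow> gm s = gm t \<longleftrightarrow> (s, t) \<in> gr"
  unfolding germ_def using eq_equiv_class_iff[OF gr_equiv] by simp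

lemma mem_gm: "t \<in> gm s \<longleftrightarrow> (s, t) \<in> gr"
  by (simp add: germ_def)

lemma self_mem_gm: "s \<in> gt \<Longrightarrow> s \<in> gm s"
  using equiv_class_self[OF gr_equiv] by (simp add: germ_def)

lemma arr_\<Gamma>: "arr \<Gamma> = gm ` gt"
  unfolding germ_groupoid_def quotient_def germ_def by auto

lemma obj_\<Gamma> [simp]: "obj \<Gamma> = IP"
  by (simp add: germ_groupoid_def)

subsection \<open>Germs of the partial homeomorphism \<open>n z \<mapsto> m (g \<cdot> z)\<close>\<close>

definition vp :: "'e list \<Rightarrow> 'g \<Rightarrow> 'e list \<Rightarrow> 'e word \<Rightarrow> bool" where
  "vp m g n z \<longleftrightarrow> valid (m, g, n) \<and> z \<in> IP \<and> ir z = dm g"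

text \<open>Germs given by two lists, a groupoid element and the tail \<open>z\<close> of the
  source: under \<open>vp\<close> the tuple condition is automatic, and computing with germs becomes
  computing with lists.\<close>

definition arrow :: "'e list \<Rightarrow> 'g \<Rightarrow> 'e list \<Rightarrow> 'e word \<Rightarrow> ('e, 'g) germ_tuple set" where
  "arrow m g n z = gm (m \<frown> ia g z, length m, g, length n, n \<frown> z)"

lemma vpD:
  assumes "vp m g n z"
  shows "g \<in> arr G" "z \<in> IP" "ir z = dm g" "n \<frown> z \<in> IP" "m \<frown> ia g z \<in> IP"
    "ia g z \<in> IP" "ir (ia g z) = cm g"
    "\<exists>v. walk E v m (cm g)" "\<exists>v. walk E v n (dm g)"
proof -
  show *: "g \<in> arr G" "z \<in> IP" "ir z = dm g" "\<exists>v. walk E v m (cm g)" "\<exists>v. walk E v n (dm g)"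
    using assms by (auto simp: vp_def valid_def)
  then show **: "ia g z \<in> IP" "ir (ia g z) = cm g" by simp_all
  show "n \<frown> z \<in> IP" "m \<frown> ia g z \<in> IP" using * ** by (metis conc_IP)+
qed

lemma vp_gt: "vp m g n z \<Longrightarrow> (m \<frown> ia g z, length m, g, length n, n \<frown> z) \<in> gt"
  using vpD[of m g n z] by (simp add: gt_iff)

lemma arrow_arr [simp]: "vp m g n z \<Longrightarrow> arrow m g n z \<in> arr \<Gamma>"
  using vp_gt by (auto simp: arrow_def arr_\<Gamma>)

lemma gt_arrow:
  assumes "(x, m, g, n, y) \<in> gt"
  shows "vp (prefix m x) g (prefix n y) (suffix n y)"
    "gm (x, m, g, n, y) = arrow (prefix m x) g (prefix n y) (suffix n y)"
proof -
  note t = assms[unfolded gt_iff]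
  have "ir (suffix m x) = cm g" using t by simp
  then show "vp (prefix m x) g (prefix n y) (suffix n y)"
    using t walk_prefix[of x m] walk_prefix[of y n] by (auto simp: vp_def valid_def)
  have "prefix m x \<frown> ia g (suffix n y) = x" using t prefix_suffix by metis
  then show "gm (x, m, g, n, y) = arrow (prefix m x) g (prefix n y) (suffix n y)"
    by (simp add: arrow_def prefix_suffix)
qed

lemma arr_cases:
  assumes "\<gamma> \<in> arr \<Gamma>"
  obtains m g n z where "vp m g n z" "\<gamma> = arrow m g n z"
proof -
  obtain x m g n y where "(x, m, g, n, y) \<in> gt" "\<gamma> = gm (x, m, g, n, y)"
    using assms by (auto simp: arr_\<Gamma>)
  then show ?thesis using that gt_arrow by blast
qed

lemma subsequence_conc: "length n \<le> l \<Longrightarrow> subsequence (n \<frown> z) (length n) l = prefix (l - length n) z"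
  by (rule nth_equalityI) (auto simp: subsequence_def)

lemma arrow_eq_iff:
  assumes "vp m g n z" "vp m' g' n' z'"
  shows "arrow m g n z = arrow m' g' n' z' \<longleftrightarrow> m \<frown> ia g z = m' \<frown> ia g' z' \<and> n \<frown> z = n' \<frown> z' \<and>
    int (length m) - int (length n) = int (length m') - int (length n') \<and>
    (\<exists>l\<ge>max (length n) (length n'). res g (prefix (l - length n) z) = res g' (prefix (l - length n') z'))"
proof -
  have "(\<exists>l\<ge>max (length n) (length n').
      res g (subsequence (n \<frown> z) (length n) l) = res g' (subsequence (n \<frown> z) (length n') l)) \<longleftrightarrow>
    (\<exists>l\<ge>max (length n) (length n'). res g (prefix (l - length n) z) = res g' (prefix (l - length n') z'))"
    if "n \<frown> z = n' \<frown> z'"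
    using subsequence_conc[of n _ z] subsequence_conc[of n' _ z'] that by auto
  then show ?thesis
    unfolding arrow_def gm_eq_iff[OF vp_gt[OF assms(1)] vp_gt[OF assms(2)]] gr_iff
    using vp_gt[OF assms(1)] vp_gt[OF assms(2)] by auto
qed

lemma vp_raise:
  assumes "vp m g n (k \<frown> w)"
  shows "vp (m @ la g k) (res g k) (n @ k) w"
proof -
  note v = vpD[OF assms]
  have k: "walk E (dm g) k (ir w)" and w: "w \<in> IP"
    using conc_IP_walk[OF v(2)] v(3) conc_IP_suffix[OF v(2)] by auto
  note r = res_walk[OF v(1) k]
  show ?thesis using v(8,9) r k w unfolding vp_def valid_def by (auto simp: walk_append)
qed

text \<open>Moving an initial piece \<open>k\<close> of the tail into the lists and restricting
  \<open>g\<close> along it does not change the germ, so every germ has representatives with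
  arbitrarily long lists.\<close>

lemma arrow_raise:
  assumes "vp m g n (k \<frown> w)"
  shows "arrow m g n (k \<frown> w) = arrow (m @ la g k) (res g k) (n @ k) w"
proof -
  have "res g (prefix (length (n @ k) - length n) (k \<frown> w)) = res (res g k) (prefix (length (n @ k) - length (n @ k)) w)"
    by simp
  then show ?thesis
    unfolding arrow_eq_iff[OF assms vp_raise[OF assms]] ia_conc
    by (auto intro!: exI[of _ "length (n @ k)"])
qed

text \<open>Representatives of one germ become literally equal triples after raising both. The cut
  is made at the index \<open>l\<close> of the germ relation; the equal differences of lengths make
  the lists on both sides equally long.\<close>

lemma arrow_eqD:
  assumes "vp m g n z" "vp m' g' n' z'" "arrow m g n z = arrow m' g' n' z'"
  shows "\<exists>k k' w. z = k \<frown> w \<and> z' = k' \<frown> w \<and> n @ k = n' @ k' \<and>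
    m @ la g k = m' @ la g' k' \<and> res g k = res g' k'"
proof -
  from assms(3) obtain l where l: "l \<ge> max (length n) (length n')"
    and rs: "res g (prefix (l - length n) z) = res g' (prefix (l - length n') z')"
    and x: "m \<frown> ia g z = m' \<frown> ia g' z'" and y: "n \<frown> z = n' \<frown> z'"
    and len: "int (length m) - int (length n) = int (length m') - int (length n')"
    unfolding arrow_eq_iff[OF assms(1,2)] by blast
  let ?k = "prefix (l - length n) z" and ?k' = "prefix (l - length n') z'"
  have z: "z = ?k \<frown> suffix (l - length n) z" "z' = ?k' \<frown> suffix (l - length n') z'"
    by (simp_all only: prefix_suffix)
  have "(n @ ?k) \<frown> suffix (l - length n) z = (n' @ ?k') \<frown> suffix (l - length n') z'"
    using y z by (metis conc_conc)
  moreover have "length (n @ ?k) = length (n' @ ?k')" using l by simp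
  ultimately have nk: "n @ ?k = n' @ ?k'" "suffix (l - length n) z = suffix (l - length n') z'"
    by (rule conc_eq_length)+
  have "(m @ la g ?k) \<frown> ia (res g ?k) (suffix (l - length n) z) =
      (m' @ la g' ?k') \<frown> ia (res g' ?k') (suffix (l - length n') z')"
    using x z ia_conc by (metis conc_conc)
  moreover have "length (m @ la g ?k) = length (m' @ la g' ?k')" using l len by simp
  ultimately have "m @ la g ?k = m' @ la g' ?k'" by (rule conc_eq_length)
  then show ?thesis using z nk rs by metis
qed

subsection \<open>The groupoid structure\<close>

lemma
  assumes "t \<in> gt"
  shows gdom_gm: "gdom \<Gamma> (gm t) = snd (snd (snd (snd t)))" and gcod_gm: "gcod \<Gamma> (gm t) = fst t"
proof -
  obtain x m g n y where t: "t = (x, m, g, n, y)" by (cases t)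
  have "(\<lambda>(x, m, g, n, y). y) ` gm t = (\<lambda>_. y) ` gm t" "(\<lambda>(x, m, g, n, y). x) ` gm t = (\<lambda>_. x) ` gm t"
    by (intro image_cong; auto simp: t mem_gm gr_iff)+
  then have "(\<lambda>(x, m, g, n, y). y) ` gm t = {y}" "(\<lambda>(x, m, g, n, y). x) ` gm t = {x}"
    using self_mem_gm[OF assms] by (simp_all only: image_constant)
  then show "gdom \<Gamma> (gm t) = snd (snd (snd (snd t)))" "gcod \<Gamma> (gm t) = fst t"
    by (simp_all add: germ_groupoid_def t)
qed

lemma gdom_arrow [simp]: "vp m g n z \<Longrightarrow> gdom \<Gamma> (arrow m g n z) = n \<frown> z"
  and gcod_arrow [simp]: "vp m g n z \<Longrightarrow> gcod \<Gamma> (arrow m g n z) = m \<frown> ia g z"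
  using vp_gt[of m g n z] by (simp_all add: arrow_def gdom_gm gcod_gm)

lemma gt_subsequence:
  assumes "(x, m, g, n, y) \<in> gt" "n \<le> l"
  shows "la g (subsequence y n l) = subsequence x m (m + (l - n))"
    "walk E (dm g) (subsequence y n l) (ir (suffix l y))"
proof -
  note t = assms(1)[unfolded gt_iff]
  show "la g (subsequence y n l) = subsequence x m (m + (l - n))"
  proof -
    have "subsequence x m (m + (l - n)) = prefix (l - n) (suffix m x)"
      using subsequence_suffix[of m "m + (l - n)" x] by (simp only: le_add1 diff_add_inverse)
    also have "\<dots> = la g (prefix (l - n) (suffix n y))"
      using t by (simp only: ia_prefix)
    finally show ?thesis by (simp only: subsequence_suffix[OF assms(2)])
  qed
  show "walk E (dm g) (subsequence y n l) (ir (suffix l y))"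
    using t assms(2) walk_prefix[of "suffix n y" "l - n"] by simp
qed

lemma ginv_cong:
  assumes "((x, m, g, n, y), (x', m', g', n', y')) \<in> gr"
  shows "((y, n, ginv G g, m, x), (y', n', ginv G g', m', x')) \<in> gr"
proof -
  from assms have t: "(x, m, g, n, y) \<in> gt" "(x, m', g', n', y) \<in> gt" and eq: "x' = x" "y' = y"
    and len: "int m - int n = int m' - int n'" by (auto simp: gr_iff)
  from assms obtain l where l: "l \<ge> max n n'" "res g (subsequence y n l) = res g' (subsequence y n' l)"
    by (auto simp: gr_iff)
  \<comment> \<open>The position in \<open>x\<close> that corresponds to position \<open>l\<close>
    in \<open>y\<close>. It is the same for both tuples because their length differences
    agree.\<close>
  let ?l = "m + (l - n)"
  have l2: "?l = m' + (l - n')" using len l by linarith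
  have gt: "(y, n, ginv G g, m, x) \<in> gt" if "(x, m, g, n, y) \<in> gt" for m g n
    using that ia_inv[of g "suffix n y"] by (auto simp: gt_iff)
  have r: "res (ginv G g) (subsequence x m (m + (l - n))) = ginv G (res g (subsequence y n l))"
    if "(x, m, g, n, y) \<in> gt" "n \<le> l" for m g n
    using gt_subsequence[OF that] la_inv[of g] that by (metis gt_iff)
  have "res (ginv G g) (subsequence x m ?l) = res (ginv G g') (subsequence x m' ?l)"
    using r[OF t(1)] r[OF t(2)] l l2 by simp
  then show ?thesis using gt[OF t(1)] gt[OF t(2)] len l l2 unfolding eq gr_iff
    by (auto intro!: exI[of _ ?l])
qed

lemma ginv_gm:
  assumes "(x, m, g, n, y) \<in> gt"
  shows "ginv \<Gamma> (gm (x, m, g, n, y)) = gm (y, n, ginv G g, m, x)" "(y, n, ginv G g, m, x) \<in> gt"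
proof -
  let ?f = "\<lambda>(x, m, g, n, y). gm (y, n, ginv G g, m, x)"
  have "?f t = gm (y, n, ginv G g, m, x)" if "t \<in> gm (x, m, g, n, y)" for t
  proof -
    obtain x' m' g' n' y' where t: "t = (x', m', g', n', y')" by (cases t)
    have "((y, n, ginv G g, m, x), (y', n', ginv G g', m', x')) \<in> gr"
      using that ginv_cong unfolding t mem_gm by blast
    then show ?thesis unfolding t using equiv_class_eq[OF gr_equiv] by (simp add: germ_def)
  qed
  then have "(\<Union>t\<in>gm (x, m, g, n, y). ?f t) = gm (y, n, ginv G g, m, x)"
    using self_mem_gm[OF assms] by blast
  then show "ginv \<Gamma> (gm (x, m, g, n, y)) = gm (y, n, ginv G g, m, x)"
    by (simp add: germ_groupoid_def)
  show "(y, n, ginv G g, m, x) \<in> gt"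
    using assms ia_inv[of g "suffix n y"] by (auto simp: gt_iff)
qed

lemma vp_inv:
  assumes "vp m g n z"
  shows "vp n (ginv G g) m (ia g z)"
  using vpD[OF assms] by (simp add: vp_def valid_def)

lemma ginv_arrow [simp]:
  assumes "vp m g n z"
  shows "ginv \<Gamma> (arrow m g n z) = arrow n (ginv G g) m (ia g z)"
  using ginv_gm(1)[OF vp_gt[OF assms]] vpD[OF assms] ia_inv[of g z] by (simp add: arrow_def)

definition mult_tuple :: "('e, 'g) germ_tuple \<Rightarrow> ('e, 'g) germ_tuple \<Rightarrow> ('e, 'g) germ_tuple" where
  "mult_tuple = (\<lambda>(x, m, g, n, y) (y', p, h, q, z). (x, m + p,
     gmult G (res g (subsequence y n (n + p))) (res h (subsequence z q (q + n))), n + q, z))"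

text \<open>The second part reads off the product at level \<open>L\<close> of \<open>z\<close> from
  the factors alone; \<open>p + (L - q)\<close> is the corresponding level of \<open>y\<close>. Seen
  from there, the restrictions built into the product have disappeared, which yields
  \<open>mult_cong\<close>.\<close>

lemma mult_tuple:
  assumes t: "(x, m, g, n, y) \<in> gt" and u: "(y, p, h, q, z) \<in> gt"
  shows "mult_tuple (x, m, g, n, y) (y, p, h, q, z) \<in> gt"
    "n + q \<le> L \<Longrightarrow> res (gmult G (res g (subsequence y n (n + p))) (res h (subsequence z q (q + n))))
      (subsequence z (n + q) L) =
     gmult G (res g (subsequence y n (p + (L - q)))) (res h (subsequence z q L))"
proof -
  note t' = t[unfolded gt_iff] and u' = u[unfolded gt_iff]
  let ?g = "res g (subsequence y n (n + p))" and ?h = "res h (subsequence z q (q + n))"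
  have g: "?g \<in> arr G" "dm ?g = ir (suffix (n + p) y)"
    using res_walk[of g "subsequence y n (n + p)"] gt_subsequence[OF t, of "n + p"] t' by auto
  have h: "?h \<in> arr G" "dm ?h = ir (suffix (q + n) z)" "cm ?h = dm ?g"
  proof -
    have hw: "walk E (dm h) (subsequence z q (q + n)) (ir (suffix (q + n) z))"
      using gt_subsequence[OF u, of "q + n"] by simp
    show "?h \<in> arr G" "dm ?h = ir (suffix (q + n) z)" using res_walk[OF _ hw] u' by auto
    have "suffix n (suffix p y) = ia ?h (suffix n (suffix q z))"
      using ia_suffix[of n h "suffix q z"] u' by simp
    then have "suffix (p + n) y = ia ?h (suffix (q + n) z)" by (simp add: add.commute)
    then have "ir (suffix (p + n) y) = cm ?h"
      using \<open>?h \<in> arr G\<close> \<open>dm ?h = ir (suffix (q + n) z)\<close> u' by simp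
    then show "cm ?h = dm ?g" using g by (simp add: add.commute)
  qed
  have "suffix n (suffix p y) = ia ?h (suffix n (suffix q z))"
    using ia_suffix[of n h "suffix q z"] u' by simp
  then have y: "suffix (n + p) y = ia ?h (suffix (q + n) z)" by (simp add: add.commute)
  have "suffix p (suffix m x) = ia ?g (suffix p (suffix n y))"
    using ia_suffix[of p g "suffix n y"] t' by simp
  then have x: "suffix (m + p) x = ia ?g (suffix (n + p) y)" by simp
  show "mult_tuple (x, m, g, n, y) (y, p, h, q, z) \<in> gt"
    using t' u' g h x y ia_mult[OF g(1) h(1) h(3)[symmetric], of "suffix (n + q) z"]
    by (simp add: mult_tuple_def gt_iff add.commute)
  assume L: "n + q \<le> L"
  have w: "walk E (dm ?h) (subsequence z (n + q) L) (ir (suffix L z))"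
    using walk_prefix[of "suffix (n + q) z" "L - (n + q)"] u' L h
    by (simp add: add.commute)
  have "la h (subsequence z q L) = subsequence y p (p + (L - q))"
    using gt_subsequence[OF u] L by simp
  moreover have "subsequence z q L = subsequence z q (q + n) @ subsequence z (q + n) L"
    using L by (intro subsequence_split) auto
  moreover have "subsequence y p (p + (L - q)) = subsequence y p (p + n) @ subsequence y (p + n) (p + (L - q))"
    using L by (intro subsequence_split) auto
  moreover have "la h (subsequence z q (q + n)) = subsequence y p (p + n)"
    using gt_subsequence[OF u, of "q + n"] by simp
  ultimately have la: "la ?h (subsequence z (n + q) L) = subsequence y (n + p) (p + (L - q))"
    by (simp add: la_append add.commute)
  have "res (gmult G ?g ?h) (subsequence z (n + q) L) =
      gmult G (res ?g (la ?h (subsequence z (n + q) L))) (res ?h (subsequence z (n + q) L))"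
    by (rule la_mult(2)[OF g(1) h(1) h(3)[symmetric] w])
  also have "res ?h (subsequence z (n + q) L) = res h (subsequence z q L)"
    using subsequence_split[of q "q + n" L z] L by (simp add: res_append add.commute)
  also have "res ?g (la ?h (subsequence z (n + q) L)) = res g (subsequence y n (p + (L - q)))"
    unfolding la using subsequence_split[of n "n + p" "p + (L - q)" y] L by (simp add: res_append)
  finally show "res (gmult G ?g ?h) (subsequence z (n + q) L) =
     gmult G (res g (subsequence y n (p + (L - q)))) (res h (subsequence z q L))" .
qed

lemma mult_cong:
  assumes t: "((x, m, g, n, y), (x', m', g', n', y')) \<in> gr"
    and u: "((y, p, h, q, z), (y'', p', h', q', z')) \<in> gr"
  shows "(mult_tuple (x, m, g, n, y) (y, p, h, q, z), mult_tuple (x', m', g', n', y') (y'', p', h', q', z')) \<in> gr"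
proof -
  from t u have eq: "x' = x" "y' = y" "y'' = y" "z' = z"
    and gt: "(x, m, g, n, y) \<in> gt" "(x, m', g', n', y) \<in> gt" "(y, p, h, q, z) \<in> gt" "(y, p', h', q', z) \<in> gt"
    and len: "int m - int n = int m' - int n'" "int p - int q = int p' - int q'"
    by (auto simp: gr_iff)
  obtain l where l: "l \<ge> max n n'" "res g (subsequence y n l) = res g' (subsequence y n' l)"
    using t by (auto simp: gr_iff)
  obtain l' where l': "l' \<ge> max q q'" "res h (subsequence z q l') = res h' (subsequence z q' l')"
    using u by (auto simp: gr_iff)
  \<comment> \<open>Large enough for the germ relations of both factors to have taken effect and for
    both products to be restricted that far.\<close>
  define L where "L = l' + l + n + n' + q + q'"
  have L: "n + q \<le> L" "n' + q' \<le> L" "p + (L - q) = p' + (L - q')" "l \<le> p + (L - q)" "l' \<le> L"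
    using len by (auto simp: L_def)
  have "res g (subsequence y n (p + (L - q))) = res g' (subsequence y n' (p' + (L - q')))"
    using res_subsequence_later[OF l(2) l(1) L(4)] L(3) by simp
  moreover have "res h (subsequence z q L) = res h' (subsequence z q' L)"
    using res_subsequence_later[OF l'(2) l'(1) L(5)] .
  ultimately show ?thesis
    using mult_tuple(1)[OF gt(1,3)] mult_tuple(1)[OF gt(2,4)]
      mult_tuple(2)[OF gt(1,3) L(1)] mult_tuple(2)[OF gt(2,4) L(2)] len L(1,2)
    unfolding eq mult_tuple_def prod.case gr_iff by (auto intro!: exI[of _ L])
qed

lemma gmult_gm:
  assumes t: "(x, m, g, n, y) \<in> gt" and u: "(y, p, h, q, z) \<in> gt"
  shows "gmult \<Gamma> (gm (x, m, g, n, y)) (gm (y, p, h, q, z)) = gm (mult_tuple (x, m, g, n, y) (y, p, h, q, z))"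
proof -
  let ?t = "(x, m, g, n, y)" and ?u = "(y, p, h, q, z)"
  have c: "gm (mult_tuple t' u') = gm (mult_tuple ?t ?u)" if "t' \<in> gm ?t" "u' \<in> gm ?u" for t' u'
  proof -
    obtain x' m' g' n' y' where t': "t' = (x', m', g', n', y')" by (cases t')
    obtain y'' p' h' q' z' where u': "u' = (y'', p', h', q', z')" by (cases u')
    have "(mult_tuple ?t ?u, mult_tuple t' u') \<in> gr"
      using that unfolding t' u' mem_gm by (rule mult_cong)
    then show ?thesis using equiv_class_eq[OF gr_equiv] by (simp add: germ_def)
  qed
  have "gmult \<Gamma> (gm ?t) (gm ?u) = (\<Union>t'\<in>gm ?t. \<Union>u'\<in>gm ?u. gm (mult_tuple t' u'))"
    by (auto simp: germ_groupoid_def mult_tuple_def path_restrict_def segment_def res_def)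
  also have "\<dots> = gm (mult_tuple ?t ?u)"
    using c self_mem_gm[OF t] self_mem_gm[OF u] by blast
  finally show ?thesis .
qed

lemma vp_mult:
  assumes "vp m g n (ia h z)" "vp n h k z"
  shows "vp m (gmult G g h) k z" "dm g = cm h"
proof -
  note v = vpD[OF assms(1)] vpD[OF assms(2)]
  show dc: "dm g = cm h" using v by simp
  show "vp m (gmult G g h) k z" using v dc by (simp add: vp_def valid_def)
qed

text \<open>With equal middle lists the groupoid elements simply multiply. The general product first
  raises both factors; the two tuples become comparable at level
  \<open>length n + length k\<close>.\<close>

lemma gmult_arrow [simp]:
  assumes "vp m g n (ia h z)" "vp n h k z"
  shows "gmult \<Gamma> (arrow m g n (ia h z)) (arrow n h k z) = arrow m (gmult G g h) k z"
proof -
  let ?t = "(m \<frown> ia g (ia h z), length m, g, length n, n \<frown> ia h z)"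
  let ?u = "(n \<frown> ia h z, length n, h, length k, k \<frown> z)"
  note v = vpD[OF assms(1)] vpD[OF assms(2)]
  note vm = vp_mult[OF assms]
  note gt = vp_gt[OF assms(1)] vp_gt[OF assms(2)] vp_gt[OF vm(1)]
  let ?L = "length n + length k"
  have iam: "ia (gmult G g h) z = ia g (ia h z)"
    using v vm(2) by (intro ia_mult) auto
  have pre: "subsequence (k \<frown> z) (length k) ?L = prefix (length n) z"
    "subsequence (n \<frown> ia h z) (length n) (length n + (?L - length k)) = la h (prefix (length n) z)"
    using subsequence_conc[of k ?L z] subsequence_conc[of n "length n + length n" "ia h z"]
    by (simp_all add: ia_prefix)
  have w: "walk E (dm h) (prefix (length n) z) (ir (suffix (length n) z))"
    using walk_prefix[of z "length n"] v by simp
  have "(mult_tuple ?t ?u, (m \<frown> ia (gmult G g h) z, length m, gmult G g h, length k, k \<frown> z)) \<in> gr"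
    using mult_tuple(1)[OF gt(1,2)] gt(3) mult_tuple(2)[OF gt(1,2), of ?L] la_mult(2)[OF v(1) v(10) vm(2) w]
    unfolding mult_tuple_def prod.case gr_iff pre
    by (auto simp: iam pre intro!: exI[of _ ?L])
  then show ?thesis
    unfolding arrow_def gmult_gm[OF gt(1,2)]
    using equiv_class_eq[OF gr_equiv] by (simp add: germ_def)
qed

text \<open>Composable germs get a common middle list by raising the one whose list is shorter. If
  that is the right factor, it is raised along the piece of \<open>z\<close> that \<open>h\<close>
  maps to the missing edges.\<close>

lemma match2:
  assumes "\<alpha> \<in> arr \<Gamma>" "\<beta> \<in> arr \<Gamma>" "gdom \<Gamma> \<alpha> = gcod \<Gamma> \<beta>"
  obtains m g n h k z where "vp m g n (ia h z)" "vp n h k z" "\<alpha> = arrow m g n (ia h z)" "\<beta> = arrow n h k z"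
proof -
  obtain m g n y where a: "vp m g n y" "\<alpha> = arrow m g n y" using assms(1) by (rule arr_cases)
  obtain p h q z where b: "vp p h q z" "\<beta> = arrow p h q z" using assms(2) by (rule arr_cases)
  have eq: "n \<frown> y = p \<frown> ia h z" using assms(3) a b by simp
  show ?thesis
  proof (cases "length n \<le> length p")
    case True
    then obtain k where k: "p = n @ k" "y = k \<frown> ia h z" using conc_eq_le[OF eq] by blast
    then show ?thesis using that[of "m @ la g k" "res g k" p h z q] vp_raise[of m g n k] arrow_raise[of m g n k] a b
      by simp
  next
    case False
    then obtain k where k: "n = p @ k" "ia h z = k \<frown> y" using conc_eq_le[OF eq[symmetric]] by force
    define j w where "j = prefix (length k) z" and "w = suffix (length k) z"
    have z: "z = j \<frown> w" by (simp add: j_def w_def prefix_suffix)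
    have "la h j \<frown> ia (res h j) w = k \<frown> y" using k(2) unfolding z ia_conc .
    then have "la h j = k" "ia (res h j) w = y" by (rule conc_eq_length; simp add: j_def)+
    then show ?thesis using that[of m g n "res h j" w "q @ j"] vp_raise[of p h q j w] arrow_raise[of p h q j w]
        a b k by (simp add: z)
  qed
qed

text \<open>The last two factors are matched first; raising the middle one afterwards has to be
  carried through \<open>f\<close> to the last one as well.\<close>

lemma match3:
  assumes "\<alpha> \<in> arr \<Gamma>" "\<beta> \<in> arr \<Gamma>" "\<gamma> \<in> arr \<Gamma>" "gdom \<Gamma> \<alpha> = gcod \<Gamma> \<beta>" "gdom \<Gamma> \<beta> = gcod \<Gamma> \<gamma>"
  obtains m g n h k f j z where "vp m g n (ia h (ia f z))" "vp n h k (ia f z)" "vp k f j z"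
    "\<alpha> = arrow m g n (ia h (ia f z))" "\<beta> = arrow n h k (ia f z)" "\<gamma> = arrow k f j z"
proof -
  obtain m g n y where a: "vp m g n y" "\<alpha> = arrow m g n y" using assms(1) by (rule arr_cases)
  obtain p h k f j z where b: "vp p h k (ia f z)" "vp k f j z" "\<beta> = arrow p h k (ia f z)" "\<gamma> = arrow k f j z"
    by (rule match2[OF assms(2,3,5)])
  have eq: "n \<frown> y = p \<frown> ia h (ia f z)" using assms(4) a b by simp
  show ?thesis
  proof (cases "length n \<le> length p")
    case True
    then obtain l where l: "p = n @ l" "y = l \<frown> ia h (ia f z)" using conc_eq_le[OF eq] by blast
    then show ?thesis using that[of "m @ la g l" "res g l" p h f z k j]
        vp_raise[of m g n l] arrow_raise[of m g n l] a b by simp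
  next
    case False
    then obtain l where l: "n = p @ l" "ia h (ia f z) = l \<frown> y" using conc_eq_le[OF eq[symmetric]] by force
    define i w where "i = prefix (length l) z" and "w = suffix (length l) z"
    have z: "z = i \<frown> w" by (simp add: i_def w_def prefix_suffix)
    have fz: "ia f z = la f i \<frown> ia (res f i) w" unfolding z by (rule ia_conc)
    have "la h (la f i) \<frown> ia (res h (la f i)) (ia (res f i) w) = l \<frown> y"
      using l(2) unfolding fz ia_conc .
    then have "la h (la f i) = l" "ia (res h (la f i)) (ia (res f i) w) = y"
      by (rule conc_eq_length; simp add: i_def)+
    then show ?thesis
      using that[of m g n "res h (la f i)" "res f i" w "k @ la f i" "j @ i"] a b l
        vp_raise[of k f j i w] arrow_raise[of k f j i w]
        vp_raise[of p h k "la f i" "ia (res f i) w"] arrow_raise[of p h k "la f i" "ia (res f i) w"]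
      by (simp add: fz z[symmetric])
  qed
qed

lemma unit_arrow:
  assumes "x \<in> IP"
  shows "gunit \<Gamma> x = arrow [] (gunit G (ir x)) [] x" "vp [] (gunit G (ir x)) [] x"
  using assms by (simp_all add: germ_groupoid_def arrow_def vp_def valid_def ia_unit)

lemma unit_arrow_conc:
  assumes "n \<frown> z \<in> IP"
  shows "gunit \<Gamma> (n \<frown> z) = arrow n (gunit G (ir z)) n z" "vp n (gunit G (ir z)) n z"
proof -
  have w: "walk E (ir (n \<frown> z)) n (ir z)" using conc_IP_walk[OF assms] .
  note r = la_unit[OF ir_verts[OF assms] w]
  show "gunit \<Gamma> (n \<frown> z) = arrow n (gunit G (ir z)) n z" "vp n (gunit G (ir z)) n z"
    using unit_arrow[OF assms] arrow_raise[of "[]" "gunit G (ir (n \<frown> z))" "[]" n z]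
      vp_raise[of "[]" "gunit G (ir (n \<frown> z))" "[]" n z] by (simp_all add: r)
qed

text \<open>On representatives with matching lists each axiom becomes the corresponding axiom of
  \<open>G\<close>.\<close>

theorem germ_groupoid: "groupoid \<Gamma>"
proof (rule groupoid.intro)
  fix \<alpha> assume "\<alpha> \<in> arr \<Gamma>"
  then obtain m g n z where a: "vp m g n z" "\<alpha> = arrow m g n z" by (rule arr_cases)
  note v = vpD[OF a(1)]
  note i = vp_inv[OF a(1)]
  have zz: "ia (ginv G g) (ia g z) = z" using v by (simp add: ia_inv)
  show "gdom \<Gamma> \<alpha> \<in> obj \<Gamma>" "gcod \<Gamma> \<alpha> \<in> obj \<Gamma>" using a v by simp_all
  show "ginv \<Gamma> \<alpha> \<in> arr \<Gamma>" "gdom \<Gamma> (ginv \<Gamma> \<alpha>) = gcod \<Gamma> \<alpha>" "gcod \<Gamma> (ginv \<Gamma> \<alpha>) = gdom \<Gamma> \<alpha>"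
    using a i zz by simp_all
  note ud = unit_arrow_conc[OF v(4)] and uc = unit_arrow_conc[OF v(5)]
  show "gmult \<Gamma> \<alpha> (gunit \<Gamma> (gdom \<Gamma> \<alpha>)) = \<alpha>"
    using gmult_arrow[of m g n "gunit G (ir z)" z n] a ud v by (simp add: ia_unit')
  show "gmult \<Gamma> (gunit \<Gamma> (gcod \<Gamma> \<alpha>)) \<alpha> = \<alpha>"
    using gmult_arrow[of m "gunit G (ir (ia g z))" m g z n] a uc v by simp
  show "gmult \<Gamma> \<alpha> (ginv \<Gamma> \<alpha>) = gunit \<Gamma> (gcod \<Gamma> \<alpha>)"
    using gmult_arrow[of m g n "ginv G g" "ia g z" m] a i uc v by (simp add: zz)
  show "gmult \<Gamma> (ginv \<Gamma> \<alpha>) \<alpha> = gunit \<Gamma> (gdom \<Gamma> \<alpha>)"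
    using gmult_arrow[of n "ginv G g" m g z n] a i ud v by simp
next
  fix \<alpha> \<beta> assume ab: "\<alpha> \<in> arr \<Gamma>" "\<beta> \<in> arr \<Gamma>" "gdom \<Gamma> \<alpha> = gcod \<Gamma> \<beta>"
  then obtain m g n h k z where m: "vp m g n (ia h z)" "vp n h k z" "\<alpha> = arrow m g n (ia h z)" "\<beta> = arrow n h k z"
    by (rule match2)
  note v = vpD[OF m(1)] vpD[OF m(2)]
  show "gmult \<Gamma> \<alpha> \<beta> \<in> arr \<Gamma>" "gdom \<Gamma> (gmult \<Gamma> \<alpha> \<beta>) = gdom \<Gamma> \<beta>" "gcod \<Gamma> (gmult \<Gamma> \<alpha> \<beta>) = gcod \<Gamma> \<alpha>"
    using m vp_mult[OF m(1,2)] v by (simp_all add: ia_mult)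
next
  fix \<alpha> \<beta> \<gamma> assume "\<alpha> \<in> arr \<Gamma>" "\<beta> \<in> arr \<Gamma>" "\<gamma> \<in> arr \<Gamma>" "gdom \<Gamma> \<alpha> = gcod \<Gamma> \<beta>" "gdom \<Gamma> \<beta> = gcod \<Gamma> \<gamma>"
  then obtain m g n h k f j z where m: "vp m g n (ia h (ia f z))" "vp n h k (ia f z)" "vp k f j z"
    "\<alpha> = arrow m g n (ia h (ia f z))" "\<beta> = arrow n h k (ia f z)" "\<gamma> = arrow k f j z"
    by (rule match3)
  note v = vpD[OF m(1)] vpD[OF m(2)] vpD[OF m(3)]
  note m12 = vp_mult[OF m(1,2)] and m23 = vp_mult[OF m(2,3)]
  have iam: "ia (gmult G h f) z = ia h (ia f z)" by (rule ia_mult[OF v(10) v(19) m23(2) v(20) v(21)[symmetric]])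
  have "vp m g n (ia (gmult G h f) z)" using m(1) iam by simp
  then have "gmult \<Gamma> \<alpha> (gmult \<Gamma> \<beta> \<gamma>) = arrow m (gmult G g (gmult G h f)) j z"
    using gmult_arrow[OF _ m23(1), of m g] by (simp only: m(4-6) gmult_arrow[OF m(2,3)] iam)
  moreover have "gmult \<Gamma> (gmult \<Gamma> \<alpha> \<beta>) \<gamma> = arrow m (gmult G (gmult G g h) f) j z"
    by (simp only: m(4-6) gmult_arrow[OF m(1,2)] gmult_arrow[OF m12(1) m(3)])
  ultimately show "gmult \<Gamma> (gmult \<Gamma> \<alpha> \<beta>) \<gamma> = gmult \<Gamma> \<alpha> (gmult \<Gamma> \<beta> \<gamma>)"
    by (simp only: mult_assoc[OF v(1) v(10) v(19) m12(2) m23(2)])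
next
  fix x assume x: "x \<in> obj \<Gamma>"
  then show "gunit \<Gamma> x \<in> arr \<Gamma>" "gdom \<Gamma> (gunit \<Gamma> x) = x" "gcod \<Gamma> (gunit \<Gamma> x) = x"
    using unit_arrow[of x] by (simp_all add: ia_unit)
qed

end

section \<open>Compact open bisections\<close>

lemma prefix_mono: "prefix n x = prefix n y \<Longrightarrow> m \<le> n \<Longrightarrow> prefix m x = prefix m y"
  by (auto simp: subsequence_def)

lemma prefix_eq_D: "prefix n x = prefix n y \<Longrightarrow> i < n \<Longrightarrow> x i = y i"
  by (auto simp: subsequence_def)

lemma prefix_conc_take: "n \<le> length es \<Longrightarrow> prefix n (es \<frown> x) = take n es"
  by (rule nth_equalityI) (auto simp: subsequence_def)

lemma prefix_eq_conc: "prefix (length es) x = es \<longleftrightarrow> (\<exists>w. x = es \<frown> w)"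
  using prefix_suffix[of x "length es"] by (metis prefix_conc_length)

text \<open>Reduces a local statement about open sets to the generating sets, for properties that
  pass to finite intersections and to larger sets, such as containing a neighbourhood of a given
  kind.\<close>

lemma openin_generated_basis:
  assumes "openin (topology_generated_by S) W"
    and inter: "\<And>a b x. P a x \<Longrightarrow> P b x \<Longrightarrow> P (a \<inter> b) x"
    and mono: "\<And>a b x. P a x \<Longrightarrow> a \<subseteq> b \<Longrightarrow> P b x"
    and basis: "\<And>s x. s \<in> S \<Longrightarrow> x \<in> s \<Longrightarrow> P s x"
    and x: "x \<in> W"
  shows "P W x"
proof -
  have "generate_topology_on S W"
    using assms(1) by (simp add: openin_topology_generated_by_iff)
  then show ?thesis using x
  proof (induction arbitrary: x)
    case (Int a b)
    then show ?case using inter by simp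
  next
    case (UN K)
    then obtain k where "k \<in> K" "x \<in> k" by blast
    then show ?case using UN.IH[of k x] mono[of k x "\<Union>K"] by blast
  qed (simp_all add: basis)
qed

section \<open>The sets Z as a basis of compact open bisections\<close>

context finite_self_similar_action
begin

definition Zc :: "'e list \<times> 'g \<times> 'e list \<Rightarrow> ('e, 'g) germ_tuple set set" where
  "Zc = (\<lambda>(m, g, n). {arrow m g n z | z. z \<in> IP \<and> ir z = dm g})"

definition rz :: "'e list \<times> 'g \<times> 'e list \<Rightarrow> 'e list \<Rightarrow> 'e list \<times> 'g \<times> 'e list" where
  "rz = (\<lambda>(m, g, n) k. (m @ la g k, res g k, n @ k))"

lemma ZcE:
  assumes "\<gamma> \<in> Zc (m, g, n)" "valid (m, g, n)"
  obtains z where "vp m g n z" "\<gamma> = arrow m g n z"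
  using assms by (auto simp: Zc_def vp_def)

lemma ZcI: "vp m g n z \<Longrightarrow> arrow m g n z \<in> Zc (m, g, n)"
  by (auto simp: Zc_def vp_def)

lemma Zc_arr: "valid \<tau> \<Longrightarrow> Zc \<tau> \<subseteq> arr \<Gamma>"
  by (cases \<tau>) (auto elim!: ZcE)

lemma arr_Zc: "\<gamma> \<in> arr \<Gamma> \<Longrightarrow> \<exists>\<tau>. valid \<tau> \<and> \<gamma> \<in> Zc \<tau>"
  by (erule arr_cases) (metis ZcI vp_def)

lemma cylinder_germ:
  assumes "g \<in> arr G" "psource E \<nu> = dm g"
  shows "germ_cylinder E G act \<mu> g \<nu> = Zc (snd \<mu>, g, snd \<nu>)"
proof -
  have ai: "act_inf E act g y = ia g y" if "y \<in> IP" "ir y = dm g" for y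
    using act_inf_eq[OF assms(1) that(1)] that(2) by simp
  show ?thesis
    unfolding germ_cylinder_def Zc_def arrow_def plength_def assms(2) prod.case
    by (rule Collect_cong, rule ex_cong1) (auto simp: ai)
qed

lemma atop_\<Gamma>: "atop \<Gamma> = topology_generated_by (Zc ` Collect valid)"
proof -
  have "{germ_cylinder E G act \<mu> g \<nu> | \<mu> g \<nu>. \<mu> \<in> fpaths E \<and> \<nu> \<in> fpaths E \<and> g \<in> arr G \<and>
      psource E \<mu> = gcod G g \<and> psource E \<nu> = gdom G g} = Zc ` Collect valid" (is "?L = ?R")
  proof
    show "?L \<subseteq> ?R"
    proof
      fix W assume "W \<in> ?L"
      then obtain v m g u n where W: "W = germ_cylinder E G act (v, m) g (u, n)" "(v, m) \<in> fpaths E"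
          "(u, n) \<in> fpaths E" "g \<in> arr G" "psource E (v, m) = cm g" "psource E (u, n) = dm g" by auto
      then have "valid (m, g, n)" using fpaths_psource unfolding valid_def by fastforce
      then show "W \<in> ?R" using W cylinder_germ[of g "(u, n)" "(v, m)"] by auto
    qed
    show "?R \<subseteq> ?L"
    proof
      fix W assume "W \<in> ?R"
      then obtain m g n where val: "valid (m, g, n)" and W: "W = Zc (m, g, n)" by auto
      then obtain v u where g: "g \<in> arr G" and w: "walk E v m (cm g)" "walk E u n (dm g)"
        by (auto simp: valid_def)
      have "v \<in> verts E" "u \<in> verts E"
        using w g walk_start_verts cm_verts dm_verts by blast+
      then have "(v, m) \<in> fpaths E" "(u, n) \<in> fpaths E" using w by (auto simp: fpaths_iff)
      moreover have "psource E (v, m) = cm g" "psource E (u, n) = dm g" 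
        using psource_walk[OF w(1)] psource_walk[OF w(2)] by simp_all
      moreover have "W = germ_cylinder E G act (v, m) g (u, n)"
        using cylinder_germ[OF g, of "(u, n)" "(v, m)"] calculation W by simp
      ultimately show "W \<in> ?L" using g by blast
    qed
  qed
  then show ?thesis by (simp add: germ_groupoid_def)
qed

lemma topspace_atop [simp]: "topspace (atop \<Gamma>) = arr \<Gamma>"
  unfolding atop_\<Gamma> topology_generated_by_topspace using Zc_arr arr_Zc by auto

lemma openin_Zc: "valid \<tau> \<Longrightarrow> openin (atop \<Gamma>) (Zc \<tau>)"
  unfolding atop_\<Gamma> by (rule topology_generated_by_Basis) simp

text \<open>By \<open>arrow_eqD\<close> the two representatives coincide after raising along some
  \<open>k\<close>, and the same raising works for every tail that begins with \<open>k\<close>. The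
  condition on \<open>ir\<close> matters when \<open>k\<close> is empty, since an empty prefix does
  not fix the range.\<close>

lemma arrow_local:
  assumes a: "vp m g n z" and b: "valid (m', g', n')" "arrow m g n z \<in> Zc (m', g', n')"
  shows "\<exists>j. \<forall>z'\<in>IP. prefix j z' = prefix j z \<longrightarrow> ir z' = ir z \<longrightarrow> arrow m g n z' \<in> Zc (m', g', n')"
proof -
  obtain z'' where z'': "vp m' g' n' z''" "arrow m g n z = arrow m' g' n' z''"
    using b by (metis ZcE)
  then obtain k k' w where k: "z = k \<frown> w" "z'' = k' \<frown> w" "n @ k = n' @ k'"
    "m @ la g k = m' @ la g' k'" "res g k = res g' k'" using arrow_eqD[OF a] by blast
  note v = vpD[OF a] and v' = vpD[OF z''(1)]
  have "arrow m g n z' \<in> Zc (m', g', n')"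
    if z': "z' \<in> IP" "prefix (length k) z' = prefix (length k) z" "ir z' = ir z" for z'
  proof -
    obtain w' where w': "z' = k \<frown> w'" using z'(2) k(1) prefix_eq_conc[of z' k] by auto
    have w: "walk E (ir z) k (ir w)" "walk E (ir z') k (ir w')"
      using conc_IP_walk v(2) z'(1) k(1) w' by auto
    then have ww: "ir w' = ir w" "w' \<in> IP"
      using walk_end_unique z' w' conc_IP_suffix by metis+
    have "vp m g n (k \<frown> w')" using a z' w' v by (simp add: vp_def)
    moreover have "vp m' g' n' (k' \<frown> w')"
    proof -
      have "walk E (dm g') k' (ir w')" using conc_IP_walk[of k' w] v' k(2) ww by metis
      then show ?thesis using z''(1) ww ir_conc by (metis vp_def conc_IP)
    qed
    ultimately show ?thesis
      using arrow_raise[of m g n k w'] arrow_raise[of m' g' n' k' w'] k w' ZcI by metis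
  qed
  then show ?thesis by blast
qed

lemma open_local:
  assumes a: "vp m g n z" and "openin (atop \<Gamma>) W" "arrow m g n z \<in> W"
  shows "\<exists>j. \<forall>z'\<in>IP. prefix j z' = prefix j z \<longrightarrow> ir z' = ir z \<longrightarrow> arrow m g n z' \<in> W"
proof -
  let ?P = "\<lambda>W \<gamma>. \<gamma> = arrow m g n z \<longrightarrow>
    (\<exists>j. \<forall>z'\<in>IP. prefix j z' = prefix j z \<longrightarrow> ir z' = ir z \<longrightarrow> arrow m g n z' \<in> W)"
  have "?P W (arrow m g n z)"
  proof (rule openin_generated_basis[OF assms(2)[unfolded atop_\<Gamma>], of ?P "arrow m g n z"])
    fix A B \<gamma> assume P: "?P A \<gamma>" "?P B \<gamma>"
    show "?P (A \<inter> B) \<gamma>"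
    proof
      assume "\<gamma> = arrow m g n z"
      then obtain i j where
        i: "\<And>z'. z' \<in> IP \<Longrightarrow> prefix i z' = prefix i z \<Longrightarrow> ir z' = ir z \<Longrightarrow> arrow m g n z' \<in> A" and
        j: "\<And>z'. z' \<in> IP \<Longrightarrow> prefix j z' = prefix j z \<Longrightarrow> ir z' = ir z \<Longrightarrow> arrow m g n z' \<in> B"
        using P by metis
      have "arrow m g n z' \<in> A \<inter> B" if "z' \<in> IP" "prefix (max i j) z' = prefix (max i j) z" "ir z' = ir z" for z'
        using i[of z'] j[of z'] that prefix_mono[OF that(2), of i] prefix_mono[OF that(2), of j] by simp
      then show "\<exists>j. \<forall>z'\<in>IP. prefix j z' = prefix j z \<longrightarrow> ir z' = ir z \<longrightarrow> arrow m g n z' \<in> A \<inter> B" by blast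
    qed
  next
    fix A B \<gamma> assume "?P A \<gamma>" "A \<subseteq> B"
    then show "?P B \<gamma>" by blast
  next
    fix s \<gamma> assume "s \<in> Zc ` Collect valid" "\<gamma> \<in> s"
    then show "?P s \<gamma>" using arrow_local[OF a] by auto
  qed (use assms(3) in simp)
  then show ?thesis by simp
qed

lemma vp_valid: "vp m g n z \<Longrightarrow> valid (m, g, n)"
  by (simp add: vp_def)

lemma rz_valid:
  assumes "valid \<tau>" "walk E (gdom G (fst (snd \<tau>))) k w"
  shows "valid (rz \<tau> k)"
proof -
  obtain m g n where t: "\<tau> = (m, g, n)" by (cases \<tau>)
  have g: "g \<in> arr G" using assms t by (simp add: valid_def)
  have w: "walk E (dm g) k w" using assms t by simp
  show ?thesis using assms(1) res_walk[OF g w] w g unfolding t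
    by (auto simp: valid_def rz_def walk_append)
qed

lemma open_Zc:
  assumes a: "vp m g n z" and W: "openin (atop \<Gamma>) W" "arrow m g n z \<in> W"
  shows "\<exists>j. let \<tau> = rz (m, g, n) (prefix j z) in valid \<tau> \<and> arrow m g n z \<in> Zc \<tau> \<and> Zc \<tau> \<subseteq> W \<and>
    Zc \<tau> \<subseteq> Zc (m, g, n)"
proof -
  obtain j where j: "\<And>z'. z' \<in> IP \<Longrightarrow> prefix j z' = prefix j z \<Longrightarrow> ir z' = ir z \<Longrightarrow> arrow m g n z' \<in> W"
    using open_local[OF a W] by blast
  note v = vpD[OF a]
  let ?k = "prefix j z" and ?w = "suffix j z"
  have z: "z = ?k \<frown> ?w" by (simp add: prefix_suffix)
  have w: "walk E (dm g) ?k (ir ?w)" using walk_prefix[of z j] v by simp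
  have val: "valid (rz (m, g, n) ?k)" using rz_valid[OF vp_valid[OF a], of ?k] w by simp
  have r: "vp (m @ la g ?k) (res g ?k) (n @ ?k) ?w" "arrow m g n z = arrow (m @ la g ?k) (res g ?k) (n @ ?k) ?w"
    using vp_raise[of m g n ?k ?w] arrow_raise[of m g n ?k ?w] a by (simp_all flip: z)
  have "\<gamma> \<in> W \<inter> Zc (m, g, n)" if \<gamma>: "\<gamma> \<in> Zc (rz (m, g, n) ?k)" for \<gamma>
  proof -
    obtain y where y: "vp (m @ la g ?k) (res g ?k) (n @ ?k) y" "\<gamma> = arrow (m @ la g ?k) (res g ?k) (n @ ?k) y"
      by (rule ZcE[OF \<gamma>[unfolded rz_def prod.case] val[unfolded rz_def prod.case]])
    have "ir y = ir ?w" using vpD(3)[OF y(1)] vpD(3)[OF r(1)] by simp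
    then have ky: "walk E (dm g) ?k (ir y)" using w by simp
    have yI: "?k \<frown> y \<in> IP" "ir (?k \<frown> y) = dm g" using ky vpD(2)[OF y(1)] ir_conc by auto
    then have vy: "vp m g n (?k \<frown> y)" using a by (simp add: vp_def)
    have "\<gamma> = arrow m g n (?k \<frown> y)" using arrow_raise[OF vy] y(2) by simp
    moreover have "prefix j (?k \<frown> y) = ?k" using prefix_conc_length[of ?k y] by simp
    ultimately show ?thesis using j[of "?k \<frown> y"] yI v(3) ZcI[OF vy] by simp
  qed
  moreover have "arrow m g n z \<in> Zc (rz (m, g, n) ?k)" using r(2) ZcI[OF r(1)] by (simp add: rz_def)
  ultimately show ?thesis using val by (auto simp: Let_def)
qed

text \<open>The generating sets, a priori only a subbasis, form a basis: \<open>open_Zc\<close>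
  shrinks around a germ by raising its representative.\<close>

lemma openin_atop_iff:
  "openin (atop \<Gamma>) W \<longleftrightarrow> W \<subseteq> arr \<Gamma> \<and> (\<forall>\<gamma>\<in>W. \<exists>\<tau>. valid \<tau> \<and> \<gamma> \<in> Zc \<tau> \<and> Zc \<tau> \<subseteq> W)"
proof
  assume W: "openin (atop \<Gamma>) W"
  then have "W \<subseteq> arr \<Gamma>" using openin_subset by force
  moreover have "\<exists>\<tau>. valid \<tau> \<and> \<gamma> \<in> Zc \<tau> \<and> Zc \<tau> \<subseteq> W" if \<gamma>: "\<gamma> \<in> W" for \<gamma>
  proof -
    obtain m g n z where "vp m g n z" "\<gamma> = arrow m g n z"
      by (rule arr_cases[OF subsetD[OF \<open>W \<subseteq> arr \<Gamma>\<close> \<gamma>]])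
    then show ?thesis using open_Zc[of m g n z W] W \<gamma> unfolding Let_def by blast
  qed
  ultimately show "W \<subseteq> arr \<Gamma> \<and> (\<forall>\<gamma>\<in>W. \<exists>\<tau>. valid \<tau> \<and> \<gamma> \<in> Zc \<tau> \<and> Zc \<tau> \<subseteq> W)" by blast
next
  assume "W \<subseteq> arr \<Gamma> \<and> (\<forall>\<gamma>\<in>W. \<exists>\<tau>. valid \<tau> \<and> \<gamma> \<in> Zc \<tau> \<and> Zc \<tau> \<subseteq> W)"
  then have "W = \<Union>{Zc \<tau> | \<tau>. valid \<tau> \<and> Zc \<tau> \<subseteq> W}" by blast
  moreover have "openin (atop \<Gamma>) (\<Union>{Zc \<tau> | \<tau>. valid \<tau> \<and> Zc \<tau> \<subseteq> W})"
    using openin_Zc by (intro openin_Union) auto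
  ultimately show "openin (atop \<Gamma>) W" by simp
qed

lemma otop_\<Gamma>: "otop \<Gamma> = topology_generated_by (cylinder E ` fpaths E)"
  by (simp add: germ_groupoid_def inf_path_topology_def)

lemma ir_prefix: "prefix (Suc n) x = prefix (Suc n) y \<Longrightarrow> ir x = ir y"
  using prefix_eq_D[of x "Suc n" y 0] by (simp add: irange_def)

lemma cylinder_iff: "x \<in> cylinder E (v, es) \<longleftrightarrow> x \<in> IP \<and> ir x = v \<and> prefix (length es) x = es"
  by (auto simp: cylinder_def segment_def plength_def irange_def)

lemma openin_otop_iff:
  "openin (otop \<Gamma>) V \<longleftrightarrow> V \<subseteq> IP \<and> (\<forall>x\<in>V. \<exists>n. \<forall>y\<in>IP. prefix n y = prefix n x \<longrightarrow> y \<in> V)"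
proof
  let ?P = "\<lambda>V x. \<exists>n. \<forall>y\<in>IP. prefix n y = prefix n x \<longrightarrow> y \<in> V"
  assume V: "openin (otop \<Gamma>) V"
  have "?P V x" if "x \<in> V" for x
  proof (rule openin_generated_basis[OF V[unfolded otop_\<Gamma>], of ?P])
    fix A B x assume "?P A x" "?P B x"
    then obtain i j where ij: "\<forall>y\<in>IP. prefix i y = prefix i x \<longrightarrow> y \<in> A"
      "\<forall>y\<in>IP. prefix j y = prefix j x \<longrightarrow> y \<in> B" by blast
    have "y \<in> A \<inter> B" if "y \<in> IP" "prefix (max i j) y = prefix (max i j) x" for y
      using ij that prefix_mono[OF that(2), of i] prefix_mono[OF that(2), of j] by simp
    then show "?P (A \<inter> B) x" by blast
  next
    fix A B x assume "?P A x" "A \<subseteq> B"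
    then show "?P B x" by blast
  next
    fix s x assume "s \<in> cylinder E ` fpaths E" "x \<in> s"
    then obtain v es where s: "s = cylinder E (v, es)" "ir x = v" "prefix (length es) x = es"
      by (auto simp: cylinder_iff)
    \<comment> \<open>One edge more than \<open>es\<close>: for a vertex the prefix of length zero
      would not fix the range.\<close>
    have "y \<in> s" if "y \<in> IP" "prefix (Suc (length es)) y = prefix (Suc (length es)) x" for y
      using that ir_prefix[OF that(2)] prefix_mono[OF that(2), of "length es"] s by (simp add: cylinder_iff)
    then show "?P s x" by blast
  qed (rule that)
  moreover have "V \<subseteq> IP"
  proof -
    have "V \<subseteq> topspace (otop \<Gamma>)" using V by (rule openin_subset)
    then show ?thesis unfolding otop_\<Gamma> topology_generated_by_topspace by (auto simp: cylinder_def)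
  qed
  ultimately show "V \<subseteq> IP \<and> (\<forall>x\<in>V. ?P V x)" by blast
next
  assume R: "V \<subseteq> IP \<and> (\<forall>x\<in>V. \<exists>n. \<forall>y\<in>IP. prefix n y = prefix n x \<longrightarrow> y \<in> V)"
  let ?C = "{cylinder E \<mu> | \<mu>. \<mu> \<in> fpaths E \<and> cylinder E \<mu> \<subseteq> V}"
  have "x \<in> \<Union>?C" if x: "x \<in> V" for x
  proof -
    obtain n where n: "\<forall>y\<in>IP. prefix n y = prefix n x \<longrightarrow> y \<in> V" using R x by blast
    have xI: "x \<in> IP" using R x by blast
    have "(ir x, prefix n x) \<in> fpaths E" using walk_prefix[OF xI] xI by (auto simp: fpaths_iff)
    moreover have "x \<in> cylinder E (ir x, prefix n x)" using xI by (simp add: cylinder_iff)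
    moreover have "cylinder E (ir x, prefix n x) \<subseteq> V" using n by (auto simp: cylinder_iff)
    ultimately show ?thesis by blast
  qed
  then have "V = \<Union>?C" by blast
  moreover have "openin (otop \<Gamma>) (\<Union>?C)"
    unfolding otop_\<Gamma> by (rule openin_Union) (auto intro: topology_generated_by_Basis)
  ultimately show "openin (otop \<Gamma>) V" by simp
qed

lemma topspace_otop [simp]: "topspace (otop \<Gamma>) = IP"
proof
  show "topspace (otop \<Gamma>) \<subseteq> IP" using openin_topspace openin_otop_iff by blast
  have "openin (otop \<Gamma>) IP" unfolding openin_otop_iff by blast
  then show "IP \<subseteq> topspace (otop \<Gamma>)" by (rule openin_subset)
qed

text \<open>The cylinder of the path with edges \<open>n\<close> and source \<open>v\<close>; the
  source is given because it cannot be read off an empty list.\<close>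

definition pcone :: "'e list \<Rightarrow> 'v \<Rightarrow> 'e word set" where
  "pcone n v = {n \<frown> z | z. z \<in> IP \<and> ir z = v}"

lemma pcone_subset: "walk E u n v \<Longrightarrow> pcone n v \<subseteq> IP"
  by (auto simp: pcone_def)

lemma pcone_prefix:
  assumes "n \<frown> z \<in> IP" "y \<in> IP" "prefix (Suc (length n)) y = prefix (Suc (length n)) (n \<frown> z)"
  shows "\<exists>w. y = n \<frown> w \<and> w \<in> IP \<and> ir w = ir z"
proof -
  have "prefix (length n) y = n" using prefix_mono[OF assms(3), of "length n"] by simp
  then obtain w where w: "y = n \<frown> w" using prefix_eq_conc by metis
  moreover have "w \<in> IP" using assms(2) w conc_IP_suffix by blast
  moreover have "w 0 = z 0" using prefix_eq_D[OF assms(3), of "length n"] w by simp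
  ultimately show ?thesis by (auto simp: irange_def)
qed

lemma openin_pcone:
  assumes "walk E u n v"
  shows "openin (otop \<Gamma>) (pcone n v)"
  unfolding openin_otop_iff
proof (intro conjI ballI)
  show "pcone n v \<subseteq> IP" using pcone_subset[OF assms] .
  fix x assume x: "x \<in> pcone n v"
  then obtain z where z: "x = n \<frown> z" "z \<in> IP" "ir z = v" by (auto simp: pcone_def)
  have "x \<in> IP" using x pcone_subset[OF assms] by blast
  then show "\<exists>k. \<forall>y\<in>IP. prefix k y = prefix k x \<longrightarrow> y \<in> pcone n v"
    using pcone_prefix[of n z] z unfolding pcone_def by blast
qed

lemma
  assumes "valid (m, g, n)"
  shows gdom_Zc: "gdom \<Gamma> ` Zc (m, g, n) = pcone n (dm g)"
    and gcod_Zc: "gcod \<Gamma> ` Zc (m, g, n) = pcone m (cm g)"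
proof -
  have vp: "vp m g n z" if "z \<in> IP" "ir z = dm g" for z using that assms by (simp add: vp_def)
  show "gdom \<Gamma> ` Zc (m, g, n) = pcone n (dm g)"
    using vp by (force simp: Zc_def pcone_def image_iff)
  have g: "g \<in> arr G" using assms by (simp add: valid_def)
  show "gcod \<Gamma> ` Zc (m, g, n) = pcone m (cm g)"
  proof
    show "gcod \<Gamma> ` Zc (m, g, n) \<subseteq> pcone m (cm g)"
    proof
      fix x assume "x \<in> gcod \<Gamma> ` Zc (m, g, n)"
      then obtain z where z: "z \<in> IP" "ir z = dm g" "x = gcod \<Gamma> (arrow m g n z)"
        by (auto simp: Zc_def)
      then show "x \<in> pcone m (cm g)" using vp[OF z(1,2)] vpD(6,7)[OF vp[OF z(1,2)]]
        by (auto simp: pcone_def)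
    qed
    show "pcone m (cm g) \<subseteq> gcod \<Gamma> ` Zc (m, g, n)"
    proof
      fix x assume "x \<in> pcone m (cm g)"
      then obtain w where w: "x = m \<frown> w" "w \<in> IP" "ir w = cm g" by (auto simp: pcone_def)
      let ?z = "ia (ginv G g) w"
      have z: "?z \<in> IP" "ir ?z = dm g" "ia g ?z = w"
        using w g ia_inv[of "ginv G g" w] by simp_all
      then have "gcod \<Gamma> (arrow m g n ?z) = x" using vp[OF z(1,2)] w by simp
      then show "x \<in> gcod \<Gamma> ` Zc (m, g, n)" using ZcI[OF vp[OF z(1,2)]] by blast
    qed
  qed
qed

lemma arrow_inj:
  assumes "vp m g n z" "vp m g n z'" "m \<frown> ia g z = m \<frown> ia g z'"
  shows "z = z'"
proof -
  have "ia (ginv G g) (ia g z) = ia (ginv G g) (ia g z')" using assms(3) by simp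
  then show ?thesis using vpD[OF assms(1)] vpD[OF assms(2)] by (simp add: ia_inv)
qed

lemma inj_on_Zc:
  assumes "valid \<tau>"
  shows "inj_on (gdom \<Gamma>) (Zc \<tau>)" "inj_on (gcod \<Gamma>) (Zc \<tau>)"
proof -
  obtain m g n where t: "\<tau> = (m, g, n)" by (cases \<tau>)
  have "\<gamma> = \<delta>" if \<gamma>: "\<gamma> \<in> Zc \<tau>" and \<delta>: "\<delta> \<in> Zc \<tau>"
    and eq: "gdom \<Gamma> \<gamma> = gdom \<Gamma> \<delta> \<or> gcod \<Gamma> \<gamma> = gcod \<Gamma> \<delta>" for \<gamma> \<delta>
  proof -
    obtain z where z: "vp m g n z" "\<gamma> = arrow m g n z" by (rule ZcE[OF \<gamma>[unfolded t] assms[unfolded t]])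
    obtain y where y: "vp m g n y" "\<delta> = arrow m g n y" by (rule ZcE[OF \<delta>[unfolded t] assms[unfolded t]])
    have "z = y" using eq arrow_inj[OF z(1) y(1)] z y by auto
    then show ?thesis using z y by simp
  qed
  then show "inj_on (gdom \<Gamma>) (Zc \<tau>)" "inj_on (gcod \<Gamma>) (Zc \<tau>)" by (auto intro!: inj_onI)
qed

lemma open_images:
  assumes W: "openin (atop \<Gamma>) W"
  shows "openin (otop \<Gamma>) (gdom \<Gamma> ` W)" "openin (otop \<Gamma>) (gcod \<Gamma> ` W)"
proof -
  have eq: "W = \<Union>(Zc ` {\<tau>. valid \<tau> \<and> Zc \<tau> \<subseteq> W})" using W unfolding openin_atop_iff by blast
  have o: "openin (otop \<Gamma>) (gdom \<Gamma> ` Zc \<tau>)" "openin (otop \<Gamma>) (gcod \<Gamma> ` Zc \<tau>)" if val: "valid \<tau>" for \<tau>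
  proof -
    obtain m g n where t: "\<tau> = (m, g, n)" by (cases \<tau>)
    show "openin (otop \<Gamma>) (gdom \<Gamma> ` Zc \<tau>)" "openin (otop \<Gamma>) (gcod \<Gamma> ` Zc \<tau>)"
      using val openin_pcone unfolding t by (auto simp: gdom_Zc gcod_Zc valid_def)
  qed
  show "openin (otop \<Gamma>) (gdom \<Gamma> ` W)" "openin (otop \<Gamma>) (gcod \<Gamma> ` W)"
    by (subst eq, unfold image_Union, rule openin_Union, use o in blast)+
qed

lemma open_preimages:
  assumes \<tau>: "valid \<tau>" and V: "openin (otop \<Gamma>) V"
  shows "openin (atop \<Gamma>) {\<gamma> \<in> Zc \<tau>. gdom \<Gamma> \<gamma> \<in> V}" "openin (atop \<Gamma>) {\<gamma> \<in> Zc \<tau>. gcod \<Gamma> \<gamma> \<in> V}"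
proof -
  obtain m g n where t: "\<tau> = (m, g, n)" by (cases \<tau>)
  have key: "\<exists>\<sigma>. valid \<sigma> \<and> \<gamma> \<in> Zc \<sigma> \<and> Zc \<sigma> \<subseteq> {\<gamma> \<in> Zc \<tau>. \<rho> \<gamma> \<in> V}"
    if \<rho>: "\<rho> = gdom \<Gamma> \<or> \<rho> = gcod \<Gamma>" and \<gamma>: "\<gamma> \<in> Zc \<tau>" "\<rho> \<gamma> \<in> V" for \<rho> \<gamma>
  proof -
    obtain z where z: "vp m g n z" "\<gamma> = arrow m g n z" using \<gamma> \<tau> unfolding t by (metis ZcE)
    note v = vpD[OF z(1)]
    obtain N where N: "\<And>y. y \<in> IP \<Longrightarrow> prefix N y = prefix N (\<rho> \<gamma>) \<Longrightarrow> y \<in> V"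
      using V \<gamma>(2) unfolding openin_otop_iff by blast
    \<comment> \<open>Raising by \<open>N\<close> edges makes both outer lists at least
      \<open>N\<close> long. The first \<open>N\<close> edges of source and range are then constant
      on the smaller set, so both maps can be treated at once.\<close>
    let ?k = "prefix N z" and ?w = "suffix N z"
    have zk: "z = ?k \<frown> ?w" by (simp add: prefix_suffix)
    have w: "walk E (dm g) ?k (ir ?w)" using walk_prefix[of z N] v by simp
    have val: "valid (rz \<tau> ?k)" using rz_valid[OF \<tau>, of ?k] w t by simp
    have "\<delta> \<in> Zc \<tau> \<and> \<rho> \<delta> \<in> V" if \<delta>: "\<delta> \<in> Zc (rz \<tau> ?k)" for \<delta>
    proof -
      obtain y where y: "vp (m @ la g ?k) (res g ?k) (n @ ?k) y" "\<delta> = arrow (m @ la g ?k) (res g ?k) (n @ ?k) y"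
        by (rule ZcE[OF \<delta>[unfolded rz_def t prod.case] val[unfolded rz_def t prod.case]])
      have "dm (res g ?k) = ir ?w" using res_walk[OF v(1) w] by simp
      then have "walk E (dm g) ?k (ir y)" using w vpD(3)[OF y(1)] by simp
      then have vy: "vp m g n (?k \<frown> y)" using z(1) vpD(2)[OF y(1)] ir_conc by (simp add: vp_def)
      have \<delta>': "\<delta> = arrow m g n (?k \<frown> y)" using arrow_raise[OF vy] y(2) by simp
      have iz: "ia g z = la g ?k \<frown> ia (res g ?k) ?w"
        using ia_conc[of g ?k ?w] by (simp only: prefix_suffix)
      have nz: "n \<frown> z = (n @ ?k) \<frown> ?w" "m \<frown> ia g z = (m @ la g ?k) \<frown> ia (res g ?k) ?w"
        using zk iz by (metis conc_conc)+
      have "N \<le> length (n @ ?k)" "N \<le> length (m @ la g ?k)" by simp_all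
      note pr = prefix_conc_take[OF this(1)] prefix_conc_take[OF this(2)]
      have "prefix N (n \<frown> (?k \<frown> y)) = prefix N (n \<frown> z)"
        by (simp only: nz conc_conc pr)
      moreover have "prefix N (m \<frown> ia g (?k \<frown> y)) = prefix N (m \<frown> ia g z)"
        by (simp only: nz ia_conc[of g ?k y] conc_conc pr)
      ultimately have "prefix N (\<rho> \<delta>) = prefix N (\<rho> \<gamma>)" "\<rho> \<delta> \<in> IP"
        using \<rho> vy z vpD(4,5)[OF vy] unfolding \<delta>' by (auto simp del: prefix_suffix)
      then show ?thesis using N ZcI[OF vy] \<delta>' t by simp
    qed
    moreover have "\<gamma> \<in> Zc (rz \<tau> ?k)"
      using vp_raise[of m g n ?k ?w] arrow_raise[of m g n ?k ?w] z ZcI unfolding t rz_def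
      by (simp flip: zk)
    ultimately show ?thesis using val by blast
  qed
  show "openin (atop \<Gamma>) {\<gamma> \<in> Zc \<tau>. gdom \<Gamma> \<gamma> \<in> V}" "openin (atop \<Gamma>) {\<gamma> \<in> Zc \<tau>. gcod \<Gamma> \<gamma> \<in> V}"
    unfolding openin_atop_iff using Zc_arr[OF \<tau>] key[of "gdom \<Gamma>"] key[of "gcod \<Gamma>"] by auto
qed

lemma open_bisection_Zc:
  assumes \<tau>: "valid \<tau>"
  shows "open_bisection \<Gamma> (Zc \<tau>)"
proof -
  have ts: "topspace (subtopology (atop \<Gamma>) (Zc \<tau>)) = Zc \<tau>"
    using Zc_arr[OF \<tau>] by (auto simp: topspace_subtopology)
  have "homeomorphic_map (subtopology (atop \<Gamma>) (Zc \<tau>)) (subtopology (otop \<Gamma>) (\<rho> ` Zc \<tau>)) \<rho>"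
    if \<rho>: "\<rho> = gdom \<Gamma> \<or> \<rho> = gcod \<Gamma>" for \<rho>
  proof (rule bijective_open_imp_homeomorphic_map)
    have im: "\<rho> ` Zc \<tau> \<subseteq> IP" using open_images[OF openin_Zc[OF \<tau>]] \<rho> openin_subset by force
    show "continuous_map (subtopology (atop \<Gamma>) (Zc \<tau>)) (subtopology (otop \<Gamma>) (\<rho> ` Zc \<tau>)) \<rho>"
      unfolding continuous_map_in_subtopology
    proof
      show "continuous_map (subtopology (atop \<Gamma>) (Zc \<tau>)) (otop \<Gamma>) \<rho>"
        unfolding continuous_map_def ts
      proof (intro conjI allI impI)
        show "\<rho> \<in> Zc \<tau> \<rightarrow> topspace (otop \<Gamma>)" using im by auto
        fix V assume "openin (otop \<Gamma>) V"
        then have "openin (atop \<Gamma>) {\<gamma> \<in> Zc \<tau>. \<rho> \<gamma> \<in> V}" using open_preimages[OF \<tau>] \<rho> by auto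
        then show "openin (subtopology (atop \<Gamma>) (Zc \<tau>)) {\<gamma> \<in> Zc \<tau>. \<rho> \<gamma> \<in> V}"
          using openin_Zc[OF \<tau>] by (simp add: openin_open_subtopology)
      qed
    qed (simp add: ts)
    show "open_map (subtopology (atop \<Gamma>) (Zc \<tau>)) (subtopology (otop \<Gamma>) (\<rho> ` Zc \<tau>)) \<rho>"
      unfolding open_map_def
    proof (intro allI impI)
      fix W assume "openin (subtopology (atop \<Gamma>) (Zc \<tau>)) W"
      then have W: "openin (atop \<Gamma>) W" "W \<subseteq> Zc \<tau>"
        using openin_Zc[OF \<tau>] by (auto simp: openin_open_subtopology)
      then have "openin (otop \<Gamma>) (\<rho> ` W)" using open_images \<rho> by auto
      then show "openin (subtopology (otop \<Gamma>) (\<rho> ` Zc \<tau>)) (\<rho> ` W)"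
        using W(2) by (auto simp: openin_subtopology intro!: exI[of _ "\<rho> ` W"])
    qed
    show "\<rho> ` topspace (subtopology (atop \<Gamma>) (Zc \<tau>)) = topspace (subtopology (otop \<Gamma>) (\<rho> ` Zc \<tau>))"
      unfolding ts using im by (auto simp: topspace_subtopology)
    show "inj_on \<rho> (topspace (subtopology (atop \<Gamma>) (Zc \<tau>)))"
      unfolding ts using inj_on_Zc[OF \<tau>] \<rho> by auto
  qed
  then show ?thesis
    unfolding open_bisection_def using openin_Zc[OF \<tau>] open_images[OF openin_Zc[OF \<tau>]] by auto
qed

text \<open>Compactness of the path space in terms of cylinders, by bar induction: a path
  \<open>es\<close> inherits a finite cover from its finitely many extensions by one edge, and the
  prefix of length \<open>N x\<close> is covered by \<open>x\<close> alone.\<close>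

lemma IP_cover:
  fixes N :: "'e word \<Rightarrow> nat"
  shows "\<exists>X. finite X \<and> X \<subseteq> IP \<and> (\<forall>y\<in>IP. \<exists>x\<in>X. prefix (N x) y = prefix (N x) x)"
proof -
  have "\<exists>X. finite X \<and> X \<subseteq> IP \<and> (\<forall>y\<in>IP. ir y = v \<longrightarrow> (\<exists>x\<in>X. prefix (N x) y = prefix (N x) x))" for v
  proof -
    define Q where "Q es \<longleftrightarrow> (\<exists>X. finite X \<and> X \<subseteq> IP \<and> (\<forall>y\<in>IP. ir y = v \<longrightarrow> prefix (length es) y = es \<longrightarrow>
      (\<exists>x\<in>X. prefix (N x) y = prefix (N x) x)))" for es
    have "Q []"
    proof (rule path_bar_induct[where v = v])
      fix es w assume w: "walk E v es w" and "\<And>e. e \<in> in_arcs E w \<Longrightarrow> Q (es @ [e])"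
      then have "\<forall>e\<in>in_arcs E w. \<exists>X. finite X \<and> X \<subseteq> IP \<and> (\<forall>y\<in>IP. ir y = v \<longrightarrow>
          prefix (length (es @ [e])) y = es @ [e] \<longrightarrow> (\<exists>x\<in>X. prefix (N x) y = prefix (N x) x))"
        unfolding Q_def by blast
      from bchoice[OF this] obtain X where X: "\<forall>e\<in>in_arcs E w. finite (X e) \<and> X e \<subseteq> IP \<and> (\<forall>y\<in>IP. ir y = v \<longrightarrow>
          prefix (length (es @ [e])) y = es @ [e] \<longrightarrow> (\<exists>x\<in>X e. prefix (N x) y = prefix (N x) x))" ..
      have "\<exists>x\<in>\<Union>(X ` in_arcs E w). prefix (N x) z = prefix (N x) x"
        if z: "z \<in> IP" "ir z = v" "prefix (length es) z = es" for z
      proof -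
        let ?e = "z (length es)"
        have "walk E v es (ir (suffix (length es) z))" using walk_prefix[OF z(1), of "length es"] z by simp
        then have "ir (suffix (length es) z) = w" by (rule walk_end_unique[OF _ w])
        then have e: "?e \<in> in_arcs E w" using IP_arc[OF z(1)] by (simp add: irange_def)
        moreover have "prefix (length (es @ [?e])) z = es @ [?e]" using z(3) by (simp add: prefix_Suc)
        ultimately show ?thesis using X z by blast
      qed
      moreover have "finite (\<Union>(X ` in_arcs E w))" "\<Union>(X ` in_arcs E w) \<subseteq> IP" using X by auto
      ultimately show "Q es" unfolding Q_def by (intro exI[of _ "\<Union>(X ` in_arcs E w)"]) blast
    next
      fix x assume x: "x \<in> IP" "ir x = v"
      then have "Q (prefix (N x) x)" unfolding Q_def by (intro exI[of _ "{x}"]) simp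
      then show "\<exists>n. Q (prefix n x)" by blast
    qed
    then show ?thesis unfolding Q_def by auto
  qed
  then have "\<forall>v. \<exists>X. finite X \<and> X \<subseteq> IP \<and> (\<forall>y\<in>IP. ir y = v \<longrightarrow> (\<exists>x\<in>X. prefix (N x) y = prefix (N x) x))" by blast
  from choice[OF this] obtain X where
    X: "\<forall>v. finite (X v) \<and> X v \<subseteq> IP \<and> (\<forall>y\<in>IP. ir y = v \<longrightarrow> (\<exists>x\<in>X v. prefix (N x) y = prefix (N x) x))" ..
  have "\<exists>x\<in>\<Union>(X ` verts E). prefix (N x) y = prefix (N x) x" if y: "y \<in> IP" for y
  proof -
    obtain x where "x \<in> X (ir y)" "prefix (N x) y = prefix (N x) x" using X y by blast
    then show ?thesis using ir_verts[OF y] by blast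
  qed
  then show ?thesis using X by (intro exI[of _ "\<Union>(X ` verts E)"]) auto
qed

text \<open>The tails \<open>z\<close> parametrise \<open>Zc \<tau>\<close>, so a finite subcover
  comes from \<open>IP_cover\<close>, applied to prefixes on which \<open>arrow m g n\<close> stays
  in one member of the cover. The \<open>Suc\<close> makes the prefix fix the range vertex.\<close>

lemma compactin_Zc:
  assumes \<tau>: "valid \<tau>"
  shows "compactin (atop \<Gamma>) (Zc \<tau>)"
  unfolding compactin_def
proof (intro conjI allI impI)
  obtain m g n where t: "\<tau> = (m, g, n)" by (cases \<tau>)
  show "Zc \<tau> \<subseteq> topspace (atop \<Gamma>)" using Zc_arr[OF \<tau>] by simp
  fix \<U> assume \<U>: "Ball \<U> (openin (atop \<Gamma>)) \<and> Zc \<tau> \<subseteq> \<Union>\<U>"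
  let ?I = "{x \<in> IP. ir x = dm g}"
  have "\<exists>p. fst p \<in> \<U> \<and> (\<forall>z\<in>IP. prefix (Suc (snd p)) z = prefix (Suc (snd p)) x \<longrightarrow> arrow m g n z \<in> fst p)"
    if x: "x \<in> ?I" for x
  proof -
    have vx: "vp m g n x" using \<tau> t x by (simp add: vp_def)
    then obtain W where W: "W \<in> \<U>" "arrow m g n x \<in> W" using subsetD[OF conjunct2[OF \<U>], of "arrow m g n x"] ZcI[OF vx] t by auto
    then obtain j where "\<forall>z\<in>IP. prefix j z = prefix j x \<longrightarrow> ir z = ir x \<longrightarrow> arrow m g n z \<in> W"
      using open_local[OF vx, of W] \<U> by blast
    then have "arrow m g n z \<in> W" if "z \<in> IP" "prefix (Suc j) z = prefix (Suc j) x" for z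
      using ir_prefix[OF that(2)] prefix_mono[OF that(2), of j] that(1) by simp
    then show ?thesis using W(1) by (intro exI[of _ "(W, j)"]) simp
  qed
  then have "\<forall>x\<in>?I. \<exists>p. fst p \<in> \<U> \<and> (\<forall>z\<in>IP. prefix (Suc (snd p)) z = prefix (Suc (snd p)) x \<longrightarrow> arrow m g n z \<in> fst p)"
    by blast
  from bchoice[OF this] obtain p where p: "\<forall>x\<in>?I. fst (p x) \<in> \<U> \<and>
    (\<forall>z\<in>IP. prefix (Suc (snd (p x))) z = prefix (Suc (snd (p x))) x \<longrightarrow> arrow m g n z \<in> fst (p x))" ..
  obtain X where X: "finite X" "X \<subseteq> IP" "\<forall>y\<in>IP. \<exists>x\<in>X. prefix (Suc (snd (p x))) y = prefix (Suc (snd (p x))) x"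
    using IP_cover[of "\<lambda>x. Suc (snd (p x))"] by blast
  have "Zc \<tau> \<subseteq> \<Union>((\<lambda>x. fst (p x)) ` (X \<inter> ?I))"
  proof
    fix \<gamma> assume "\<gamma> \<in> Zc \<tau>"
    then obtain z where z: "z \<in> IP" "ir z = dm g" "\<gamma> = arrow m g n z" by (auto simp: t Zc_def)
    then obtain x where x: "x \<in> X" "prefix (Suc (snd (p x))) z = prefix (Suc (snd (p x))) x" using X(3) by blast
    then have "x \<in> ?I" using z(2) X(2) ir_prefix[OF x(2)] by auto
    then show "\<gamma> \<in> \<Union>((\<lambda>x. fst (p x)) ` (X \<inter> ?I))" using p x z by blast
  qed
  then show "\<exists>\<F>. finite \<F> \<and> \<F> \<subseteq> \<U> \<and> Zc \<tau> \<subseteq> \<Union>\<F>"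
    using p X(1) by (intro exI[of _ "(\<lambda>x. fst (p x)) ` (X \<inter> ?I)"]) auto
qed

subsection \<open>Continuous functions on the path space\<close>

text \<open>The neighbourhood filter of \<open>x\<close>, generated by prefixes; with it
  \<open>cont\<close> is a \<open>tendsto\<close> statement and inherits its closure properties from
  the library.\<close>

definition path_nhds :: "'e word \<Rightarrow> 'e word filter" where
  "path_nhds x = (INF n. principal {y \<in> IP. prefix n y = prefix n x})"

lemma eventually_path_nhds:
  "eventually Q (path_nhds x) \<longleftrightarrow> (\<exists>n. \<forall>y\<in>IP. prefix n y = prefix n x \<longrightarrow> Q y)"
  unfolding path_nhds_def
proof (subst eventually_INF_base)
  fix a b :: nat
  show "\<exists>c\<in>UNIV. principal {y \<in> IP. prefix c y = prefix c x} \<le>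
      inf (principal {y \<in> IP. prefix a y = prefix a x}) (principal {y \<in> IP. prefix b y = prefix b x})"
  proof -
    have "prefix a y = prefix a x \<and> prefix b y = prefix b x"
      if "prefix (max a b) y = prefix (max a b) x" for y
      using prefix_mono[OF that, of a] prefix_mono[OF that, of b] by simp
    then have "{y \<in> IP. prefix (max a b) y = prefix (max a b) x} \<subseteq>
        {y \<in> IP. prefix a y = prefix a x} \<inter> {y \<in> IP. prefix b y = prefix b x}" by blast
    then show ?thesis
      by (intro bexI[of _ "max a b"]) (simp_all only: inf_principal principal_le_iff UNIV_I)
  qed
qed (auto simp: eventually_principal)

definition cont :: "('e word \<Rightarrow> complex) \<Rightarrow> bool" where
  "cont \<phi> \<longleftrightarrow> (\<forall>x\<in>IP. (\<phi> \<longlongrightarrow> \<phi> x) (path_nhds x))"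

lemma contD:
  assumes "cont \<phi>" "x \<in> IP" "open S" "\<phi> x \<in> S"
  shows "\<exists>n. \<forall>y\<in>IP. prefix n y = prefix n x \<longrightarrow> \<phi> y \<in> S"
  using assms topological_tendstoD[of \<phi> "\<phi> x" "path_nhds x" S] unfolding cont_def eventually_path_nhds by blast

text \<open>Finitely many local indices suffice by compactness, and since \<open>R\<close> is
  monotone in the index their sum works everywhere.\<close>

lemma IP_uniform:
  fixes R :: "nat \<Rightarrow> 'e word \<Rightarrow> bool"
  assumes mono: "\<And>m n x. R m x \<Longrightarrow> m \<le> n \<Longrightarrow> R n x"
    and local: "\<And>x. x \<in> IP \<Longrightarrow> \<exists>k n. \<forall>y\<in>IP. prefix k y = prefix k x \<longrightarrow> R n y"
  shows "\<exists>n. \<forall>x\<in>IP. R n x"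
proof -
  have "\<forall>x\<in>IP. \<exists>p. \<forall>y\<in>IP. prefix (fst p) y = prefix (fst p) x \<longrightarrow> R (snd p) y"
    using local by fastforce
  from bchoice[OF this] obtain p where
    p: "\<forall>x\<in>IP. \<forall>y\<in>IP. prefix (fst (p x)) y = prefix (fst (p x)) x \<longrightarrow> R (snd (p x)) y" ..
  obtain X where X: "finite X" "X \<subseteq> IP" "\<forall>y\<in>IP. \<exists>x\<in>X. prefix (fst (p x)) y = prefix (fst (p x)) x"
    using IP_cover[of "\<lambda>x. fst (p x)"] by blast
  have "R (\<Sum>x\<in>X. snd (p x)) y" if y: "y \<in> IP" for y
  proof -
    obtain x where x: "x \<in> X" "prefix (fst (p x)) y = prefix (fst (p x)) x" using X(3) y by blast
    then have "R (snd (p x)) y" using p y X(2) by blast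
    moreover have "snd (p x) \<le> (\<Sum>x\<in>X. snd (p x))" using X(1) x(1) by (intro member_le_sum) auto
    ultimately show ?thesis by (rule mono)
  qed
  then show ?thesis by blast
qed

lemma cont_bounded:
  assumes \<phi>: "cont \<phi>"
  shows "\<exists>K\<ge>0. \<forall>x\<in>IP. norm (\<phi> x) \<le> K"
proof -
  have "\<exists>n. \<forall>x\<in>IP. norm (\<phi> x) \<le> real n"
  proof (rule IP_uniform)
    fix x assume x: "x \<in> IP"
    obtain n where "norm (\<phi> x) < real n" using reals_Archimedean2 by blast
    then obtain k where "\<forall>y\<in>IP. prefix k y = prefix k x \<longrightarrow> \<phi> y \<in> ball 0 (real n)"
      using contD[OF \<phi> x open_ball, of 0 "real n"] by auto
    then show "\<exists>k n. \<forall>y\<in>IP. prefix k y = prefix k x \<longrightarrow> norm (\<phi> y) \<le> real n"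
      by (intro exI[of _ k] exI[of _ n]) (auto simp: less_imp_le)
  qed simp
  then show ?thesis using of_nat_0_le_iff by blast
qed

lemma cont_const: "cont (\<lambda>_. c)" and cont_mult: "cont \<phi> \<Longrightarrow> cont \<psi> \<Longrightarrow> cont (\<lambda>x. \<phi> x * \<psi> x)"
  and cont_add: "cont \<phi> \<Longrightarrow> cont \<psi> \<Longrightarrow> cont (\<lambda>x. \<phi> x + \<psi> x)"
  and cont_diff: "cont \<phi> \<Longrightarrow> cont \<psi> \<Longrightarrow> cont (\<lambda>x. \<phi> x - \<psi> x)"
  and cont_cnj: "cont \<phi> \<Longrightarrow> cont (\<lambda>x. cnj (\<phi> x))"
  unfolding cont_def by (auto intro!: tendsto_intros)

lemma cont_locally:
  assumes "\<And>x. x \<in> IP \<Longrightarrow> \<exists>\<psi> n. cont \<psi> \<and> (\<forall>y\<in>IP. prefix n y = prefix n x \<longrightarrow> \<phi> y = \<psi> y)"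
  shows "cont \<phi>"
  unfolding cont_def
proof
  fix x assume x: "x \<in> IP"
  then obtain \<psi> n where \<psi>: "cont \<psi>" "\<forall>y\<in>IP. prefix n y = prefix n x \<longrightarrow> \<phi> y = \<psi> y" using assms by blast
  have "eventually (\<lambda>y. \<psi> y = \<phi> y) (path_nhds x)"
    unfolding eventually_path_nhds using \<psi>(2) by (intro exI[of _ n]) auto
  moreover have "(\<psi> \<longlongrightarrow> \<phi> x) (path_nhds x)" using \<psi> x by (simp add: cont_def)
  ultimately show "(\<phi> \<longlongrightarrow> \<phi> x) (path_nhds x)" by (rule Lim_transform_eventually[rotated])
qed

lemma not_pcone_local:
  assumes "x \<in> IP" "x \<notin> pcone n v" "y \<in> IP" "prefix (Suc (length n)) y = prefix (Suc (length n)) x"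
  shows "y \<notin> pcone n v"
proof
  assume "y \<in> pcone n v"
  then obtain z where z: "y = n \<frown> z" "z \<in> IP" "ir z = v" by (auto simp: pcone_def)
  then have "x \<in> pcone n v" using pcone_prefix[of n z x] assms by (auto simp: pcone_def)
  then show False using assms by simp
qed

lemma cont_indicator_pcone:
  assumes "walk E u n v"
  shows "cont (\<lambda>x. if x \<in> pcone n v then 1 else 0)"
proof (rule cont_locally)
  fix x assume x: "x \<in> IP"
  show "\<exists>\<psi> k. cont \<psi> \<and> (\<forall>y\<in>IP. prefix k y = prefix k x \<longrightarrow> (if y \<in> pcone n v then 1 else 0) = \<psi> y)"
  proof (cases "x \<in> pcone n v")
    case True
    then obtain k where "\<forall>y\<in>IP. prefix k y = prefix k x \<longrightarrow> y \<in> pcone n v"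
      using openin_pcone[OF assms] unfolding openin_otop_iff by blast
    then show ?thesis using cont_const[of 1] by (intro exI[of _ "\<lambda>_. 1"] exI[of _ k]) auto
  next
    case False
    then show ?thesis using cont_const[of 0] not_pcone_local[OF x False]
      by (intro exI[of _ "\<lambda>_. 0"] exI[of _ "Suc (length n)"]) auto
  qed
qed

text \<open>\<open>pull \<tau> \<phi>\<close> is \<open>\<phi> \<circ> gcod\<close> on \<open>Zc \<tau>\<close>, transported to the sources.\<close>

definition pull :: "'e list \<times> 'g \<times> 'e list \<Rightarrow> ('e word \<Rightarrow> complex) \<Rightarrow> 'e word \<Rightarrow> complex" where
  "pull = (\<lambda>(m, g, n) \<phi> x. if x \<in> pcone n (dm g) then \<phi> (m \<frown> ia g (suffix (length n) x)) else 0)"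

lemma pull_arrow: "vp m g n z \<Longrightarrow> pull (m, g, n) \<phi> (n \<frown> z) = \<phi> (m \<frown> ia g z)"
  by (auto simp: pull_def pcone_def vp_def)

lemma pull_gdom: "valid \<tau> \<Longrightarrow> \<gamma> \<in> Zc \<tau> \<Longrightarrow> pull \<tau> \<phi> (gdom \<Gamma> \<gamma>) = \<phi> (gcod \<Gamma> \<gamma>)"
  by (cases \<tau>) (auto elim!: ZcE simp: pull_arrow)

lemma pull_bound:
  assumes "valid \<tau>" "\<forall>x\<in>IP. norm (\<phi> x) \<le> K" "0 \<le> K" "x \<in> IP"
  shows "norm (pull \<tau> \<phi> x) \<le> K"
proof -
  obtain m g n where t: "\<tau> = (m, g, n)" by (cases \<tau>)
  show ?thesis
  proof (cases "x \<in> pcone n (dm g)")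
    case True
    then obtain z where z: "x = n \<frown> z" "z \<in> IP" "ir z = dm g" by (auto simp: pcone_def)
    then have "vp m g n z" using assms(1) t by (simp add: vp_def)
    then show ?thesis using pull_arrow vpD(5) assms(2) z t by metis
  qed (use assms t in \<open>simp add: pull_def\<close>)
qed

lemma cont_pull:
  assumes \<tau>: "valid \<tau>" and \<phi>: "cont \<phi>"
  shows "cont (pull \<tau> \<phi>)"
  unfolding cont_def
proof
  obtain m g n where t: "\<tau> = (m, g, n)" by (cases \<tau>)
  fix x assume x: "x \<in> IP"
  show "(pull \<tau> \<phi> \<longlongrightarrow> pull \<tau> \<phi> x) (path_nhds x)"
  proof (cases "x \<in> pcone n (dm g)")
    case True
    then obtain z where z: "x = n \<frown> z" "z \<in> IP" "ir z = dm g" by (auto simp: pcone_def)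
    then have vz: "vp m g n z" using \<tau> t by (simp add: vp_def)
    show ?thesis
    proof (rule topological_tendstoI)
      fix S assume S: "open S" "pull \<tau> \<phi> x \<in> S"
      then have "\<phi> (m \<frown> ia g z) \<in> S" using pull_arrow[OF vz] z t by simp
      then obtain N where N: "\<forall>y\<in>IP. prefix N y = prefix N (m \<frown> ia g z) \<longrightarrow> \<phi> y \<in> S"
        using contD[OF \<phi> vpD(5)[OF vz] S(1)] by blast
      \<comment> \<open>\<open>Suc (length n)\<close> edges keep \<open>y\<close> in the cone, and
        agreement on \<open>length n + N\<close> edges fixes \<open>N\<close> edges of the tail,
        hence also the first \<open>N\<close> edges of the range.\<close>
      have "pull \<tau> \<phi> y \<in> S" if y: "y \<in> IP" "prefix (Suc (length n) + N) y = prefix (Suc (length n) + N) x" for y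
      proof -
        have "prefix (Suc (length n)) y = prefix (Suc (length n)) (n \<frown> z)"
          using prefix_mono[OF y(2), of "Suc (length n)"] z(1) by simp
        then obtain w where w: "y = n \<frown> w" "w \<in> IP" "ir w = ir z"
          using pcone_prefix[of n z y] x y z by auto
        then have vw: "vp m g n w" using vz by (simp add: vp_def)
        have "prefix (length n + N) y = prefix (length n + N) x" using prefix_mono[OF y(2)] by simp
        then have "prefix N w = prefix N z" unfolding w(1) z(1) prefix_conc_add by simp
        then have "prefix N (ia g w) = prefix N (ia g z)" by (simp add: ia_prefix)
        then have "prefix (length m + N) (m \<frown> ia g w) = prefix (length m + N) (m \<frown> ia g z)"
          by (simp add: prefix_conc_add)
        then have "prefix N (m \<frown> ia g w) = prefix N (m \<frown> ia g z)" by (rule prefix_mono) simp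
        then show ?thesis using N vpD(5)[OF vw] pull_arrow[OF vw] w t by simp
      qed
      then show "eventually (\<lambda>y. pull \<tau> \<phi> y \<in> S) (path_nhds x)"
        unfolding eventually_path_nhds by blast
    qed
  next
    case False
    then have "eventually (\<lambda>y. 0 = pull \<tau> \<phi> y) (path_nhds x)"
      unfolding eventually_path_nhds using not_pcone_local[OF x False] t
      by (intro exI[of _ "Suc (length n)"]) (auto simp: pull_def)
    moreover have "pull \<tau> \<phi> x = 0" using False t by (simp add: pull_def)
    ultimately show ?thesis by (simp only: Lim_transform_eventually[OF tendsto_const])
  qed
qed

end

section \<open>Convolution\<close>

text \<open>A sum over an infinite set is zero in HOL, so the algebraic laws of \<open>conv\<close>
  are proved under this condition, which makes the convolution a genuine finite sum.\<close>

definition fibre_finite :: "('o, 'a, 'm) groupoid_scheme \<Rightarrow> ('a \<Rightarrow> complex) \<Rightarrow> bool" where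
  "fibre_finite G f \<longleftrightarrow> (\<forall>\<gamma>. \<gamma> \<notin> arr G \<longrightarrow> f \<gamma> = 0) \<and>
     (\<forall>x. finite {\<alpha> \<in> arr G. gcod G \<alpha> = x \<and> f \<alpha> \<noteq> 0}) \<and>
     (\<forall>x. finite {\<alpha> \<in> arr G. gdom G \<alpha> = x \<and> f \<alpha> \<noteq> 0})"

definition conv :: "('o, 'a, 'm) groupoid_scheme \<Rightarrow> ('a \<Rightarrow> complex) \<Rightarrow> ('a \<Rightarrow> complex) \<Rightarrow> 'a \<Rightarrow> complex" where
  "conv G f h \<gamma> = (\<Sum>(\<alpha>, \<beta>) | \<alpha> \<in> arr G \<and> \<beta> \<in> arr G \<and> gdom G \<alpha> = gcod G \<beta> \<and>
     gmult G \<alpha> \<beta> = \<gamma> \<and> f \<alpha> \<noteq> 0 \<and> h \<beta> \<noteq> 0. f \<alpha> * h \<beta>)"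

context groupoid
begin

lemma mult_inv_mult [simp]:
  assumes "\<alpha> \<in> arr G" "\<gamma> \<in> arr G" "gcod G \<alpha> = gcod G \<gamma>"
  shows "gmult G \<alpha> (gmult G (ginv G \<alpha>) \<gamma>) = \<gamma>"
  using assms mult_assoc[of \<alpha> "ginv G \<alpha>" \<gamma>]
  by (simp add: inv_arr dom_inv cod_inv mult_inv_right mult_unit_left)

lemma inv_mult_mult [simp]:
  assumes "\<alpha> \<in> arr G" "\<beta> \<in> arr G" "gdom G \<alpha> = gcod G \<beta>"
  shows "gmult G (ginv G \<alpha>) (gmult G \<alpha> \<beta>) = \<beta>"
  using assms mult_assoc[of "ginv G \<alpha>" \<alpha> \<beta>]
  by (simp add: inv_arr dom_inv cod_inv mult_inv_left mult_unit_left)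

lemma mult_mult_inv [simp]:
  assumes "\<alpha> \<in> arr G" "\<beta> \<in> arr G" "gdom G \<alpha> = gcod G \<beta>"
  shows "gmult G (gmult G \<alpha> \<beta>) (ginv G \<beta>) = \<alpha>"
  using assms mult_assoc[of \<alpha> \<beta> "ginv G \<beta>"] mult_unit_right[of \<alpha>]
  by (simp add: inv_arr dom_inv cod_inv mult_inv_right)

lemma mult_inv_cancel_right [simp]:
  assumes "\<gamma> \<in> arr G" "\<beta> \<in> arr G" "gdom G \<gamma> = gdom G \<beta>"
  shows "gmult G (gmult G \<gamma> (ginv G \<beta>)) \<beta> = \<gamma>"
  using assms mult_assoc[of \<gamma> "ginv G \<beta>" \<beta>] mult_unit_right[of \<gamma>]
  by (simp add: inv_arr dom_inv cod_inv mult_inv_left)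

text \<open>In a product equal to \<open>\<gamma>\<close> the second factor determines the first.
  \<open>Q\<close> may be any finite part of the source fibre that contains the support, so an index
  set can be chosen to suit the application.\<close>

lemma conv_right:
  assumes \<gamma>: "\<gamma> \<in> arr G" and Q: "finite Q" "{\<beta> \<in> arr G. gdom G \<beta> = gdom G \<gamma> \<and> h \<beta> \<noteq> 0} \<subseteq> Q"
    "Q \<subseteq> {\<beta> \<in> arr G. gdom G \<beta> = gdom G \<gamma>}"
  shows "conv G f h \<gamma> = (\<Sum>\<beta>\<in>Q. f (gmult G \<gamma> (ginv G \<beta>)) * h \<beta>)"
proof -
  let ?Q = "{\<beta> \<in> Q. h \<beta> \<noteq> 0 \<and> f (gmult G \<gamma> (ginv G \<beta>)) \<noteq> 0}"
  have Qa: "\<beta> \<in> arr G" "gdom G \<beta> = gdom G \<gamma>" if "\<beta> \<in> Q" for \<beta> using Q(3) that by auto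
  have "conv G f h \<gamma> = (\<Sum>\<beta>\<in>?Q. f (gmult G \<gamma> (ginv G \<beta>)) * h \<beta>)"
    unfolding conv_def
  proof (rule sum.reindex_bij_witness[where i = "\<lambda>\<beta>. (gmult G \<gamma> (ginv G \<beta>), \<beta>)" and j = snd])
    fix p assume p: "p \<in> {(\<alpha>, \<beta>). \<alpha> \<in> arr G \<and> \<beta> \<in> arr G \<and> gdom G \<alpha> = gcod G \<beta> \<and>
      gmult G \<alpha> \<beta> = \<gamma> \<and> f \<alpha> \<noteq> 0 \<and> h \<beta> \<noteq> 0}"
    obtain \<alpha> \<beta> where ab: "p = (\<alpha>, \<beta>)" by (cases p)
    have "\<alpha> \<in> arr G" "\<beta> \<in> arr G" "gdom G \<alpha> = gcod G \<beta>" "\<gamma> = gmult G \<alpha> \<beta>" "f \<alpha> \<noteq> 0" "h \<beta> \<noteq> 0"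
      using p ab by auto
    moreover from this have "\<beta> \<in> Q" using Q(2) by (auto simp: dom_mult)
    ultimately show "(gmult G \<gamma> (ginv G (snd p)), snd p) = p" "snd p \<in> ?Q"
      "f (gmult G \<gamma> (ginv G (snd p))) * h (snd p) = (case p of (\<alpha>, \<beta>) \<Rightarrow> f \<alpha> * h \<beta>)"
      by (simp_all add: ab)
  next
    fix \<beta> assume "\<beta> \<in> ?Q"
    then show "snd (gmult G \<gamma> (ginv G \<beta>), \<beta>) = \<beta>"
      "(gmult G \<gamma> (ginv G \<beta>), \<beta>) \<in> {(\<alpha>, \<beta>). \<alpha> \<in> arr G \<and> \<beta> \<in> arr G \<and> gdom G \<alpha> = gcod G \<beta> \<and>
        gmult G \<alpha> \<beta> = \<gamma> \<and> f \<alpha> \<noteq> 0 \<and> h \<beta> \<noteq> 0}"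
      using Qa[of \<beta>] \<gamma> by (simp_all add: mult_arr inv_arr cod_inv dom_inv dom_mult)
  qed
  also have "\<dots> = (\<Sum>\<beta>\<in>Q. f (gmult G \<gamma> (ginv G \<beta>)) * h \<beta>)"
    using Q(1) by (intro sum.mono_neutral_left) auto
  finally show ?thesis .
qed

lemma conv_left:
  assumes \<gamma>: "\<gamma> \<in> arr G" and P: "finite P" "{\<alpha> \<in> arr G. gcod G \<alpha> = gcod G \<gamma> \<and> f \<alpha> \<noteq> 0} \<subseteq> P"
    "P \<subseteq> {\<alpha> \<in> arr G. gcod G \<alpha> = gcod G \<gamma>}"
  shows "conv G f h \<gamma> = (\<Sum>\<alpha>\<in>P. f \<alpha> * h (gmult G (ginv G \<alpha>) \<gamma>))"
proof -
  let ?P = "{\<alpha> \<in> P. f \<alpha> \<noteq> 0 \<and> h (gmult G (ginv G \<alpha>) \<gamma>) \<noteq> 0}"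
  have Pa: "\<alpha> \<in> arr G" "gcod G \<alpha> = gcod G \<gamma>" if "\<alpha> \<in> P" for \<alpha> using P(3) that by auto
  have "conv G f h \<gamma> = (\<Sum>\<alpha>\<in>?P. f \<alpha> * h (gmult G (ginv G \<alpha>) \<gamma>))"
    unfolding conv_def
  proof (rule sum.reindex_bij_witness[where i = "\<lambda>\<alpha>. (\<alpha>, gmult G (ginv G \<alpha>) \<gamma>)" and j = fst])
    fix p assume p: "p \<in> {(\<alpha>, \<beta>). \<alpha> \<in> arr G \<and> \<beta> \<in> arr G \<and> gdom G \<alpha> = gcod G \<beta> \<and>
      gmult G \<alpha> \<beta> = \<gamma> \<and> f \<alpha> \<noteq> 0 \<and> h \<beta> \<noteq> 0}"
    obtain \<alpha> \<beta> where ab: "p = (\<alpha>, \<beta>)" by (cases p)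
    have "\<alpha> \<in> arr G" "\<beta> \<in> arr G" "gdom G \<alpha> = gcod G \<beta>" "\<gamma> = gmult G \<alpha> \<beta>" "f \<alpha> \<noteq> 0" "h \<beta> \<noteq> 0"
      using p ab by auto
    moreover from this have "\<alpha> \<in> P" using P(2) by (auto simp: cod_mult)
    ultimately show "(fst p, gmult G (ginv G (fst p)) \<gamma>) = p" "fst p \<in> ?P"
      "f (fst p) * h (gmult G (ginv G (fst p)) \<gamma>) = (case p of (\<alpha>, \<beta>) \<Rightarrow> f \<alpha> * h \<beta>)"
      by (simp_all add: ab)
  next
    fix \<alpha> assume "\<alpha> \<in> ?P"
    then show "fst (\<alpha>, gmult G (ginv G \<alpha>) \<gamma>) = \<alpha>"
      "(\<alpha>, gmult G (ginv G \<alpha>) \<gamma>) \<in> {(\<alpha>, \<beta>). \<alpha> \<in> arr G \<and> \<beta> \<in> arr G \<and> gdom G \<alpha> = gcod G \<beta> \<and>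
        gmult G \<alpha> \<beta> = \<gamma> \<and> f \<alpha> \<noteq> 0 \<and> h \<beta> \<noteq> 0}"
      using Pa[of \<alpha>] \<gamma> by (simp_all add: mult_arr inv_arr cod_inv dom_inv cod_mult)
  qed
  also have "\<dots> = (\<Sum>\<alpha>\<in>P. f \<alpha> * h (gmult G (ginv G \<alpha>) \<gamma>))"
    using P(1) by (intro sum.mono_neutral_left) auto
  finally show ?thesis .
qed

lemma conv_outside: "\<gamma> \<notin> arr G \<Longrightarrow> conv G f h \<gamma> = 0"
  unfolding conv_def by (rule sum.neutral) (auto simp: mult_arr)

lemma conv_eq_right:
  assumes "\<gamma> \<in> arr G" "fibre_finite G h"
  shows "conv G f h \<gamma> =
    (\<Sum>\<beta> | \<beta> \<in> arr G \<and> gdom G \<beta> = gdom G \<gamma> \<and> h \<beta> \<noteq> 0. f (gmult G \<gamma> (ginv G \<beta>)) * h \<beta>)"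
  using assms by (intro conv_right) (auto simp: fibre_finite_def)

lemma conv_eq_left:
  assumes "\<gamma> \<in> arr G" "fibre_finite G f"
  shows "conv G f h \<gamma> =
    (\<Sum>\<alpha> | \<alpha> \<in> arr G \<and> gcod G \<alpha> = gcod G \<gamma> \<and> f \<alpha> \<noteq> 0. f \<alpha> * h (gmult G (ginv G \<alpha>) \<gamma>))"
  using assms by (intro conv_left) (auto simp: fibre_finite_def)

text \<open>Solving for the middle factor turns both sides into the same double sum, over first
  factors with the range of \<open>\<gamma>\<close> and last factors with its source. Both index
  sets are finite by the hypotheses on \<open>f\<close> and \<open>k\<close>.\<close>

lemma conv_assoc:
  assumes f: "fibre_finite G f" and k: "fibre_finite G k"
  shows "conv G (conv G f h) k = conv G f (conv G h k)"
proof
  fix \<gamma>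
  show "conv G (conv G f h) k \<gamma> = conv G f (conv G h k) \<gamma>"
  proof (cases "\<gamma> \<in> arr G")
    case \<gamma>: True
    let ?P = "{\<alpha> \<in> arr G. gcod G \<alpha> = gcod G \<gamma> \<and> f \<alpha> \<noteq> 0}"
    let ?Q = "{\<beta> \<in> arr G. gdom G \<beta> = gdom G \<gamma> \<and> k \<beta> \<noteq> 0}"
    have "conv G (conv G f h) k \<gamma> = (\<Sum>\<beta>\<in>?Q. conv G f h (gmult G \<gamma> (ginv G \<beta>)) * k \<beta>)"
      using conv_eq_right[OF \<gamma> k] .
    also have "\<dots> = (\<Sum>\<beta>\<in>?Q. \<Sum>\<alpha>\<in>?P. f \<alpha> * h (gmult G (gmult G (ginv G \<alpha>) \<gamma>) (ginv G \<beta>)) * k \<beta>)"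
    proof (rule sum.cong[OF refl])
      fix \<beta> assume \<beta>: "\<beta> \<in> ?Q"
      then have a: "gmult G \<gamma> (ginv G \<beta>) \<in> arr G" "gcod G (gmult G \<gamma> (ginv G \<beta>)) = gcod G \<gamma>"
        using \<gamma> by (simp_all add: mult_arr inv_arr cod_inv cod_mult)
      have "conv G f h (gmult G \<gamma> (ginv G \<beta>)) = (\<Sum>\<alpha>\<in>?P. f \<alpha> * h (gmult G (ginv G \<alpha>) (gmult G \<gamma> (ginv G \<beta>))))"
        using conv_eq_left[OF a(1) f] a(2) by simp
      also have "\<dots> = (\<Sum>\<alpha>\<in>?P. f \<alpha> * h (gmult G (gmult G (ginv G \<alpha>) \<gamma>) (ginv G \<beta>)))"
        using \<beta> \<gamma> by (intro sum.cong) (auto simp: mult_assoc inv_arr cod_inv dom_inv)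
      finally show "conv G f h (gmult G \<gamma> (ginv G \<beta>)) * k \<beta> =
          (\<Sum>\<alpha>\<in>?P. f \<alpha> * h (gmult G (gmult G (ginv G \<alpha>) \<gamma>) (ginv G \<beta>)) * k \<beta>)"
        by (simp add: sum_distrib_right)
    qed
    also have "\<dots> = (\<Sum>\<alpha>\<in>?P. \<Sum>\<beta>\<in>?Q. f \<alpha> * h (gmult G (gmult G (ginv G \<alpha>) \<gamma>) (ginv G \<beta>)) * k \<beta>)"
      by (rule sum.swap)
    also have "\<dots> = (\<Sum>\<alpha>\<in>?P. f \<alpha> * conv G h k (gmult G (ginv G \<alpha>) \<gamma>))"
    proof (rule sum.cong[OF refl])
      fix \<alpha> assume \<alpha>: "\<alpha> \<in> ?P"
      then have a: "gmult G (ginv G \<alpha>) \<gamma> \<in> arr G" "gdom G (gmult G (ginv G \<alpha>) \<gamma>) = gdom G \<gamma>"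
        using \<gamma> by (simp_all add: mult_arr inv_arr dom_inv dom_mult)
      show "(\<Sum>\<beta>\<in>?Q. f \<alpha> * h (gmult G (gmult G (ginv G \<alpha>) \<gamma>) (ginv G \<beta>)) * k \<beta>) =
          f \<alpha> * conv G h k (gmult G (ginv G \<alpha>) \<gamma>)"
        using conv_eq_right[OF a(1) k, of h] a(2) by (simp add: sum_distrib_left mult.assoc)
    qed
    also have "\<dots> = conv G f (conv G h k) \<gamma>" using conv_eq_left[OF \<gamma> f] by simp
    finally show ?thesis .
  qed (simp add: conv_outside)
qed

lemma conv_add_left:
  assumes "fibre_finite G h"
  shows "conv G (\<lambda>\<gamma>. f \<gamma> + f' \<gamma>) h = (\<lambda>\<gamma>. conv G f h \<gamma> + conv G f' h \<gamma>)"
proof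
  fix \<gamma> show "conv G (\<lambda>\<gamma>. f \<gamma> + f' \<gamma>) h \<gamma> = conv G f h \<gamma> + conv G f' h \<gamma>"
    by (cases "\<gamma> \<in> arr G")
      (simp_all add: conv_eq_right[OF _ assms] conv_outside sum.distrib distrib_right)
qed

lemma conv_add_right:
  assumes "fibre_finite G f"
  shows "conv G f (\<lambda>\<gamma>. h \<gamma> + h' \<gamma>) = (\<lambda>\<gamma>. conv G f h \<gamma> + conv G f h' \<gamma>)"
proof
  fix \<gamma> show "conv G f (\<lambda>\<gamma>. h \<gamma> + h' \<gamma>) \<gamma> = conv G f h \<gamma> + conv G f h' \<gamma>"
    by (cases "\<gamma> \<in> arr G")
      (simp_all add: conv_eq_left[OF _ assms] conv_outside sum.distrib distrib_left)
qed

lemma conv_scale_left: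
  assumes "fibre_finite G h"
  shows "conv G (\<lambda>\<gamma>. c * f \<gamma>) h = (\<lambda>\<gamma>. c * conv G f h \<gamma>)"
proof
  fix \<gamma> show "conv G (\<lambda>\<gamma>. c * f \<gamma>) h \<gamma> = c * conv G f h \<gamma>"
    by (cases "\<gamma> \<in> arr G")
      (simp_all add: conv_eq_right[OF _ assms] conv_outside sum_distrib_left mult.assoc)
qed

lemma conv_scale_right:
  assumes "fibre_finite G f"
  shows "conv G f (\<lambda>\<gamma>. c * h \<gamma>) = (\<lambda>\<gamma>. c * conv G f h \<gamma>)"
proof
  fix \<gamma> show "conv G f (\<lambda>\<gamma>. c * h \<gamma>) \<gamma> = c * conv G f h \<gamma>"
    by (cases "\<gamma> \<in> arr G")
      (simp_all add: conv_eq_left[OF _ assms] conv_outside sum_distrib_left mult.left_commute)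
qed

lemma conv_star:
  "(\<lambda>\<gamma>. if \<gamma> \<in> arr G then cnj (conv G f h (ginv G \<gamma>)) else 0) =
    conv G (\<lambda>\<gamma>. if \<gamma> \<in> arr G then cnj (h (ginv G \<gamma>)) else 0)
      (\<lambda>\<gamma>. if \<gamma> \<in> arr G then cnj (f (ginv G \<gamma>)) else 0)"
proof
  fix \<gamma>
  let ?h = "\<lambda>\<gamma>. if \<gamma> \<in> arr G then cnj (h (ginv G \<gamma>)) else 0"
  let ?f = "\<lambda>\<gamma>. if \<gamma> \<in> arr G then cnj (f (ginv G \<gamma>)) else 0"
  show "(if \<gamma> \<in> arr G then cnj (conv G f h (ginv G \<gamma>)) else 0) = conv G ?h ?f \<gamma>"
  proof (cases "\<gamma> \<in> arr G")
    case \<gamma>: True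
    let ?i = "\<lambda>(\<alpha>, \<beta>). (ginv G \<beta>, ginv G \<alpha>)"
    have "cnj (conv G f h (ginv G \<gamma>)) = conv G ?h ?f \<gamma>"
      unfolding conv_def cnj_sum
      by (rule sum.reindex_bij_witness[where i = ?i and j = ?i])
        (auto simp: inv_arr inv_inv cod_inv dom_inv inv_mult[symmetric] \<gamma>)
    then show ?thesis using \<gamma> by simp
  qed (simp add: conv_outside)
qed

lemma fibre_finite_add:
  assumes "fibre_finite G f" "fibre_finite G h"
  shows "fibre_finite G (\<lambda>\<gamma>. f \<gamma> + h \<gamma>)"
proof -
  have "finite {\<alpha> \<in> arr G. gcod G \<alpha> = x \<and> f \<alpha> + h \<alpha> \<noteq> 0}" for x
    by (rule finite_subset[of _ "{\<alpha> \<in> arr G. gcod G \<alpha> = x \<and> f \<alpha> \<noteq> 0} \<union> {\<alpha> \<in> arr G. gcod G \<alpha> = x \<and> h \<alpha> \<noteq> 0}"])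
      (use assms in \<open>auto simp: fibre_finite_def\<close>)
  moreover have "finite {\<alpha> \<in> arr G. gdom G \<alpha> = x \<and> f \<alpha> + h \<alpha> \<noteq> 0}" for x
    by (rule finite_subset[of _ "{\<alpha> \<in> arr G. gdom G \<alpha> = x \<and> f \<alpha> \<noteq> 0} \<union> {\<alpha> \<in> arr G. gdom G \<alpha> = x \<and> h \<alpha> \<noteq> 0}"])
      (use assms in \<open>auto simp: fibre_finite_def\<close>)
  ultimately show ?thesis using assms by (simp add: fibre_finite_def)
qed

end

lemma conv_algebra_ops:
  "azero (convolution_algebra \<Gamma>) = (\<lambda>_. 0)"
  "aadd (convolution_algebra \<Gamma>) f h = (\<lambda>\<gamma>. f \<gamma> + h \<gamma>)"
  "ascale (convolution_algebra \<Gamma>) c f = (\<lambda>\<gamma>. c * f \<gamma>)"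
  "amult (convolution_algebra \<Gamma>) f h = conv \<Gamma> f h"
  "astar (convolution_algebra \<Gamma>) f = (\<lambda>\<gamma>. if \<gamma> \<in> arr \<Gamma> then cnj (f (ginv \<Gamma> \<gamma>)) else 0)"
  by (simp_all add: convolution_algebra_def conv_def fun_eq_iff)

lemma conv_algebra_carrier_add_Cc:
  assumes f: "f \<in> carrier (convolution_algebra \<Gamma>)" and h: "open_bisection \<Gamma> U" "h \<in> Cc_on \<Gamma> U"
  shows "(\<lambda>\<gamma>. f \<gamma> + h \<gamma>) \<in> carrier (convolution_algebra \<Gamma>)"
proof -
  obtain F c where F: "finite F" "F \<subseteq> (\<Union>U\<in>Collect (open_bisection \<Gamma>). Cc_on \<Gamma> U)"
    "f = (\<lambda>\<gamma>. \<Sum>k\<in>F. c k * k \<gamma>)"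
    using f by (auto simp: convolution_algebra_def)
  \<comment> \<open>If \<open>h\<close> already occurs in \<open>F\<close>, its coefficient is
    raised by one.\<close>
  let ?c = "\<lambda>k. (if k \<in> F then c k else 0) + (if k = h then 1 else 0)"
  have "(\<Sum>k\<in>insert h F. ?c k * k \<gamma>) = f \<gamma> + h \<gamma>" for \<gamma>
  proof -
    have "(\<Sum>k\<in>insert h F. ?c k * k \<gamma>) =
        (\<Sum>k\<in>insert h F. (if k \<in> F then c k * k \<gamma> else 0)) + (\<Sum>k\<in>insert h F. if k = h then k \<gamma> else 0)"
      unfolding sum.distrib[symmetric] by (intro sum.cong) (auto simp: distrib_right)
    also have "(\<Sum>k\<in>insert h F. (if k \<in> F then c k * k \<gamma> else 0)) = (\<Sum>k\<in>F. c k * k \<gamma>)"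
      using F(1) by (intro sum.mono_neutral_cong_right) auto
    also have "(\<Sum>k\<in>insert h F. if k = h then k \<gamma> else 0) = h \<gamma>" using F(1) by simp
    finally show ?thesis by (simp add: F(3))
  qed
  then show ?thesis using F(1,2) h
    by (auto simp: convolution_algebra_def intro!: exI[of _ "insert h F"] exI[of _ ?c])
qed

section \<open>The convolution algebra of the groupoid of germs\<close>

context finite_self_similar_action
begin

sublocale germs: groupoid \<Gamma> by (rule germ_groupoid)

abbreviation "CA \<equiv> convolution_algebra \<Gamma>"

text \<open>A function on a basic bisection, carried to the path space by the source map. Taking
  \<open>\<phi>\<close> on all paths lets functions on different bisections be handled by the same
  operations.\<close>

definition T :: "'e list \<times> 'g \<times> 'e list \<Rightarrow> ('e word \<Rightarrow> complex) \<Rightarrow> ('e, 'g) germ_tuple set \<Rightarrow> complex" where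
  "T \<tau> \<phi> \<gamma> = (if \<gamma> \<in> Zc \<tau> then \<phi> (gdom \<Gamma> \<gamma>) else 0)"

lemma gdom_IP: "\<gamma> \<in> arr \<Gamma> \<Longrightarrow> gdom \<Gamma> \<gamma> \<in> IP" and gcod_IP: "\<gamma> \<in> arr \<Gamma> \<Longrightarrow> gcod \<Gamma> \<gamma> \<in> IP"
  using germs.dom_closed germs.cod_closed by simp_all

lemma T_cong:
  assumes "valid \<tau>" "\<And>x. x \<in> IP \<Longrightarrow> \<phi> x = \<psi> x"
  shows "T \<tau> \<phi> = T \<tau> \<psi>"
  unfolding T_def by (rule ext) (use assms gdom_IP Zc_arr[OF assms(1)] in auto)

lemma T_Cc:
  assumes \<tau>: "valid \<tau>" and \<phi>: "cont \<phi>"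
  shows "T \<tau> \<phi> \<in> Cc_on \<Gamma> (Zc \<tau>)"
proof -
  have ts: "topspace (subtopology (atop \<Gamma>) (Zc \<tau>)) = Zc \<tau>"
    using Zc_arr[OF \<tau>] by (auto simp: topspace_subtopology)
  have "openin (subtopology (atop \<Gamma>) (Zc \<tau>)) {\<gamma> \<in> Zc \<tau>. T \<tau> \<phi> \<gamma> \<in> S}" if S: "open S" for S
  proof -
    have "openin (otop \<Gamma>) {x \<in> IP. \<phi> x \<in> S}"
      unfolding openin_otop_iff using contD[OF \<phi> _ S] by blast
    then have "openin (atop \<Gamma>) {\<gamma> \<in> Zc \<tau>. gdom \<Gamma> \<gamma> \<in> {x \<in> IP. \<phi> x \<in> S}}"
      by (rule open_preimages[OF \<tau>])
    also have "{\<gamma> \<in> Zc \<tau>. gdom \<Gamma> \<gamma> \<in> {x \<in> IP. \<phi> x \<in> S}} = {\<gamma> \<in> Zc \<tau>. T \<tau> \<phi> \<gamma> \<in> S}"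
      using germs.dom_closed Zc_arr[OF \<tau>] by (auto simp: T_def)
    finally show ?thesis using openin_Zc[OF \<tau>] by (auto simp: openin_open_subtopology)
  qed
  then have "continuous_map (subtopology (atop \<Gamma>) (Zc \<tau>)) euclidean (T \<tau> \<phi>)"
    unfolding continuous_map_def ts by simp
  then show ?thesis unfolding Cc_on_def using compactin_Zc[OF \<tau>] by (auto simp: T_def)
qed

text \<open>The least such \<open>M\<close> dominates every \<open>C\<^sup>*\<close>-seminorm. It therefore bounds the universal norm and
  also measures approximation.\<close>

inductive bd :: "(('e, 'g) germ_tuple set \<Rightarrow> complex) \<Rightarrow> real \<Rightarrow> bool" where
  zero: "0 \<le> M \<Longrightarrow> bd (\<lambda>_. 0) M"
| add: "bd f M \<Longrightarrow> valid \<tau> \<Longrightarrow> cont \<phi> \<Longrightarrow> \<forall>x\<in>IP. norm (\<phi> x) \<le> K \<Longrightarrow> 0 \<le> K \<Longrightarrow>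
    bd (\<lambda>\<gamma>. f \<gamma> + T \<tau> \<phi> \<gamma>) (M + K)"

lemma bd_nonneg: "bd f M \<Longrightarrow> 0 \<le> M"
  by (induction rule: bd.induct) auto

lemma bd_mono: "bd f M \<Longrightarrow> M \<le> M' \<Longrightarrow> bd f M'"
proof (induction arbitrary: M' rule: bd.induct)
  case (zero M)
  then show ?case by (intro bd.zero) simp
next
  case (add f M \<tau> \<phi> K)
  have "bd f (M' - K)" using add.prems by (intro add.IH) simp
  from bd.add[OF this add.hyps(2-5)] show ?case by simp
qed

lemma bd_T: "valid \<tau> \<Longrightarrow> cont \<phi> \<Longrightarrow> \<forall>x\<in>IP. norm (\<phi> x) \<le> K \<Longrightarrow> 0 \<le> K \<Longrightarrow> bd (T \<tau> \<phi>) K"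
  using bd.add[OF bd.zero[of 0], of \<tau> \<phi> K] by simp

lemma bd_add: "bd f M \<Longrightarrow> bd h M' \<Longrightarrow> bd (\<lambda>\<gamma>. f \<gamma> + h \<gamma>) (M + M')"
proof (rotate_tac, induction rule: bd.induct)
  case (zero M')
  then show ?case using bd_mono[of f M "M + M'"] by simp
next
  case (add h M' \<tau> \<phi> K)
  from bd.add[OF add.IH[OF add.prems] add.hyps(2-5)] show ?case by (simp add: add.assoc)
qed

lemma T_scale: "T \<tau> (\<lambda>x. c * \<phi> x) = (\<lambda>\<gamma>. c * T \<tau> \<phi> \<gamma>)"
  by (auto simp: T_def)

lemma bd_scale: "bd f M \<Longrightarrow> bd (\<lambda>\<gamma>. c * f \<gamma>) (norm c * M)"
proof (induction rule: bd.induct)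
  case (zero M)
  then show ?case using bd.zero[of "norm c * M"] by simp
next
  case (add f M \<tau> \<phi> K)
  have "bd (\<lambda>\<gamma>. c * f \<gamma> + T \<tau> (\<lambda>x. c * \<phi> x) \<gamma>) (norm c * M + norm c * K)"
    using add by (intro bd.add cont_mult cont_const) (auto simp: norm_mult mult_left_mono)
  then show ?case by (simp add: T_scale distrib_left)
qed

lemma bd_sum:
  assumes "finite I" "\<And>i. i \<in> I \<Longrightarrow> \<exists>M. bd (f i) M"
  shows "\<exists>M. bd (\<lambda>\<gamma>. \<Sum>i\<in>I. f i \<gamma>) M"
  using assms
proof (induction I)
  case empty
  then show ?case using bd.zero[of 0] by auto
next
  case (insert i I)
  then show ?case using bd_add[of "f i" _ "\<lambda>\<gamma>. \<Sum>i\<in>I. f i \<gamma>"] by fastforce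
qed

lemma bd_carrier: "bd f M \<Longrightarrow> f \<in> carrier CA"
proof (induction rule: bd.induct)
  case (zero M)
  then show ?case by (auto simp: convolution_algebra_def intro!: exI[of _ "{}"])
next
  case (add f M \<tau> \<phi> K)
  show ?case
    by (rule conv_algebra_carrier_add_Cc[OF add.IH open_bisection_Zc[OF add.hyps(2)] T_Cc[OF add.hyps(2,3)]])
qed

text \<open>The part of \<open>f\<close> over the cylinder of a path, for bar induction on the
  source.\<close>

definition cutoff :: "'v \<Rightarrow> 'e list \<Rightarrow> (('e, 'g) germ_tuple set \<Rightarrow> complex) \<Rightarrow> ('e, 'g) germ_tuple set \<Rightarrow> complex" where
  "cutoff v es f \<gamma> = (if \<gamma> \<in> arr \<Gamma> \<and> ir (gdom \<Gamma> \<gamma>) = v \<and> prefix (length es) (gdom \<Gamma> \<gamma>) = es then f \<gamma> else 0)"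

lemma cutoff_step:
  assumes w: "walk E v es w"
  shows "cutoff v es f \<gamma> = (\<Sum>e\<in>in_arcs E w. cutoff v (es @ [e]) f \<gamma>)"
proof (cases "\<gamma> \<in> arr \<Gamma> \<and> ir (gdom \<Gamma> \<gamma>) = v \<and> prefix (length es) (gdom \<Gamma> \<gamma>) = es")
  case True
  let ?x = "gdom \<Gamma> \<gamma>"
  let ?e = "?x (length es)"
  have x: "?x \<in> IP" using True germs.dom_closed by auto
  have "walk E v es (ir (suffix (length es) ?x))" using walk_prefix[OF x, of "length es"] True by simp
  then have "ir (suffix (length es) ?x) = w" by (rule walk_end_unique[OF _ w])
  then have e: "?e \<in> in_arcs E w" using IP_arc[OF x] by (simp add: irange_def)
  have "(\<Sum>e\<in>in_arcs E w. cutoff v (es @ [e]) f \<gamma>) = (\<Sum>e\<in>in_arcs E w. if e = ?e then f \<gamma> else 0)"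
    using True by (intro sum.cong) (auto simp: cutoff_def prefix_Suc)
  then show ?thesis using e True by (simp add: cutoff_def)
next
  case False
  have "prefix (length (es @ [e])) (gdom \<Gamma> \<gamma>) = es @ [e] \<Longrightarrow> prefix (length es) (gdom \<Gamma> \<gamma>) = es" for e
    by (simp add: prefix_Suc)
  then have "cutoff v (es @ [e]) f \<gamma> = 0" for e using False unfolding cutoff_def by auto
  then show ?thesis using False by (auto simp: cutoff_def)
qed

lemma prefix_differ: "x \<noteq> y \<Longrightarrow> \<exists>N. prefix N x \<noteq> prefix N y"
  using prefix_eq_D[of x _ y] by (metis ext lessI)

text \<open>Bar induction on sources. If \<open>x\<close> is the source of an arrow of
  \<open>U\<close>, then \<open>U\<close> contains a basic bisection over a cylinder around
  \<open>x\<close>, and injectivity of \<open>gdom\<close> on \<open>U\<close> leaves no other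
  arrows of \<open>U\<close> there. Otherwise the compact support has no arrow with source
  \<open>x\<close>, hence none with source near \<open>x\<close>. Arguing over the sources avoids
  separating arrows, which a non-Hausdorff space may not allow.\<close>

lemma Cc_bd:
  assumes U: "open_bisection \<Gamma> U" and f: "f \<in> Cc_on \<Gamma> U"
  shows "\<exists>M. bd f M"
proof -
  obtain K where K: "K \<subseteq> U" "compactin (atop \<Gamma>) K" "\<And>\<gamma>. \<gamma> \<notin> K \<Longrightarrow> f \<gamma> = 0"
    and fc: "continuous_map (subtopology (atop \<Gamma>) U) euclidean f"
    using f by (auto simp: Cc_on_def)
  have Uo: "openin (atop \<Gamma>) U" and inj: "inj_on (gdom \<Gamma>) U"
  proof -
    show o: "openin (atop \<Gamma>) U" using U by (simp add: open_bisection_def)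
    have "topspace (subtopology (atop \<Gamma>) U) = U"
      using openin_subset[OF o] by (auto simp: topspace_subtopology)
    moreover have "homeomorphic_map (subtopology (atop \<Gamma>) U) (subtopology (otop \<Gamma>) (gdom \<Gamma> ` U)) (gdom \<Gamma>)"
      using U by (simp add: open_bisection_def)
    ultimately show "inj_on (gdom \<Gamma>) U" using homeomorphic_imp_injective_map by metis
  qed
  have Ka: "K \<subseteq> arr \<Gamma>" using compactin_subset_topspace[OF K(2)] by simp
  have fopen: "openin (atop \<Gamma>) {\<gamma> \<in> U. f \<gamma> \<in> S}" if "open S" for S
  proof -
    have ts: "topspace (subtopology (atop \<Gamma>) U) = U"
      using openin_subset[OF Uo] by (auto simp: topspace_subtopology)
    have "openin (subtopology (atop \<Gamma>) U) {\<gamma> \<in> U. f \<gamma> \<in> S}"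
      using fc that unfolding continuous_map_def ts by auto
    then show ?thesis using openin_open_subtopology[OF Uo] by blast
  qed
  have root: "\<exists>M. bd (cutoff v [] f) M" for v
  proof (rule path_bar_induct[where v = v and Q = "\<lambda>es. \<exists>M. bd (cutoff v es f) M"])
    fix es w assume w: "walk E v es w" and "\<And>e. e \<in> in_arcs E w \<Longrightarrow> \<exists>M. bd (cutoff v (es @ [e]) f) M"
    moreover have "cutoff v es f = (\<lambda>\<gamma>. \<Sum>e\<in>in_arcs E w. cutoff v (es @ [e]) f \<gamma>)"
      by (rule ext) (rule cutoff_step[OF w])
    ultimately show "\<exists>M. bd (cutoff v es f) M"
      using bd_sum[of "in_arcs E w" "\<lambda>e. cutoff v (es @ [e]) f"] by (simp only: finite_in_arcs)
  next
    fix x assume x: "x \<in> IP" "ir x = v"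
    show "\<exists>N M. bd (cutoff v (prefix N x) f) M"
    proof (cases "x \<in> gdom \<Gamma> ` U")
      case True
      then obtain \<gamma> where \<gamma>: "\<gamma> \<in> U" "gdom \<Gamma> \<gamma> = x" by blast
      have "\<gamma> \<in> arr \<Gamma>" using \<gamma> openin_subset[OF Uo] by auto
      then obtain m g n z where z: "vp m g n z" "\<gamma> = arrow m g n z" by (rule arr_cases)
      obtain j where j: "valid (rz (m, g, n) (prefix j z))" "Zc (rz (m, g, n) (prefix j z)) \<subseteq> U"
        using open_Zc[OF z(1) Uo] \<gamma> z by (auto simp: Let_def)
      obtain m' g' n' where t: "rz (m, g, n) (prefix j z) = (m', g', n')" by (metis prod_cases3)
      have n': "n' = n @ prefix j z" using t by (simp add: rz_def)
      have xz: "x = n' \<frown> suffix j z"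
      proof -
        have "x = n \<frown> z" using \<gamma>(2) z by simp
        also have "\<dots> = n' \<frown> suffix j z" unfolding n' using prefix_suffix[of z j] by (metis conc_conc)
        finally show ?thesis .
      qed
      note val = j(1)[unfolded t]
      note ZU = j(2)[unfolded t]
      have dx: "ir (suffix j z) = dm g'"
      proof -
        have "z = prefix j z \<frown> suffix j z" by (simp add: prefix_suffix)
        then have "vp m g n (prefix j z \<frown> suffix j z)" using z(1) by simp
        from vp_raise[OF this] show ?thesis using t by (simp add: rz_def vp_def)
      qed
      have wv: "walk E v n' (dm g')" using conc_IP_walk[of n' "suffix j z"] x xz dx by simp
      define \<phi> where "\<phi> y = (if y \<in> pcone n' (dm g') then f (arrow m' g' n' (suffix (length n') y)) else 0)" for y
      have c\<phi>: "cont \<phi>"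
        unfolding cont_def
      proof
        fix y assume y: "y \<in> IP"
        show "(\<phi> \<longlongrightarrow> \<phi> y) (path_nhds y)"
        proof (cases "y \<in> pcone n' (dm g')")
          case True
          then obtain w where w: "y = n' \<frown> w" "w \<in> IP" "ir w = dm g'" by (auto simp: pcone_def)
          have vw: "vp m' g' n' w" using val w by (simp add: vp_def)
          have \<phi>w: "\<phi> (n' \<frown> u) = f (arrow m' g' n' u)" if "u \<in> IP" "ir u = dm g'" for u
            using that by (auto simp: \<phi>_def pcone_def)
          show ?thesis
          proof (rule topological_tendstoI)
            fix S assume S: "open S" "\<phi> y \<in> S"
            then have "arrow m' g' n' w \<in> {\<gamma> \<in> U. f \<gamma> \<in> S}"
              using ZU ZcI[OF vw] \<phi>w w by auto
            then obtain N where N: "\<forall>u\<in>IP. prefix N u = prefix N w \<longrightarrow> ir u = ir w \<longrightarrow>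
                arrow m' g' n' u \<in> {\<gamma> \<in> U. f \<gamma> \<in> S}"
              using open_local[OF vw fopen[OF S(1)]] by blast
            have "\<phi> u \<in> S" if u: "u \<in> IP" "prefix (Suc (length n') + N) u = prefix (Suc (length n') + N) y" for u
            proof -
              have "prefix (Suc (length n')) u = prefix (Suc (length n')) (n' \<frown> w)"
                using prefix_mono[OF u(2), of "Suc (length n')"] w(1) by simp
              then obtain u' where u': "u = n' \<frown> u'" "u' \<in> IP" "ir u' = ir w"
                using pcone_prefix[of n' w u] y u w by auto
              have "prefix (length n' + N) u = prefix (length n' + N) y" using prefix_mono[OF u(2)] by simp
              then have "prefix N u' = prefix N w" unfolding u'(1) w(1) prefix_conc_add by simp
              then show ?thesis using N u' \<phi>w w by auto
            qed
            then show "eventually (\<lambda>u. \<phi> u \<in> S) (path_nhds y)" unfolding eventually_path_nhds by blast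
          qed
        next
          case False
          then have "eventually (\<lambda>u. 0 = \<phi> u) (path_nhds y)"
            unfolding eventually_path_nhds using not_pcone_local[OF y False]
            by (intro exI[of _ "Suc (length n')"]) (auto simp: \<phi>_def)
          moreover have "\<phi> y = 0" using False by (simp add: \<phi>_def)
          ultimately show ?thesis by (simp only: Lim_transform_eventually[OF tendsto_const])
        qed
      qed
      have "cutoff v n' f = T (m', g', n') \<phi>"
      proof
        fix \<delta>
        show "cutoff v n' f \<delta> = T (m', g', n') \<phi> \<delta>"
        proof (cases "\<delta> \<in> Zc (m', g', n')")
          case True
          then obtain u where u: "vp m' g' n' u" "\<delta> = arrow m' g' n' u" using val by (rule ZcE)
          then have "n' \<frown> u \<in> pcone n' (dm g')" "ir (n' \<frown> u) = v"
            using ir_conc[of v n' u] wv by (auto simp: pcone_def vp_def)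
          then show ?thesis using True u by (simp add: cutoff_def T_def \<phi>_def)
        next
          case False
          have "cutoff v n' f \<delta> = 0"
          proof (rule ccontr)
            assume c: "cutoff v n' f \<delta> \<noteq> 0"
            then have \<delta>: "\<delta> \<in> arr \<Gamma>" "ir (gdom \<Gamma> \<delta>) = v" "prefix (length n') (gdom \<Gamma> \<delta>) = n'" "f \<delta> \<noteq> 0"
              by (auto simp: cutoff_def split: if_splits)
            then have \<delta>U: "\<delta> \<in> U" using K by blast
            obtain u where u: "gdom \<Gamma> \<delta> = n' \<frown> u" using \<delta>(3) prefix_eq_conc by metis
            have dI: "n' \<frown> u \<in> IP" using germs.dom_closed[OF \<delta>(1)] u by simp
            have "walk E v n' (ir u)" using conc_IP_walk[OF dI] \<delta>(2) u by simp
            then have "ir u = dm g'" by (rule walk_end_unique[OF _ wv])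
            then have vu: "vp m' g' n' u" using val conc_IP_suffix[OF dI] by (simp add: vp_def)
            then have "arrow m' g' n' u \<in> U" "gdom \<Gamma> (arrow m' g' n' u) = gdom \<Gamma> \<delta>"
              using ZU ZcI[OF vu] u by auto
            then have "\<delta> = arrow m' g' n' u" using inj \<delta>U by (simp add: inj_on_def)
            then show False using False ZcI[OF vu] by simp
          qed
          then show ?thesis using False by (simp add: T_def)
        qed
      qed
      moreover obtain M where "M \<ge> 0" "\<forall>x\<in>IP. norm (\<phi> x) \<le> M" using cont_bounded[OF c\<phi>] by blast
      ultimately have "bd (cutoff v n' f) M" using bd_T[OF val c\<phi>] by simp
      moreover have "n' = prefix (length n') x" using xz by simp
      ultimately show ?thesis by metis
    next
      case False
      \<comment> \<open>Open sets of arrows whose sources leave \<open>x\<close> within a fixed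
        number of edges; a finite subcover of the support gives one number for all of it.\<close>
      let ?C = "{W. openin (atop \<Gamma>) W \<and> (\<exists>N. \<forall>\<delta>\<in>W. prefix N (gdom \<Gamma> \<delta>) \<noteq> prefix N x)}"
      have "K \<subseteq> \<Union>?C"
      proof
        fix \<gamma> assume \<gamma>: "\<gamma> \<in> K"
        then have "gdom \<Gamma> \<gamma> \<noteq> x" using False K(1) by blast
        then obtain N where N: "prefix N (gdom \<Gamma> \<gamma>) \<noteq> prefix N x" using prefix_differ by blast
        obtain \<tau> where \<tau>: "valid \<tau>" "\<gamma> \<in> Zc \<tau>" using arr_Zc Ka \<gamma> by blast
        let ?V = "{y \<in> IP. prefix N y \<noteq> prefix N x}"
        have "openin (otop \<Gamma>) ?V" unfolding openin_otop_iff by (auto intro!: exI[of _ N])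
        then have "openin (atop \<Gamma>) {\<delta> \<in> Zc \<tau>. gdom \<Gamma> \<delta> \<in> ?V}" by (rule open_preimages[OF \<tau>(1)])
        moreover have "\<gamma> \<in> {\<delta> \<in> Zc \<tau>. gdom \<Gamma> \<delta> \<in> ?V}" using \<tau> N Ka \<gamma> germs.dom_closed[of \<gamma>] by auto
        ultimately show "\<gamma> \<in> \<Union>?C" by blast
      qed
      moreover have "Ball ?C (openin (atop \<Gamma>))" by blast
      ultimately have "\<exists>\<F>. finite \<F> \<and> \<F> \<subseteq> ?C \<and> K \<subseteq> \<Union>\<F>"
        using K(2) unfolding compactin_def by blast
      then obtain \<F> where \<F>: "finite \<F>" "\<F> \<subseteq> ?C" "K \<subseteq> \<Union>\<F>" by blast
      then obtain N where N: "\<And>W. W \<in> \<F> \<Longrightarrow> \<forall>\<delta>\<in>W. prefix (N W) (gdom \<Gamma> \<delta>) \<noteq> prefix (N W) x"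
        using bchoice[of \<F> "\<lambda>W N. \<forall>\<delta>\<in>W. prefix N (gdom \<Gamma> \<delta>) \<noteq> prefix N x"] by blast
      let ?N = "\<Sum>W\<in>\<F>. N W"
      have "cutoff v (prefix ?N x) f \<delta> = 0" for \<delta>
      proof (rule ccontr)
        assume "cutoff v (prefix ?N x) f \<delta> \<noteq> 0"
        then have \<delta>: "prefix ?N (gdom \<Gamma> \<delta>) = prefix ?N x" "f \<delta> \<noteq> 0" by (auto simp: cutoff_def split: if_splits)
        then have "\<delta> \<in> K" using K(3) by blast
        then obtain W where W: "W \<in> \<F>" "\<delta> \<in> W" using \<F>(3) by blast
        have "N W \<le> ?N" using W(1) \<F>(1) by (intro member_le_sum) auto
        then have "prefix (N W) (gdom \<Gamma> \<delta>) = prefix (N W) x" using prefix_mono[OF \<delta>(1)] by blast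
        then show False using N W by blast
      qed
      then have "cutoff v (prefix ?N x) f = (\<lambda>_. 0)" by blast
      then show ?thesis using bd.zero[of 0] by (metis order_refl)
    qed
  qed
  have "f \<gamma> = (\<Sum>v\<in>verts E. cutoff v [] f \<gamma>)" for \<gamma>
  proof (cases "\<gamma> \<in> arr \<Gamma>")
    case True
    then have "(\<Sum>v\<in>verts E. cutoff v [] f \<gamma>) = (\<Sum>v\<in>verts E. if v = ir (gdom \<Gamma> \<gamma>) then f \<gamma> else 0)"
      by (intro sum.cong) (auto simp: cutoff_def)
    then show ?thesis using True germs.dom_closed[OF True] by simp
  next
    case False
    then show ?thesis using K(3) Ka by (auto simp: cutoff_def)
  qed
  then have "f = (\<lambda>\<gamma>. \<Sum>v\<in>verts E. cutoff v [] f \<gamma>)" by blast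
  then show ?thesis using bd_sum[of "verts E" "\<lambda>v. cutoff v [] f"] root by simp
qed

text \<open>Induction on \<open>bd\<close> therefore covers the whole convolution algebra.\<close>

lemma CA_carrier: "f \<in> carrier CA \<longleftrightarrow> (\<exists>M. bd f M)"
proof
  assume "f \<in> carrier CA"
  then obtain F c where F: "finite F" "F \<subseteq> (\<Union>U\<in>Collect (open_bisection \<Gamma>). Cc_on \<Gamma> U)"
    "f = (\<lambda>\<gamma>. \<Sum>k\<in>F. c k * k \<gamma>)"
    by (auto simp: convolution_algebra_def)
  have "\<exists>M. bd (\<lambda>\<gamma>. c k * k \<gamma>) M" if k: "k \<in> F" for k
  proof -
    obtain U where "open_bisection \<Gamma> U" "k \<in> Cc_on \<Gamma> U" using F(2) k by blast
    then obtain M where "bd k M" using Cc_bd by blast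
    then show ?thesis using bd_scale by blast
  qed
  then show "\<exists>M. bd f M" unfolding F(3) by (rule bd_sum[OF F(1)])
qed (auto intro: bd_carrier)

end

section \<open>Products and adjoints of functions on basic bisections\<close>

context finite_self_similar_action
begin

lemma T_eqI:
  assumes "\<And>\<gamma>. \<gamma> \<in> Zc \<tau> \<Longrightarrow> \<phi> (gdom \<Gamma> \<gamma>) = \<psi> (gdom \<Gamma> \<gamma>)"
  shows "T \<tau> \<phi> = T \<tau> \<psi>"
  using assms by (auto simp: T_def)

lemma Zc_fibre_finite:
  assumes "valid \<tau>"
  shows "finite {\<beta> \<in> Zc \<tau>. gdom \<Gamma> \<beta> = x}" "finite {\<beta> \<in> Zc \<tau>. gcod \<Gamma> \<beta> = x}"
  using finite_vimage_IntI[OF _ inj_on_Zc(1)[OF assms], of "{x}"]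
    finite_vimage_IntI[OF _ inj_on_Zc(2)[OF assms], of "{x}"]
  by (simp_all add: vimage_def Int_def conj_commute)

lemma T_fibre_finite:
  assumes "valid \<tau>"
  shows "fibre_finite \<Gamma> (T \<tau> \<phi>)"
proof -
  have "finite {\<alpha> \<in> arr \<Gamma>. gcod \<Gamma> \<alpha> = x \<and> T \<tau> \<phi> \<alpha> \<noteq> 0}" for x
    by (rule finite_subset[OF _ Zc_fibre_finite(2)[OF assms, of x]]) (auto simp: T_def)
  moreover have "finite {\<alpha> \<in> arr \<Gamma>. gdom \<Gamma> \<alpha> = x \<and> T \<tau> \<phi> \<alpha> \<noteq> 0}" for x
    by (rule finite_subset[OF _ Zc_fibre_finite(1)[OF assms, of x]]) (auto simp: T_def)
  ultimately show ?thesis using Zc_arr[OF assms] by (auto simp: fibre_finite_def T_def)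
qed

lemma bd_fibre_finite: "bd f M \<Longrightarrow> fibre_finite \<Gamma> f"
proof (induction rule: bd.induct)
  case (zero M)
  then show ?case by (simp add: fibre_finite_def)
next
  case (add f M \<tau> \<phi> K)
  then show ?case by (intro germs.fibre_finite_add T_fibre_finite)
qed

definition Zprod :: "'e list \<times> 'g \<times> 'e list \<Rightarrow> 'e list \<times> 'g \<times> 'e list \<Rightarrow> ('e, 'g) germ_tuple set set" where
  "Zprod \<tau> \<tau>' = {gmult \<Gamma> \<alpha> \<beta> | \<alpha> \<beta>. \<alpha> \<in> Zc \<tau> \<and> \<beta> \<in> Zc \<tau>' \<and> gdom \<Gamma> \<alpha> = gcod \<Gamma> \<beta>}"

text \<open>The third list of the first triple is a prefix of the first list of the second. Raising
  the first triple by the rest \<open>k\<close> matches the two lists, and then the groupoid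
  elements multiply.\<close>

lemma Zprod_le:
  assumes \<tau>: "valid (m, g, n)" and \<tau>': "valid (n @ k, h, q)" and w: "walk E (dm g) k (cm h)"
  shows "valid (m @ la g k, gmult G (res g k) h, q)"
    "Zprod (m, g, n) (n @ k, h, q) = Zc (m @ la g k, gmult G (res g k) h, q)"
proof -
  let ?\<sigma> = "(m @ la g k, gmult G (res g k) h, q)"
  have g: "g \<in> arr G" "h \<in> arr G" using \<tau> \<tau>' by (auto simp: valid_def)
  note r = res_walk[OF g(1) w]
  show val: "valid ?\<sigma>" using \<tau> \<tau>' g r by (auto simp: valid_def walk_append)
  have key: "vp m g n (k \<frown> ia h z) \<and> vp (n @ k) h q z \<and>
      gmult \<Gamma> (arrow m g n (k \<frown> ia h z)) (arrow (n @ k) h q z) = arrow (m @ la g k) (gmult G (res g k) h) q z"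
    if z: "z \<in> IP" "ir z = dm h" for z
  proof -
    have vb: "vp (n @ k) h q z" using \<tau>' z by (simp add: vp_def)
    note v = vpD[OF vb]
    have va: "vp m g n (k \<frown> ia h z)"
      using \<tau> w v conc_IP[of "dm g" k "ia h z"] ir_conc[of "dm g" k "ia h z"] by (simp add: vp_def)
    show ?thesis
      using va vb gmult_arrow[OF vp_raise[OF va] vb] arrow_raise[OF va] by simp
  qed
  show "Zprod (m, g, n) (n @ k, h, q) = Zc ?\<sigma>"
  proof
    show "Zprod (m, g, n) (n @ k, h, q) \<subseteq> Zc ?\<sigma>"
    proof
      fix \<gamma> assume "\<gamma> \<in> Zprod (m, g, n) (n @ k, h, q)"
      then obtain \<alpha> \<beta> where ab: "\<gamma> = gmult \<Gamma> \<alpha> \<beta>" "\<alpha> \<in> Zc (m, g, n)" "\<beta> \<in> Zc (n @ k, h, q)"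
        "gdom \<Gamma> \<alpha> = gcod \<Gamma> \<beta>" by (auto simp: Zprod_def)
      obtain y where y: "vp m g n y" "\<alpha> = arrow m g n y" by (rule ZcE[OF ab(2) \<tau>])
      obtain z where z: "vp (n @ k) h q z" "\<beta> = arrow (n @ k) h q z" by (rule ZcE[OF ab(3) \<tau>'])
      have "n \<frown> y = n \<frown> (k \<frown> ia h z)" using ab(4) y z by simp
      then have yk: "y = k \<frown> ia h z" by (rule conc_eq_length) simp
      have zz: "z \<in> IP" "ir z = dm h" using z by (simp_all add: vp_def)
      have "\<gamma> = arrow (m @ la g k) (gmult G (res g k) h) q z"
        using key[OF zz] ab(1) y(2) z(2) yk by simp
      moreover have "vp (m @ la g k) (gmult G (res g k) h) q z"
        using val zz g r by (simp add: vp_def)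
      ultimately show "\<gamma> \<in> Zc ?\<sigma>" using ZcI by metis
    qed
    show "Zc ?\<sigma> \<subseteq> Zprod (m, g, n) (n @ k, h, q)"
    proof
      fix \<gamma> assume "\<gamma> \<in> Zc ?\<sigma>"
      then obtain z where z: "vp (m @ la g k) (gmult G (res g k) h) q z"
        "\<gamma> = arrow (m @ la g k) (gmult G (res g k) h) q z" using val by (rule ZcE)
      have "z \<in> IP" "ir z = dm h" using vpD[OF z(1)] g r by simp_all
      note k = key[OF this]
      have "gdom \<Gamma> (arrow m g n (k \<frown> ia h z)) = gcod \<Gamma> (arrow (n @ k) h q z)" using k by simp
      then show "\<gamma> \<in> Zprod (m, g, n) (n @ k, h, q)"
        using k z(2) ZcI unfolding Zprod_def by (metis (mono_tags, lifting) mem_Collect_eq)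
    qed
  qed
qed

definition flip :: "'e list \<times> 'g \<times> 'e list \<Rightarrow> 'e list \<times> 'g \<times> 'e list" where
  "flip = (\<lambda>(m, g, n). (n, ginv G g, m))"

lemma flip_valid: "valid \<tau> \<Longrightarrow> valid (flip \<tau>)"
  by (auto simp: valid_def flip_def)

lemma flip_flip: "valid \<tau> \<Longrightarrow> flip (flip \<tau>) = \<tau>"
  by (auto simp: valid_def flip_def)

lemma ginv_Zc:
  assumes "valid \<tau>" "\<gamma> \<in> Zc \<tau>"
  shows "ginv \<Gamma> \<gamma> \<in> Zc (flip \<tau>)"
proof -
  obtain m g n where t: "\<tau> = (m, g, n)" by (cases \<tau>)
  obtain z where z: "vp m g n z" "\<gamma> = arrow m g n z" by (rule ZcE[OF assms(2)[unfolded t] assms(1)[unfolded t]])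
  show ?thesis using ZcI[OF vp_inv[OF z(1)]] z by (simp add: t flip_def)
qed

lemma ginv_Zc_iff:
  assumes "valid \<tau>" "\<gamma> \<in> arr \<Gamma>"
  shows "ginv \<Gamma> \<gamma> \<in> Zc \<tau> \<longleftrightarrow> \<gamma> \<in> Zc (flip \<tau>)"
  using ginv_Zc[OF assms(1), of "ginv \<Gamma> \<gamma>"] ginv_Zc[OF flip_valid[OF assms(1)], of \<gamma>] flip_flip[OF assms(1)]
    germs.inv_inv[OF assms(2)] by auto

lemma Zprod_flip:
  assumes "valid \<tau>" "valid \<tau>'" "\<gamma> \<in> Zprod \<tau> \<tau>'"
  shows "\<gamma> \<in> arr \<Gamma>" "ginv \<Gamma> \<gamma> \<in> Zprod (flip \<tau>') (flip \<tau>)"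
proof -
  obtain \<alpha> \<beta> where ab: "\<gamma> = gmult \<Gamma> \<alpha> \<beta>" "\<alpha> \<in> Zc \<tau>" "\<beta> \<in> Zc \<tau>'" "gdom \<Gamma> \<alpha> = gcod \<Gamma> \<beta>"
    using assms by (auto simp: Zprod_def)
  then have arr: "\<alpha> \<in> arr \<Gamma>" "\<beta> \<in> arr \<Gamma>" using Zc_arr assms by blast+
  show "\<gamma> \<in> arr \<Gamma>" using arr ab by (simp add: germs.mult_arr)
  have "ginv \<Gamma> \<gamma> = gmult \<Gamma> (ginv \<Gamma> \<beta>) (ginv \<Gamma> \<alpha>)" using arr ab by (simp add: germs.inv_mult)
  then show "ginv \<Gamma> \<gamma> \<in> Zprod (flip \<tau>') (flip \<tau>)"
    unfolding Zprod_def using ab arr ginv_Zc[OF assms(1) ab(2)] ginv_Zc[OF assms(2) ab(3)]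
    by (intro CollectI exI[of _ "ginv \<Gamma> \<beta>"] exI[of _ "ginv \<Gamma> \<alpha>"]) (simp add: germs.dom_inv germs.cod_inv)
qed

lemma Zprod_eq:
  assumes \<tau>: "valid \<tau>" and \<tau>': "valid \<tau>'" and \<alpha>: "\<alpha> \<in> Zc \<tau>" and \<beta>: "\<beta> \<in> Zc \<tau>'"
    and d: "gdom \<Gamma> \<alpha> = gcod \<Gamma> \<beta>" and le: "length (snd (snd \<tau>)) \<le> length (fst \<tau>')"
  shows "\<exists>\<sigma>. valid \<sigma> \<and> Zprod \<tau> \<tau>' = Zc \<sigma>"
proof -
  obtain m g n p h q where t: "\<tau> = (m, g, n)" "\<tau>' = (p, h, q)" by (metis prod_cases3)
  note \<tau> = \<tau>[unfolded t] and \<tau>' = \<tau>'[unfolded t]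
  obtain y where y: "vp m g n y" "\<alpha> = arrow m g n y" by (rule ZcE[OF \<alpha>[unfolded t] \<tau>])
  obtain z where z: "vp p h q z" "\<beta> = arrow p h q z" by (rule ZcE[OF \<beta>[unfolded t] \<tau>'])
  note vy = vpD[OF y(1)] and vz = vpD[OF z(1)]
  have eq: "n \<frown> y = p \<frown> ia h z" using d y z by simp
  obtain k where k: "p = n @ k" "y = k \<frown> ia h z" using conc_eq_le[OF eq] le t by auto
  have "walk E (dm g) k (cm h)" using conc_IP_walk[of k "ia h z"] vy vz k by simp
  then show ?thesis using Zprod_le[OF \<tau> \<tau>'[unfolded k(1)]] unfolding t k(1) by blast
qed

text \<open>If the lists are nested the other way round, inversion exchanges the factors and reduces
  to \<open>Zprod_eq\<close>.\<close>

lemma Zprod_cases: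
  assumes \<tau>: "valid \<tau>" and \<tau>': "valid \<tau>'" and ne: "Zprod \<tau> \<tau>' \<noteq> {}"
  shows "\<exists>\<sigma>. valid \<sigma> \<and> Zprod \<tau> \<tau>' = Zc \<sigma>"
proof -
  obtain \<alpha> \<beta> where ab: "\<alpha> \<in> Zc \<tau>" "\<beta> \<in> Zc \<tau>'" "gdom \<Gamma> \<alpha> = gcod \<Gamma> \<beta>"
    using ne by (auto simp: Zprod_def)
  show ?thesis
  proof (cases "length (snd (snd \<tau>)) \<le> length (fst \<tau>')")
    case True
    then show ?thesis by (rule Zprod_eq[OF \<tau> \<tau>' ab])
  next
    case False
    note v = flip_valid[OF \<tau>] flip_valid[OF \<tau>']
    have "\<alpha> \<in> arr \<Gamma>" "\<beta> \<in> arr \<Gamma>" using ab Zc_arr \<tau> \<tau>' by blast+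
    then have d: "gdom \<Gamma> (ginv \<Gamma> \<beta>) = gcod \<Gamma> (ginv \<Gamma> \<alpha>)" using ab(3) by (simp add: germs.dom_inv germs.cod_inv)
    have "length (snd (snd (flip \<tau>'))) \<le> length (fst (flip \<tau>))"
      using False by (cases \<tau>; cases \<tau>') (simp add: flip_def)
    then obtain \<sigma> where \<sigma>: "valid \<sigma>" "Zprod (flip \<tau>') (flip \<tau>) = Zc \<sigma>"
      using Zprod_eq[OF v(2,1) ginv_Zc[OF \<tau>' ab(2)] ginv_Zc[OF \<tau> ab(1)] d] by blast
    have "\<gamma> \<in> Zprod \<tau> \<tau>' \<longleftrightarrow> \<gamma> \<in> Zc (flip \<sigma>)" for \<gamma>
    proof
      assume "\<gamma> \<in> Zprod \<tau> \<tau>'"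
      note f = Zprod_flip[OF \<tau> \<tau>' this]
      then show "\<gamma> \<in> Zc (flip \<sigma>)" using ginv_Zc_iff[OF \<sigma>(1) f(1)] \<sigma>(2) by blast
    next
      assume \<gamma>: "\<gamma> \<in> Zc (flip \<sigma>)"
      then have arr: "\<gamma> \<in> arr \<Gamma>" using Zc_arr flip_valid[OF \<sigma>(1)] by blast
      then have "ginv \<Gamma> \<gamma> \<in> Zprod (flip \<tau>') (flip \<tau>)" using ginv_Zc_iff[OF \<sigma>(1) arr] \<gamma> \<sigma>(2) by blast
      from Zprod_flip(2)[OF v(2,1) this] show "\<gamma> \<in> Zprod \<tau> \<tau>'"
        by (simp add: flip_flip[OF \<tau>] flip_flip[OF \<tau>'] germs.inv_inv[OF arr])
    qed
    then show ?thesis using flip_valid[OF \<sigma>(1)] by blast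
  qed
qed

lemma Zprod_gdom:
  assumes "valid \<tau>" "valid \<tau>'" "\<gamma> \<in> Zprod \<tau> \<tau>'"
  shows "\<exists>\<beta>\<in>Zc \<tau>'. gdom \<Gamma> \<beta> = gdom \<Gamma> \<gamma> \<and> gmult \<Gamma> \<gamma> (ginv \<Gamma> \<beta>) \<in> Zc \<tau> \<and>
    gdom \<Gamma> (gmult \<Gamma> \<gamma> (ginv \<Gamma> \<beta>)) = gcod \<Gamma> \<beta>"
proof -
  obtain \<alpha> \<beta> where ab: "\<gamma> = gmult \<Gamma> \<alpha> \<beta>" "\<alpha> \<in> Zc \<tau>" "\<beta> \<in> Zc \<tau>'" "gdom \<Gamma> \<alpha> = gcod \<Gamma> \<beta>"
    using assms by (auto simp: Zprod_def)
  then have "\<alpha> \<in> arr \<Gamma>" "\<beta> \<in> arr \<Gamma>" using Zc_arr assms by blast+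
  then show ?thesis using ab by (intro bexI[of _ \<beta>]) (simp_all add: germs.dom_mult)
qed

text \<open>\<open>gdom\<close> is injective on \<open>Zc \<tau>'\<close>, so a product decomposes
  in at most one way. The first function is evaluated at the range of the second factor, which
  \<open>pull\<close> transports to the source of the product.\<close>

lemma conv_T_T:
  assumes \<tau>: "valid \<tau>" and \<tau>': "valid \<tau>'"
  shows "conv \<Gamma> (T \<tau> \<phi>) (T \<tau>' \<psi>) =
    (\<lambda>\<gamma>. if \<gamma> \<in> Zprod \<tau> \<tau>' then pull \<tau>' \<phi> (gdom \<Gamma> \<gamma>) * \<psi> (gdom \<Gamma> \<gamma>) else 0)"
proof
  fix \<gamma>
  show "conv \<Gamma> (T \<tau> \<phi>) (T \<tau>' \<psi>) \<gamma> =
    (if \<gamma> \<in> Zprod \<tau> \<tau>' then pull \<tau>' \<phi> (gdom \<Gamma> \<gamma>) * \<psi> (gdom \<Gamma> \<gamma>) else 0)"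
  proof (cases "\<gamma> \<in> arr \<Gamma>")
    case \<gamma>: True
    let ?Q = "{\<beta> \<in> Zc \<tau>'. gdom \<Gamma> \<beta> = gdom \<Gamma> \<gamma>}"
    have eq: "conv \<Gamma> (T \<tau> \<phi>) (T \<tau>' \<psi>) \<gamma> = (\<Sum>\<beta>\<in>?Q. T \<tau> \<phi> (gmult \<Gamma> \<gamma> (ginv \<Gamma> \<beta>)) * T \<tau>' \<psi> \<beta>)"
      using Zc_fibre_finite(1)[OF \<tau>'] Zc_arr[OF \<tau>'] by (intro germs.conv_right[OF \<gamma>]) (auto simp: T_def)
    show ?thesis
    proof (cases "\<gamma> \<in> Zprod \<tau> \<tau>'")
      case True
      then obtain \<beta> where \<beta>: "\<beta> \<in> Zc \<tau>'" "gdom \<Gamma> \<beta> = gdom \<Gamma> \<gamma>" "gmult \<Gamma> \<gamma> (ginv \<Gamma> \<beta>) \<in> Zc \<tau>"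
          "gdom \<Gamma> (gmult \<Gamma> \<gamma> (ginv \<Gamma> \<beta>)) = gcod \<Gamma> \<beta>"
        using Zprod_gdom[OF \<tau> \<tau>'] by blast
      have "?Q = {\<beta>}" using \<beta> inj_on_Zc(1)[OF \<tau>'] by (auto simp: inj_on_def)
      then have "conv \<Gamma> (T \<tau> \<phi>) (T \<tau>' \<psi>) \<gamma> = \<phi> (gcod \<Gamma> \<beta>) * \<psi> (gdom \<Gamma> \<gamma>)"
        using eq \<beta> by (simp add: T_def)
      then show ?thesis using True pull_gdom[OF \<tau>' \<beta>(1)] \<beta>(2) by simp
    next
      case False
      have "T \<tau> \<phi> (gmult \<Gamma> \<gamma> (ginv \<Gamma> \<beta>)) = 0" if \<beta>: "\<beta> \<in> ?Q" for \<beta>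
      proof (rule ccontr)
        assume "T \<tau> \<phi> (gmult \<Gamma> \<gamma> (ginv \<Gamma> \<beta>)) \<noteq> 0"
        then have a: "gmult \<Gamma> \<gamma> (ginv \<Gamma> \<beta>) \<in> Zc \<tau>" by (auto simp: T_def split: if_splits)
        have b: "\<beta> \<in> arr \<Gamma>" using \<beta> Zc_arr[OF \<tau>'] by blast
        then have "gdom \<Gamma> (gmult \<Gamma> \<gamma> (ginv \<Gamma> \<beta>)) = gcod \<Gamma> \<beta>"
          "\<gamma> = gmult \<Gamma> (gmult \<Gamma> \<gamma> (ginv \<Gamma> \<beta>)) \<beta>"
          using \<beta> \<gamma> by (simp_all add: germs.dom_mult germs.inv_arr germs.cod_inv germs.dom_inv)
        then show False using False a \<beta> unfolding Zprod_def by blast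
      qed
      then show ?thesis using eq False by simp
    qed
  next
    case False
    have "Zprod \<tau> \<tau>' \<subseteq> arr \<Gamma>"
      using Zc_arr[OF \<tau>] Zc_arr[OF \<tau>'] by (auto simp: Zprod_def intro!: germs.mult_arr)
    then show ?thesis using False by (auto simp: germs.conv_outside)
  qed
qed

lemma T_mult:
  assumes "valid \<tau>" "valid \<tau>'" "valid \<sigma>" "Zprod \<tau> \<tau>' = Zc \<sigma>"
  shows "conv \<Gamma> (T \<tau> \<phi>) (T \<tau>' \<psi>) = T \<sigma> (\<lambda>x. pull \<tau>' \<phi> x * \<psi> x)"
  unfolding conv_T_T[OF assms(1,2)] assms(4) by (auto simp: T_def)

lemma T_star:
  assumes \<tau>: "valid \<tau>"
  shows "astar CA (T \<tau> \<phi>) = T (flip \<tau>) (\<lambda>x. cnj (pull (flip \<tau>) \<phi> x))"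
proof
  fix \<gamma>
  show "astar CA (T \<tau> \<phi>) \<gamma> = T (flip \<tau>) (\<lambda>x. cnj (pull (flip \<tau>) \<phi> x)) \<gamma>"
  proof (cases "\<gamma> \<in> arr \<Gamma>")
    case True
    then show ?thesis
      using ginv_Zc_iff[OF \<tau> True] pull_gdom[OF flip_valid[OF \<tau>], of \<gamma> \<phi>]
      by (simp add: conv_algebra_ops T_def germs.dom_inv)
  next
    case False
    then show ?thesis using Zc_arr[OF flip_valid[OF \<tau>]] by (auto simp: conv_algebra_ops T_def)
  qed
qed

lemma bd_conv_T:
  assumes \<tau>: "valid \<tau>" "cont \<phi>" "\<forall>x\<in>IP. norm (\<phi> x) \<le> K" "0 \<le> K"
    and \<tau>': "valid \<tau>'" "cont \<psi>" "\<forall>x\<in>IP. norm (\<psi> x) \<le> L" "0 \<le> L"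
  shows "bd (conv \<Gamma> (T \<tau> \<phi>) (T \<tau>' \<psi>)) (K * L)"
proof (cases "Zprod \<tau> \<tau>' = {}")
  case True
  then have "conv \<Gamma> (T \<tau> \<phi>) (T \<tau>' \<psi>) = (\<lambda>_. 0)" unfolding conv_T_T[OF \<tau>(1) \<tau>'(1)] by simp
  then show ?thesis using bd.zero \<tau> \<tau>' by simp
next
  case False
  then obtain \<sigma> where \<sigma>: "valid \<sigma>" "Zprod \<tau> \<tau>' = Zc \<sigma>" using Zprod_cases[OF \<tau>(1) \<tau>'(1)] by blast
  have "norm (pull \<tau>' \<phi> x * \<psi> x) \<le> K * L" if "x \<in> IP" for x
    using pull_bound[OF \<tau>'(1) \<tau>(3,4) that] \<tau>' that \<tau>(4) by (auto simp: norm_mult intro!: mult_mono)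
  then show ?thesis
    unfolding T_mult[OF \<tau>(1) \<tau>'(1) \<sigma>] using \<sigma> \<tau> \<tau>'
    by (intro bd_T cont_mult cont_pull) auto
qed

lemma conv_zero: "conv \<Gamma> (\<lambda>_. 0) h = (\<lambda>_. 0)" "conv \<Gamma> f (\<lambda>_. 0) = (\<lambda>_. 0)"
  by (auto simp: conv_def)

lemma bd_conv: "bd f M \<Longrightarrow> bd h L \<Longrightarrow> bd (conv \<Gamma> f h) (M * L)"
proof (induction rule: bd.induct)
  case (zero M)
  then show ?case using bd.zero[of "M * L"] bd_nonneg[of h L] by (simp add: conv_zero)
next
  case (add f M \<tau> \<phi> K)
  have "bd (conv \<Gamma> (T \<tau> \<phi>) h) (K * L)" using add.prems
  proof (induction rule: bd.induct)
    case (zero L)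
    then show ?case using bd.zero[of "K * L"] add.hyps by (simp add: conv_zero)
  next
    case (add h L \<tau>' \<psi> K')
    have "bd (\<lambda>\<gamma>. conv \<Gamma> (T \<tau> \<phi>) h \<gamma> + conv \<Gamma> (T \<tau> \<phi>) (T \<tau>' \<psi>) \<gamma>) (K * L + K * K')"
      by (rule bd_add[OF add.IH bd_conv_T]) fact+
    then show ?case
      using \<open>valid \<tau>\<close> by (simp add: germs.conv_add_right T_fibre_finite distrib_left)
  qed
  with add.IH[OF add.prems] have "bd (\<lambda>\<gamma>. conv \<Gamma> f h \<gamma> + conv \<Gamma> (T \<tau> \<phi>) h \<gamma>) (M * L + K * L)"
    by (rule bd_add)
  then show ?case
    using bd_fibre_finite[OF add.prems] by (simp add: germs.conv_add_left distrib_right)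
qed

lemma bd_star: "bd f M \<Longrightarrow> bd (astar CA f) M"
proof (induction rule: bd.induct)
  case (zero M)
  have "astar CA (\<lambda>_. 0) = (\<lambda>_. 0)" by (auto simp: conv_algebra_ops)
  then show ?case using bd.zero zero by simp
next
  case (add f M \<tau> \<phi> K)
  have v: "valid (flip \<tau>)" by (rule flip_valid[OF add.hyps(2)])
  have "bd (astar CA (T \<tau> \<phi>)) K"
    unfolding T_star[OF add.hyps(2)] using v add.hyps pull_bound[OF v add.hyps(4,5)]
    by (intro bd_T cont_cnj cont_pull) auto
  with add.IH have "bd (\<lambda>\<gamma>. astar CA f \<gamma> + astar CA (T \<tau> \<phi>) \<gamma>) (M + K)" by (rule bd_add)
  moreover have "(\<lambda>\<gamma>. astar CA f \<gamma> + astar CA (T \<tau> \<phi>) \<gamma>) = astar CA (\<lambda>\<gamma>. f \<gamma> + T \<tau> \<phi> \<gamma>)"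
    by (auto simp: conv_algebra_ops)
  ultimately show ?case by simp
qed

lemma carrier_fibre_finite: "f \<in> carrier CA \<Longrightarrow> fibre_finite \<Gamma> f"
  using CA_carrier bd_fibre_finite by blast

theorem CA_star_algebra: "star_algebra CA"
proof (intro star_algebra.intro)
  show "comm_group (additive_part CA)"
  proof (rule comm_groupI)
    fix f assume f: "f \<in> carrier (additive_part CA)"
    then obtain M where "bd f M" by (auto simp: additive_part_def CA_carrier)
    then have "\<exists>M. bd (\<lambda>\<gamma>. -1 * f \<gamma>) M" by (intro exI) (rule bd_scale)
    then show "\<exists>h\<in>carrier (additive_part CA). h \<otimes>\<^bsub>additive_part CA\<^esub> f = \<one>\<^bsub>additive_part CA\<^esub>"
      by (intro bexI[of _ "\<lambda>\<gamma>. -1 * f \<gamma>"]) (simp_all add: additive_part_def conv_algebra_ops CA_carrier)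
  next
    fix f h assume "f \<in> carrier (additive_part CA)" "h \<in> carrier (additive_part CA)"
    then show "f \<otimes>\<^bsub>additive_part CA\<^esub> h \<in> carrier (additive_part CA)"
      using bd_add by (auto simp: additive_part_def conv_algebra_ops CA_carrier) blast
  next
    show "\<one>\<^bsub>additive_part CA\<^esub> \<in> carrier (additive_part CA)"
      using bd.zero[of 0] by (auto simp: additive_part_def conv_algebra_ops CA_carrier)
  qed (simp_all add: additive_part_def conv_algebra_ops add_ac)
  fix f h k c assume f: "f \<in> carrier CA"
  note ff = carrier_fibre_finite[OF f]
  obtain M where M: "bd f M" using f CA_carrier by blast
  show "ascale CA c f \<in> carrier CA"
    using bd_scale[OF M] by (auto simp: CA_carrier conv_algebra_ops)
  show "astar CA f \<in> carrier CA" using bd_star[OF M] by (auto simp: CA_carrier)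
  show "astar CA (astar CA f) = f"
    using ff by (auto simp: conv_algebra_ops fun_eq_iff germs.inv_arr germs.inv_inv fibre_finite_def)
  show "astar CA (ascale CA c f) = ascale CA (cnj c) (astar CA f)"
    by (auto simp: conv_algebra_ops)
  assume h: "h \<in> carrier CA"
  note fh = carrier_fibre_finite[OF h]
  obtain L where L: "bd h L" using h CA_carrier by blast
  show "amult CA f h \<in> carrier CA" using bd_conv[OF M L] by (auto simp: CA_carrier conv_algebra_ops)
  show "amult CA (ascale CA c f) h = ascale CA c (amult CA f h)"
    by (simp add: conv_algebra_ops germs.conv_scale_left fh)
  show "amult CA f (ascale CA c h) = ascale CA c (amult CA f h)"
    by (simp add: conv_algebra_ops germs.conv_scale_right ff)
  show "astar CA (amult CA f h) = amult CA (astar CA h) (astar CA f)"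
    unfolding conv_algebra_ops by (rule germs.conv_star)
  assume k: "k \<in> carrier CA"
  note fk = carrier_fibre_finite[OF k]
  show "amult CA (amult CA f h) k = amult CA f (amult CA h k)"
    unfolding conv_algebra_ops
    by (rule germs.conv_assoc[OF ff fk])
  show "amult CA (aadd CA f h) k = aadd CA (amult CA f k) (amult CA h k)"
    by (simp add: conv_algebra_ops germs.conv_add_left fk)
  show "amult CA f (aadd CA h k) = aadd CA (amult CA f h) (amult CA f k)"
    by (simp add: conv_algebra_ops germs.conv_add_right ff)
qed (auto simp: conv_algebra_ops algebra_simps)

end

section \<open>Indicators, functions on the unit space, and the bound for all C*-seminorms\<close>

context finite_self_similar_action
begin

sublocale cvl: star_algebra CA by (rule CA_star_algebra)

definition chi :: "'e list \<times> 'g \<times> 'e list \<Rightarrow> ('e, 'g) germ_tuple set \<Rightarrow> complex" where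
  "chi \<tau> = T \<tau> (\<lambda>_. 1)"

lemma chi_indicator: "chi \<tau> = indicator (Zc \<tau>)"
  by (auto simp: chi_def T_def indicator_def)

lemma chi_carrier [simp]: "valid \<tau> \<Longrightarrow> chi \<tau> \<in> carrier CA"
  unfolding chi_def CA_carrier using bd_T[of \<tau> "\<lambda>_. 1" 1] cont_const by auto

lemma chi_mult:
  assumes "valid \<tau>" "valid \<tau>'" "valid \<sigma>" "Zprod \<tau> \<tau>' = Zc \<sigma>"
  shows "amult CA (chi \<tau>) (chi \<tau>') = chi \<sigma>"
  unfolding chi_def conv_algebra_ops T_mult[OF assms]
proof (rule T_eqI)
  fix \<gamma> assume "\<gamma> \<in> Zc \<sigma>"
  then have "\<gamma> \<in> Zprod \<tau> \<tau>'" unfolding assms(4) .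
  from Zprod_gdom[OF assms(1,2) this]
  obtain \<beta> where \<beta>: "\<beta> \<in> Zc \<tau>'" "gdom \<Gamma> \<beta> = gdom \<Gamma> \<gamma>" by blast
  show "pull \<tau>' (\<lambda>_. 1) (gdom \<Gamma> \<gamma>) * 1 = 1"
    unfolding \<beta>(2)[symmetric] pull_gdom[OF assms(2) \<beta>(1)] by simp
qed

lemma chi_mult_empty:
  assumes "valid \<tau>" "valid \<tau>'" "Zprod \<tau> \<tau>' = {}"
  shows "amult CA (chi \<tau>) (chi \<tau>') = azero CA"
  unfolding chi_def conv_algebra_ops conv_T_T[OF assms(1,2)] assms(3) by simp

lemma chi_star: "valid \<tau> \<Longrightarrow> astar CA (chi \<tau>) = chi (flip \<tau>)"
  unfolding chi_def T_star by (rule T_eqI) (simp add: pull_gdom flip_valid)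

lemma chi_matched:
  assumes "valid (m, g, n)" "valid (n, h, q)" "dm g = cm h"
  shows "amult CA (chi (m, g, n)) (chi (n, h, q)) = chi (m, gmult G g h, q)"
  using Zprod_le[of m g n "[]" h q] assms by (intro chi_mult) simp_all

lemma chi_append:
  assumes "valid (m, g, [])" "valid (k, h, q)" "walk E (dm g) k (cm h)"
  shows "amult CA (chi (m, g, [])) (chi (k, h, q)) = chi (m @ la g k, gmult G (res g k) h, q)"
  using Zprod_le[of m g "[]" k h q] assms by (intro chi_mult) simp_all

definition D :: "('e word \<Rightarrow> complex) \<Rightarrow> ('e, 'g) germ_tuple set \<Rightarrow> complex" where
  "D \<psi> \<gamma> = (if \<gamma> \<in> gunit \<Gamma> ` IP then \<psi> (gdom \<Gamma> \<gamma>) else 0)"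

lemma gunit_facts:
  assumes "x \<in> IP"
  shows "gunit \<Gamma> x \<in> arr \<Gamma>" "gdom \<Gamma> (gunit \<Gamma> x) = x" "gcod \<Gamma> (gunit \<Gamma> x) = x" "ginv \<Gamma> (gunit \<Gamma> x) = gunit \<Gamma> x"
  using assms germs.unit_arr germs.dom_unit germs.cod_unit germs.inv_unit by simp_all

lemma Zc_units:
  assumes "v \<in> verts E" "walk E u n v"
  shows "Zc (n, gunit G v, n) = gunit \<Gamma> ` pcone n v"
proof -
  have "arrow n (gunit G v) n z = gunit \<Gamma> (n \<frown> z)" if "z \<in> IP" "ir z = v" for z
    using unit_arrow_conc(1)[of n z] conc_IP[of u n z] that assms by simp
  then show ?thesis using assms(1) unfolding Zc_def pcone_def by (force simp: image_iff)
qed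

lemma valid_unit [simp]: "v \<in> verts E \<Longrightarrow> valid ([], gunit G v, [])"
  by (simp add: valid_def)

text \<open>The unit space is the disjoint union of one basic bisection per vertex. Finitely many
  vertices then place \<open>D \<psi>\<close> in the convolution algebra.\<close>

lemma D_eq_sum: "D \<psi> \<gamma> = (\<Sum>v\<in>verts E. T ([], gunit G v, []) \<psi> \<gamma>)"
proof (cases "\<gamma> \<in> gunit \<Gamma> ` IP")
  case True
  then obtain x where x: "x \<in> IP" "\<gamma> = gunit \<Gamma> x" by blast
  have units: "pcone [] v = {x \<in> IP. ir x = v}" for v by (auto simp: pcone_def)
  have "T ([], gunit G v, []) \<psi> \<gamma> = (if v = ir x then \<psi> x else 0)" if v: "v \<in> verts E" for v
  proof -
    have "\<gamma> \<in> Zc ([], gunit G v, []) \<longleftrightarrow> v = ir x"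
      using Zc_units[OF v, of v "[]"] x v gunit_facts(2) units by (auto simp: image_iff dest: arg_cong[of _ _ "gdom \<Gamma>"])
    then show ?thesis using x gunit_facts by (simp add: T_def)
  qed
  then have "(\<Sum>v\<in>verts E. T ([], gunit G v, []) \<psi> \<gamma>) = (\<Sum>v\<in>verts E. if v = ir x then \<psi> x else 0)"
    by (intro sum.cong) auto
  then show ?thesis using x gunit_facts by (simp add: D_def)
next
  case False
  have "T ([], gunit G v, []) \<psi> \<gamma> = 0" if v: "v \<in> verts E" for v
    using Zc_units[OF v, of v "[]"] False by (auto simp: T_def pcone_def)
  then show ?thesis using False by (simp add: D_def)
qed

lemma D_carrier [simp]:
  assumes "cont \<psi>"
  shows "D \<psi> \<in> carrier CA"
proof -
  obtain K where K: "K \<ge> 0" "\<forall>x\<in>IP. norm (\<psi> x) \<le> K" using cont_bounded[OF assms] by blast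
  have "\<exists>M. bd (T ([], gunit G v, []) \<psi>) M" if "v \<in> verts E" for v
    using bd_T[OF valid_unit[OF that] assms K(2,1)] by blast
  then have "\<exists>M. bd (\<lambda>\<gamma>. \<Sum>v\<in>verts E. T ([], gunit G v, []) \<psi> \<gamma>) M" by (intro bd_sum) auto
  then show ?thesis unfolding CA_carrier D_eq_sum[abs_def] .
qed

lemma D_cong: "(\<And>x. x \<in> IP \<Longrightarrow> \<phi> x = \<psi> x) \<Longrightarrow> D \<phi> = D \<psi>"
  by (rule ext) (auto simp: D_def gunit_facts(2))

lemma conv_D_right:
  assumes "\<gamma> \<in> arr \<Gamma>"
  shows "conv \<Gamma> f (D \<psi>) \<gamma> = f \<gamma> * \<psi> (gdom \<Gamma> \<gamma>)"
proof -
  have x: "gdom \<Gamma> \<gamma> \<in> IP" using gdom_IP[OF assms] .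
  have "conv \<Gamma> f (D \<psi>) \<gamma> = (\<Sum>\<beta>\<in>{gunit \<Gamma> (gdom \<Gamma> \<gamma>)}. f (gmult \<Gamma> \<gamma> (ginv \<Gamma> \<beta>)) * D \<psi> \<beta>)"
    using x gunit_facts by (intro germs.conv_right[OF assms]) (auto simp: D_def split: if_splits)
  then show ?thesis using x gunit_facts germs.mult_unit_right[OF assms] by (simp add: D_def)
qed

lemma conv_D_left:
  assumes "\<gamma> \<in> arr \<Gamma>"
  shows "conv \<Gamma> (D \<psi>) f \<gamma> = \<psi> (gcod \<Gamma> \<gamma>) * f \<gamma>"
proof -
  have x: "gcod \<Gamma> \<gamma> \<in> IP" using gcod_IP[OF assms] .
  have "conv \<Gamma> (D \<psi>) f \<gamma> = (\<Sum>\<beta>\<in>{gunit \<Gamma> (gcod \<Gamma> \<gamma>)}. D \<psi> \<beta> * f (gmult \<Gamma> (ginv \<Gamma> \<beta>) \<gamma>))"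
    using x gunit_facts by (intro germs.conv_left[OF assms]) (auto simp: D_def split: if_splits)
  then show ?thesis using x gunit_facts germs.mult_unit_left[OF assms] by (simp add: D_def)
qed

lemma D_mult: "amult CA (D \<phi>) (D \<psi>) = D (\<lambda>x. \<phi> x * \<psi> x)"
proof
  fix \<gamma> show "amult CA (D \<phi>) (D \<psi>) \<gamma> = D (\<lambda>x. \<phi> x * \<psi> x) \<gamma>"
  proof (cases "\<gamma> \<in> arr \<Gamma>")
    case True
    then show ?thesis by (simp add: conv_algebra_ops conv_D_right D_def)
  next
    case False
    then show ?thesis using gunit_facts(1) by (auto simp: conv_algebra_ops germs.conv_outside D_def)
  qed
qed

lemma D_star: "astar CA (D \<psi>) = D (\<lambda>x. cnj (\<psi> x))"
proof
  fix \<gamma>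
  have "ginv \<Gamma> \<gamma> \<in> gunit \<Gamma> ` IP \<longleftrightarrow> \<gamma> \<in> gunit \<Gamma> ` IP" if "\<gamma> \<in> arr \<Gamma>"
  proof
    assume "ginv \<Gamma> \<gamma> \<in> gunit \<Gamma> ` IP"
    then obtain x where x: "x \<in> IP" "ginv \<Gamma> \<gamma> = gunit \<Gamma> x" by blast
    have "\<gamma> = gunit \<Gamma> x"
      using germs.inv_inv[OF that] unfolding x(2) gunit_facts(4)[OF x(1)] by (rule sym)
    then show "\<gamma> \<in> gunit \<Gamma> ` IP" using x by blast
  next
    assume "\<gamma> \<in> gunit \<Gamma> ` IP"
    then show "ginv \<Gamma> \<gamma> \<in> gunit \<Gamma> ` IP" using gunit_facts(4) by auto
  qed
  moreover have "gunit \<Gamma> ` IP \<subseteq> arr \<Gamma>" using gunit_facts(1) by auto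
  ultimately show "astar CA (D \<psi>) \<gamma> = D (\<lambda>x. cnj (\<psi> x)) \<gamma>"
    using gunit_facts by (auto simp: conv_algebra_ops D_def germs.dom_inv)
qed

lemma D_add: "aadd CA (D \<phi>) (D \<psi>) = D (\<lambda>x. \<phi> x + \<psi> x)"
  and D_scale: "ascale CA c (D \<phi>) = D (\<lambda>x. c * \<phi> x)"
  by (auto simp: conv_algebra_ops D_def)

text \<open>Separates a function on a bisection into the bisection and a function on the unit space;
  the norm bound and the approximation then deal with the latter.\<close>

lemma chi_D: "valid \<tau> \<Longrightarrow> amult CA (chi \<tau>) (D \<phi>) = T \<tau> \<phi>"
proof
  fix \<gamma> assume \<tau>: "valid \<tau>"
  show "amult CA (chi \<tau>) (D \<phi>) \<gamma> = T \<tau> \<phi> \<gamma>"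
    using Zc_arr[OF \<tau>] by (cases "\<gamma> \<in> arr \<Gamma>")
      (auto simp: conv_algebra_ops conv_D_right germs.conv_outside chi_def T_def)
qed

lemma chi_unit:
  assumes "walk E u n v" "v \<in> verts E"
  shows "chi (n, gunit G v, n) = D (\<lambda>x. if x \<in> pcone n v then 1 else 0)"
proof
  fix \<gamma>
  show "chi (n, gunit G v, n) \<gamma> = D (\<lambda>x. if x \<in> pcone n v then 1 else 0) \<gamma>"
    using Zc_units[OF assms(2,1)] pcone_subset[OF assms(1)] gunit_facts(2)
    unfolding chi_def T_def D_def by (auto simp: subset_iff)
qed

lemma chi_star_chi:
  assumes "valid (m, g, n)"
  shows "amult CA (astar CA (chi (m, g, n))) (chi (m, g, n)) = D (\<lambda>x. if x \<in> pcone n (dm g) then 1 else 0)"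
proof -
  have g: "g \<in> arr G" and n: "\<exists>u. walk E u n (dm g)" using assms by (auto simp: valid_def)
  obtain u where u: "walk E u n (dm g)" using n by blast
  have "amult CA (astar CA (chi (m, g, n))) (chi (m, g, n)) = chi (n, gmult G (ginv G g) g, n)"
    using chi_matched[of n "ginv G g" m g n] flip_valid[OF assms] assms g
    by (simp add: chi_star flip_def del: mult_inv_left)
  also have "\<dots> = chi (n, gunit G (dm g), n)" using g by simp
  also have "\<dots> = D (\<lambda>x. if x \<in> pcone n (dm g) then 1 else 0)"
    using chi_unit[OF u dm_verts[OF g]] .
  finally show ?thesis .
qed

text \<open>A continuous function with values in \<open>[0, 1]\<close> is the real part of the unitary
  \<open>g + i \<surd>(1 - g\<^sup>2)\<close>, whose norm is at most \<open>1\<close> in every \<open>C\<^sup>*\<close>-seminorm.\<close>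

lemma cstar_seminorm_D_le:
  assumes N: "cstar_seminorm CA N" and \<psi>: "cont \<psi>"
    and real: "\<And>x. x \<in> IP \<Longrightarrow> Im (\<psi> x) = 0" and bound: "\<And>x. x \<in> IP \<Longrightarrow> \<bar>Re (\<psi> x)\<bar> \<le> 1"
  shows "N (D \<psi>) \<le> 1"
proof -
  interpret N: cstar_seminormed CA N
    by (simp add: cstar_seminormed_def cstar_seminormed_axioms_def CA_star_algebra N)
  define u where "u x = Complex (Re (\<psi> x)) (sqrt (1 - (Re (\<psi> x))\<^sup>2))" for x
  have u: "cont u" using \<psi> unfolding cont_def u_def by (auto intro!: tendsto_intros tendsto_Complex)
  have uu: "cnj (u x) * u x = 1" if "x \<in> IP" for x
  proof -
    have "(Re (\<psi> x))\<^sup>2 \<le> 1" using bound[OF that] by (simp add: abs_square_le_1)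
    then show ?thesis by (simp add: u_def complex_eq_iff flip: power2_eq_square)
  qed
  have "N (D (\<lambda>_. 1)) \<le> 1"
    using cont_const[of 1] by (intro N.norm_projection_le_1) (simp_all add: D_mult D_star)
  moreover have "(N (D u))\<^sup>2 = N (D (\<lambda>_. 1))"
    using N.norm_star_mult[OF D_carrier[OF u]] uu
    by (simp add: D_mult D_star) (metis (no_types, lifting) D_cong)
  ultimately have "(N (D u))\<^sup>2 \<le> 1\<^sup>2" by simp
  then have Nu: "N (D u) \<le> 1" by (rule power2_le_imp_le) simp
  have Nv: "N (D (\<lambda>x. cnj (u x))) = N (D u)" using N.norm_star[OF D_carrier[OF u]] by (simp add: D_star)
  have "D \<psi> = ascale CA (1 / 2) (aadd CA (D u) (D (\<lambda>x. cnj (u x))))"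
    unfolding D_add D_scale using real by (intro D_cong) (simp add: u_def complex_eq_iff)
  then have "N (D \<psi>) = 1 / 2 * N (aadd CA (D u) (D (\<lambda>x. cnj (u x))))"
    using u by (simp add: N.norm_scale cont_cnj norm_divide)
  also have "\<dots> \<le> 1 / 2 * (N (D u) + N (D (\<lambda>x. cnj (u x))))"
    using u by (intro mult_left_mono N.norm_add) (simp_all add: cont_cnj)
  finally show ?thesis using Nu Nv by simp
qed

text \<open>The adjoint of \<open>T \<tau> \<phi>\<close> times \<open>T \<tau> \<phi>\<close> is
  the real function \<open>|\<phi>|^2\<close> on a cone of the unit space. The C*-identity so
  reduces arbitrary bisections and complex values to \<open>cstar_seminorm_D_le\<close>, without a
  constant from splitting \<open>\<phi>\<close> into real and imaginary parts.\<close>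

lemma cstar_seminorm_T_le:
  assumes N: "cstar_seminorm CA N" and \<tau>: "valid \<tau>" and \<phi>: "cont \<phi>"
    and K: "\<forall>x\<in>IP. norm (\<phi> x) \<le> K" "0 \<le> K"
  shows "N (T \<tau> \<phi>) \<le> K"
proof (cases "K = 0")
  case True
  interpret N: cstar_seminormed CA N
    by (simp add: cstar_seminormed_def cstar_seminormed_axioms_def CA_star_algebra N)
  have "T \<tau> \<phi> = T \<tau> (\<lambda>_. 0)" using K True by (intro T_cong \<tau>) simp
  also have "\<dots> = azero CA" by (auto simp: T_def conv_algebra_ops)
  finally show ?thesis using True N.norm_zero by simp
next
  case False
  interpret N: cstar_seminormed CA N
    by (simp add: cstar_seminormed_def cstar_seminormed_axioms_def CA_star_algebra N)
  have K0: "K > 0" using False K by simp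
  obtain m g n where t: "\<tau> = (m, g, n)" by (cases \<tau>)
  obtain w where w: "walk E w n (dm g)" using \<tau> t by (auto simp: valid_def)
  let ?i = "\<lambda>x. if x \<in> pcone n (dm g) then 1 else 0 :: complex"
  define \<psi> where "\<psi> x = cnj (\<phi> x) * (?i x * \<phi> x) * complex_of_real (1 / K\<^sup>2)" for x
  have \<psi>: "cont \<psi>" unfolding \<psi>_def
    by (intro cont_mult cont_cnj cont_const cont_indicator_pcone[OF w] \<phi>)
  have val: "\<psi> x = complex_of_real ((if x \<in> pcone n (dm g) then (norm (\<phi> x))\<^sup>2 else 0) / K\<^sup>2)" for x
    by (simp add: \<psi>_def complex_norm_square[symmetric] mult.commute[of "cnj (\<phi> x)"] flip: of_real_power)
  have "\<bar>Re (\<psi> x)\<bar> \<le> 1" if "x \<in> IP" for x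
    using K that K0 power_mono[of "norm (\<phi> x)" K 2] by (auto simp: val)
  then have 1: "N (D \<psi>) \<le> 1" by (intro cstar_seminorm_D_le[OF N \<psi>]) (auto simp: val)
  have Tc: "T \<tau> \<phi> \<in> carrier CA" using bd_T[OF \<tau> \<phi> K] bd_carrier by blast
  have "amult CA (astar CA (T \<tau> \<phi>)) (T \<tau> \<phi>) =
      amult CA (D (\<lambda>x. cnj (\<phi> x))) (amult CA (amult CA (astar CA (chi \<tau>)) (chi \<tau>)) (D \<phi>))"
    using \<tau> \<phi> unfolding chi_D[OF \<tau>, symmetric]
    by (simp add: cvl.star_mult D_star cvl.mult_assoc cont_cnj)
  also have "\<dots> = D (\<lambda>x. cnj (\<phi> x) * (?i x * \<phi> x))"
    unfolding t chi_star_chi[OF \<tau>[unfolded t]] D_mult ..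
  also have "\<dots> = ascale CA (complex_of_real (K\<^sup>2)) (D \<psi>)"
    unfolding D_scale using K0 by (intro D_cong) (simp add: \<psi>_def)
  finally have "(N (T \<tau> \<phi>))\<^sup>2 = K\<^sup>2 * N (D \<psi>)"
    using N.norm_star_mult[OF Tc] \<psi> by (simp add: N.norm_scale norm_power)
  also have "\<dots> \<le> K\<^sup>2" using 1 by (simp add: mult_left_le)
  finally show ?thesis using K0 by (simp add: power2_le_iff_abs_le)
qed

theorem cstar_seminorm_le_bd:
  assumes N: "cstar_seminorm CA N"
  shows "bd f M \<Longrightarrow> N f \<le> M"
proof (induction rule: bd.induct)
  interpret N: cstar_seminormed CA N
    by (simp add: cstar_seminormed_def cstar_seminormed_axioms_def CA_star_algebra N)
  case (zero M)
  then show ?case using N.norm_zero by (simp add: conv_algebra_ops)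
next
  interpret N: cstar_seminormed CA N
    by (simp add: cstar_seminormed_def cstar_seminormed_axioms_def CA_star_algebra N)
  case (add f M \<tau> \<phi> K)
  have "N (aadd CA f (T \<tau> \<phi>)) \<le> N f + N (T \<tau> \<phi>)"
    using bd_carrier[OF add.hyps(1)] bd_carrier[OF bd_T[OF add.hyps(2-5)]] by (rule N.norm_add)
  then show ?case
    using add.IH cstar_seminorm_T_le[OF N add.hyps(2-5)] by (simp add: conv_algebra_ops)
qed

section \<open>The generators in the convolution algebra\<close>

definition "cU g = chi ([], g, [])"
definition "cP v = chi ([], gunit G v, [])"
definition "cS e = chi ([e], gunit G (tail E e), [])"

lemma valid_gen [simp]:
  "g \<in> arr G \<Longrightarrow> valid ([], g, [])" "e \<in> arcs E \<Longrightarrow> valid ([e], gunit G (tail E e), [])"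
  "e \<in> arcs E \<Longrightarrow> valid ([], gunit G (tail E e), [e])"
  by (auto simp: valid_def)

lemma asum_CA:
  assumes "finite I" "\<And>i. i \<in> I \<Longrightarrow> f i \<in> carrier CA"
  shows "asum CA f I = (\<lambda>\<gamma>. \<Sum>i\<in>I. f i \<gamma>)"
  using assms
proof (induction I)
  case empty
  then show ?case by (simp add: conv_algebra_ops)
next
  case (insert i I)
  then show ?case by (simp add: conv_algebra_ops)
qed

lemma cP_D: "v \<in> verts E \<Longrightarrow> cP v = D (\<lambda>x. if ir x = v then 1 else 0)"
proof
  fix \<gamma> assume v: "v \<in> verts E"
  have "pcone [] v = {x \<in> IP. ir x = v}" by (auto simp: pcone_def)
  then have "\<gamma> \<in> Zc ([], gunit G v, []) \<longleftrightarrow> \<gamma> \<in> gunit \<Gamma> ` IP \<and> ir (gdom \<Gamma> \<gamma>) = v"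
    using Zc_units[of v v "[]"] v gunit_facts(2) by (auto simp: image_iff)
  then show "cP v \<gamma> = D (\<lambda>x. if ir x = v then 1 else 0) \<gamma>"
    by (simp add: cP_def chi_def T_def D_def)
qed

lemma unit_mult_left' [simp]: "g \<in> arr G \<Longrightarrow> v = cm g \<Longrightarrow> gmult G (gunit G v) g = g"
  and unit_mult_right' [simp]: "g \<in> arr G \<Longrightarrow> v = dm g \<Longrightarrow> gmult G g (gunit G v) = g"
  by simp_all

lemma CA_ssa_family: "ssa_family E G act CA cU cP cS"
proof (unfold_locales)
  fix g assume g: "g \<in> arr G"
  then show "cU g \<in> carrier CA" by (simp add: cU_def)
  show "astar CA (cU g) = cU (ginv G g)" using g by (simp add: cU_def chi_star flip_def)
  fix h assume h: "h \<in> arr G"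
  show "amult CA (cU g) (cU h) = (if dm g = cm h then cU (gmult G g h) else azero CA)"
  proof (cases "dm g = cm h")
    case True
    then show ?thesis using g h by (simp add: cU_def chi_matched)
  next
    case False
    have "Zprod ([], g, []) ([], h, []) = {}"
    proof (rule ccontr)
      assume "Zprod ([], g, []) ([], h, []) \<noteq> {}"
      then obtain \<alpha> \<beta> where ab: "\<alpha> \<in> Zc ([], g, [])" "\<beta> \<in> Zc ([], h, [])" "gdom \<Gamma> \<alpha> = gcod \<Gamma> \<beta>"
        by (auto simp: Zprod_def)
      obtain y where y: "vp [] g [] y" "\<alpha> = arrow [] g [] y" by (rule ZcE[OF ab(1)]) (use g in simp)
      obtain z where z: "vp [] h [] z" "\<beta> = arrow [] h [] z" by (rule ZcE[OF ab(2)]) (use h in simp)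
      have "y = ia h z" using ab(3) y z by simp
      then show False using False vpD[OF y(1)] vpD[OF z(1)] by simp
    qed
    then show ?thesis using False g h by (simp add: cU_def chi_mult_empty)
  qed
next
  fix e assume e: "e \<in> arcs E"
  then show "cS e \<in> carrier CA" by (simp add: cS_def)
  show "amult CA (cS e) (cP (tail E e)) = cS e"
    using e by (simp add: cS_def cP_def chi_matched)
  have Se: "astar CA (cS e) = chi ([], gunit G (tail E e), [e])"
    using e by (simp add: cS_def chi_star flip_def)
  show "amult CA (cP (head E e)) (cS e) = cS e"
  proof
    fix \<gamma>
    have v: "valid ([e], gunit G (tail E e), [])" using e by simp
    have "ir (gcod \<Gamma> \<gamma>) = head E e" if \<gamma>: "\<gamma> \<in> Zc ([e], gunit G (tail E e), [])"
    proof -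
      obtain z where "vp [e] (gunit G (tail E e)) [] z" "\<gamma> = arrow [e] (gunit G (tail E e)) [] z"
        by (rule ZcE[OF \<gamma> v])
      then show ?thesis by (simp add: irange_def)
    qed
    then show "amult CA (cP (head E e)) (cS e) \<gamma> = cS e \<gamma>"
      using e Zc_arr[OF v]
      by (cases "\<gamma> \<in> arr \<Gamma>") (auto simp: cP_D conv_algebra_ops conv_D_left germs.conv_outside cS_def chi_def T_def)
  qed
  fix f assume f: "f \<in> arcs E"
  show "amult CA (astar CA (cS e)) (cS f) = (if e = f then cP (tail E e) else azero CA)"
  proof (cases "e = f")
    case True
    then show ?thesis using e unfolding Se by (simp add: cS_def cP_def chi_matched)
  next
    case False
    have "Zprod ([], gunit G (tail E e), [e]) ([f], gunit G (tail E f), []) = {}"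
    proof (rule ccontr)
      assume "Zprod ([], gunit G (tail E e), [e]) ([f], gunit G (tail E f), []) \<noteq> {}"
      then obtain \<alpha> \<beta> where ab: "\<alpha> \<in> Zc ([], gunit G (tail E e), [e])" "\<beta> \<in> Zc ([f], gunit G (tail E f), [])"
        "gdom \<Gamma> \<alpha> = gcod \<Gamma> \<beta>" by (auto simp: Zprod_def)
      obtain y where y: "vp [] (gunit G (tail E e)) [e] y" "\<alpha> = arrow [] (gunit G (tail E e)) [e] y"
        by (rule ZcE[OF ab(1)]) (use e in simp)
      obtain z where z: "vp [f] (gunit G (tail E f)) [] z" "\<beta> = arrow [f] (gunit G (tail E f)) [] z"
        by (rule ZcE[OF ab(2)]) (use f in simp)
      have "[e] \<frown> y = [f] \<frown> ia (gunit G (tail E f)) z" using ab(3) y z by simp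
      then have "[e] = [f]" by (rule conc_eq_length) simp
      then show False using False by simp
    qed
    then show ?thesis using False e f unfolding Se by (simp add: cS_def chi_mult_empty)
  qed
next
  fix v assume v: "v \<in> verts E"
  show "cP v = cU (gunit G v)" by (simp add: cP_def cU_def)
  have SS: "amult CA (cS e) (astar CA (cS e)) = chi ([e], gunit G (tail E e), [e])" if "e \<in> arcs E" for e
    using that by (simp add: cS_def chi_star flip_def chi_matched)
  have val: "valid ([e], gunit G (tail E e), [e])" if "e \<in> arcs E" for e using that by (auto simp: valid_def)
  \<comment> \<open>The unit at a path \<open>x\<close> with range \<open>v\<close> lies in exactly
    one of these bisections, the one for its first edge \<open>x 0\<close>; all other arrows lie in
    none.\<close>
  have "cP v \<gamma> = (\<Sum>e\<in>in_arcs E v. chi ([e], gunit G (tail E e), [e]) \<gamma>)" for \<gamma>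
  proof -
    have Z: "Zc ([e], gunit G (tail E e), [e]) = gunit \<Gamma> ` pcone [e] (tail E e)" if "e \<in> arcs E" for e
      using Zc_units[of "tail E e" "head E e" "[e]"] that by simp
    have cone: "x \<in> pcone [e] (tail E e) \<longleftrightarrow> x \<in> IP \<and> x 0 = e" if e: "e \<in> arcs E" for x e
    proof
      assume "x \<in> pcone [e] (tail E e)"
      then show "x \<in> IP \<and> x 0 = e" using pcone_subset[of "head E e" "[e]" "tail E e"] e by (auto simp: pcone_def)
    next
      assume x: "x \<in> IP \<and> x 0 = e"
      have "x = [e] \<frown> suffix 1 x" using prefix_suffix[of x 1] x by (simp add: subsequence_def)
      moreover have "ir (suffix 1 x) = tail E e" using x by (auto simp: irange_def inf_paths_def)
      ultimately show "x \<in> pcone [e] (tail E e)" using x suffix_IP[of x 1] unfolding pcone_def by blast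
    qed
    show ?thesis
    proof (cases "\<gamma> \<in> gunit \<Gamma> ` IP")
      case True
      then obtain x where x: "x \<in> IP" "\<gamma> = gunit \<Gamma> x" by blast
      have "chi ([e], gunit G (tail E e), [e]) \<gamma> = (if e = x 0 then 1 else 0)" if e: "e \<in> in_arcs E v" for e
        using e x gunit_facts(2) cone unfolding chi_def T_def by (simp add: Z image_iff) metis
      then have "(\<Sum>e\<in>in_arcs E v. chi ([e], gunit G (tail E e), [e]) \<gamma>) = (if x 0 \<in> in_arcs E v then 1 else 0)"
        by simp
      then show ?thesis using v x gunit_facts IP_arc[OF x(1)] by (simp add: cP_D D_def irange_def)
    next
      case False
      have "chi ([e], gunit G (tail E e), [e]) \<gamma> = 0" if e: "e \<in> in_arcs E v" for e
        using e False cone Z[of e] unfolding chi_def T_def by auto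
      then show ?thesis using v False by (simp add: cP_D D_def)
    qed
  qed
  then show "cP v = asum CA (\<lambda>e. amult CA (cS e) (astar CA (cS e))) (in_arcs E v)"
    using val by (subst asum_CA) (auto simp: SS)
next
  fix g e assume g: "g \<in> arr G" and e: "e \<in> arcs E" "head E e = dm g"
  have "amult CA (cU g) (cS e) = chi ([ae g e], er g e, [])"
    using chi_append[of "[]" g "[e]" "gunit G (tail E e)" "[]"] g e by (simp add: cU_def cS_def)
  moreover have "amult CA (cS (ae g e)) (cU (er g e)) = chi ([ae g e], er g e, [])"
    using chi_matched[of "[ae g e]" "gunit G (tail E (ae g e))" "[]" "er g e" "[]"] g e
    by (simp add: cU_def cS_def)
  ultimately show "amult CA (cU g) (cS e) = amult CA (cS (ae g e)) (cU (er g e))" by simp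
qed

text \<open>The two readings of a triple, as an element and as a set, agree in the convolution
  algebra. Images of the free algebra are therefore combinations of indicators of basic
  bisections.\<close>

lemma tt_CA:
  assumes "valid \<tau>"
  shows "ssa_family.tt G CA cU cP cS \<tau> = chi \<tau>"
proof -
  interpret fam: ssa_family E G act CA cU cP cS by (rule CA_ssa_family)
  obtain m g n where t: "\<tau> = (m, g, n)" by (cases \<tau>)
  have SL: "fam.SL k w = chi (k, gunit G w, []) \<and> valid (k, gunit G w, [])" if "walk E v k w" "w \<in> verts E" for v k w
    using that
  proof (induction k arbitrary: v)
    case Nil
    then show ?case by (simp add: cP_def[of w])
  next
    case (Cons e k)
    then have e: "e \<in> arcs E" "walk E (tail E e) k w" by auto
    have IH: "fam.SL k w = chi (k, gunit G w, [])" "valid (k, gunit G w, [])" using Cons.IH[OF e(2) Cons.prems(2)] by auto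
    have "valid (e # k, gunit G w, [])" using Cons.prems by (auto simp: valid_def)
    then show ?case
      using chi_append[of "[e]" "gunit G (tail E e)" k "gunit G w" "[]"] e IH Cons.prems la_unit[of "tail E e" k w]
      by (simp add: cS_def[of e])
  qed
  have g: "g \<in> arr G" using assms t by (simp add: valid_def)
  obtain v u where w: "walk E v m (cm g)" "walk E u n (dm g)" using assms t by (auto simp: valid_def)
  have Sm: "fam.SL m (cm g) = chi (m, gunit G (cm g), [])" "valid (m, gunit G (cm g), [])"
    and Sn: "fam.SL n (dm g) = chi (n, gunit G (dm g), [])" "valid (n, gunit G (dm g), [])"
    using SL[OF w(1)] SL[OF w(2)] g by auto
  have vn: "valid ([], gunit G (dm g), n)" "valid ([], g, n)"
    using Sn(2) g w by (auto simp: valid_def)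
  have "astar CA (fam.SL n (dm g)) = chi ([], gunit G (dm g), n)"
    using Sn g by (simp add: chi_star flip_def)
  then have "amult CA (cU g) (astar CA (fam.SL n (dm g))) = chi ([], g, n)"
    using chi_matched[of "[]" g "[]" "gunit G (dm g)" n] g vn by (simp add: cU_def)
  then show ?thesis
    using chi_matched[of m "gunit G (cm g)" "[]" g n] Sm g vn by (simp add: fam.tt_def t)
qed

end

section \<open>Comparison of seminorms\<close>

lemma suffix_conc_add: "suffix (length es + k) (es \<frown> x) = suffix k x"
  using suffix_suffix[of k "length es" "es \<frown> x"] by (simp only: suffix_conc)

context ssa_family
begin

text \<open>Edges cancel one by one through \<open>S_S\<close>. For empty \<open>n\<close> the
  prefix condition is void, and the walk condition records whether \<open>P v\<close> keeps or kills
  the path.\<close>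

lemma star_SL:
  assumes "walk E u n v" "walk E u' l w" "v \<in> verts E" "w \<in> verts E" "length n \<le> length l"
  shows "amult A (astar A (SL n v)) (SL l w) =
    (if take (length n) l = n \<and> walk E v (drop (length n) l) w then SL (drop (length n) l) w else azero A)"
  using assms
proof (induction n arbitrary: u u' l)
  case Nil
  have "walk E v l w \<longleftrightarrow> v = u'" using Nil.prems by (cases l) auto
  then show ?case using Nil.prems P_SL[of u' l w v] by simp
next
  case (Cons f n)
  then obtain e k where l: "l = e # k" by (cases l) auto
  have n: "f \<in> arcs E" "walk E (tail E f) n v" and k: "e \<in> arcs E" "walk E (tail E e) k w"
    using Cons.prems l by auto
  have "amult A (astar A (SL (f # n) v)) (SL l w) =
      amult A (astar A (SL n v)) (amult A (amult A (astar A (S f)) (S e)) (SL k w))"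
    using n k Cons.prems l by (simp add: star_mult mult_assoc)
  also have "\<dots> = (if f = e then amult A (astar A (SL n v)) (SL k w) else azero A)"
    using n k Cons.prems P_SL[OF k(2)] by (simp add: S_S)
  finally show ?case using Cons.IH[OF n(2) k(2)] Cons.prems l by auto
qed

text \<open>The counterpart of \<open>arrow_raise\<close> in \<open>A\<close>: on the path
  \<open>n @ k\<close> the adjoint part of the triple is used up, and \<open>g\<close> acts on
  \<open>k\<close>.\<close>

lemma tt_SL:
  assumes "valid (m, g, n)" "walk E (dm g) k w"
  shows "amult A (tt (m, g, n)) (SL (n @ k) w) = amult A (SL (m @ la g k) (cm (res g k))) (U (res g k))"
proof -
  have g: "g \<in> arr G" using assms by (simp add: valid_def)
  note r = res_walk[OF g assms(2)]
  have w: "w \<in> verts E" using r dm_verts by metis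
  obtain u v where m: "walk E u m (cm g)" and n: "walk E v n (dm g)" using assms by (auto simp: valid_def)
  have nk: "walk E v (n @ k) w" using n assms(2) by (auto simp: walk_append)
  note c = valid_closed[OF assms(1)]
  have "amult A (astar A (SL n (dm g))) (SL (n @ k) w) = SL k w"
    using star_SL[OF n nk _ w] g assms(2) by simp
  then have "amult A (tt (m, g, n)) (SL (n @ k) w) = amult A (SL m (cm g)) (amult A (U g) (SL k w))"
    using c SL_closed[OF nk w] by (simp add: tt_def mult_assoc)
  also have "\<dots> = amult A (SL m (cm g)) (amult A (SL (la g k) (cm (res g k))) (U (res g k)))"
    using U_SL[OF g assms(2)] by simp
  also have "\<dots> = amult A (SL (m @ la g k) (cm (res g k))) (U (res g k))"
    using SL_append[OF m r(3)] c r SL_closed[OF r(3)] by (simp add: mult_assoc)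
  finally show ?thesis .
qed

definition QP :: "'e list \<Rightarrow> 'v \<Rightarrow> 'a" where
  "QP l w = amult A (SL l w) (astar A (SL l w))"

lemma QP:
  assumes "walk E v l w" "w \<in> verts E"
  shows "QP l w \<in> carrier A" "astar A (QP l w) = QP l w" "amult A (QP l w) (QP l w) = QP l w"
proof -
  note c = SL_closed[OF assms]
  show "QP l w \<in> carrier A" "astar A (QP l w) = QP l w" using c by (simp_all add: QP_def star_mult)
  have "amult A (QP l w) (QP l w) = amult A (amult A (SL l w) (amult A (astar A (SL l w)) (SL l w))) (astar A (SL l w))"
    using c by (simp add: QP_def mult_assoc)
  then show "amult A (QP l w) (QP l w) = QP l w"
    using star_SL[OF assms(1,1) assms(2,2)] assms by (simp add: QP_def SL_P)
qed

lemma QP_Nil: "v \<in> verts E \<Longrightarrow> QP [] v = P v"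
  by (simp add: QP_def P_mult)

lemma QP_orthogonal:
  assumes "walk E v l w" "e \<in> in_arcs E w" "f \<in> in_arcs E w" "e \<noteq> f"
  shows "amult A (QP (l @ [e]) (tail E e)) (QP (l @ [f]) (tail E f)) = azero A"
proof -
  have we: "walk E v (l @ [e]) (tail E e)" and wf: "walk E v (l @ [f]) (tail E f)"
    and v: "tail E e \<in> verts E" "tail E f \<in> verts E"
    using assms by (auto simp: walk_append)
  have "amult A (astar A (SL (l @ [e]) (tail E e))) (SL (l @ [f]) (tail E f)) = azero A"
    using star_SL[OF we wf v] assms(4) by simp
  then have "amult A (SL (l @ [e]) (tail E e)) (amult A (amult A (astar A (SL (l @ [e]) (tail E e)))
      (SL (l @ [f]) (tail E f))) (astar A (SL (l @ [f]) (tail E f)))) = azero A"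
    using SL_closed[OF we v(1)] SL_closed[OF wf v(2)] by simp
  then show ?thesis using SL_closed[OF we v(1)] SL_closed[OF wf v(2)] by (simp add: QP_def mult_assoc)
qed

text \<open>The refinement step of the later bar induction: \<open>P w\<close>, inserted in the
  middle, is a sum over the edges into \<open>w\<close>.\<close>

lemma QP_sum:
  assumes l: "walk E v l w" and w: "w \<in> verts E"
  shows "QP l w = asum A (\<lambda>e. QP (l @ [e]) (tail E e)) (in_arcs E w)"
proof -
  note c = SL_closed[OF l w]
  have "QP l w = amult A (SL l w) (amult A (P w) (astar A (SL l w)))"
    using c w SL_P[OF l w] by (simp add: QP_def mult_assoc[symmetric])
  also have "\<dots> = asum A (\<lambda>e. amult A (SL l w) (amult A (amult A (S e) (astar A (S e))) (astar A (SL l w)))) (in_arcs E w)"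
    unfolding P_sum[OF w] using c by (subst asum_mult_left asum_mult_right; simp)+
  also have "\<dots> = asum A (\<lambda>e. QP (l @ [e]) (tail E e)) (in_arcs E w)"
  proof (rule asum_cong[OF refl])
    fix e assume "e \<in> in_arcs E w"
    then have e: "e \<in> arcs E" "walk E w [e] (tail E e)" by auto
    have le: "walk E v (l @ [e]) (tail E e)" using l e by (auto simp: walk_append)
    have "SL (l @ [e]) (tail E e) = amult A (SL l w) (S e)"
      using SL_append[OF l e(2)] e by (simp add: S_P)
    then show "amult A (SL l w) (amult A (amult A (S e) (astar A (S e))) (astar A (SL l w))) = QP (l @ [e]) (tail E e)"
      using c e by (simp add: QP_def star_mult mult_assoc)
    show "QP (l @ [e]) (tail E e) \<in> carrier A" using QP(1)[OF le] e by simp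
  qed
  finally show ?thesis .
qed

text \<open>\<open>A\<close> need not have a unit, but the sum of the vertex projections is a right
  unit for every \<open>tt \<tau>\<close>: the only contribution comes from the range vertex of the
  third list.\<close>

lemma tt_P_sum:
  assumes "valid \<tau>"
  shows "asum A (\<lambda>v. amult A (tt \<tau>) (P v)) (verts E) = tt \<tau>"
proof -
  obtain m g n where t: "\<tau> = (m, g, n)" by (cases \<tau>)
  obtain u where n: "walk E u n (dm g)" using assms t by (auto simp: valid_def)
  note c = valid_closed[OF assms[unfolded t]]
  have u: "u \<in> verts E" using walk_start_verts[OF n] c by simp
  have "amult A (astar A (SL n (dm g))) (P v) = (if v = u then astar A (SL n (dm g)) else azero A)"
    if v: "v \<in> verts E" for v
  proof -
    have "amult A (astar A (SL n (dm g))) (P v) = astar A (amult A (P v) (SL n (dm g)))"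
      using c v by (simp add: star_mult)
    then show ?thesis using P_SL[OF n _ v] c by simp
  qed
  then have "amult A (tt \<tau>) (P v) = (if v = u then tt \<tau> else azero A)" if "v \<in> verts E" for v
    using that c by (simp add: t tt_def mult_assoc)
  then show ?thesis using u assms asum_single[of u "verts E" "\<lambda>v. amult A (tt \<tau>) (P v)"] by simp
qed

text \<open>Multiplied by the projection of a long initial segment of \<open>x\<close>, the elements
  \<open>s\<^sub>m u\<^sub>g s\<^sub>n\<^sup>*\<close> only depend on the germ of \<open>(m, g, n)\<close> at \<open>x\<close>.\<close>

definition Qx :: "'e word \<Rightarrow> nat \<Rightarrow> 'a" where
  "Qx x i = QP (prefix i x) (ir (suffix i x))"

lemma tt_Qx_zero:
  assumes v: "valid (m, g, n)" and x: "x \<in> IP" "x \<notin> pcone n (dm g)" and i: "i \<ge> length n"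
  shows "amult A (tt (m, g, n)) (Qx x i) = azero A"
proof -
  let ?l = "prefix i x" and ?w = "ir (suffix i x)"
  obtain u where n: "walk E u n (dm g)" using v by (auto simp: valid_def)
  note c = valid_closed[OF v]
  have l: "walk E (ir x) ?l ?w" by (rule walk_prefix[OF x(1)])
  have w: "?w \<in> verts E" using x by simp
  have p: "?l = prefix (length n) x @ prefix (i - length n) (suffix (length n) x)"
    using prefix_add[of x "length n" "i - length n"] i by simp
  have False if "take (length n) ?l = n" "walk E (dm g) (drop (length n) ?l) ?w"
  proof -
    have n': "prefix (length n) x = n" using that(1) by (simp add: p)
    have k: "walk E (dm g) (prefix (i - length n) (suffix (length n) x)) ?w" using that(2) by (simp add: p)
    have "walk E (ir (suffix (length n) x)) (prefix (i - length n) (suffix (length n) x)) ?w"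
      using walk_prefix[of "suffix (length n) x" "i - length n"] x i by simp
    with k have "ir (suffix (length n) x) = dm g" by (cases "prefix (i - length n) (suffix (length n) x)") auto
    moreover have "x = n \<frown> suffix (length n) x" using prefix_suffix[of x "length n"] n' by simp
    ultimately show False using x suffix_IP[OF x(1)] unfolding pcone_def by blast
  qed
  then have "amult A (astar A (SL n (dm g))) (SL ?l ?w) = azero A"
    using star_SL[OF n l _ w] i c by auto
  then have "amult A (tt (m, g, n)) (SL ?l ?w) = azero A"
    using c SL_closed[OF l w] by (simp add: tt_def mult_assoc)
  then have "amult A (amult A (tt (m, g, n)) (SL ?l ?w)) (astar A (SL ?l ?w)) = azero A"
    using SL_closed[OF l w] by simp
  then show ?thesis using c SL_closed[OF l w] by (simp add: Qx_def QP_def mult_assoc)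
qed

text \<open>By \<open>arrow_eqD\<close> both triples raise to the same triple. Once the prefix of
  the source contains \<open>n @ k\<close>, \<open>tt_SL\<close> carries out this raising on both
  sides.\<close>

lemma tt_Qx_eq:
  assumes v: "valid \<sigma>" "valid \<sigma>'" and \<gamma>: "\<gamma> \<in> Zc \<sigma>" "\<gamma> \<in> Zc \<sigma>'"
  shows "\<exists>i\<^sub>0. \<forall>i\<ge>i\<^sub>0. amult A (tt \<sigma>) (Qx (gdom \<Gamma> \<gamma>) i) = amult A (tt \<sigma>') (Qx (gdom \<Gamma> \<gamma>) i)"
proof -
  obtain m g n m' g' n' where t: "\<sigma> = (m, g, n)" "\<sigma>' = (m', g', n')" by (cases \<sigma>, cases \<sigma>') auto
  obtain z where z: "vp m g n z" "\<gamma> = arrow m g n z" by (rule ZcE[OF \<gamma>(1)[unfolded t] v(1)[unfolded t]])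
  obtain z' where z': "vp m' g' n' z'" "\<gamma> = arrow m' g' n' z'" by (rule ZcE[OF \<gamma>(2)[unfolded t] v(2)[unfolded t]])
  have "arrow m g n z = arrow m' g' n' z'" using z(2) z'(2) by simp
  from arrow_eqD[OF z(1) z'(1) this] obtain k k' w where
    k: "z = k \<frown> w" "z' = k' \<frown> w" "n @ k = n' @ k'" "m @ la g k = m' @ la g' k'" "res g k = res g' k'"
    by blast
  let ?x = "gdom \<Gamma> \<gamma>"
  have x: "?x = (n @ k) \<frown> w" using gdom_arrow[OF z(1)] z(2) k(1) by simp
  have "amult A (tt \<sigma>) (Qx ?x i) = amult A (tt \<sigma>') (Qx ?x i)" if i: "i \<ge> length (n @ k)" for i
  proof -
    define l where "l = prefix (i - length (n @ k)) w"
    define u where "u = ir (suffix i ?x)"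
    have p: "prefix i ?x = (n @ k) @ l"
      using prefix_conc_add[of "n @ k" w "i - length (n @ k)"] i unfolding x l_def by simp
    have zi: "z \<in> IP" "ir z = dm g" "z' \<in> IP" "ir z' = dm g'"
      using vpD[OF z(1)] vpD[OF z'(1)] by auto
    have wz: "walk E (dm g) (prefix (i - length n) z) (ir (suffix (i - length n) z))"
      using walk_prefix[OF zi(1)] zi by simp
    have wz': "walk E (dm g') (prefix (i - length n') z') (ir (suffix (i - length n') z'))"
      using walk_prefix[OF zi(3)] zi by simp
    have len: "i - length n = length k + (i - length (n @ k))" "i - length n' = length k' + (i - length (n @ k))"
      using i arg_cong[OF k(3), of length] by simp_all
    have su: "suffix i ?x = suffix (i - length (n @ k)) w"
      using suffix_conc_add[of "n @ k" "i - length (n @ k)" w] i unfolding x by simp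
    have kl: "walk E (dm g) (k @ l) u" "walk E (dm g') (k' @ l) u"
      using wz wz' unfolding len k(1,2) prefix_conc_add u_def su suffix_conc_add l_def by simp_all
    have c: "tt \<sigma> \<in> carrier A" "tt \<sigma>' \<in> carrier A" using v by simp_all
    have wx: "walk E (ir ?x) (prefix i ?x) u" "u \<in> verts E"
      using vpD[OF z(1)] gdom_arrow[OF z(1)] z(2) walk_prefix unfolding u_def by simp_all
    note s = SL_closed[OF wx]
    have "amult A (tt \<sigma>) (SL (prefix i ?x) u) = amult A (tt \<sigma>') (SL (prefix i ?x) u)"
      using tt_SL[OF v(1)[unfolded t] kl(1)] tt_SL[OF v(2)[unfolded t] kl(2)] k(3,4,5)
      unfolding t p by (simp add: la_append res_append flip: append_assoc)
    then have "amult A (amult A (tt \<sigma>) (SL (prefix i ?x) u)) (astar A (SL (prefix i ?x) u)) =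
      amult A (amult A (tt \<sigma>') (SL (prefix i ?x) u)) (astar A (SL (prefix i ?x) u))" by simp
    then show ?thesis using c s by (simp add: Qx_def QP_def mult_assoc flip: u_def)
  qed
  then show ?thesis by blast
qed

text \<open>After multiplication by a long enough \<open>Qx x i\<close>, all triples of
  \<open>Z\<close> are expressed through one family \<open>t\<close> indexed by germs with source
  \<open>x\<close>, with the values of the indicators as coefficients. A linear relation between
  indicators over \<open>x\<close> thus becomes a relation in \<open>A\<close>.\<close>

lemma germ_expansion:
  assumes fin: "finite Z" and v: "\<And>\<sigma>. \<sigma> \<in> Z \<Longrightarrow> valid \<sigma>" and x: "x \<in> IP"
  shows "\<exists>i\<^sub>0. \<forall>i\<ge>i\<^sub>0. \<exists>B t. finite B \<and> B \<subseteq> {\<gamma>\<in>arr \<Gamma>. gdom \<Gamma> \<gamma> = x} \<and> (\<forall>\<gamma>\<in>B. t \<gamma> \<in> carrier A) \<and>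
    (\<forall>\<sigma>\<in>Z. amult A (tt \<sigma>) (Qx x i) = asum A (\<lambda>\<gamma>. ascale A (chi \<sigma> \<gamma>) (t \<gamma>)) B)"
proof -
  have Qc: "Qx x i \<in> carrier A" for i
    using QP(1)[OF walk_prefix[OF x, of i]] x by (simp add: Qx_def)
  have "\<exists>i\<^sub>0. \<forall>i\<ge>i\<^sub>0. \<forall>p\<in>Z \<times> Z. (\<exists>\<gamma>. gdom \<Gamma> \<gamma> = x \<and> \<gamma> \<in> Zc (fst p) \<and> \<gamma> \<in> Zc (snd p)) \<longrightarrow>
      amult A (tt (fst p)) (Qx x i) = amult A (tt (snd p)) (Qx x i)" (is "\<exists>i\<^sub>0. \<forall>i\<ge>i\<^sub>0. \<forall>p\<in>_. ?R i p")
  proof -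
    have "\<exists>i\<^sub>0. \<forall>i\<ge>i\<^sub>0. ?R i p" if "p \<in> Z \<times> Z" for p
    proof (cases "\<exists>\<gamma>. gdom \<Gamma> \<gamma> = x \<and> \<gamma> \<in> Zc (fst p) \<and> \<gamma> \<in> Zc (snd p)")
      case True
      then obtain \<gamma> where \<gamma>: "gdom \<Gamma> \<gamma> = x" "\<gamma> \<in> Zc (fst p)" "\<gamma> \<in> Zc (snd p)" by blast
      have "valid (fst p)" "valid (snd p)" using v that by auto
      from tt_Qx_eq[OF this \<gamma>(2,3)] show ?thesis unfolding \<gamma>(1) by blast
    qed blast
    then have "\<forall>\<^sub>F i in sequentially. \<forall>p\<in>Z \<times> Z. ?R i p"
      unfolding eventually_sequentially[symmetric]
      by (intro eventually_ball_finite finite_cartesian_product fin ballI)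
    then show ?thesis by (simp add: eventually_sequentially)
  qed
  then obtain i1 where i1: "\<And>i \<sigma> \<sigma>' \<gamma>. i \<ge> i1 \<Longrightarrow> \<sigma> \<in> Z \<Longrightarrow> \<sigma>' \<in> Z \<Longrightarrow> gdom \<Gamma> \<gamma> = x \<Longrightarrow>
      \<gamma> \<in> Zc \<sigma> \<Longrightarrow> \<gamma> \<in> Zc \<sigma>' \<Longrightarrow> amult A (tt \<sigma>) (Qx x i) = amult A (tt \<sigma>') (Qx x i)"
    by fastforce
  \<comment> \<open>Beyond \<open>i1\<close> triples with a common germ agree; beyond every
    \<open>length n\<close> triples whose cone misses \<open>x\<close> give zero.\<close>
  define i0 where "i0 = Max (insert i1 ((\<lambda>(m, g, n). length n) ` Z))"
  have i0: "i1 \<le> i0" "\<And>m g n. (m, g, n) \<in> Z \<Longrightarrow> length n \<le> i0"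
    unfolding i0_def using fin by (auto intro!: Max_ge image_eqI)
  define B where "B = {\<gamma>. gdom \<Gamma> \<gamma> = x \<and> (\<exists>\<sigma>\<in>Z. \<gamma> \<in> Zc \<sigma>)}"
  have arrow: "\<gamma> = arrow m g n (suffix (length n) x) \<and> x \<in> pcone n (dm g)"
    if h: "(m, g, n) \<in> Z" "\<gamma> \<in> Zc (m, g, n)" "gdom \<Gamma> \<gamma> = x" for m g n \<gamma>
  proof -
    obtain z where z: "vp m g n z" "\<gamma> = arrow m g n z" by (rule ZcE[OF h(2) v[OF h(1)]])
    have "x = n \<frown> z" using h(3) gdom_arrow[OF z(1)] z(2) by simp
    then show ?thesis using z(2) vpD[OF z(1)] unfolding pcone_def by auto
  qed
  have "B \<subseteq> (\<lambda>(m, g, n). arrow m g n (suffix (length n) x)) ` Z"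
    using arrow unfolding B_def by (fastforce simp: image_iff)
  then have finB: "finite B" using fin finite_subset by blast
  have B: "B \<subseteq> {\<gamma>\<in>arr \<Gamma>. gdom \<Gamma> \<gamma> = x}" unfolding B_def using Zc_arr v by blast
  \<comment> \<open>By the choice of \<open>i1\<close> the value of the family at a germ does not
    depend on which triple containing it is picked.\<close>
  define s where "s \<gamma> = (SOME \<sigma>. \<sigma> \<in> Z \<and> \<gamma> \<in> Zc \<sigma>)" for \<gamma>
  have s: "s \<gamma> \<in> Z \<and> \<gamma> \<in> Zc (s \<gamma>)" if "\<gamma> \<in> B" for \<gamma>
    unfolding s_def using that by (intro someI_ex[of "\<lambda>\<sigma>. \<sigma> \<in> Z \<and> \<gamma> \<in> Zc \<sigma>"]) (auto simp: B_def)
  show ?thesis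
  proof (intro exI[of _ i0] allI impI exI[of _ B] exI[of _ "\<lambda>\<gamma>. amult A (tt (s \<gamma>)) (Qx x _)"] conjI ballI)
    fix i assume i: "i0 \<le> i"
    show "finite B" "B \<subseteq> {\<gamma>\<in>arr \<Gamma>. gdom \<Gamma> \<gamma> = x}" by fact+
    let ?t = "\<lambda>\<gamma>. amult A (tt (s \<gamma>)) (Qx x i)"
    show tc: "?t \<gamma> \<in> carrier A" if "\<gamma> \<in> B" for \<gamma> using s[OF that] v Qc by simp
    fix \<sigma> assume \<sigma>: "\<sigma> \<in> Z"
    obtain m g n where t: "\<sigma> = (m, g, n)" by (cases \<sigma>)
    note val = v[OF \<sigma>]
    show "amult A (tt \<sigma>) (Qx x i) = asum A (\<lambda>\<gamma>. ascale A (chi \<sigma> \<gamma>) (?t \<gamma>)) B"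
    proof (cases "x \<in> pcone n (dm g)")
      case False
      have "chi \<sigma> \<gamma> = 0" if "\<gamma> \<in> B" for \<gamma>
        using arrow[OF \<sigma>[unfolded t]] that False unfolding chi_indicator t B_def indicator_def by auto
      then have "asum A (\<lambda>\<gamma>. ascale A (chi \<sigma> \<gamma>) (?t \<gamma>)) B = azero A"
        using tc by (intro asum_zeroI) simp
      moreover have "amult A (tt \<sigma>) (Qx x i) = azero A"
        using tt_Qx_zero[OF val[unfolded t] x False] i0(2)[OF \<sigma>[unfolded t]] i unfolding t by simp
      ultimately show ?thesis by simp
    next
      case True
      then obtain z where z: "x = n \<frown> z" "z \<in> IP" "ir z = dm g" by (auto simp: pcone_def)
      have vp: "vp m g n z" using val z t by (simp add: vp_def)
      let ?\<gamma> = "arrow m g n z"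
      have \<gamma>: "?\<gamma> \<in> Zc \<sigma>" "gdom \<Gamma> ?\<gamma> = x" using ZcI[OF vp] gdom_arrow[OF vp] t z by simp_all
      have \<gamma>B: "?\<gamma> \<in> B" using \<gamma> \<sigma> by (auto simp: B_def)
      have eq: "\<delta> = ?\<gamma>" if "\<delta> \<in> Zc \<sigma>" "\<delta> \<in> B" for \<delta>
        using inj_onD[OF inj_on_Zc(1)[OF val] _ that(1) \<gamma>(1)] that(2) \<gamma>(2) by (simp add: B_def)
      have "asum A (\<lambda>\<gamma>. ascale A (chi \<sigma> \<gamma>) (?t \<gamma>)) B = ascale A (chi \<sigma> ?\<gamma>) (?t ?\<gamma>)"
      proof (rule asum_single[OF \<gamma>B finB])
        fix \<delta> assume "\<delta> \<in> B" "\<delta> \<noteq> ?\<gamma>"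
        then show "ascale A (chi \<sigma> \<delta>) (?t \<delta>) = azero A"
          using eq tc by (auto simp: chi_indicator indicator_def)
      qed (use tc[OF \<gamma>B] in \<open>simp add: scale_closed\<close>)
      also have "\<dots> = ?t ?\<gamma>" using \<gamma>(1) tc[OF \<gamma>B] by (simp add: chi_indicator scale_one)
      also have "\<dots> = amult A (tt \<sigma>) (Qx x i)"
        using i1[of i "s ?\<gamma>" \<sigma> ?\<gamma>] s[OF \<gamma>B] \<sigma> \<gamma> i i0(1) by simp
      finally show ?thesis by simp
    qed
  qed
qed

end

section \<open>Decompositions along orthogonal projections\<close>

context cstar_seminormed
begin

text \<open>The factors \<open>b i\<close> are confined to the corner of \<open>r\<close>. For
  orthogonal projections such factors are orthogonal on both sides, so their sum obeys the same
  bound \<open>K i\<close>; norm bounds on the elements \<open>a r\<close> alone could grow with the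
  number of pieces.\<close>

definition split_by :: "('i \<Rightarrow> 'a) \<Rightarrow> 'i set \<Rightarrow> ('i \<Rightarrow> real) \<Rightarrow> 'a \<Rightarrow> 'a \<Rightarrow> bool" where
  "split_by t I K a r \<longleftrightarrow> (\<exists>b. (\<forall>i\<in>I. b i \<in> carrier A \<and> amult A r (b i) = b i \<and> amult A (b i) r = b i \<and> N (b i) \<le> K i) \<and>
     amult A a r = asum A (\<lambda>i. amult A (t i) (b i)) I)"

text \<open>The coefficients \<open>t i\<close> are the same on all pieces, so the factors for the
  sum are the sums of the factors, and \<open>norm_orthogonal_sum\<close> bounds these.\<close>

lemma split_by_sum:
  assumes fin: "finite J" "finite I"
    and t: "\<And>i. i \<in> I \<Longrightarrow> t i \<in> carrier A" and K: "\<And>i. i \<in> I \<Longrightarrow> 0 \<le> K i" and a: "a \<in> carrier A"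
    and r: "\<And>j. j \<in> J \<Longrightarrow> r j \<in> carrier A" "\<And>j. j \<in> J \<Longrightarrow> astar A (r j) = r j"
      "\<And>j. j \<in> J \<Longrightarrow> amult A (r j) (r j) = r j"
      "\<And>j k. j \<in> J \<Longrightarrow> k \<in> J \<Longrightarrow> j \<noteq> k \<Longrightarrow> amult A (r j) (r k) = azero A"
    and split: "\<And>j. j \<in> J \<Longrightarrow> split_by t I K a (r j)"
  shows "split_by t I K a (asum A r J)"
proof -
  let ?s = "asum A r J"
  from split have "\<forall>j\<in>J. \<exists>b. (\<forall>i\<in>I. b i \<in> carrier A \<and> amult A (r j) (b i) = b i \<and>
      amult A (b i) (r j) = b i \<and> N (b i) \<le> K i) \<and> amult A a (r j) = asum A (\<lambda>i. amult A (t i) (b i)) I"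
    unfolding split_by_def by (rule ballI)
  from bchoice[OF this] obtain b where b: "\<And>i j. j \<in> J \<Longrightarrow> i \<in> I \<Longrightarrow> b j i \<in> carrier A \<and> amult A (r j) (b j i) = b j i \<and>
        amult A (b j i) (r j) = b j i \<and> N (b j i) \<le> K i"
    and ar: "\<And>j. j \<in> J \<Longrightarrow> amult A a (r j) = asum A (\<lambda>i. amult A (t i) (b j i)) I"
    by blast
  have sc: "?s \<in> carrier A" using r by auto
  have sr: "amult A ?s (r j) = r j" "amult A (r j) ?s = r j" if j: "j \<in> J" for j
  proof -
    have "amult A ?s (r j) = asum A (\<lambda>k. amult A (r k) (r j)) J"
      using r j by (subst asum_mult_right) auto
    also have "\<dots> = amult A (r j) (r j)"
      using fin r j by (intro asum_single[OF j]) (auto simp: mult_closed)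
    finally show "amult A ?s (r j) = r j" using r j by simp
    have "amult A (r j) ?s = asum A (\<lambda>k. amult A (r j) (r k)) J"
      using r j by (subst asum_mult_left) auto
    also have "\<dots> = amult A (r j) (r j)"
      using fin r j by (intro asum_single[OF j]) (auto simp: mult_closed)
    finally show "amult A (r j) ?s = r j" using r j by simp
  qed
  have bc: "b j i \<in> carrier A" if "j \<in> J" "i \<in> I" for i j using b that by blast
  have sb: "amult A ?s (b j i) = b j i" "amult A (b j i) ?s = b j i" if j: "j \<in> J" and i: "i \<in> I" for i j
  proof -
    have "amult A ?s (b j i) = amult A ?s (amult A (r j) (b j i))" using b[OF j i] by simp
    also have "\<dots> = amult A (amult A ?s (r j)) (b j i)" using sc r(1)[OF j] bc[OF j i] by (simp only: mult_assoc)
    finally show "amult A ?s (b j i) = b j i" using b[OF j i] sr[OF j] by simp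
    have "amult A (b j i) ?s = amult A (amult A (b j i) (r j)) ?s" using b[OF j i] by simp
    also have "\<dots> = amult A (b j i) (amult A (r j) ?s)" using sc r(1)[OF j] bc[OF j i] by (simp only: mult_assoc)
    finally show "amult A (b j i) ?s = b j i" using b[OF j i] sr[OF j] by simp
  qed
  let ?B = "\<lambda>i. asum A (\<lambda>j. b j i) J"
  have "?B i \<in> carrier A \<and> amult A ?s (?B i) = ?B i \<and> amult A (?B i) ?s = ?B i \<and> N (?B i) \<le> K i" if i: "i \<in> I" for i
  proof (intro conjI)
    show "?B i \<in> carrier A" using bc i by auto
    show "amult A ?s (?B i) = ?B i"
      using sc bc i sb by (subst asum_mult_left[symmetric]) (auto intro!: asum_cong)
    show "amult A (?B i) ?s = ?B i"
      using sc bc i sb by (subst asum_mult_right[symmetric]) (auto intro!: asum_cong)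
    show "N (?B i) \<le> K i"
    proof (rule norm_orthogonal_sum[OF fin(1)])
      fix j k assume jk: "j \<in> J" "k \<in> J" "j \<noteq> k"
      have c: "b j i \<in> carrier A" "b k i \<in> carrier A" "r j \<in> carrier A" "r k \<in> carrier A"
        using bc jk i r by auto
      have "amult A (astar A (b j i)) (b k i) = amult A (astar A (amult A (r j) (b j i))) (amult A (r k) (b k i))"
        using b jk i by simp
      also have "\<dots> = amult A (astar A (b j i)) (amult A (amult A (r j) (r k)) (b k i))"
        using c r(1,2) jk(1,2) by (simp add: star_mult mult_assoc star_closed mult_closed)
      finally show "amult A (astar A (b j i)) (b k i) = azero A" unfolding r(4)[OF jk] using c by simp
      have "amult A (b j i) (astar A (b k i)) = amult A (amult A (b j i) (r j)) (astar A (amult A (b k i) (r k)))"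
        using b jk i by simp
      also have "\<dots> = amult A (b j i) (amult A (amult A (r j) (r k)) (astar A (b k i)))"
        using c r(1,2) jk(1,2) by (simp add: star_mult mult_assoc star_closed mult_closed)
      finally show "amult A (b j i) (astar A (b k i)) = azero A" unfolding r(4)[OF jk] using c by simp
    qed (use b bc K i in auto)
  qed
  moreover have "amult A a ?s = asum A (\<lambda>i. amult A (t i) (?B i)) I"
  proof -
    have "amult A a ?s = asum A (\<lambda>j. asum A (\<lambda>i. amult A (t i) (b j i)) I) J"
      using a r ar t bc by (subst asum_mult_left[symmetric]) (auto intro!: asum_cong mult_closed)
    also have "\<dots> = asum A (\<lambda>i. asum A (\<lambda>j. amult A (t i) (b j i)) J) I"
      using fin t bc by (intro asum_swap) (auto simp: mult_closed)
    also have "\<dots> = asum A (\<lambda>i. amult A (t i) (?B i)) I"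
      using t bc by (intro asum_cong refl asum_mult_left) (auto simp: mult_closed)
    finally show ?thesis .
  qed
  ultimately show ?thesis unfolding split_by_def by (intro exI[of _ ?B] conjI[OF ballI])
qed

end

locale normed_ssa_family = ssa_family E G act A U P S + cstar_seminormed A N
  for E :: "('v, 'e) pre_digraph" and G :: "('v, 'g, 'm) groupoid_scheme"
    and act :: "'g \<Rightarrow> ('v, 'e) fpath \<Rightarrow> ('v, 'e) fpath"
    and A :: "('a, 'n) star_algebra_scheme"
    and U :: "'g \<Rightarrow> 'a" and P :: "'v \<Rightarrow> 'a" and S :: "'e \<Rightarrow> 'a" and N :: "'a \<Rightarrow> real"
begin

lemma norm_partial_isometry_le_1:
  assumes "x \<in> carrier A" "v \<in> verts E" "amult A (astar A x) x = P v"
  shows "N x \<le> 1"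
proof -
  have "N (P v) \<le> 1" using assms by (intro norm_projection_le_1) (simp_all add: P_mult)
  then have "(N x)\<^sup>2 \<le> 1\<^sup>2" using norm_star_mult[OF assms(1)] assms(3) by simp
  then show ?thesis by (rule power2_le_imp_le) simp
qed

lemma norm_tt_le_1:
  assumes "valid \<tau>"
  shows "N (tt \<tau>) \<le> 1"
proof -
  obtain m g n where t: "\<tau> = (m, g, n)" by (cases \<tau>)
  note c = valid_closed[OF assms[unfolded t]]
  have SL: "N (SL l w) \<le> 1" if "walk E v l w" "w \<in> verts E" for v l w
    using star_SL[OF that(1,1) that(2,2)] SL_closed[OF that] that
    by (intro norm_partial_isometry_le_1) simp_all
  have m: "N (SL m (cm g)) \<le> 1" and n: "N (SL n (dm g)) \<le> 1"
    using SL assms c(1) by (auto simp: t valid_def)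
  have g: "N (U g) \<le> 1"
    using c(1) by (intro norm_partial_isometry_le_1[of _ "dm g"]) (simp_all add: U_inv U_mult P_unit)
  have "N (tt \<tau>) \<le> N (SL m (cm g)) * N (amult A (U g) (astar A (SL n (dm g))))"
    unfolding t tt_def using c by (simp add: norm_mult)
  also have "\<dots> \<le> 1 * (N (U g) * N (astar A (SL n (dm g))))"
    using c m by (intro mult_mono norm_mult) simp_all
  also have "\<dots> \<le> 1 * (1 * 1)"
    using c g n by (intro mult_mono) simp_all
  finally show ?thesis by simp
qed

text \<open>The comparison of norms that makes the representation faithful: the pointwise bounds \<open>K\<close> of
  any decomposition of the function with coefficients \<open>c\<close> bound the element of \<open>A\<close> with these
  coefficients. By bar induction it suffices to decompose that element after multiplication by
  the projections of long paths.\<close>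

lemma norm_le_sum_bounds:
  assumes fin: "finite W" "finite I"
    and \<sigma>: "\<And>w. w \<in> W \<Longrightarrow> valid (\<sigma> w)" and \<tau>: "\<And>i. i \<in> I \<Longrightarrow> valid (\<tau> i)"
    and K: "\<And>i x. i \<in> I \<Longrightarrow> x \<in> IP \<Longrightarrow> norm (\<phi> i x) \<le> K i" "\<And>i. i \<in> I \<Longrightarrow> 0 \<le> K i"
    and eq: "\<And>\<gamma>. (\<Sum>w\<in>W. c w * chi (\<sigma> w) \<gamma>) = (\<Sum>i\<in>I. T (\<tau> i) (\<phi> i) \<gamma>)"
  shows "N (asum A (\<lambda>w. ascale A (c w) (tt (\<sigma> w))) W) \<le> sum K I"
proof -
  let ?a = "asum A (\<lambda>w. ascale A (c w) (tt (\<sigma> w))) W"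
  let ?split = "split_by (\<lambda>i. tt (\<tau> i)) I K ?a"
  have a: "?a \<in> carrier A" using \<sigma> by (auto simp: scale_closed)
  have leaf: "\<exists>i. ?split (Qx x i)" if x: "x \<in> IP" for x
  proof -
    let ?Z = "\<sigma> ` W \<union> \<tau> ` I"
    have "\<exists>i\<^sub>0. \<forall>i\<ge>i\<^sub>0. \<exists>B t. finite B \<and> B \<subseteq> {\<gamma>\<in>arr \<Gamma>. gdom \<Gamma> \<gamma> = x} \<and> (\<forall>\<gamma>\<in>B. t \<gamma> \<in> carrier A) \<and>
      (\<forall>\<sigma>\<in>?Z. amult A (tt \<sigma>) (Qx x i) = asum A (\<lambda>\<gamma>. ascale A (chi \<sigma> \<gamma>) (t \<gamma>)) B)"
      using fin \<sigma> \<tau> x by (intro germ_expansion) auto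
    then obtain i\<^sub>0 where "\<forall>i\<ge>i\<^sub>0. \<exists>B t. finite B \<and> B \<subseteq> {\<gamma>\<in>arr \<Gamma>. gdom \<Gamma> \<gamma> = x} \<and> (\<forall>\<gamma>\<in>B. t \<gamma> \<in> carrier A) \<and>
      (\<forall>\<sigma>\<in>?Z. amult A (tt \<sigma>) (Qx x i) = asum A (\<lambda>\<gamma>. ascale A (chi \<sigma> \<gamma>) (t \<gamma>)) B)" ..
    from this[rule_format, OF order_refl] obtain B t where
      Bt: "finite B \<and> B \<subseteq> {\<gamma>\<in>arr \<Gamma>. gdom \<Gamma> \<gamma> = x} \<and> (\<forall>\<gamma>\<in>B. t \<gamma> \<in> carrier A) \<and>
        (\<forall>\<sigma>\<in>?Z. amult A (tt \<sigma>) (Qx x i\<^sub>0) = asum A (\<lambda>\<gamma>. ascale A (chi \<sigma> \<gamma>) (t \<gamma>)) B)" by (elim exE)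
    define i where "i = i\<^sub>0"
    have B: "finite B" "B \<subseteq> {\<gamma>\<in>arr \<Gamma>. gdom \<Gamma> \<gamma> = x}" and t: "\<And>\<gamma>. \<gamma> \<in> B \<Longrightarrow> t \<gamma> \<in> carrier A"
      and ex: "\<And>\<sigma>. \<sigma> \<in> ?Z \<Longrightarrow> amult A (tt \<sigma>) (Qx x i) = asum A (\<lambda>\<gamma>. ascale A (chi \<sigma> \<gamma>) (t \<gamma>)) B"
      using Bt unfolding i_def by (simp_all only: simp_thms)
    have q: "Qx x i \<in> carrier A" "astar A (Qx x i) = Qx x i" "amult A (Qx x i) (Qx x i) = Qx x i"
      using QP[OF walk_prefix[OF x, of i]] x by (simp_all add: Qx_def)
    have Nq: "N (Qx x i) \<le> 1" using q by (intro norm_projection_le_1)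
    \<comment> \<open>A combination of triples from \<open>?Z\<close>, multiplied by the projection,
      depends only on its coefficient function at germs with source \<open>x\<close>. Applied to
      both decompositions, this lets \<open>eq\<close> identify them.\<close>
    have exp: "asum A (\<lambda>j. ascale A (d j) (amult A (tt (\<rho> j)) (Qx x i))) J =
        asum A (\<lambda>\<gamma>. ascale A (\<Sum>j\<in>J. d j * chi (\<rho> j) \<gamma>) (t \<gamma>)) B"
      if J: "finite J" "\<And>j. j \<in> J \<Longrightarrow> \<rho> j \<in> ?Z" for J :: "'j set" and d \<rho>
    proof -
      have "asum A (\<lambda>j. ascale A (d j) (amult A (tt (\<rho> j)) (Qx x i))) J =
          asum A (\<lambda>j. asum A (\<lambda>\<gamma>. ascale A (d j * chi (\<rho> j) \<gamma>) (t \<gamma>)) B) J"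
      proof (rule asum_cong[OF refl])
        fix j assume j: "j \<in> J"
        have "asum A (\<lambda>\<gamma>. ascale A (d j * chi (\<rho> j) \<gamma>) (t \<gamma>)) B =
            asum A (\<lambda>\<gamma>. ascale A (d j) (ascale A (chi (\<rho> j) \<gamma>) (t \<gamma>))) B"
          using t by (intro asum_cong refl) (simp_all add: scale_scale scale_closed)
        also have "\<dots> = ascale A (d j) (asum A (\<lambda>\<gamma>. ascale A (chi (\<rho> j) \<gamma>) (t \<gamma>)) B)"
          using t by (intro asum_scale) (simp add: scale_closed)
        finally show "ascale A (d j) (amult A (tt (\<rho> j)) (Qx x i)) =
            asum A (\<lambda>\<gamma>. ascale A (d j * chi (\<rho> j) \<gamma>) (t \<gamma>)) B"
          using ex[OF J(2)[OF j]] by simp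
      qed (use t in \<open>auto simp: scale_closed\<close>)
      also have "\<dots> = asum A (\<lambda>\<gamma>. asum A (\<lambda>j. ascale A (d j * chi (\<rho> j) \<gamma>) (t \<gamma>)) J) B"
        using B J t by (intro asum_swap) (auto simp: scale_closed)
      also have "\<dots> = asum A (\<lambda>\<gamma>. ascale A (\<Sum>j\<in>J. d j * chi (\<rho> j) \<gamma>) (t \<gamma>)) B"
        using J t by (intro asum_cong refl asum_scale_sum) (auto simp: scale_closed)
      finally show ?thesis .
    qed
    \<comment> \<open>Over the single source \<open>x\<close> each function is just the scalar
      \<open>\<phi> i' x\<close>, so no approximation error arises.\<close>
    let ?b = "\<lambda>i'. ascale A (\<phi> i' x) (Qx x i)"
    have "amult A ?a (Qx x i) = asum A (\<lambda>w. ascale A (c w) (amult A (tt (\<sigma> w)) (Qx x i))) W"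
      using \<sigma> q by (subst asum_mult_right[symmetric]) (auto intro!: asum_cong simp: scale_closed mult_scale_left mult_closed)
    also have "\<dots> = asum A (\<lambda>\<gamma>. ascale A (\<Sum>w\<in>W. c w * chi (\<sigma> w) \<gamma>) (t \<gamma>)) B"
      using fin by (intro exp) auto
    also have "\<dots> = asum A (\<lambda>\<gamma>. ascale A (\<Sum>i'\<in>I. \<phi> i' x * chi (\<tau> i') \<gamma>) (t \<gamma>)) B"
    proof (rule asum_cong[OF refl])
      fix \<gamma> assume \<gamma>: "\<gamma> \<in> B"
      then have "(\<Sum>w\<in>W. c w * chi (\<sigma> w) \<gamma>) = (\<Sum>i'\<in>I. \<phi> i' x * chi (\<tau> i') \<gamma>)"
        unfolding eq using B(2) by (intro sum.cong) (auto simp: T_def chi_def)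
      then show "ascale A (\<Sum>w\<in>W. c w * chi (\<sigma> w) \<gamma>) (t \<gamma>) = ascale A (\<Sum>i'\<in>I. \<phi> i' x * chi (\<tau> i') \<gamma>) (t \<gamma>)"
        by simp
    qed (use t in \<open>simp add: scale_closed\<close>)
    also have "\<dots> = asum A (\<lambda>i'. ascale A (\<phi> i' x) (amult A (tt (\<tau> i')) (Qx x i))) I"
      using fin by (intro exp[symmetric]) auto
    also have "\<dots> = asum A (\<lambda>i'. amult A (tt (\<tau> i')) (?b i')) I"
      using \<tau> q by (intro asum_cong refl) (simp_all add: mult_scale_right mult_closed scale_closed)
    finally have "amult A ?a (Qx x i) = asum A (\<lambda>i'. amult A (tt (\<tau> i')) (?b i')) I" .
    moreover have "?b i' \<in> carrier A \<and> amult A (Qx x i) (?b i') = ?b i' \<and> amult A (?b i') (Qx x i) = ?b i' \<and>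
        N (?b i') \<le> K i'" if "i' \<in> I" for i'
      using q K[OF that] x mult_mono[OF K(1)[OF that x] Nq K(2)[OF that]]
      by (simp add: scale_closed mult_scale_left mult_scale_right norm_scale)
    ultimately have "?split (Qx x i)" unfolding split_by_def by (intro exI[of _ ?b]) blast
    then show ?thesis ..
  qed
  have root: "?split (P v)" if v: "v \<in> verts E" for v
  proof -
    have "\<forall>w. walk E v [] w \<longrightarrow> ?split (QP [] w)"
    proof (rule path_bar_induct[where v = v and Q = "\<lambda>es. \<forall>w. walk E v es w \<longrightarrow> ?split (QP es w)"])
      fix es w
      assume w: "walk E v es w"
        and IH: "\<And>e. e \<in> in_arcs E w \<Longrightarrow> \<forall>u. walk E v (es @ [e]) u \<longrightarrow> ?split (QP (es @ [e]) u)"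
      have wv: "w \<in> verts E"
        using w v by (cases es rule: rev_cases) (auto simp: walk_append)
      have next_walk: "walk E v (es @ [e]) (tail E e)" "tail E e \<in> verts E" if "e \<in> in_arcs E w" for e
        using that w by (auto simp: walk_append)
      have "?split (asum A (\<lambda>e. QP (es @ [e]) (tail E e)) (in_arcs E w))"
      proof (rule split_by_sum)
        fix e f assume "e \<in> in_arcs E w" "f \<in> in_arcs E w" "e \<noteq> f"
        then show "amult A (QP (es @ [e]) (tail E e)) (QP (es @ [f]) (tail E f)) = azero A"
          by (rule QP_orthogonal[OF w])
      next
        fix e assume e: "e \<in> in_arcs E w"
        show "QP (es @ [e]) (tail E e) \<in> carrier A" "astar A (QP (es @ [e]) (tail E e)) = QP (es @ [e]) (tail E e)"
          "amult A (QP (es @ [e]) (tail E e)) (QP (es @ [e]) (tail E e)) = QP (es @ [e]) (tail E e)"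
          by (rule QP[OF next_walk[OF e]])+
        show "?split (QP (es @ [e]) (tail E e))" using IH[OF e] next_walk(1)[OF e] by blast
      qed (use fin \<tau> K a in auto)
      then have "?split (QP es w)" unfolding QP_sum[OF w wv, symmetric] .
      then show "\<forall>w. walk E v es w \<longrightarrow> ?split (QP es w)" using walk_end_unique[OF w] by auto
    next
      fix x assume x: "x \<in> IP" "ir x = v"
      obtain i where "?split (Qx x i)" using leaf[OF x(1)] by blast
      moreover have "walk E v (prefix i x) (ir (suffix i x))" using walk_prefix[OF x(1)] x(2) by simp
      ultimately show "\<exists>n. \<forall>w. walk E v (prefix n x) w \<longrightarrow> ?split (QP (prefix n x) w)"
        using walk_end_unique unfolding Qx_def by metis
    qed
    then show ?thesis using v by (simp add: QP_Nil)
  qed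
  have "?split (asum A P (verts E))"
    using fin \<tau> K a root by (intro split_by_sum) (auto simp: P_mult)
  then obtain b where b: "\<And>i. i \<in> I \<Longrightarrow> b i \<in> carrier A \<and> N (b i) \<le> K i"
    and ab: "amult A ?a (asum A P (verts E)) = asum A (\<lambda>i. amult A (tt (\<tau> i)) (b i)) I"
    unfolding split_by_def by blast
  \<comment> \<open>Replaces the missing unit: cutting by all vertex projections does not change the
    element.\<close>
  have tP: "amult A (tt (\<sigma> w)) (asum A P (verts E)) = tt (\<sigma> w)" if "w \<in> W" for w
    using tt_P_sum[OF \<sigma>[OF that]] \<sigma>[OF that] by (simp add: asum_mult_left)
  have "amult A ?a (asum A P (verts E)) = asum A (\<lambda>w. ascale A (c w) (amult A (tt (\<sigma> w)) (asum A P (verts E)))) W"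
    using \<sigma> by (subst asum_mult_right[symmetric]) (auto intro!: asum_cong asum_closed simp: scale_closed mult_scale_left mult_closed)
  also have "\<dots> = ?a" using tP \<sigma> by (intro asum_cong) (auto simp: scale_closed)
  finally have "N ?a \<le> (\<Sum>i\<in>I. N (amult A (tt (\<tau> i)) (b i)))"
    using norm_asum[of I "\<lambda>i. amult A (tt (\<tau> i)) (b i)"] b \<tau> ab by (simp add: mult_closed)
  also have "\<dots> \<le> sum K I"
  proof (rule sum_mono)
    fix i assume i: "i \<in> I"
    have "N (amult A (tt (\<tau> i)) (b i)) \<le> N (tt (\<tau> i)) * N (b i)" using b \<tau> i by (intro norm_mult) auto
    also have "\<dots> \<le> 1 * K i" using b[OF i] norm_tt_le_1[OF \<tau>[OF i]] \<tau>[OF i] by (intro mult_mono) auto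
    finally show "N (amult A (tt (\<tau> i)) (b i)) \<le> K i" by simp
  qed
  finally show ?thesis .
qed

end

section \<open>Density of the image of the free algebra\<close>

context finite_self_similar_action
begin

lemma cont_uniform:
  assumes \<phi>: "cont \<phi>" and \<epsilon>: "\<epsilon> > 0"
  shows "\<exists>n. \<forall>x\<in>IP. \<forall>y\<in>IP. prefix n y = prefix n x \<longrightarrow> norm (\<phi> x - \<phi> y) \<le> \<epsilon>"
proof (rule IP_uniform)
  fix x assume x: "x \<in> IP"
  obtain n where n: "\<forall>y\<in>IP. prefix n y = prefix n x \<longrightarrow> \<phi> y \<in> ball (\<phi> x) (\<epsilon> / 2)"
    using contD[OF \<phi> x, of "ball (\<phi> x) (\<epsilon> / 2)"] \<epsilon> by auto
  have "norm (\<phi> y - \<phi> z) \<le> \<epsilon>" if "y \<in> IP" "z \<in> IP" "prefix n y = prefix n x" "prefix n z = prefix n y" for y z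
  proof -
    have "dist (\<phi> x) (\<phi> y) < \<epsilon> / 2" "dist (\<phi> x) (\<phi> z) < \<epsilon> / 2" using n that by auto
    then show ?thesis using dist_triangle3[of "\<phi> y" "\<phi> z" "\<phi> x"] by (simp add: dist_norm)
  qed
  then show "\<exists>k n. \<forall>y\<in>IP. prefix k y = prefix k x \<longrightarrow> (\<forall>z\<in>IP. prefix n z = prefix n y \<longrightarrow> norm (\<phi> y - \<phi> z) \<le> \<epsilon>)"
    by blast
next
  fix m n x assume h: "\<forall>y\<in>IP. prefix m y = prefix m x \<longrightarrow> norm (\<phi> x - \<phi> y) \<le> \<epsilon>" and mn: "m \<le> n"
  show "\<forall>y\<in>IP. prefix n y = prefix n x \<longrightarrow> norm (\<phi> x - \<phi> y) \<le> \<epsilon>"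
  proof (intro ballI impI)
    fix y assume y: "y \<in> IP" "prefix n y = prefix n x"
    have "prefix m y = prefix m x" by (rule prefix_mono[OF y(2) mn])
    then show "norm (\<phi> x - \<phi> y) \<le> \<epsilon>" using h y(1) by blast
  qed
qed

lemma asub_CA: "asub CA f h = (\<lambda>\<gamma>. f \<gamma> - h \<gamma>)"
  by (simp add: asub_def conv_algebra_ops)

end

context generators
begin

lemma image_closed:
  assumes "x \<in> \<Phi> ` carrier FX"
  shows "astar A x \<in> \<Phi> ` carrier FX" "ascale A c x \<in> \<Phi> ` carrier FX"
    "y \<in> \<Phi> ` carrier FX \<Longrightarrow> aadd A x y \<in> \<Phi> ` carrier FX"
    "y \<in> \<Phi> ` carrier FX \<Longrightarrow> amult A x y \<in> \<Phi> ` carrier FX"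
  using assms by (auto simp flip: \<Phi>_star \<Phi>_scale \<Phi>_add \<Phi>_mult)

lemma gen_image: "x \<in> X \<Longrightarrow> \<eta> x \<in> \<Phi> ` carrier FX"
  using \<Phi>_gen by (metis free_gen_carrier imageI)

lemma zero_image: "azero A \<in> \<Phi> ` carrier FX"
  using \<Phi>_zero free.zero_closed by (metis imageI)

end

context ssa_family
begin

lemma gen_images:
  "g \<in> arr G \<Longrightarrow> U g \<in> \<Phi> ` carrier FX" "v \<in> verts E \<Longrightarrow> P v \<in> \<Phi> ` carrier FX"
  "e \<in> arcs E \<Longrightarrow> S e \<in> \<Phi> ` carrier FX"
  using gen_image[of "U_gen g"] gen_image[of "P_gen v"] gen_image[of "S_gen e"] by (simp_all add: gens_def)

lemma tt_image:
  assumes "valid \<tau>"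
  shows "tt \<tau> \<in> \<Phi> ` carrier FX"
proof -
  have SL: "SL l w \<in> \<Phi> ` carrier FX" if "walk E v l w" "w \<in> verts E" for v l w
    using that by (induction l arbitrary: v) (auto simp: gen_images image_closed(4))
  obtain m g n where t: "\<tau> = (m, g, n)" by (cases \<tau>)
  have g: "g \<in> arr G" using assms t by (simp add: valid_def)
  have "SL m (cm g) \<in> \<Phi> ` carrier FX" "SL n (dm g) \<in> \<Phi> ` carrier FX"
    using assms g SL by (auto simp: t valid_def)
  then show ?thesis unfolding t tt_def prod.case by (intro image_closed gen_images g)
qed

end

context finite_self_similar_action
begin

abbreviation "FA \<equiv> free_star_algebra gens :: ((('v, 'e, 'g) generator \<times> bool) list \<Rightarrow> complex) star_algebra"
abbreviation "\<Phi>A \<equiv> free_hom CA (ssa_family.\<eta> cU cP cS)"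

lemma step_image:
  assumes "finite L" "\<And>l w. (l, w) \<in> L \<Longrightarrow> w \<in> verts E \<and> (\<exists>v. walk E v l w)"
  shows "cont (\<lambda>x. \<Sum>p\<in>L. c p * (if x \<in> pcone (fst p) (snd p) then 1 else 0))"
    "D (\<lambda>x. \<Sum>p\<in>L. c p * (if x \<in> pcone (fst p) (snd p) then 1 else 0)) \<in> \<Phi>A ` carrier FA"
proof -
  interpret cf: ssa_family E G act CA cU cP cS by (rule CA_ssa_family)
  let ?f = "\<lambda>L x. \<Sum>p\<in>L. c p * (if x \<in> pcone (fst p) (snd p) then 1 else 0)"
  have "cont (?f L) \<and> D (?f L) \<in> \<Phi>A ` carrier FA"
    using assms
  proof (induction L)
    case empty
    have "D (\<lambda>x. 0) = azero CA" by (auto simp: D_def conv_algebra_ops)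
    then show ?case using cf.zero_image cont_const[of 0] by simp
  next
    case (insert p L)
    obtain l w where p: "p = (l, w)" by (cases p)
    from insert.prems[of l w] p obtain v where lw: "w \<in> verts E" "walk E v l w" by auto
    have "valid (l, gunit G w, l)" using lw by (auto simp: valid_def)
    then have "chi (l, gunit G w, l) \<in> \<Phi>A ` carrier FA" using cf.tt_image tt_CA by metis
    then have i: "D (\<lambda>x. c p * (if x \<in> pcone (fst p) (snd p) then 1 else 0)) \<in> \<Phi>A ` carrier FA"
      unfolding chi_unit[OF lw(2,1)] p fst_conv snd_conv D_scale[symmetric] by (rule cf.image_closed(2))
    have "cont (\<lambda>x. c p * (if x \<in> pcone (fst p) (snd p) then 1 else 0))"
      unfolding p fst_conv snd_conv by (intro cont_mult cont_const cont_indicator_pcone[OF lw(2)])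
    moreover have IH: "cont (?f L)" "D (?f L) \<in> \<Phi>A ` carrier FA" using insert by blast+
    moreover have "?f (insert p L) = (\<lambda>x. c p * (if x \<in> pcone (fst p) (snd p) then 1 else 0) + ?f L x)"
      using insert.hyps by simp
    ultimately show ?case using cf.image_closed(3)[OF i IH(2)] by (simp only: D_add cont_add)
  qed
  then show "cont (?f L)" "D (?f L) \<in> \<Phi>A ` carrier FA" by blast+
qed

text \<open>\<open>\<phi>\<close> is replaced by the step function that on each cylinder of length
  \<open>n\<close> takes the value at a chosen point. Step functions on the unit space come from the
  projections of paths, and multiplication by \<open>chi \<tau>\<close> brings them to the
  bisection.\<close>

lemma T_approx:
  assumes \<tau>: "valid \<tau>" and \<phi>: "cont \<phi>" and \<epsilon>: "\<epsilon> > 0"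
  shows "\<exists>r\<in>\<Phi>A ` carrier FA. bd (\<lambda>\<gamma>. T \<tau> \<phi> \<gamma> - r \<gamma>) \<epsilon>"
proof -
  interpret cf: ssa_family E G act CA cU cP cS by (rule CA_ssa_family)
  obtain n where n: "\<forall>x\<in>IP. \<forall>y\<in>IP. prefix n y = prefix n x \<longrightarrow> norm (\<phi> x - \<phi> y) \<le> \<epsilon>"
    using cont_uniform[OF \<phi> \<epsilon>] by blast
  \<comment> \<open>The vertex distinguishes the cylinders when \<open>n\<close> is zero and the
    prefix is empty.\<close>
  define pt where "pt x = (prefix n x, ir (suffix n x))" for x
  define L where "L = pt ` IP"
  have "L \<subseteq> {es. set es \<subseteq> arcs E \<and> length es = n} \<times> verts E"
    unfolding L_def pt_def using IP_arc by (auto simp: subsequence_def simp del: upt_Suc)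
  then have fin: "finite L"
    by (rule finite_subset) (intro finite_cartesian_product finite_lists_length_eq finite_arcs finite_verts)
  have L: "w \<in> verts E \<and> (\<exists>v. walk E v l w)" if "(l, w) \<in> L" for l w
    using that walk_prefix unfolding L_def pt_def by auto
  define pick where "pick p = (SOME x. x \<in> IP \<and> pt x = p)" for p
  have pick: "pick p \<in> IP \<and> pt (pick p) = p" if "p \<in> L" for p
    unfolding pick_def using that by (intro someI_ex[of "\<lambda>x. x \<in> IP \<and> pt x = p"]) (auto simp: L_def)
  define \<psi> where "\<psi> x = (\<Sum>p\<in>L. \<phi> (pick p) * (if x \<in> pcone (fst p) (snd p) then 1 else 0))" for x
  have \<psi>: "cont \<psi>" "D \<psi> \<in> \<Phi>A ` carrier FA"
    unfolding \<psi>_def using step_image[OF fin L, where c = "\<lambda>p. \<phi> (pick p)"] by blast+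
  have near: "norm (\<phi> x - \<psi> x) \<le> \<epsilon>" if x: "x \<in> IP" for x
  proof -
    have "x \<in> pcone (fst p) (snd p) \<longleftrightarrow> p = pt x" if p: "p \<in> L" for p
    proof
      assume "x \<in> pcone (fst p) (snd p)"
      then obtain z where "x = fst p \<frown> z" "ir z = snd p" by (auto simp: pcone_def)
      moreover have "length (fst p) = n" using p by (auto simp: L_def pt_def)
      ultimately show "p = pt x" unfolding pt_def by (auto simp: prod_eq_iff)
    next
      assume "p = pt x"
      moreover have "x \<in> pcone (prefix n x) (ir (suffix n x))"
        unfolding pcone_def using suffix_IP[OF x]
        by (intro CollectI exI[of _ "suffix n x"] conjI refl) (rule prefix_suffix[symmetric])
      ultimately show "x \<in> pcone (fst p) (snd p)" by (simp add: pt_def)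
    qed
    then have "\<psi> x = (\<Sum>p\<in>L. if p = pt x then \<phi> (pick p) else 0)"
      unfolding \<psi>_def by (intro sum.cong) auto
    moreover have ptL: "pt x \<in> L" using x by (simp add: L_def)
    ultimately have "\<psi> x = \<phi> (pick (pt x))" using fin by simp
    moreover have "prefix n (pick (pt x)) = prefix n x" using pick[OF ptL] by (simp add: pt_def)
    ultimately show ?thesis using n x pick[OF ptL] by auto
  qed
  have "chi \<tau> \<in> \<Phi>A ` carrier FA" using cf.tt_image[OF \<tau>] tt_CA[OF \<tau>] by simp
  then have "T \<tau> \<psi> \<in> \<Phi>A ` carrier FA"
    unfolding chi_D[OF \<tau>, symmetric] by (rule cf.image_closed(4)) (rule \<psi>)
  moreover have "(\<lambda>\<gamma>. T \<tau> \<phi> \<gamma> - T \<tau> \<psi> \<gamma>) = T \<tau> (\<lambda>x. \<phi> x - \<psi> x)" by (auto simp: T_def)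
  then have "bd (\<lambda>\<gamma>. T \<tau> \<phi> \<gamma> - T \<tau> \<psi> \<gamma>) \<epsilon>"
    using bd_T[OF \<tau> cont_diff[OF \<phi> \<psi>(1)], of \<epsilon>] near \<epsilon> by simp
  ultimately show ?thesis by blast
qed

theorem image_dense:
  assumes "h \<in> carrier CA" "\<epsilon> > 0"
  shows "\<exists>a\<in>carrier FA. bd (asub CA h (\<Phi>A a)) \<epsilon>"
proof -
  interpret cf: ssa_family E G act CA cU cP cS by (rule CA_ssa_family)
  obtain M where "bd h M" using assms by (auto simp: CA_carrier)
  then have "\<exists>r\<in>\<Phi>A ` carrier FA. bd (\<lambda>\<gamma>. h \<gamma> - r \<gamma>) \<epsilon>" using assms(2)
  proof (induction arbitrary: \<epsilon> rule: bd.induct)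
    case (zero M)
    have "bd (\<lambda>\<gamma>. 0 - azero CA \<gamma>) \<epsilon>" using bd.zero[of \<epsilon>] zero by (simp add: conv_algebra_ops)
    then show ?case using cf.zero_image by blast
  next
    case (add f M \<tau> \<phi> K)
    have e: "\<epsilon> / 2 > 0" using add.prems by simp
    obtain r where r: "r \<in> \<Phi>A ` carrier FA" "bd (\<lambda>\<gamma>. f \<gamma> - r \<gamma>) (\<epsilon> / 2)"
      using add.IH[OF e] by blast
    obtain s where s: "s \<in> \<Phi>A ` carrier FA" "bd (\<lambda>\<gamma>. T \<tau> \<phi> \<gamma> - s \<gamma>) (\<epsilon> / 2)"
      using T_approx[OF add.hyps(2,3) e] by blast
    have "bd (\<lambda>\<gamma>. (f \<gamma> + T \<tau> \<phi> \<gamma>) - aadd CA r s \<gamma>) \<epsilon>"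
      using bd_add[OF r(2) s(2)] by (simp add: conv_algebra_ops algebra_simps)
    then show ?case using cf.image_closed(3)[OF r(1) s(1)] by blast
  qed
  then show ?thesis unfolding asub_CA by blast
qed

end

section \<open>The defining relations\<close>

lemma ssa_relations_mono:
  assumes "ssa_relations A (=) E G act u p s" "\<And>x y. x = y \<Longrightarrow> eqv x y"
  shows "ssa_relations A eqv E G act u p s"
proof -
  note rel = assms(1)[unfolded ssa_relations_def]
  note rels = rel[THEN conjunct1, rule_format] rel[THEN conjunct2, THEN conjunct1, rule_format]
    rel[THEN conjunct2, THEN conjunct2, THEN conjunct1, rule_format, THEN conjunct1]
    rel[THEN conjunct2, THEN conjunct2, THEN conjunct1, rule_format, THEN conjunct2]
    rel[THEN conjunct2, THEN conjunct2, THEN conjunct2, THEN conjunct1, rule_format]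
    rel[THEN conjunct2, THEN conjunct2, THEN conjunct2, THEN conjunct2, THEN conjunct1, rule_format]
    rel[THEN conjunct2, THEN conjunct2, THEN conjunct2, THEN conjunct2, THEN conjunct2, THEN conjunct1, rule_format]
    rel[THEN conjunct2, THEN conjunct2, THEN conjunct2, THEN conjunct2, THEN conjunct2, THEN conjunct2, THEN conjunct1, rule_format]
    rel[THEN conjunct2, THEN conjunct2, THEN conjunct2, THEN conjunct2, THEN conjunct2, THEN conjunct2, THEN conjunct2, rule_format]
  show ?thesis
    unfolding ssa_relations_def by (intro conjI ballI impI assms(2)) (rule rels; assumption)+
qed

text \<open>Equality is pulled back along \<open>h\<close>, so relations move both ways: from a
  seminorm on the free algebra to its completion, and from the convolution algebra back to the free
  algebra.\<close>

lemma ssa_relations_hom: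
  assumes A: "star_algebra A" and B: "star_algebra B" and h: "star_hom A B h"
    and eqv: "\<And>x y. x \<in> carrier A \<Longrightarrow> y \<in> carrier A \<Longrightarrow> eqv x y \<longleftrightarrow> eqv' (h x) (h y)"
    and G: "groupoid G" "obj G = verts E"
    and c: "\<And>g. g \<in> arr G \<Longrightarrow> u g \<in> carrier A" "\<And>v. v \<in> verts E \<Longrightarrow> p v \<in> carrier A"
      "\<And>e. e \<in> arcs E \<Longrightarrow> s e \<in> carrier A"
    and arcs: "\<And>e. e \<in> arcs E \<Longrightarrow> tail E e \<in> verts E"
    and act: "\<And>g e. g \<in> arr G \<Longrightarrow> e \<in> in_arcs E (gdom G g) \<Longrightarrow>
      act_edge E act g e \<in> arcs E \<and> edge_restrict E G act g e \<in> arr G"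
    and images: "\<And>g. g \<in> arr G \<Longrightarrow> h (u g) = u' g" "\<And>v. v \<in> verts E \<Longrightarrow> h (p v) = p' v"
      "\<And>e. e \<in> arcs E \<Longrightarrow> h (s e) = s' e"
  shows "ssa_relations A eqv E G act u p s \<longleftrightarrow> ssa_relations B eqv' E G act u' p' s'"
proof -
  interpret A: star_algebra A by fact
  interpret G: groupoid G by fact
  have hm: "h (amult A x y) = amult B (h x) (h y)" "h (astar A x) = astar B (h x)"
    if "x \<in> carrier A" "y \<in> carrier A" for x y
    using h that unfolding star_hom_def by simp_all
  have hs: "h (astar A x) = astar B (h x)" if "x \<in> carrier A" for x
    using h that unfolding star_hom_def by simp
  have hsum: "h (asum A (\<lambda>e. amult A (s e) (astar A (s e))) (in_arcs E v)) =
      asum B (\<lambda>e. amult B (s' e) (astar B (s' e))) (in_arcs E v)" for v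
  proof -
    have "h (asum A (\<lambda>e. amult A (s e) (astar A (s e))) (in_arcs E v)) =
        asum B (\<lambda>e. h (amult A (s e) (astar A (s e)))) (in_arcs E v)"
      using c by (intro star_hom_asum[OF A B h]) (auto simp: A.mult_closed A.star_closed)
    also have "\<dots> = asum B (\<lambda>e. amult B (s' e) (astar B (s' e))) (in_arcs E v)"
    proof (rule star_algebra.asum_cong[OF B refl])
      fix e assume "e \<in> in_arcs E v"
      then have e: "s e \<in> carrier A" "h (s e) = s' e" "s' e \<in> carrier B"
        using c(3) images(3) h unfolding star_hom_def by (auto simp flip: images(3))
      show "h (amult A (s e) (astar A (s e))) = amult B (s' e) (astar B (s' e))"
        using e A.star_closed by (simp add: hm hs)
      show "amult B (s' e) (astar B (s' e)) \<in> carrier B"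
        using e star_algebra.mult_closed[OF B] star_algebra.star_closed[OF B] by simp
    qed
    finally show ?thesis .
  qed
  have sc: "asum A (\<lambda>e. amult A (s e) (astar A (s e))) (in_arcs E v) \<in> carrier A" for v
    using c by (intro A.asum_closed) (auto simp: A.mult_closed A.star_closed)
  note z = star_hom_zero[OF A B h]
  show ?thesis
    unfolding ssa_relations_def
    using c act arcs eqv z
    by (intro conj_cong ball_cong refl imp_cong)
      (simp_all add: hm hs hsum sc images A.mult_closed A.star_closed G.mult_arr G.inv_arr G.unit_arr G(2))
qed

lemma (in ssa_family) ssa_relations: "ssa_relations A (=) E G act U P S"
  unfolding ssa_relations_def
  by (auto simp: U_mult U_inv P_mult S_S P_unit[symmetric] U_S intro!: P_sum)

text \<open>The relations do not mention products of different edges, nor that vertex projections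
  absorb edges. The C*-identity gives that \<open>S e\<close> absorbs the projection at its source,
  the theorem on projections gives orthogonal ranges at a common vertex, and orthogonality of the
  vertex projections does the rest.\<close>

lemma (in finite_self_similar_action) cstar_ssa_family:
  assumes B: "cstar_algebra B" and rel: "ssa_relations B (=) E G act U P S"
    and U: "\<And>g. g \<in> arr G \<Longrightarrow> U g \<in> carrier B" and S: "\<And>e. e \<in> arcs E \<Longrightarrow> S e \<in> carrier B"
  shows "ssa_family E G act B U P S"
proof -
  interpret B: cstar_algebra B by fact
  note rel = rel[unfolded ssa_relations_def]
  have UU: "amult B (U g) (U h) = (if dm g = cm h then U (gmult G g h) else azero B)"
    if "g \<in> arr G" "h \<in> arr G" for g h
    using that by (rule rel[THEN conjunct1, rule_format])
  have UI: "U (ginv G g) = astar B (U g)" if "g \<in> arr G" for g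
    using that by (rule rel[THEN conjunct2, THEN conjunct1, rule_format])
  have PP: "astar B (P v) = P v" "amult B (P v) (P v) = P v" if "v \<in> verts E" for v
    using that rel[THEN conjunct2, THEN conjunct2, THEN conjunct1] by simp_all
  have PO: "amult B (P v) (P w) = azero B" if "v \<in> verts E" "w \<in> verts E" "v \<noteq> w" for v w
    using that by (rule rel[THEN conjunct2, THEN conjunct2, THEN conjunct2, THEN conjunct1, rule_format])
  have SS: "amult B (astar B (S e)) (S e) = P (tail E e)" if "e \<in> arcs E" for e
    using that by (rule rel[THEN conjunct2, THEN conjunct2, THEN conjunct2, THEN conjunct2, THEN conjunct1, rule_format])
  have PS: "P v = asum B (\<lambda>e. amult B (S e) (astar B (S e))) (in_arcs E v)" if "v \<in> verts E" for v
    using that by (rule rel[THEN conjunct2, THEN conjunct2, THEN conjunct2, THEN conjunct2, THEN conjunct2, THEN conjunct1, rule_format])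
  have PU: "P v = U (gunit G v)" if "v \<in> verts E" for v
    using that by (rule rel[THEN conjunct2, THEN conjunct2, THEN conjunct2, THEN conjunct2, THEN conjunct2, THEN conjunct2, THEN conjunct1, rule_format])
  have US: "amult B (U g) (S e) = amult B (S (ae g e)) (U (er g e))" if "g \<in> arr G" "e \<in> in_arcs E (dm g)" for g e
    using that by (rule rel[THEN conjunct2, THEN conjunct2, THEN conjunct2, THEN conjunct2, THEN conjunct2, THEN conjunct2, THEN conjunct2, rule_format])
  have P: "P v \<in> carrier B" if "v \<in> verts E" for v using PU U that by simp
  have S_P: "amult B (S e) (P (tail E e)) = S e" if e: "e \<in> arcs E" for e
  proof -
    let ?P = "P (tail E e)"
    have v: "?P \<in> carrier B" "S e \<in> carrier B" using P S e by auto
    \<comment> \<open>The adjoint of \<open>?z\<close> annihilates \<open>S e\<close>, so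
      \<open>?z^* ?z\<close> is zero, and then \<open>?z\<close> is zero because the norm is
      definite.\<close>
    let ?z = "asub B (S e) (amult B (S e) ?P)"
    have sz: "astar B ?z = asub B (astar B (S e)) (amult B ?P (astar B (S e)))"
      using v e PP by (simp add: B.asub_star[symmetric] B.star_mult)
    have zS: "amult B (astar B ?z) (S e) = azero B"
      unfolding sz using v e SS PP by (simp add: B.asub_mult_left B.mult_assoc)
    have "amult B (astar B ?z) ?z = asub B (amult B (astar B ?z) (S e)) (amult B (amult B (astar B ?z) (S e)) ?P)"
      using v by (simp add: B.asub_mult_right B.mult_assoc)
    also have "\<dots> = azero B" unfolding zS using v by simp
    finally have zz: "amult B (astar B ?z) ?z = azero B" .
    have "?z = azero B" by (rule B.norm_definite[OF _ zz]) (use v in auto)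
    then show ?thesis using v by (simp add: B.asub_eq_zero)
  qed
  define q where "q e = amult B (S e) (astar B (S e))" for e
  have q: "q e \<in> carrier B" "amult B (q e) (q e) = q e" "astar B (q e) = q e"
    "amult B (q e) (S e) = S e" "amult B (astar B (S e)) (q e) = astar B (S e)" if e: "e \<in> arcs E" for e
  proof -
    have v: "P (tail E e) \<in> carrier B" "S e \<in> carrier B" using P S e by auto
    show qc: "q e \<in> carrier B" "astar B (q e) = q e" using v by (simp_all add: q_def B.star_mult)
    show qS: "amult B (q e) (S e) = S e" unfolding q_def using v e by (simp add: B.mult_assoc SS S_P)
    have "amult B (astar B (S e)) (q e) = astar B (amult B (q e) (S e))"
      using v qc by (simp add: B.star_mult)
    then show "amult B (astar B (S e)) (q e) = astar B (S e)" unfolding qS .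
    show "amult B (q e) (q e) = q e"
      using v e qS unfolding q_def by (simp add: B.mult_assoc[symmetric])
  qed
  have S_S0: "amult B (astar B (S e)) (S f) = azero B" if e: "e \<in> arcs E" "f \<in> arcs E" "e \<noteq> f" "head E e = head E f" for e f
  proof -
    let ?J = "in_arcs E (head E f)"
    have hv: "head E f \<in> verts E" using e by simp
    \<comment> \<open>The range projections at one vertex sum to the projection of that vertex, so
      \<open>orthogonal_projections\<close> applies.\<close>
    have "amult B (q e) (q f) = azero B"
    proof (rule B.orthogonal_projections[of ?J])
      show "amult B (asum B q ?J) (asum B q ?J) = asum B q ?J"
        using PS[OF hv] PP[OF hv] unfolding q_def by simp
    qed (use e q in auto)
    then have "amult B (astar B (S e)) (amult B (amult B (q e) (q f)) (S f)) = azero B" using S e by simp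
    moreover have "amult B (astar B (S e)) (amult B (amult B (q e) (q f)) (S f)) =
        amult B (amult B (astar B (S e)) (q e)) (amult B (q f) (S f))"
      using S e q(1)[OF e(1)] q(1)[OF e(2)] by (simp add: B.mult_assoc)
    ultimately show ?thesis using q e by simp
  qed
  have P_S: "amult B (P (head E f)) (S f) = S f" if f: "f \<in> arcs E" for f
  proof -
    let ?J = "in_arcs E (head E f)"
    have "amult B (P (head E f)) (S f) = asum B (\<lambda>e. amult B (q e) (S f)) ?J"
      using PS[of "head E f"] f S q unfolding q_def[symmetric] by (subst B.asum_mult_right) auto
    also have "\<dots> = amult B (q f) (S f)"
    proof (rule B.asum_single)
      fix e assume e: "e \<in> ?J" "e \<noteq> f"
      then show "amult B (q e) (S f) = azero B" using S f S_S0[of e f] by (simp add: q_def B.mult_assoc)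
    qed (use f S q in auto)
    finally show ?thesis using q f by simp
  qed
  have S_S: "amult B (astar B (S e)) (S f) = (if e = f then P (tail E e) else azero B)"
    if e: "e \<in> arcs E" "f \<in> arcs E" for e f
  proof (cases "head E e = head E f")
    case True
    then show ?thesis using SS S_S0 e by simp
  next
    case False
    have v: "P (head E e) \<in> carrier B" "P (head E f) \<in> carrier B" "S e \<in> carrier B" "S f \<in> carrier B"
      using P S e by auto
    have "amult B (astar B (S e)) (S f) =
        amult B (astar B (amult B (P (head E e)) (S e))) (amult B (P (head E f)) (S f))"
      using P_S e by simp
    also have "\<dots> = amult B (astar B (S e)) (amult B (amult B (P (head E e)) (P (head E f))) (S f))"
      using v e PP(1) by (simp add: B.star_mult B.mult_assoc)
    also have "\<dots> = azero B" using PO[of "head E e" "head E f"] v e False by simp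
    finally show ?thesis using False by auto
  qed
  show ?thesis
    by unfold_locales (assumption | rule U S UU UI[symmetric] PU S_P P_S PS S_S | rule US; simp)+
qed

section \<open>Extending a seminorm\<close>

text \<open>By \<open>norm_le_bd\<close> elements with close images have close seminorms, in
  particular \<open>N\<close> vanishes where \<open>h\<close> does. Hence \<open>N\<close> descends
  to the image of \<open>h\<close> and, the image being dense, extends by continuity.\<close>

locale seminorm_extension = finite_self_similar_action E G act + cstar_seminormed F N
  for E :: "('v, 'e) pre_digraph" and G :: "('v, 'g, 'm) groupoid_scheme"
    and act :: "'g \<Rightarrow> ('v, 'e) fpath \<Rightarrow> ('v, 'e) fpath"
    and F :: "('a, 'n) star_algebra_scheme" and N :: "'a \<Rightarrow> real" +
  fixes h :: "'a \<Rightarrow> ('e, 'g) germ_tuple set \<Rightarrow> complex"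
  assumes hom: "star_hom F CA h"
    and norm_le_bd: "a \<in> carrier F \<Longrightarrow> bd (h a) M \<Longrightarrow> N a \<le> M"
    and dense: "f \<in> carrier CA \<Longrightarrow> \<epsilon> > 0 \<Longrightarrow> \<exists>a\<in>carrier F. bd (asub CA f (h a)) \<epsilon>"
begin

lemma h_simps [simp]:
  "a \<in> carrier F \<Longrightarrow> h a \<in> carrier CA"
  "a \<in> carrier F \<Longrightarrow> b \<in> carrier F \<Longrightarrow> h (aadd F a b) = aadd CA (h a) (h b)"
  "a \<in> carrier F \<Longrightarrow> h (ascale F c a) = ascale CA c (h a)"
  "a \<in> carrier F \<Longrightarrow> b \<in> carrier F \<Longrightarrow> h (amult F a b) = amult CA (h a) (h b)"
  "a \<in> carrier F \<Longrightarrow> h (astar F a) = astar CA (h a)"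
  using hom unfolding star_hom_def by simp_all

text \<open>The extension by continuity in closed form, without choosing approximating sequences;
  \<open>ext_near\<close> shows that it differs from \<open>N a\<close> by at most the approximation
  cost.\<close>

definition ext :: "(('e, 'g) germ_tuple set \<Rightarrow> complex) \<Rightarrow> real" where
  "ext f = Inf {N a + M | a M. a \<in> carrier F \<and> bd (asub CA f (h a)) M}"

lemma bd_aadd: "bd f M \<Longrightarrow> bd k L \<Longrightarrow> bd (aadd CA f k) (M + L)"
  using bd_add by (simp add: conv_algebra_ops)

lemma bd_ascale: "bd f M \<Longrightarrow> bd (ascale CA c f) (norm c * M)"
  using bd_scale by (simp add: conv_algebra_ops)

lemma bd_amult: "bd f M \<Longrightarrow> bd k L \<Longrightarrow> bd (amult CA f k) (M * L)"
  using bd_conv by (simp add: conv_algebra_ops)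

lemma norm_diff_le_bd:
  assumes "a \<in> carrier F" "a' \<in> carrier F" "f \<in> carrier CA" "bd (asub CA f (h a)) M" "bd (asub CA f (h a')) M'"
  shows "N a \<le> N a' + (M' + M)"
proof -
  have "asub CA (h a) (h a') = aadd CA (asub CA (h a) f) (asub CA f (h a'))"
    using assms by (simp add: cvl.asub_trans)
  also have "asub CA (h a) f = ascale CA (-1) (asub CA f (h a))"
    using assms by (simp add: cvl.asub_swap)
  finally have "bd (asub CA (h a) (h a')) (M + M')"
    using bd_aadd[OF bd_ascale[OF assms(4), of "-1"] assms(5)] by simp
  moreover have "h (asub F a a') = asub CA (h a) (h a')"
    using assms by (simp add: asub_def scale_closed)
  ultimately have "N (asub F a a') \<le> M + M'" using assms by (intro norm_le_bd) (auto simp: asub_closed)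
  then show ?thesis using norm_le_asub[OF assms(1,2)] by simp
qed

lemma ext_near:
  assumes "a \<in> carrier F" "f \<in> carrier CA" "bd (asub CA f (h a)) M"
  shows "\<bar>ext f - N a\<bar> \<le> M"
proof -
  let ?S = "{N a + M | a M. a \<in> carrier F \<and> bd (asub CA f (h a)) M}"
  have "ext f \<le> N a + M"
    unfolding ext_def
  proof (rule cInf_lower)
    show "bdd_below ?S" using bd_nonneg by (intro bdd_belowI[of _ 0]) (auto intro!: add_nonneg_nonneg)
  qed (use assms in blast)
  moreover have "N a - M \<le> ext f"
    unfolding ext_def
  proof (rule cInf_greatest)
    show "?S \<noteq> {}" using assms by blast
    fix x assume "x \<in> ?S"
    then obtain a' M' where x: "x = N a' + M'" "a' \<in> carrier F" "bd (asub CA f (h a')) M'" by blast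
    then show "N a - M \<le> x" using norm_diff_le_bd[OF assms(1) x(2) assms(2,3) x(3)] by simp
  qed
  ultimately show ?thesis by linarith
qed

text \<open>Convergence measured by the cost of the difference. The seminorm axioms for
  \<open>ext\<close> follow by passing to limits along such sequences.\<close>

definition approx :: "(nat \<Rightarrow> 'a) \<Rightarrow> (('e, 'g) germ_tuple set \<Rightarrow> complex) \<Rightarrow> bool" where
  "approx X f \<longleftrightarrow> f \<in> carrier CA \<and> range X \<subseteq> carrier F \<and>
     (\<exists>M. (\<forall>n. bd (asub CA f (h (X n))) (M n)) \<and> M \<longlonglongrightarrow> 0)"

lemma approx_exists:
  assumes "f \<in> carrier CA"
  obtains X where "approx X f"
proof -
  have "\<forall>n. \<exists>a. a \<in> carrier F \<and> bd (asub CA f (h a)) (inverse (real (Suc n)))"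
    using dense[OF assms, of "inverse (real (Suc _))"] by auto
  from choice[OF this] obtain X where "\<forall>n. X n \<in> carrier F \<and> bd (asub CA f (h (X n))) (inverse (real (Suc n)))" ..
  then have "approx X f" using assms LIMSEQ_inverse_real_of_nat unfolding approx_def
    by (intro conjI exI[of _ "\<lambda>n. inverse (real (Suc n))"]) auto
  then show thesis by (rule that)
qed

lemma approx_const: "a \<in> carrier F \<Longrightarrow> approx (\<lambda>_. a) (h a)"
  unfolding approx_def using bd.zero[of 0] by (intro conjI exI[of _ "\<lambda>_. 0"]) (auto simp: conv_algebra_ops)

lemma approx_ext:
  assumes "approx X f"
  shows "(\<lambda>n. N (X n)) \<longlonglongrightarrow> ext f"
proof -
  obtain M where M: "\<And>n. bd (asub CA f (h (X n))) (M n)" "M \<longlonglongrightarrow> 0" and c: "f \<in> carrier CA" "\<And>n. X n \<in> carrier F"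
    using assms(1) unfolding approx_def by blast
  have "\<bar>ext f - N (X n)\<bar> \<le> M n" for n using ext_near M c by blast
  then have "(\<lambda>n. N (X n) - ext f) \<longlonglongrightarrow> 0"
    by (intro Lim_null_comparison[OF _ M(2)] always_eventually allI) (simp add: abs_minus_commute)
  then show ?thesis by (simp add: LIM_zero_iff)
qed

lemma approx_add:
  assumes "approx X f" "approx Y k"
  shows "approx (\<lambda>n. aadd F (X n) (Y n)) (aadd CA f k)"
proof -
  obtain M where M: "\<And>n. bd (asub CA f (h (X n))) (M n)" "M \<longlonglongrightarrow> 0" and c: "f \<in> carrier CA" "\<And>n. X n \<in> carrier F"
    using assms(1) unfolding approx_def by blast
  obtain L where L: "\<And>n. bd (asub CA k (h (Y n))) (L n)" "L \<longlonglongrightarrow> 0" and d: "k \<in> carrier CA" "\<And>n. Y n \<in> carrier F"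
    using assms(2) unfolding approx_def by blast
  have "bd (asub CA (aadd CA f k) (h (aadd F (X n) (Y n)))) (M n + L n)" for n
    using c d bd_aadd[OF M(1) L(1)] by (simp add: cvl.asub_asub_swap)
  moreover have "(\<lambda>n. M n + L n) \<longlonglongrightarrow> 0" using tendsto_add[OF M(2) L(2)] by simp
  ultimately show ?thesis unfolding approx_def using c d by (intro conjI exI[of _ "\<lambda>n. M n + L n"]) auto
qed

lemma approx_scale:
  assumes "approx X f"
  shows "approx (\<lambda>n. ascale F c (X n)) (ascale CA c f)"
proof -
  obtain M where M: "\<And>n. bd (asub CA f (h (X n))) (M n)" "M \<longlonglongrightarrow> 0" and c: "f \<in> carrier CA" "\<And>n. X n \<in> carrier F"
    using assms(1) unfolding approx_def by blast
  have "bd (asub CA (ascale CA c f) (h (ascale F c (X n)))) (norm c * M n)" for n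
    using c bd_ascale[OF M(1)] by (simp add: cvl.asub_scale)
  moreover have "(\<lambda>n. norm c * M n) \<longlonglongrightarrow> 0" using tendsto_mult_right_zero[OF M(2)] .
  ultimately show ?thesis unfolding approx_def using c
    by (intro conjI exI[of _ "\<lambda>n. norm c * M n"]) (auto simp: scale_closed cvl.scale_closed)
qed

lemma approx_star:
  assumes "approx X f"
  shows "approx (\<lambda>n. astar F (X n)) (astar CA f)"
proof -
  obtain M where M: "\<And>n. bd (asub CA f (h (X n))) (M n)" "M \<longlonglongrightarrow> 0" and c: "f \<in> carrier CA" "\<And>n. X n \<in> carrier F"
    using assms(1) unfolding approx_def by blast
  have "bd (asub CA (astar CA f) (h (astar F (X n)))) (M n)" for n
    using c bd_star[OF M(1)] by (simp add: cvl.asub_star)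
  then show ?thesis unfolding approx_def using c M(2)
    by (intro conjI exI[of _ M]) (auto simp: star_closed cvl.star_closed)
qed

lemma approx_mult:
  assumes "approx X f" "approx Y k"
  shows "approx (\<lambda>n. amult F (X n) (Y n)) (amult CA f k)"
proof -
  obtain M where M: "\<And>n. bd (asub CA f (h (X n))) (M n)" "M \<longlonglongrightarrow> 0" and c: "f \<in> carrier CA" "\<And>n. X n \<in> carrier F"
    using assms(1) unfolding approx_def by blast
  obtain L where L: "\<And>n. bd (asub CA k (h (Y n))) (L n)" "L \<longlonglongrightarrow> 0" and d: "k \<in> carrier CA" "\<And>n. Y n \<in> carrier F"
    using assms(2) unfolding approx_def by blast
  obtain A B where A: "bd f A" and B: "bd k B" using c d by (auto simp: CA_carrier)
  \<comment> \<open>The difference of products is \<open>(f - x) k + x (k - y)\<close> with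
    \<open>x\<close> and \<open>y\<close> the approximants; \<open>x\<close> costs at most
    \<open>A + M n\<close> because it differs from \<open>f\<close> by cost
    \<open>M n\<close>.\<close>
  have "bd (asub CA (amult CA f k) (h (amult F (X n) (Y n)))) (M n * B + (A + M n) * L n)" for n
  proof -
    have "h (X n) = aadd CA f (ascale CA (-1) (asub CA f (h (X n))))"
      using c cvl.add_commute[of f "asub CA (h (X n)) f"] by (simp add: cvl.asub_swap cvl.add_asub_cancel)
    then have "bd (h (X n)) (A + norm (-1 :: complex) * M n)"
      using bd_aadd[OF A bd_ascale[OF M(1), of "-1" n]] by simp
    then have "bd (h (X n)) (A + M n)" by simp
    then show ?thesis
      using c d bd_aadd[OF bd_amult[OF M(1) B] bd_amult[OF _ L(1)]] by (simp add: cvl.asub_mult)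
  qed
  moreover have "(\<lambda>n. M n * B + (A + M n) * L n) \<longlonglongrightarrow> 0 * B + (A + 0) * 0"
    by (intro tendsto_intros M L)
  ultimately show ?thesis unfolding approx_def using c d mult_closed cvl.mult_closed
    by (intro conjI exI[of _ "\<lambda>n. M n * B + (A + M n) * L n"]) auto
qed

lemma approx_closed: "approx X f \<Longrightarrow> X n \<in> carrier F"
  unfolding approx_def by blast

theorem ext_cstar_seminorm: "cstar_seminorm CA ext"
  unfolding cstar_seminorm_def
proof (intro conjI ballI allI)
  fix f assume "f \<in> carrier CA"
  then obtain X where X: "approx X f" by (rule approx_exists)
  note c = approx_closed[OF X] and x = approx_ext[OF X]
  show "0 \<le> ext f" using c by (intro LIMSEQ_le_const[OF x]) auto
  have "(\<lambda>n. N (amult F (astar F (X n)) (X n))) \<longlonglongrightarrow> (ext f)\<^sup>2"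
    using c tendsto_power[OF x, of 2] by (simp add: norm_star_mult)
  with approx_ext[OF approx_mult[OF approx_star[OF X] X]]
  show "ext (amult CA (astar CA f) f) = (ext f)\<^sup>2" by (rule LIMSEQ_unique)
  {
    fix z
    have "(\<lambda>n. N (ascale F z (X n))) \<longlonglongrightarrow> norm z * ext f"
      using c tendsto_mult_left[OF x, of "norm z"] by (simp add: norm_scale)
    with approx_ext[OF approx_scale[OF X]]
    show "ext (ascale CA z f) = norm z * ext f" by (rule LIMSEQ_unique)
  }
  fix k assume "k \<in> carrier CA"
  then obtain Y where Y: "approx Y k" by (rule approx_exists)
  note d = approx_closed[OF Y] and y = approx_ext[OF Y]
  show "ext (aadd CA f k) \<le> ext f + ext k"
    using c d by (intro LIMSEQ_le[OF approx_ext[OF approx_add[OF X Y]] tendsto_add[OF x y]]) (auto intro: norm_add)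
  show "ext (amult CA f k) \<le> ext f * ext k"
    using c d by (intro LIMSEQ_le[OF approx_ext[OF approx_mult[OF X Y]] tendsto_mult[OF x y]]) (auto intro: norm_mult)
qed

lemma ext_hom: "a \<in> carrier F \<Longrightarrow> ext (h a) = N a"
  using approx_ext[OF approx_const] LIMSEQ_unique tendsto_const by metis

end

section \<open>The isomorphism\<close>

lemma (in star_algebra) cstar_seminorm_comp:
  assumes "star_algebra B" "cstar_seminorm B K" "star_hom A B h"
  shows "cstar_seminorm A (\<lambda>a. K (h a))"
  using assms unfolding cstar_seminorm_def star_hom_def by (simp add: star_closed)

context finite_self_similar_action
begin

text \<open>Turns a derivation of \<open>bd\<close> into the indexed family that
  \<open>norm_le_sum_bounds\<close> expects.\<close>

lemma bd_decomposition:
  "bd f M \<Longrightarrow> \<exists>k \<tau> \<phi> K. (\<forall>i<k. valid (\<tau> i) \<and> (\<forall>x\<in>IP. norm (\<phi> i x) \<le> K i) \<and> 0 \<le> K i) \<and>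
    f = (\<lambda>\<gamma>. \<Sum>i<(k::nat). T (\<tau> i) (\<phi> i) \<gamma>) \<and> (\<Sum>i<k. K i) \<le> M"
proof (induction rule: bd.induct)
  case (zero M)
  then show ?case by (intro exI[of _ 0]) simp
next
  case (add f M \<tau>' \<phi>' K')
  then obtain k \<tau> \<phi> K where IH: "\<forall>i<k. valid (\<tau> i) \<and> (\<forall>x\<in>IP. norm (\<phi> i x) \<le> K i) \<and> 0 \<le> K i"
    "f = (\<lambda>\<gamma>. \<Sum>i<(k::nat). T (\<tau> i) (\<phi> i) \<gamma>)" "(\<Sum>i<k. K i) \<le> M" by blast
  show ?case
    using IH add.hyps
    by (intro exI[of _ "Suc k"] exI[of _ "\<tau>(k := \<tau>')"] exI[of _ "\<phi>(k := \<phi>')"] exI[of _ "K(k := K')"])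
      (auto simp: less_Suc_eq)
qed

end

context ssa_family
begin

lemma free_hom_tt:
  assumes "f \<in> carrier FX"
  shows "\<Phi> f = asum A (\<lambda>w. ascale A (f w) (tt (the (red w)))) {w. f w \<noteq> 0 \<and> red w \<noteq> None}"
    "finite {w. f w \<noteq> 0 \<and> red w \<noteq> None}" "\<And>w. f w \<noteq> 0 \<Longrightarrow> red w \<noteq> None \<Longrightarrow> valid (the (red w))"
proof -
  have W: "finite {w. f w \<noteq> 0}" "{w. f w \<noteq> 0} \<subseteq> words_on gens" using assms by (auto simp: free_carrier)
  show "finite {w. f w \<noteq> 0 \<and> red w \<noteq> None}" by (rule finite_subset[OF _ W(1)]) blast
  show v: "valid (the (red w))" if "f w \<noteq> 0" "red w \<noteq> None" for w
    using red_eval(2)[of w] W(2) that by auto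
  have ev: "ev w = tt (the (red w))" if "f w \<noteq> 0" "red w \<noteq> None" for w
    using red_eval(1)[of w] W(2) that by (auto simp: opt_eval_def)
  have ev0: "ev w = azero A" if "f w \<noteq> 0" "red w = None" for w
    using red_eval(1)[of w] W(2) that by (auto simp: opt_eval_def)
  have "\<Phi> f = asum A (\<lambda>w. ascale A (f w) (ev w)) {w. f w \<noteq> 0 \<and> red w \<noteq> None}"
    unfolding free_hom_def using W ev0
    by (intro asum_mono_neutral[symmetric]) (auto intro!: scale_closed ev_closed simp del: not_None_eq)
  also have "\<dots> = asum A (\<lambda>w. ascale A (f w) (tt (the (red w)))) {w. f w \<noteq> 0 \<and> red w \<noteq> None}"
    using ev v by (intro asum_cong) (auto intro!: scale_closed)
  finally show "\<Phi> f = asum A (\<lambda>w. ascale A (f w) (tt (the (red w)))) {w. f w \<noteq> 0 \<and> red w \<noteq> None}" .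
qed

end

text \<open>Reduction to triples is the same in both algebras, so \<open>f\<close> has the same
  coefficients on the same triples, read as indicators in the convolution algebra and as elements
  \<open>tt\<close> in \<open>A\<close>. This is the input of
  \<open>norm_le_sum_bounds\<close>.\<close>

lemma (in normed_ssa_family) norm_free_hom_le_bd:
  assumes f: "f \<in> carrier FX" and M: "bd (\<Phi>A f) M"
  shows "N (\<Phi> f) \<le> M"
proof -
  interpret cf: ssa_family E G act CA cU cP cS by (rule CA_ssa_family)
  let ?W = "{w. f w \<noteq> 0 \<and> red w \<noteq> None}"
  note tt = free_hom_tt[OF f]
  obtain k \<tau> \<phi> K where k: "\<forall>i<k. valid (\<tau> i) \<and> (\<forall>x\<in>IP. norm (\<phi> i x) \<le> K i) \<and> 0 \<le> K i"
    "\<Phi>A f = (\<lambda>\<gamma>. \<Sum>i<(k::nat). T (\<tau> i) (\<phi> i) \<gamma>)" "(\<Sum>i<k. K i) \<le> M"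
    using bd_decomposition[OF M] by blast
  have "\<Phi>A f = asum CA (\<lambda>w. ascale CA (f w) (chi (the (red w)))) ?W"
    unfolding cf.free_hom_tt(1)[OF f] using tt(3)
    by (intro cvl.asum_cong) (auto simp: tt_CA intro!: cvl.scale_closed chi_carrier)
  also have "\<dots> = (\<lambda>\<gamma>. \<Sum>w\<in>?W. f w * chi (the (red w)) \<gamma>)"
    using tt by (subst asum_CA) (auto simp: conv_algebra_ops intro!: cvl.scale_closed[unfolded conv_algebra_ops] chi_carrier)
  finally have eq: "(\<Sum>w\<in>?W. f w * chi (the (red w)) \<gamma>) = (\<Sum>i<k. T (\<tau> i) (\<phi> i) \<gamma>)" for \<gamma>
    unfolding k(2) by (rule fun_cong[OF sym])
  have "N (\<Phi> f) \<le> (\<Sum>i<k. K i)"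
    unfolding tt(1)
    by (rule norm_le_sum_bounds[where \<tau> = \<tau> and \<phi> = \<phi>]) (use tt k(1) eq in auto)
  then show ?thesis using k(3) by simp
qed

context finite_self_similar_action
begin

definition free_relations :: "(((('v, 'e, 'g) generator \<times> bool) list \<Rightarrow> complex) \<Rightarrow> real) \<Rightarrow> bool" where
  "free_relations N \<longleftrightarrow> ssa_relations FA (\<lambda>a b. N (asub FA a b) = 0) E G act
     (\<lambda>g. free_gen (U_gen g)) (\<lambda>v. free_gen (P_gen v)) (\<lambda>e. free_gen (S_gen e))"

lemma ssa_relations_FA_iff:
  assumes "star_algebra B" "star_hom FA B h"
    "\<And>x y. x \<in> carrier FA \<Longrightarrow> y \<in> carrier FA \<Longrightarrow> eqv x y \<longleftrightarrow> eqv' (h x) (h y)"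
    "\<And>g. g \<in> arr G \<Longrightarrow> h (free_gen (U_gen g)) = U g" "\<And>v. v \<in> verts E \<Longrightarrow> h (free_gen (P_gen v)) = P v"
    "\<And>e. e \<in> arcs E \<Longrightarrow> h (free_gen (S_gen e)) = S e"
  shows "ssa_relations FA eqv E G act (\<lambda>g. free_gen (U_gen g)) (\<lambda>v. free_gen (P_gen v)) (\<lambda>e. free_gen (S_gen e)) \<longleftrightarrow>
    ssa_relations B eqv' E G act U P S"
  by (rule ssa_relations_hom[where h = h, OF free_star_algebra assms(1,2) _ groupoid_axioms obj_eq])
    (auto simp: gens_def assms(3-6))

text \<open>For \<open>N\<close> the relations hold only up to elements of seminorm zero. In the
  completion they become equations in a C*-algebra, so \<open>norm_free_hom_le_bd\<close> applies
  there, and the embedding preserves the seminorm.\<close>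

lemma seminorm_le_bd:
  assumes N: "cstar_seminorm FA N" and rel: "free_relations N"
    and f: "f \<in> carrier FA" and M: "bd (\<Phi>A f) M"
  shows "N f \<le> M"
proof -
  interpret F: cstar_seminormed FA N
    using N free_star_algebra by (simp add: cstar_seminormed_def cstar_seminormed_axioms_def)
  let ?B = "cstar_completion FA N" and ?i = "completion_embed FA N"
  have B: "cstar_algebra ?B" by (rule F.completion_cstar_algebra)
  interpret B: cstar_algebra ?B by (rule B)
  note i = F.embed_star_hom
  have ic: "?i x \<in> carrier ?B" if "x \<in> carrier FA" for x using i that unfolding star_hom_def by blast
  have eq: "N (asub FA x y) = 0 \<longleftrightarrow> ?i x = ?i y" if xy: "x \<in> carrier FA" "y \<in> carrier FA" for x y
  proof -
    have n: "anorm ?B (asub ?B (?i x) (?i y)) = N (asub FA x y)"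
      using star_hom_asub[OF free_star_algebra i xy] F.norm_embed[of "asub FA x y"] xy by simp
    show ?thesis
    proof
      assume "N (asub FA x y) = 0"
      then have "asub ?B (?i x) (?i y) = azero ?B" using n ic xy by (intro B.norm_eq_zero) auto
      then show "?i x = ?i y" using ic xy B.asub_eq_zero by blast
    next
      assume "?i x = ?i y"
      then have "?i (asub FA x y) = azero ?B"
        using star_hom_asub[OF free_star_algebra i xy] ic xy by simp
      then show "N (asub FA x y) = 0"
        using n ic xy F.norm_embed[of "azero FA"] star_hom_zero[OF free_star_algebra B.star_algebra_axioms i]
        by (simp add: star_hom_asub[OF free_star_algebra i xy])
    qed
  qed
  let ?U = "\<lambda>g. ?i (free_gen (U_gen g))" and ?P = "\<lambda>v. ?i (free_gen (P_gen v))" and ?S = "\<lambda>e. ?i (free_gen (S_gen e))"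
  have "ssa_relations ?B (=) E G act ?U ?P ?S"
    using rel ssa_relations_FA_iff[where eqv = "\<lambda>x y. N (asub FA x y) = 0" and eqv' = "(=)"
      and U = ?U and P = ?P and S = ?S, OF B.star_algebra_axioms i eq refl refl refl]
    unfolding free_relations_def by blast
  then have "ssa_family E G act ?B ?U ?P ?S"
    by (rule cstar_ssa_family[OF B]) (rule ic, rule free_gen_carrier, simp add: gens_def)+
  then interpret bf: normed_ssa_family E G act ?B ?U ?P ?S "anorm ?B"
    using cstar_algebra_seminormed[OF B] by (simp add: normed_ssa_family_def cstar_seminormed_def)
  have "?i f = free_hom ?B (ssa_family.\<eta> ?U ?P ?S) f"
  proof (rule bf.free_hom_unique[OF i _ f])
    fix x :: "('v, 'e, 'g) generator"
    show "?i (free_gen x) = bf.\<eta> x" by (cases x) simp_all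
  qed
  then have "N f = anorm ?B (free_hom ?B (ssa_family.\<eta> ?U ?P ?S) f)" using F.norm_embed[OF f] by simp
  then show ?thesis using bf.norm_free_hom_le_bd[OF f M] by simp
qed

lemma \<Phi>A_star_hom: "star_hom FA CA \<Phi>A"
proof -
  interpret cf: ssa_family E G act CA cU cP cS by (rule CA_ssa_family)
  show ?thesis by (rule cf.free_hom_star_hom)
qed

lemma \<Phi>A_gen: "x \<in> gens \<Longrightarrow> \<Phi>A (free_gen x) = ssa_family.\<eta> cU cP cS x"
proof -
  interpret cf: ssa_family E G act CA cU cP cS by (rule CA_ssa_family)
  show "x \<in> gens \<Longrightarrow> ?thesis" by (rule cf.\<Phi>_gen)
qed

lemma \<Phi>A_bd:
  assumes "f \<in> carrier FA"
  obtains M where "bd (\<Phi>A f) M"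
  using assms \<Phi>A_star_hom unfolding star_hom_def CA_carrier by blast

lemma seminorm_comp_\<Phi>A:
  assumes K: "cstar_seminorm CA K"
  shows "cstar_seminorm FA (\<lambda>a. K (\<Phi>A a))" "free_relations (\<lambda>a. K (\<Phi>A a))"
proof -
  interpret F: star_algebra FA by (rule free_star_algebra)
  interpret cf: ssa_family E G act CA cU cP cS by (rule CA_ssa_family)
  interpret K: cstar_seminormed CA K
    by (simp add: cstar_seminormed_def cstar_seminormed_axioms_def CA_star_algebra K)
  show "cstar_seminorm FA (\<lambda>a. K (\<Phi>A a))"
    by (rule F.cstar_seminorm_comp[OF CA_star_algebra K \<Phi>A_star_hom])
  have "ssa_relations CA (\<lambda>x y. K (asub CA x y) = 0) E G act cU cP cS"
    by (rule ssa_relations_mono[OF cf.ssa_relations])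
      (use K.norm_zero in \<open>simp add: asub_CA conv_algebra_ops\<close>)
  moreover have "K (\<Phi>A (asub FA x y)) = 0 \<longleftrightarrow> K (asub CA (\<Phi>A x) (\<Phi>A y)) = 0"
    if "x \<in> carrier FA" "y \<in> carrier FA" for x y
    using star_hom_asub[OF free_star_algebra \<Phi>A_star_hom that] by simp
  ultimately show "free_relations (\<lambda>a. K (\<Phi>A a))"
    unfolding free_relations_def
    by (subst ssa_relations_FA_iff[OF CA_star_algebra \<Phi>A_star_hom]) (auto simp: \<Phi>A_gen gens_def)
qed

text \<open>The seminorms on both sides correspond: composition with \<open>\<Phi>A\<close> goes one
  way, the extension \<open>ext\<close> the other, so the suprema agree.\<close>

theorem ssa_norm_eq:
  assumes f: "f \<in> carrier FA"
  shows "universal_seminorm FA free_relations f = groupoid_norm \<Gamma> (\<Phi>A f)"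
proof -
  obtain M where M: "bd (\<Phi>A f) M" by (rule \<Phi>A_bd[OF f])
  have zero: "cstar_seminorm CA (\<lambda>_. 0)" by (rule cstar_seminorm_zero)
  note z = seminorm_comp_\<Phi>A[OF zero]
  show ?thesis
  proof (rule antisym)
    show "universal_seminorm FA free_relations f \<le> groupoid_norm \<Gamma> (\<Phi>A f)"
    proof (unfold universal_seminorm_def, rule cSUP_least)
      show "{N. cstar_seminorm FA N \<and> free_relations N} \<noteq> {}" using z by blast
      fix N assume "N \<in> {N. cstar_seminorm FA N \<and> free_relations N}"
      then have N: "cstar_seminorm FA N" "free_relations N" by auto
      interpret F: cstar_seminormed FA N
        using N free_star_algebra by (simp add: cstar_seminormed_def cstar_seminormed_axioms_def)
      interpret ex: seminorm_extension E G act FA N \<Phi>A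
        by unfold_locales (fact \<Phi>A_star_hom, rule seminorm_le_bd[OF N], assumption+, rule image_dense)
      have "N f = ex.ext (\<Phi>A f)" using ex.ext_hom[OF f] by simp
      also have "\<dots> \<le> groupoid_norm \<Gamma> (\<Phi>A f)"
        unfolding groupoid_norm_def
        by (rule universal_seminorm_upper[OF ex.ext_cstar_seminorm TrueI]) (rule cstar_seminorm_le_bd[OF _ M])
      finally show "N f \<le> groupoid_norm \<Gamma> (\<Phi>A f)" .
    qed
    show "groupoid_norm \<Gamma> (\<Phi>A f) \<le> universal_seminorm FA free_relations f"
      unfolding groupoid_norm_def universal_seminorm_def[of CA]
    proof (rule cSUP_least)
      show "{N. cstar_seminorm CA N \<and> True} \<noteq> {}" using zero by blast
      fix K assume "K \<in> {N. cstar_seminorm CA N \<and> True}"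
      then have K: "cstar_seminorm CA K" by simp
      show "K (\<Phi>A f) \<le> universal_seminorm FA free_relations f"
        using universal_seminorm_upper[where P = free_relations, OF seminorm_comp_\<Phi>A[OF K], where x = f and M = M]
          seminorm_le_bd[OF _ _ f M] by simp
    qed
  qed
qed

lemma groupoid_norm_cstar_seminorm: "cstar_seminorm CA (groupoid_norm \<Gamma>)"
  unfolding groupoid_norm_def
  by (rule universal_seminorm_cstar_seminorm[OF CA_star_algebra cstar_seminorm_zero TrueI])
    (use cstar_seminorm_le_bd in \<open>auto simp: CA_carrier\<close>)

theorem isomorphism:
  "\<exists>\<pi>. cstar_isomorphism (cstar_completion FA (universal_seminorm FA free_relations)) (groupoid_cstar \<Gamma>) \<pi> \<and>
    (\<forall>a\<in>carrier FA. \<pi> (completion_embed FA (universal_seminorm FA free_relations) a) = groupoid_cstar_embed \<Gamma> (\<Phi>A a))"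
  unfolding groupoid_cstar_def groupoid_cstar_embed_def
proof (rule completion_isomorphism)
  have "cstar_seminorm FA (universal_seminorm FA free_relations)"
  proof (rule universal_seminorm_cstar_seminorm[where P = free_relations, OF free_star_algebra seminorm_comp_\<Phi>A[OF cstar_seminorm_zero]])
    fix x assume x: "x \<in> carrier FA"
    obtain M where "bd (\<Phi>A x) M" by (rule \<Phi>A_bd[OF x])
    then show "\<exists>M. \<forall>N. cstar_seminorm FA N \<and> free_relations N \<longrightarrow> N x \<le> M"
      using seminorm_le_bd[OF _ _ x] by blast
  qed
  then show "cstar_seminormed FA (universal_seminorm FA free_relations)"
    using free_star_algebra by (simp add: cstar_seminormed_def cstar_seminormed_axioms_def)
  show K: "cstar_seminormed CA (groupoid_norm \<Gamma>)"
    by (simp add: cstar_seminormed_def cstar_seminormed_axioms_def CA_star_algebra groupoid_norm_cstar_seminorm)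
  show "star_hom FA CA \<Phi>A" by (rule \<Phi>A_star_hom)
  show "groupoid_norm \<Gamma> (\<Phi>A a) = universal_seminorm FA free_relations a" if "a \<in> carrier FA" for a
    by (rule ssa_norm_eq[OF that, symmetric])
  fix b and \<epsilon> :: real assume b: "b \<in> carrier CA" "\<epsilon> > 0"
  \<comment> \<open>Half of \<open>\<epsilon>\<close>, because \<open>bd\<close> gives a weak
    inequality and density asks for a strict one.\<close>
  then obtain a where a: "a \<in> carrier FA" "bd (asub CA b (\<Phi>A a)) (\<epsilon> / 2)" using image_dense[of b "\<epsilon> / 2"] by auto
  interpret K: cstar_seminormed CA "groupoid_norm \<Gamma>" by (rule K)
  have "groupoid_norm \<Gamma> (asub CA (\<Phi>A a) b) = groupoid_norm \<Gamma> (asub CA b (\<Phi>A a))"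
    using a b \<Phi>A_star_hom unfolding star_hom_def by (intro K.norm_asub_swap) auto
  also have "\<dots> \<le> \<epsilon> / 2" using cstar_seminorm_le_bd[OF groupoid_norm_cstar_seminorm a(2)] .
  finally show "\<exists>a\<in>carrier FA. groupoid_norm \<Gamma> (asub CA (\<Phi>A a) b) < \<epsilon>" using a b by (intro bexI[of _ a]) auto
qed

end

theorem proposition6p5:
  fixes E :: "('v, 'e) pre_digraph"
    and G :: "('v, 'g) groupoid"
    and act :: "'g \<Rightarrow> ('v, 'e) fpath \<Rightarrow> ('v, 'e) fpath"
  assumes "fin_digraph E" and "no_sources E"
    and "self_similar_action E G act"
  shows "\<exists>\<pi>. cstar_isomorphism (ssa_cstar E G act) (groupoid_cstar (germ_groupoid E G act)) \<pi> \<and>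
    (\<forall>g\<in>arr G. \<pi> (ssa_gen E G act (U_gen g)) =
       groupoid_cstar_embed (germ_groupoid E G act)
         (indicator (germ_cylinder E G act (gcod G g, []) g (gdom G g, [])))) \<and>
    (\<forall>e\<in>arcs E. \<pi> (ssa_gen E G act (S_gen e)) =
       groupoid_cstar_embed (germ_groupoid E G act)
         (indicator (germ_cylinder E G act (edge_path E e) (gunit G (tail E e)) (tail E e, []))))"
proof -
  interpret fin_digraph E by fact
  interpret self_similar_action E G act by fact
  interpret finite_self_similar_action E G act by unfold_locales
  interpret cf: ssa_family E G act CA cU cP cS by (rule CA_ssa_family)
  have free: "ssa_free E G = FA" by (simp add: ssa_free_def gens_def)
  have norm: "ssa_norm E G act = universal_seminorm FA free_relations"
    unfolding ssa_norm_def free free_relations_def[abs_def] ..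
  obtain \<pi> where \<pi>: "cstar_isomorphism (ssa_cstar E G act) (groupoid_cstar \<Gamma>) \<pi>"
    "\<And>x. x \<in> gens \<Longrightarrow> \<pi> (ssa_gen E G act x) = groupoid_cstar_embed \<Gamma> (cf.\<eta> x)"
    using isomorphism \<Phi>A_gen free_gen_carrier unfolding ssa_cstar_def ssa_gen_def free norm by metis
  show ?thesis
  proof (intro exI[of _ \<pi>] conjI ballI \<pi>(1))
    fix g assume g: "g \<in> arr G"
    then have "cU g = indicator (germ_cylinder E G act (cm g, []) g (dm g, []))"
      by (simp add: cU_def chi_indicator cylinder_germ psource_def)
    then show "\<pi> (ssa_gen E G act (U_gen g)) =
        groupoid_cstar_embed \<Gamma> (indicator (germ_cylinder E G act (cm g, []) g (dm g, [])))"
      using \<pi>(2)[of "U_gen g"] g by (simp add: gens_def)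
  next
    fix e assume e: "e \<in> arcs E"
    then have "cS e = indicator (germ_cylinder E G act (edge_path E e) (gunit G (tail E e)) (tail E e, []))"
      by (simp add: cS_def chi_indicator cylinder_germ psource_def edge_path_def)
    then show "\<pi> (ssa_gen E G act (S_gen e)) =
        groupoid_cstar_embed \<Gamma> (indicator (germ_cylinder E G act (edge_path E e) (gunit G (tail E e)) (tail E e, [])))"
      using \<pi>(2)[of "S_gen e"] e by (simp add: gens_def)
  qed
qed

end
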